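(* Let $0<\alpha<n$, $1<q\le p<\infty$, $1<t\le s<\infty$ with $\frac1s=\frac1p-\frac\alpha n$ and $\frac ts=\frac qp$. Then for $a\in{\rm BMO}_{\rm dyadic}$, the commutator $[a,I_{\alpha,{\rm dyadic}}]:\mathcal M^p_q\to\mathcal M^s_t$ is a compact operator if and only if $a\in{\rm VMO}_{\rm dyadic}$.
   Context: Dyadic cubes: $Q_{jm}=\prod_{\nu=1}^n[m_\nu2^{-j},(m_\nu+1)2^{-j})$, $\mathcal D_j=\{Q_{jm}:m\in\mathbb Z^n\}$, $\mathcal D=\bigcup_j\mathcal D_j$. Haar functions: $h^{\epsilon_i}(t)=\chi_{[0,1)}(2t)+(-1)^{\epsilon_i}\chi_{[1,2)}(2t)$ for $\epsilon_i\in\{0,1\}$; $E=\{0,1\}^n\setminus\{(0,\dots,0)\}$; $h^\varepsilon(x)=\prod_i h^{\varepsilon_i}(x_i)$; $h^\varepsilon_{Q_{jm}}(x)=2^{jn/2}h^\varepsilon(2^jx-m)$. $\langle f,g\rangle=\int fg$, $m_Q(f)=|Q|^{-1}\int_Qf$. Morrey space: $\|f\|_{\mathcal M^p_q}=\sup_{Q\in\mathcal D}|Q|^{1/p-1/q}(\int_Q|f|^q)^{1/q}$, $\mathcal M^p_q=\{f\in L^q_{\rm loc}:\|f\|_{\mathcal M^p_q}<\infty\}$. Dyadic BMO: $M^{\sharp,{\rm dyadic}}a(x)=\sup_{Q\in\mathcal D,\,x\in Q}m_Q(|a-m_Q(a)|)$, $\|a\|_{{\rm BMO}_{\rm dyadic}}=\|M^{\sharp,{\rm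 dyadic}}a\|_{L^\infty}$, ${\rm BMO}_{\rm dyadic}$ the set of $a\in L^1_{\rm loc}$ with finite norm. ${\rm VMO}_{\rm dyadic}$ is the closure in ${\rm BMO}_{\rm dyadic}$ of the linear span of $\{h^\varepsilon_Q:\varepsilon\in E,\ Q\in\mathcal D\}$. Dyadic fractional integral: $I_{\alpha,{\rm dyadic}}f=\lim_{M\to\infty}\sum_{\varepsilon\in E}\sum_{j=-M}^{M}\sum_{Q\in\mathcal D_j}|Q|^{\alpha/n}\langle f,h^\varepsilon_Q\rangle h^\varepsilon_Q$. Commutator: $[a,I_{\alpha,{\rm dyadic}}]f=\lim_{M\to\infty}\sum_{\varepsilon\in E}\sum_{j=-M}^{M}\sum_{Q\in\mathcal D_j}\langle a\cdot I_{\alpha,{\rm dyadic}}f-I_{\alpha,{\rm dyadic}}[af],h^\varepsilon_Q\rangle h^\varepsilon_Q$ (limit in $L^q_{\rm loc}$). *)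

theory Defs
  imports "HOL-Analysis.Analysis" "HOL-Probability.Essential_Supremum"
begin

definition dcube :: "int \<Rightarrow> int^'n::finite \<Rightarrow> (real^'n) set" where
  "dcube j m = {x. \<forall>i. real_of_int (m$i) * 2 powr (- real_of_int j) \<le> x$i
                     \<and> x$i < (real_of_int (m$i) + 1) * 2 powr (- real_of_int j)}"

definition dyadic_cubes :: "(real^'n::finite) set set" where
  "dyadic_cubes = {dcube j m | j m. True}"

definition haar1 :: "bool \<Rightarrow> real \<Rightarrow> real" where
  "haar1 e t = indicator {0..<1} (2*t) + (-1) ^ (of_bool e :: nat) * indicator {1..<2} (2*t)"

definition haar_E :: "('n::finite \<Rightarrow> bool) set" where
  "haar_E = {e. e \<noteq> (\<lambda>_. False)}"

definition haar :: "('n::finite \<Rightarrow> bool) \<Rightarrow> int \<Rightarrow> int^'n \<Rightarrow> real^'n \<Rightarrow> real" where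
  "haar e j m x = 2 powr (real_of_int j * real CARD('n) / 2) *
     (\<Prod>i\<in>UNIV. haar1 (e i) (2 powr (real_of_int j) * x$i - real_of_int (m$i)))"

definition pairing :: "(real^'n::finite \<Rightarrow> real) \<Rightarrow> (real^'n \<Rightarrow> real) \<Rightarrow> real" where
  "pairing f g = (LINT x|lborel. f x * g x)"

definition mean :: "(real^'n::finite) set \<Rightarrow> (real^'n \<Rightarrow> real) \<Rightarrow> real" where
  "mean Q f = (LINT x:Q|lborel. f x) / measure lborel Q"

definition Lloc :: "real \<Rightarrow> (real^'n::finite \<Rightarrow> real) set" where
  "Lloc r = {f. f \<in> borel_measurable lborel \<and>
     (\<forall>K. compact K \<longrightarrow> set_integrable lborel K (\<lambda>x. \<bar>f x\<bar> powr r))}"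

definition Lloc_conv :: "real \<Rightarrow> (nat \<Rightarrow> real^'n::finite \<Rightarrow> real) \<Rightarrow> (real^'n \<Rightarrow> real) \<Rightarrow> bool" where
  "Lloc_conv r S g \<longleftrightarrow> g \<in> Lloc r \<and> (\<forall>M. S M \<in> borel_measurable lborel) \<and>
     (\<forall>K. compact K \<longrightarrow>
        ((\<lambda>M. \<integral>\<^sup>+ x\<in>K. ennreal (\<bar>S M x - g x\<bar> powr r) \<partial>lborel) \<longlongrightarrow> 0) sequentially)"

text \<open>The L^r_loc limit (a representative; unique up to null sets), 0 if it does not exist.\<close>
definition Lloc_lim :: "real \<Rightarrow> (nat \<Rightarrow> real^'n::finite \<Rightarrow> real) \<Rightarrow> (real^'n \<Rightarrow> real)" where
  "Lloc_lim r S = (if \<exists>g. Lloc_conv r S g then SOME g. Lloc_conv r S g else (\<lambda>_. 0))"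

definition haar_partial :: "(('n::finite \<Rightarrow> bool) \<Rightarrow> int \<Rightarrow> int^'n \<Rightarrow> real) \<Rightarrow> nat \<Rightarrow> real^'n \<Rightarrow> real" where
  "haar_partial c M x = (\<Sum>e\<in>haar_E. \<Sum>j\<in>{- int M..int M}.
      (\<Sum>\<^sub>\<infinity> m\<in>UNIV. c e j m * haar e j m x))"

definition frac_int :: "real \<Rightarrow> (real^'n::finite \<Rightarrow> real) \<Rightarrow> real^'n \<Rightarrow> real" where
  "frac_int \<alpha> f = Lloc_lim 1 (haar_partial
     (\<lambda>e j m. measure lborel (dcube j m) powr (\<alpha> / real CARD('n)) * pairing f (haar e j m)))"

definition commutator :: "real \<Rightarrow> real \<Rightarrow> (real^'n::finite \<Rightarrow> real) \<Rightarrow> (real^'n \<Rightarrow> real) \<Rightarrow> real^'n \<Rightarrow> real" where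
  "commutator r \<alpha> a f = Lloc_lim r (haar_partial
     (\<lambda>e j m. pairing (\<lambda>y. a y * frac_int \<alpha> f y - frac_int \<alpha> (\<lambda>z. a z * f z) y) (haar e j m)))"

definition morrey_norm :: "real \<Rightarrow> real \<Rightarrow> (real^'n::finite \<Rightarrow> real) \<Rightarrow> real" where
  "morrey_norm p q f = (SUP Q\<in>dyadic_cubes. measure lborel Q powr (1/p - 1/q) *
       (LINT x:Q|lborel. \<bar>f x\<bar> powr q) powr (1/q))"

definition morrey :: "real \<Rightarrow> real \<Rightarrow> (real^'n::finite \<Rightarrow> real) set" where
  "morrey p q = {f. f \<in> Lloc q \<and> bdd_above ((\<lambda>Q. measure lborel Q powr (1/p - 1/q) *
       (LINT x:Q|lborel. \<bar>f x\<bar> powr q) powr (1/q)) ` dyadic_cubes)}"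

definition msharp :: "(real^'n::finite \<Rightarrow> real) \<Rightarrow> real^'n \<Rightarrow> ereal" where
  "msharp a x = (SUP Q\<in>{Q\<in>dyadic_cubes. x \<in> Q}. ereal (mean Q (\<lambda>y. \<bar>a y - mean Q a\<bar>)))"

definition bmo_norm :: "(real^'n::finite \<Rightarrow> real) \<Rightarrow> ereal" where
  "bmo_norm a = esssup lborel (msharp a)"

definition BMO :: "(real^'n::finite \<Rightarrow> real) set" where
  "BMO = {a. a \<in> Lloc 1 \<and> bmo_norm a < \<infinity>}"

definition haar_span :: "(real^'n::finite \<Rightarrow> real) set" where
  "haar_span = {g. \<exists>S c. finite S \<and> S \<subseteq> haar_E \<times> UNIV \<and>
      g = (\<lambda>x. \<Sum>(e,j,m)\<in>S. c (e,j,m) * haar e j m x)}"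

definition VMO :: "(real^'n::finite \<Rightarrow> real) set" where
  "VMO = {a. a \<in> BMO \<and> (\<forall>\<epsilon>>0. \<exists>g\<in>haar_span. bmo_norm (\<lambda>x. a x - g x) < ereal \<epsilon>)}"

definition compact_op :: "real \<Rightarrow> real \<Rightarrow> real \<Rightarrow> real \<Rightarrow>
    ((real^'n::finite \<Rightarrow> real) \<Rightarrow> (real^'n \<Rightarrow> real)) \<Rightarrow> bool" where
  "compact_op p q s t T \<longleftrightarrow> (\<forall>f\<in>morrey p q. T f \<in> morrey s t) \<and>
     (\<forall>F::nat \<Rightarrow> real^'n \<Rightarrow> real. (\<forall>k. F k \<in> morrey p q) \<and> bdd_above (range (\<lambda>k. morrey_norm p q (F k))) \<longrightarrow>
        (\<exists>(r::nat\<Rightarrow>nat) (g::real^'n \<Rightarrow> real). strict_mono r \<and> g \<in> morrey s t \<and>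
           ((\<lambda>k. morrey_norm s t (\<lambda>x. T (F (r k)) x - g x)) \<longlongrightarrow> 0) sequentially))"

end

(*
  Write E_j f for the average of f over the dyadic cubes of side 2^-j.  Since the Haar functions of
  level j diagonalise E_{j+1} - E_j, Abel summation gives I_alpha f = k * sum_j 2^(-j alpha) E_j f with
  k = 2^alpha - 1, hence [a, I_alpha] f = k * sum_j 2^(-j alpha) (a E_j f - E_j (a f)).

  Boundedness.  By Hoelder and John-Nirenberg the j-th term is at most
  2^(-j alpha) (E_j |f|^r)^(1/r) u_j with r < q and all power means of u_j over cubes of level j
  bounded by the BMO norm.  The dual form of Doob's maximal inequality removes the factors u_j in the
  L^t norm, and Hedberg's splitting of the sum over scales yields the Morrey bound, linear in the BMO norm.

  VMO implies compactness.  For a in the Haar span the commutator is controlled by finitely many averages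
  of f and a tail over coarse scales which is uniformly small, so a diagonal subsequence along which all
  averages converge is mapped to a Cauchy sequence.  Linearity of the bound in a passes this to the closure.

  Compactness implies VMO.  A function of BMO lies in VMO as soon as, for every eps > 0, only finitely
  many dyadic cubes carry mean oscillation > eps.  Otherwise take infinitely many such cubes and test on
  the normalised indicators of their siblings.  On the cube itself the image is, up to constants,
  |a - constant| from below, so its norm stays away from 0.  On the other hand the commutator is
  antisymmetric, so the average of the image over a fixed cube R is an average of [a, I_alpha] 1_R over the
  sibling, which tends to 0; hence every limit point of the images is 0, a contradiction.
*)

theory Submission
  imports Defs "HOL-Library.Diagonal_Subsequence"
begin

text \<open>The obstacle in the bound is that u_j, about |a - E_j a|, varies inside the cubes of
  level j and that its supremum over j is not controlled. Its coefficient is constant on those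
  cubes, so after pairing with a test function only averages over level j of u_j times that function
  matter, and Hoelder disposes of them scale by scale; hence the duality. Scales coarser than the
  tested cube use instead that E_j a drifts only linearly in j, which geometric decay beats. The
  exponent r has 1 < r < q: Hoelder against John-Nirenberg needs r > 1, the maximal inequality in
  exponent q/r needs r < q. In the converse, siblings are used because on them every scale
  contributes with the same sign and the same factor a - const, so nothing cancels. That averages of
  [a, I_alpha] 1_R tend to 0 with the right normalisation comes from the boundedness theorem itself,
  applied with p = q and s = t to Lebesgue exponents on both sides of the critical one. The limits
  in the definitions are arbitrary representatives, so identities for them hold only almost
  everywhere.\<close>

section \<open>Dyadic cubes addressed by their points\<close>

definition idx :: "int \<Rightarrow> real^'n::finite \<Rightarrow> int^'n" where
  "idx j x = (\<chi> i. \<lfloor>x$i * 2 powr real_of_int j\<rfloor>)"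

text \<open>Cubes are named by a point instead of an index vector. Statements about all cubes then
  quantify over points, and nesting and disjointness become equations between values of
  \<open>idx\<close>.\<close>

definition cell :: "int \<Rightarrow> real^'n::finite \<Rightarrow> (real^'n) set" where
  "cell j x = dcube j (idx j x)"

lemma mem_dcube: "x \<in> dcube j m \<longleftrightarrow> idx j x = m"
proof -
  have "(real_of_int (m$i) * 2 powr (- real_of_int j) \<le> x$i \<and> x$i < (real_of_int (m$i) + 1) * 2 powr (- real_of_int j))
     \<longleftrightarrow> \<lfloor>x$i * 2 powr real_of_int j\<rfloor> = m$i" for i
    by (simp add: powr_minus field_simps floor_eq_iff)
  then show ?thesis by (auto simp: dcube_def idx_def vec_eq_iff)
qed

lemma mem_cell: "y \<in> cell j x \<longleftrightarrow> idx j y = idx j x"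
  by (simp add: cell_def mem_dcube)

lemma self_mem_cell [simp]: "x \<in> cell j x"
  by (simp add: mem_cell)

lemma cell_cong: "idx j y = idx j x \<Longrightarrow> cell j y = cell j x"
  by (simp add: cell_def)

lemma idx_surj: "\<exists>x. idx j x = m"
proof
  show "idx j (\<chi> i. real_of_int (m$i) * 2 powr (- real_of_int j)) = m"
    by (simp add: idx_def vec_eq_iff powr_minus field_simps)
qed

lemma dcube_cellE: obtains x where "dcube j m = cell j x" "idx j x = m"
  using idx_surj[of j m] by (metis cell_def)

lemma dyadic_cubes_eq: "dyadic_cubes = {cell j x |j x. True}"
  unfolding dyadic_cubes_def using dcube_cellE by (metis cell_def)

text \<open>The coarser floor is the finer one divided by a power of 2, so the fine index determines
  the coarse one. All nesting of cubes rests on this.\<close>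

lemma idx_coarse:
  assumes "idx j x = idx j y" "k \<le> j"
  shows "idx k x = idx k y"
proof -
  have *: "\<lfloor>z * 2 powr real_of_int k\<rfloor> = \<lfloor>z * 2 powr real_of_int j\<rfloor> div 2 ^ nat (j - k)" for z :: real
  proof -
    have "2 powr real_of_int k = 2 powr real_of_int j / real_of_int (2 ^ nat (j-k))"
    proof -
      have "real_of_int (2 ^ nat (j-k)) = 2 powr real_of_int (j - k)"
        using assms(2) by (simp add: powr_realpow[symmetric])
      then show ?thesis by (simp add: powr_diff)
    qed
    then have "z * 2 powr real_of_int k = (z * 2 powr real_of_int j) / real_of_int (2 ^ nat (j-k))"
      by simp
    then show ?thesis
      by (metis floor_divide_real_eq_div zero_le_numeral zero_le_power)
  qed
  show ?thesis using assms(1) by (simp add: idx_def vec_eq_iff *)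
qed

lemma cell_subset: "y \<in> cell k x \<Longrightarrow> k \<le> j \<Longrightarrow> cell j y \<subseteq> cell k x"
  by (auto simp: mem_cell) (metis idx_coarse)

lemma sets_dcube [measurable, simp]: "dcube j m \<in> sets borel"
proof -
  have "dcube j m = (\<Inter>i\<in>UNIV. {x. real_of_int (m$i) * 2 powr (- real_of_int j) \<le> x$i} \<inter>
       {x. x$i < (real_of_int (m$i) + 1) * 2 powr (- real_of_int j)})"
    by (auto simp: dcube_def)
  also have "\<dots> \<in> sets borel"
    by (intro sets.finite_INT) (auto intro!: sets.Int borel_open open_halfspace_component_lt_cart
        borel_closed closed_halfspace_component_ge_cart)
  finally show ?thesis .
qed

lemma sets_cell [measurable, simp]: "cell j x \<in> sets borel"
  by (simp add: cell_def)

text \<open>The half-open cube is squeezed between an open and a closed box of equal volume.\<close>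

lemma emeasure_dcube: "emeasure lborel (dcube j (m::int^'n::finite)) = ennreal (2 powr (- (real_of_int j * real CARD('n))))"
proof -
  define d where "d = 2 powr (- real_of_int j)"
  define l :: "real^'n" where "l = (\<chi> i. real_of_int (m$i) * d)"
  define u :: "real^'n" where "u = (\<chi> i. (real_of_int (m$i) + 1) * d)"
  have d0: "d > 0" by (simp add: d_def)
  have *: "(u - l) \<bullet> b = d" if "b \<in> Basis" for b
    using that by (auto simp: Basis_vec_def inner_axis u_def l_def algebra_simps)
  have le: "l \<bullet> b \<le> u \<bullet> b" if "b \<in> Basis" for b
    using *[OF that] d0 by (simp add: inner_diff_left)
  have v: "(\<Prod>b\<in>Basis. (u - l) \<bullet> b) = 2 powr (- (real_of_int j * real CARD('n)))"
  proof -
    have "(\<Prod>b\<in>Basis. (u - l) \<bullet> b) = d ^ CARD('n)" using * by simp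
    also have "\<dots> = d powr real CARD('n)" using d0 by (simp add: powr_realpow)
    finally show ?thesis by (simp add: d_def powr_powr)
  qed
  have "box l u \<subseteq> dcube j m"
    by (force simp: mem_box_cart dcube_def l_def u_def d_def less_imp_le)
  then have "emeasure lborel (box l u) \<le> emeasure lborel (dcube j m)"
    by (rule emeasure_mono) simp
  moreover have "dcube j m \<subseteq> cbox l u"
    by (force simp: mem_box_cart dcube_def l_def u_def d_def less_imp_le)
  then have "emeasure lborel (dcube j m) \<le> emeasure lborel (cbox l u)"
    by (rule emeasure_mono) simp
  moreover have "emeasure lborel (box l u) = ennreal (2 powr (- (real_of_int j * real CARD('n))))"
     "emeasure lborel (cbox l u) = ennreal (2 powr (- (real_of_int j * real CARD('n))))"
    using le v by (simp_all add: emeasure_lborel_box_eq emeasure_lborel_cbox_eq)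
  ultimately show ?thesis by (metis antisym)
qed

lemma measure_dcube: "measure lborel (dcube j (m::int^'n::finite)) = 2 powr (- (real_of_int j * real CARD('n)))"
  by (simp add: measure_def emeasure_dcube)

lemma emeasure_cell: "emeasure lborel (cell j (x::real^'n::finite)) = ennreal (2 powr (- (real_of_int j * real CARD('n))))"
  by (simp add: cell_def emeasure_dcube)

lemma measure_cell: "measure lborel (cell j (x::real^'n::finite)) = 2 powr (- (real_of_int j * real CARD('n)))"
  by (simp add: cell_def measure_dcube)

lemma finite_vec_range: "finite F \<Longrightarrow> finite {m::int^'n::finite. \<forall>i. m$i \<in> F}"
proof -
  assume F: "finite F"
  have "{m::int^'n. \<forall>i. m$i \<in> F} \<subseteq> vec_lambda ` (PiE UNIV (\<lambda>_. F))"
  proof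
    fix m :: "int^'n" assume "m \<in> {m. \<forall>i. m$i \<in> F}"
    then have "vec_nth m \<in> PiE UNIV (\<lambda>_. F)" by auto
    then show "m \<in> vec_lambda ` (PiE UNIV (\<lambda>_. F))"
      by (metis image_eqI vec_nth_inverse)
  qed
  then show ?thesis using F by (meson finite_PiE finite_UNIV finite_imageI finite_subset finite)
qed

lemma finite_idx_image:
  assumes "bounded S" shows "finite (idx j ` S)"
proof -
  obtain b where b: "\<And>x. x \<in> S \<Longrightarrow> norm x \<le> b" using assms bounded_iff by blast
  define c where "c = \<lceil>\<bar>b\<bar> * 2 powr real_of_int j\<rceil> + 1"
  have "idx j x $ i \<in> {-c..c}" if "x \<in> S" for x i
  proof -
    have "\<bar>x$i\<bar> \<le> \<bar>b\<bar>" using b[OF that] component_le_norm_cart[of x i] by linarith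
    then have "\<bar>x$i * 2 powr real_of_int j\<bar> \<le> \<bar>b\<bar> * 2 powr real_of_int j"
      by (simp add: abs_mult mult_right_mono)
    then have "\<lfloor>x$i * 2 powr real_of_int j\<rfloor> \<le> \<lceil>\<bar>b\<bar> * 2 powr real_of_int j\<rceil>"
        "- \<lceil>\<bar>b\<bar> * 2 powr real_of_int j\<rceil> \<le> \<lfloor>x$i * 2 powr real_of_int j\<rfloor>"
      by linarith+
    then show ?thesis unfolding c_def idx_def by auto
  qed
  then have "idx j ` S \<subseteq> {m. \<forall>i. m$i \<in> {-c..c}}" by auto
  then show ?thesis using finite_vec_range finite_subset by blast
qed

lemma bounded_dcube: "bounded (dcube j m)"
proof -
  have "dcube j m \<subseteq> cbox (\<chi> i. real_of_int (m$i) * 2 powr (- real_of_int j)) (\<chi> i. (real_of_int (m$i) + 1) * 2 powr (- real_of_int j))"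
    by (force simp: dcube_def mem_box_cart less_imp_le)
  then show ?thesis using bounded_cbox bounded_subset by blast
qed

lemma bounded_cell: "bounded (cell j x)"
  by (simp add: cell_def bounded_dcube)

section \<open>Functions constant on the cubes of one level\<close>

text \<open>Measurability with respect to the sigma-algebra of level j, expressed as factorisation
  through \<open>idx j\<close>, so that no filtration of sigma-algebras has to be carried
  along.\<close>

definition lev :: "int \<Rightarrow> (real^'n::finite \<Rightarrow> 'b) \<Rightarrow> bool" where
  "lev j g \<longleftrightarrow> (\<forall>x y. idx j x = idx j y \<longrightarrow> g x = g y)"

lemma levD: "lev j g \<Longrightarrow> y \<in> cell j x \<Longrightarrow> g y = g x"
  unfolding lev_def mem_cell by blast

lemma lev_mono: "lev k g \<Longrightarrow> k \<le> j \<Longrightarrow> lev j g"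
  unfolding lev_def by (meson idx_coarse)

lemma lev_const [simp]: "lev j (\<lambda>x. c)"
  by (simp add: lev_def)

lemma lev_comp: "lev j g \<Longrightarrow> lev j (\<lambda>x. h (g x))"
  unfolding lev_def by (intro allI impI arg_cong[of _ _ h]) blast

lemma lev_comp2: "lev j g \<Longrightarrow> lev j g' \<Longrightarrow> lev j (\<lambda>x. h (g x) (g' x))"
  unfolding lev_def by (intro allI impI arg_cong2[of _ _ _ _ h]) blast+

lemma lev_arith [intro]:
  fixes f g :: "real^'n::finite \<Rightarrow> real"
  assumes "lev j f" "lev j g"
  shows "lev j (\<lambda>x. f x + g x)" "lev j (\<lambda>x. f x - g x)" "lev j (\<lambda>x. f x * g x)" "lev j (\<lambda>x. max (f x) (g x))"
  using assms by (rule lev_comp2)+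

lemma lev_abs [intro]: "lev j (g :: real^'n::finite \<Rightarrow> real) \<Longrightarrow> lev j (\<lambda>x. \<bar>g x\<bar>)"
  by (rule lev_comp)

lemma lev_powr [intro]: "lev j (g :: real^'n::finite \<Rightarrow> real) \<Longrightarrow> lev j (\<lambda>x. g x powr c)"
  by (rule lev_comp)

lemma lev_sum: "(\<And>i. i \<in> I \<Longrightarrow> lev j (g i)) \<Longrightarrow> lev j (\<lambda>x. \<Sum>i\<in>I. g i x)"
  unfolding lev_def by (intro allI impI sum.cong refl) blast

text \<open>Preimages are unions of cubes of one level, and there are only countably many of
  those.\<close>

lemma lev_measurable:
  fixes g :: "real^'n::finite \<Rightarrow> 'b::topological_space"
  assumes "lev j g" shows "g \<in> borel_measurable borel"
proof (rule borel_measurableI)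
  fix S :: "'b set" assume "open S"
  have eq: "g x = g y" if "idx j x = idx j y" for x y
    using assms that unfolding lev_def by blast
  have "g -` S \<inter> space borel = (\<Union>m\<in>idx j ` (g -` S). dcube j m)"
  proof (intro set_eqI iffI)
    fix x assume "x \<in> (\<Union>m\<in>idx j ` (g -` S). dcube j m)"
    then obtain y where "g y \<in> S" "idx j x = idx j y" by (auto simp: mem_dcube)
    then show "x \<in> g -` S \<inter> space borel" using eq[of x y] by simp
  qed (auto simp: mem_dcube)
  also have "\<dots> \<in> sets borel" by (intro sets.countable_UN') auto
  finally show "g -` S \<inter> space borel \<in> sets borel" .
qed

section \<open>Local integrability and averages over cells\<close>

text \<open>Local integrability tested on cubes instead of compact sets; \<open>Lloc_1\<close>
  identifies the two notions for Borel functions.\<close>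

definition loc_int :: "(real^'n::finite \<Rightarrow> real) \<Rightarrow> bool" where
  "loc_int f \<longleftrightarrow> f \<in> borel_measurable borel \<and> (\<forall>j x. set_integrable lborel (cell j x) f)"

text \<open>The conditional expectation E_j f at the point x; the prefactor is the reciprocal of the
  volume of the cell.\<close>

definition avg :: "int \<Rightarrow> (real^'n::finite \<Rightarrow> real) \<Rightarrow> real^'n \<Rightarrow> real" where
  "avg j f x = 2 powr (real_of_int j * real CARD('n)) * (LINT y:cell j x|lborel. f y)"

lemma mean_cell: "mean (cell j x) f = avg j f x"
  by (simp add: mean_def avg_def measure_cell powr_minus field_simps)

lemma lev_avg [simp]: "lev j (avg j f)"
  by (simp add: avg_def lev_def cell_def)

lemma avg_measurable [measurable]: "avg j f \<in> borel_measurable borel"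
  using lev_measurable lev_avg by blast

lemma avg_cell: "y \<in> cell j x \<Longrightarrow> avg j f y = avg j f x"
  using levD[OF lev_avg] by blast

lemma loc_int_measurable: "loc_int f \<Longrightarrow> f \<in> borel_measurable borel"
  by (simp add: loc_int_def)

lemma loc_int_cell: "loc_int f \<Longrightarrow> set_integrable lborel (cell j x) f"
  by (simp add: loc_int_def)

lemma loc_int_dcube: "loc_int f \<Longrightarrow> set_integrable lborel (dcube j m) f"
  by (rule dcube_cellE[of j m]) (simp add: loc_int_cell)

text \<open>A bounded cell of any level is covered by finitely many cells of the given level j, so
  one level suffices.\<close>

lemma loc_intI_level:
  fixes f :: "real^'n::finite \<Rightarrow> real"
  assumes m: "f \<in> borel_measurable borel" and c: "\<And>x. set_integrable lborel (cell j x) f"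
  shows "loc_int f"
  unfolding loc_int_def
proof (intro conjI allI)
  fix i :: int and x :: "real^'n"
  have "cell i x \<subseteq> (\<Union>m\<in>idx j ` cell i x. dcube j m)" by (auto simp: mem_dcube)
  moreover have "set_integrable lborel (\<Union>m\<in>idx j ` cell i x. dcube j m) f"
    using c by (intro set_integrable_UN finite_idx_image bounded_cell) (auto simp: cell_def)
  ultimately show "set_integrable lborel (cell i x) f"
    by (rule set_integrable_subset[rotated 2]) simp
qed (rule m)

lemma loc_int_bound:
  fixes f :: "real^'n::finite \<Rightarrow> real"
  assumes "loc_int g" "f \<in> borel_measurable borel" "\<And>x. \<bar>f x\<bar> \<le> g x"
  shows "loc_int f"
  unfolding loc_int_def
proof (intro conjI allI)
  fix j :: int and x :: "real^'n"
  show "set_integrable lborel (cell j x) f"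
    by (rule set_integrable_bound[OF loc_int_cell[OF assms(1)]])
      (use assms in \<open>auto simp: set_borel_measurable_def intro!: AE_I2 order_trans[OF assms(3)]\<close>)
qed (rule assms)

lemma loc_int_cong_AE:
  fixes f :: "real^'n::finite \<Rightarrow> real"
  assumes "loc_int g" "f \<in> borel_measurable borel" "AE x in lborel. f x = g x"
  shows "loc_int f"
  unfolding loc_int_def
proof (intro conjI allI)
  fix j :: int and x :: "real^'n"
  show "set_integrable lborel (cell j x) f"
    using assms by (subst set_integrable_cong_AE[of _ _ g]) (auto simp: loc_int_def)
qed (rule assms)

lemma lev_loc_int: 
  assumes "lev j g" shows "loc_int g"
proof (rule loc_intI_level)
  show "set_integrable lborel (cell j x) g" for x
  proof -
    have "set_integrable lborel (cell j x) (\<lambda>_. g x)"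
      by (simp add: set_integrable_def emeasure_cell)
    then show ?thesis
      by (rule iffD1[OF set_integrable_cong, rotated -1]) (use levD[OF assms] in auto)
  qed
qed (rule lev_measurable[OF assms])

lemma loc_int_avg [simp, intro!]: "loc_int (avg j f)"
  using lev_loc_int lev_avg by blast

lemma loc_int_const [simp, intro!]: "loc_int (\<lambda>x. c)"
  by (rule lev_loc_int[of 0]) simp

lemma loc_int_add [intro!]: "loc_int f \<Longrightarrow> loc_int g \<Longrightarrow> loc_int (\<lambda>x. f x + g x)"
  and loc_int_diff [intro!]: "loc_int f \<Longrightarrow> loc_int g \<Longrightarrow> loc_int (\<lambda>x. f x - g x)"
  and loc_int_abs [intro!]: "loc_int f \<Longrightarrow> loc_int (\<lambda>x. \<bar>f x\<bar>)"
  and loc_int_cmult [intro!]: "loc_int f \<Longrightarrow> loc_int (\<lambda>x. c * f x)"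
  and loc_int_multc [intro!]: "loc_int f \<Longrightarrow> loc_int (\<lambda>x. f x * c)"
  by (auto simp: loc_int_def intro: set_integrable_abs set_integral_add set_integral_diff)

lemma loc_int_sum [intro!]: "(\<And>i. i \<in> I \<Longrightarrow> loc_int (f i)) \<Longrightarrow> loc_int (\<lambda>x. \<Sum>i\<in>I. f i x)"
  by (induction I rule: infinite_finite_induct) auto

lemma loc_int_lev_mult:
  assumes "lev j g" "loc_int f" shows "loc_int (\<lambda>x. g x * f x)"
proof (rule loc_intI_level)
  show "(\<lambda>x. g x * f x) \<in> borel_measurable borel"
    using lev_measurable[OF assms(1)] loc_int_measurable[OF assms(2)] by simp
  show "set_integrable lborel (cell j x) (\<lambda>x. g x * f x)" for x
  proof -
    have "set_integrable lborel (cell j x) (\<lambda>y. g x * f y)"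
      using loc_int_cell[OF assms(2)] by auto
    then show ?thesis
      by (rule iffD1[OF set_integrable_cong, rotated -1]) (use levD[OF assms(1)] in auto)
  qed
qed

lemma avg_cong: "(\<And>y. y \<in> cell j x \<Longrightarrow> f y = g y) \<Longrightarrow> avg j f x = avg j g x"
  unfolding avg_def by (metis (no_types, lifting) set_lebesgue_integral_cong sets_cell sets_lborel)

lemma avg_cong_AE:
  assumes "f \<in> borel_measurable borel" "g \<in> borel_measurable borel" "AE x in lborel. f x = g x"
  shows "avg j f x = avg j g x"
  unfolding avg_def using assms by (subst set_lebesgue_integral_cong_AE[of _ _ f g]) auto

lemma avg_add: "loc_int f \<Longrightarrow> loc_int g \<Longrightarrow> avg j (\<lambda>x. f x + g x) x = avg j f x + avg j g x"
  and avg_diff: "loc_int f \<Longrightarrow> loc_int g \<Longrightarrow> avg j (\<lambda>x. f x - g x) x = avg j f x - avg j g x"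
  by (auto simp: avg_def loc_int_def algebra_simps set_integral_add set_integral_diff)

lemma avg_cmult: "avg j (\<lambda>x. c * f x) x = c * avg j f x"
  and avg_multc: "avg j (\<lambda>x. f x * c) x = avg j f x * c"
  by (auto simp: avg_def)

lemma avg_const [simp]: "avg j (\<lambda>x. c) x = c"
  by (simp add: avg_def set_lebesgue_integral_def measure_cell powr_minus)

lemma avg_lev_mult: "lev j g \<Longrightarrow> avg j (\<lambda>y. g y * f y) x = g x * avg j f x"
  by (subst avg_cmult[symmetric], rule avg_cong) (auto dest: levD)

lemma avg_lev: "lev j g \<Longrightarrow> avg j g x = g x"
  using avg_lev_mult[of j g "\<lambda>_. 1"] by simp

lemma avg_sum: "(\<And>i. i \<in> I \<Longrightarrow> loc_int (f i)) \<Longrightarrow> avg j (\<lambda>x. \<Sum>i\<in>I. f i x) x = (\<Sum>i\<in>I. avg j (f i) x)"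
  by (induction I rule: infinite_finite_induct) (auto simp: avg_add loc_int_sum)

lemma avg_mono_cell:
  assumes "loc_int f" "loc_int g" "\<And>y. y \<in> cell j x \<Longrightarrow> f y \<le> g y"
  shows "avg j f x \<le> avg j g x"
  unfolding avg_def using assms
  by (intro mult_left_mono set_integral_mono loc_int_cell) auto

lemma avg_mono_AE:
  assumes "loc_int f" "loc_int g" "AE y in lborel. f y \<le> g y"
  shows "avg j f x \<le> avg j g x"
  unfolding avg_def using assms
  by (intro mult_left_mono set_integral_mono_AE loc_int_cell) auto

lemma avg_nonneg: "(\<And>y. y \<in> cell j x \<Longrightarrow> 0 \<le> f y) \<Longrightarrow> 0 \<le> avg j f x"
  unfolding avg_def set_lebesgue_integral_def
  by (intro mult_nonneg_nonneg integral_nonneg) (auto simp: indicator_def)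

lemma avg_abs_le: "loc_int f \<Longrightarrow> \<bar>avg j f x\<bar> \<le> avg j (\<lambda>y. \<bar>f y\<bar>) x"
proof -
  assume f: "loc_int f"
  have "avg j f x \<le> avg j (\<lambda>y. \<bar>f y\<bar>) x"
    by (rule avg_mono_cell[OF f loc_int_abs[OF f]]) simp
  moreover have "avg j (\<lambda>y. (-1) * f y) x \<le> avg j (\<lambda>y. \<bar>f y\<bar>) x"
    by (rule avg_mono_cell[OF loc_int_cmult[OF f] loc_int_abs[OF f]]) simp
  ultimately show ?thesis unfolding avg_cmult by linarith
qed

text \<open>The tower property of conditional expectations: the coarse cell is a finite disjoint
  union of level j cubes, on each of which f and its average have the same integral.\<close>

lemma avg_tower:
  assumes f: "loc_int f" and ij: "i \<le> j"
  shows "avg i (avg j f) x = avg i f x"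
proof -
  define I where "I = idx j ` cell i x"
  have fin: "finite I" unfolding I_def by (intro finite_idx_image bounded_cell)
  have un: "cell i x = (\<Union>m\<in>I. dcube j m)"
  proof -
    have "y \<in> cell i x" if "z \<in> cell i x" "idx j y = idx j z" for y z
      using that idx_coarse[of j y z i] ij by (simp add: mem_cell)
    then show ?thesis by (auto simp: I_def mem_dcube)
  qed
  have disj: "disjoint_family_on (dcube j) I"
    by (auto simp: disjoint_family_on_def mem_dcube)
  have *: "(LINT y:cell i x|lborel. g y) = (\<Sum>m\<in>I. LINT y:dcube j m|lborel. g y)" if "loc_int g" for g
    unfolding un by (intro set_integral_finite_Union fin disj) (simp_all add: loc_int_dcube[OF that])
  have "(LINT y:dcube j m|lborel. avg j f y) = (LINT y:dcube j m|lborel. f y)" for m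
  proof -
    obtain z where z: "dcube j m = cell j z" using dcube_cellE by blast
    have "avg j (avg j f) z = avg j f z" by (simp add: avg_lev)
    then show ?thesis unfolding z avg_def[of j "avg j f"] avg_def[of j f z] by simp
  qed
  then show ?thesis unfolding avg_def[of i] by (simp add: *[OF f] *[OF loc_int_avg])
qed

text \<open>Bridge to nonnegative integrals, through which Fatou's lemma and Tonelli's theorem
  become available for averages.\<close>

lemma nn_avg:
  fixes g :: "real^'n::finite \<Rightarrow> real"
  assumes g: "set_integrable lborel (cell k x) g" and nn: "\<And>y. 0 \<le> g y"
  shows "(\<integral>\<^sup>+ y\<in>cell k x. ennreal (g y) \<partial>lborel) = ennreal (2 powr (- (real_of_int k * real CARD('n))) * avg k g x)"
proof -
  have "(\<integral>\<^sup>+ y\<in>cell k x. ennreal (g y) \<partial>lborel) = (\<integral>\<^sup>+ y. ennreal (indicator (cell k x) y *\<^sub>R g y) \<partial>lborel)"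
    by (intro nn_integral_cong) (auto simp: indicator_def)
  also have "\<dots> = ennreal (LINT y:cell k x|lborel. g y)"
    unfolding set_lebesgue_integral_def using g nn
    by (intro nn_integral_eq_integral) (auto simp: set_integrable_def)
  also have "(LINT y:cell k x|lborel. g y) = 2 powr (- (real_of_int k * real CARD('n))) * avg k g x"
    by (simp add: avg_def powr_minus)
  finally show ?thesis .
qed

lemma avg_leI_nn:
  fixes g :: "real^'n::finite \<Rightarrow> real"
  assumes m: "g \<in> borel_measurable borel" and nn: "\<And>y. 0 \<le> g y" and C: "0 \<le> C"
    and le: "(\<integral>\<^sup>+ y\<in>cell k x. ennreal (g y) \<partial>lborel) \<le> ennreal (2 powr (- (real_of_int k * real CARD('n))) * C)"
  shows "set_integrable lborel (cell k x) g" "avg k g x \<le> C"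
proof -
  show int: "set_integrable lborel (cell k x) g"
    unfolding set_integrable_def
  proof (rule integrableI_bounded)
    have "(\<integral>\<^sup>+ y. ennreal (norm (indicator (cell k x) y *\<^sub>R g y)) \<partial>lborel) = (\<integral>\<^sup>+ y\<in>cell k x. ennreal (g y) \<partial>lborel)"
      using nn by (intro nn_integral_cong) (auto simp: indicator_def)
    also have "\<dots> < \<infinity>" using le by (metis ennreal_less_top infinity_ennreal_def le_less_trans)
    finally show "(\<integral>\<^sup>+ y. ennreal (norm (indicator (cell k x) y *\<^sub>R g y)) \<partial>lborel) < \<infinity>" .
  qed (use m in measurable)
  have "2 powr (- (real_of_int k * real CARD('n))) * avg k g x \<le> 2 powr (- (real_of_int k * real CARD('n))) * C"
    using le C unfolding nn_avg[OF int nn] by (subst (asm) ennreal_le_iff) auto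
  then show "avg k g x \<le> C" by simp
qed

text \<open>Fatou's lemma for averages. Integrability of the limit is a conclusion, so it also
  serves to show that limits stay in the spaces considered.\<close>

lemma avg_fatou:
  fixes g :: "real^'n::finite \<Rightarrow> real"
  assumes G: "\<And>i. loc_int (G i)" "\<And>i y. 0 \<le> G i y" and m: "g \<in> borel_measurable borel" and nn: "\<And>y. 0 \<le> g y"
    and lim: "AE y in lborel. y \<in> cell k x \<longrightarrow> (\<lambda>i. G i y) \<longlonglongrightarrow> g y" and C: "0 \<le> C" "\<And>i::nat. avg k (G i) x \<le> C"
  shows "set_integrable lborel (cell k x) g" "avg k g x \<le> C"
proof -
  let ?c = "2 powr (- (real_of_int k * real CARD('n)))"
  have Gm[measurable]: "\<And>i. G i \<in> borel_measurable borel" using G(1) loc_int_measurable by blast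
  have "(\<integral>\<^sup>+ y\<in>cell k x. ennreal (g y) \<partial>lborel) \<le> (\<integral>\<^sup>+ y. liminf (\<lambda>i. ennreal (G i y) * indicator (cell k x) y) \<partial>lborel)"
  proof (rule nn_integral_mono_AE)
    show "AE y in lborel. ennreal (g y) * indicator (cell k x) y \<le> liminf (\<lambda>i. ennreal (G i y) * indicator (cell k x) y)"
      using lim
    proof eventually_elim
      case (elim y)
      show ?case
      proof (cases "y \<in> cell k x")
        case True
        have "(\<lambda>i. ennreal (G i y)) \<longlonglongrightarrow> ennreal (g y)" using elim True by (intro tendsto_ennrealI) blast
        then have "liminf (\<lambda>i. ennreal (G i y)) = ennreal (g y)" by (simp add: lim_imp_Liminf)
        then show ?thesis using True by simp
      qed simp
    qed
  qed
  also have "\<dots> \<le> liminf (\<lambda>i. \<integral>\<^sup>+ y\<in>cell k x. ennreal (G i y) \<partial>lborel)"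
    by (intro nn_integral_liminf) measurable
  also have "\<dots> \<le> ennreal (?c * C)"
  proof (rule Liminf_le)
    show "\<forall>\<^sub>F i in sequentially. (\<integral>\<^sup>+ y\<in>cell k x. ennreal (G i y) \<partial>lborel) \<le> ennreal (?c * C)"
      by (intro always_eventually allI, subst nn_avg[OF loc_int_cell[OF G(1)] G(2)])
        (intro ennreal_leI mult_left_mono C, simp)
  qed simp
  finally show "set_integrable lborel (cell k x) g" "avg k g x \<le> C"
    using avg_leI_nn[OF m nn C(1)] by auto
qed

section \<open>Density of dyadic step functions and convergence of averages\<close>

lemma cell_small:
  fixes y :: "real^'n::finite"
  assumes "open U" "y \<in> U" shows "\<exists>N::nat. cell (int N) y \<subseteq> U"
proof -
  obtain e where e: "e > 0" "ball y e \<subseteq> U" using assms open_contains_ball by blast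
  have "(\<lambda>N. real CARD('n) * 2 powr (- real N)) \<longlonglongrightarrow> 0"
  proof -
    have "(\<lambda>N. real CARD('n) * (1/2) ^ N) \<longlonglongrightarrow> real CARD('n) * 0"
      by (intro tendsto_intros) auto
    moreover have "2 powr (- real N) = (1/2) ^ N" for N
      by (simp add: powr_minus powr_realpow power_divide inverse_eq_divide)
    ultimately show ?thesis by simp
  qed
  then have "\<forall>\<^sub>F N in sequentially. real CARD('n) * 2 powr (- real N) < e"
    using e(1) by (rule order_tendstoD)
  then obtain N where N: "real CARD('n) * 2 powr (- real N) < e" using eventually_happens by fastforce
  have "cell (int N) y \<subseteq> ball y e"
  proof
    fix z assume z: "z \<in> cell (int N) y"
    have "\<bar>(y - z)$i\<bar> \<le> 2 powr (- real N)" for i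
    proof -
      have "\<lfloor>z$i * 2 powr real N\<rfloor> = \<lfloor>y$i * 2 powr real N\<rfloor>"
        using z by (simp add: mem_cell idx_def vec_eq_iff)
      then have "\<bar>y$i * 2 powr real N - z$i * 2 powr real N\<bar> \<le> 1" by linarith
      then have "\<bar>y$i - z$i\<bar> * 2 powr real N \<le> 1" by (simp add: left_diff_distrib[symmetric] abs_mult)
      then show ?thesis by (simp add: powr_minus field_simps)
    qed
    then have "norm (y - z) \<le> (\<Sum>i\<in>(UNIV::'n set). 2 powr (- real N))"
      by (intro order_trans[OF norm_le_l1_cart] sum_mono) auto
    then show "z \<in> ball y e" using N by (simp add: dist_norm)
  qed
  then show ?thesis using e by blast
qed

text \<open>Approximability in L^1 by integrable dyadic step functions, packaged as a predicate on
  which the induction over integrable functions can run.\<close>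

definition lev_approx :: "(real^'n::finite \<Rightarrow> real) \<Rightarrow> bool" where
  "lev_approx h \<longleftrightarrow> (\<forall>\<epsilon>>0. \<exists>N g. lev (int N) g \<and> integrable lborel g \<and> (LINT y|lborel. \<bar>h y - g y\<bar>) < \<epsilon>)"

lemma lev_approxE:
  assumes "lev_approx h" "\<epsilon> > 0"
  obtains N g where "lev (int N) g" "integrable lborel g" "(LINT y|lborel. \<bar>h y - g y\<bar>) < \<epsilon>"
  using assms(1)[unfolded lev_approx_def, rule_format, OF assms(2)] by blast

lemma lev_approx_add:
  assumes "integrable lborel f" "lev_approx f" "integrable lborel g" "lev_approx g"
  shows "lev_approx (\<lambda>x. f x + g x)"
  unfolding lev_approx_def
proof (intro allI impI)
  fix \<epsilon> :: real assume "\<epsilon> > 0"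
  then have "\<epsilon>/2 > 0" by simp
  obtain N1 g1 where 1: "lev (int N1) g1" "integrable lborel g1" "(LINT y|lborel. \<bar>f y - g1 y\<bar>) < \<epsilon>/2"
    by (rule lev_approxE[OF assms(2) \<open>\<epsilon>/2 > 0\<close>])
  obtain N2 g2 where 2: "lev (int N2) g2" "integrable lborel g2" "(LINT y|lborel. \<bar>g y - g2 y\<bar>) < \<epsilon>/2"
    by (rule lev_approxE[OF assms(4) \<open>\<epsilon>/2 > 0\<close>])
  have "lev (int (max N1 N2)) (\<lambda>x. g1 x + g2 x)"
    by (intro lev_arith lev_mono[OF 1(1)] lev_mono[OF 2(1)]) auto
  moreover have "(LINT y|lborel. \<bar>(f y + g y) - (g1 y + g2 y)\<bar>) \<le> (LINT y|lborel. \<bar>f y - g1 y\<bar> + \<bar>g y - g2 y\<bar>)"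
    using assms 1 2 by (intro integral_mono) auto
  moreover have "\<dots> = (LINT y|lborel. \<bar>f y - g1 y\<bar>) + (LINT y|lborel. \<bar>g y - g2 y\<bar>)"
    using assms 1 2 by (intro Bochner_Integration.integral_add) auto
  ultimately show "\<exists>N g'. lev (int N) g' \<and> integrable lborel g' \<and> (LINT y|lborel. \<bar>(f y + g y) - g' y\<bar>) < \<epsilon>"
    using 1 2 by (intro exI[of _ "max N1 N2"] exI[of _ "\<lambda>x. g1 x + g2 x"]) auto
qed

text \<open>Outer regularity replaces the set by an open set of almost the same measure, and an open
  set is exhausted by the cubes that it contains.\<close>

lemma lev_approx_indicator:
  fixes A :: "(real^'n::finite) set"
  assumes A: "A \<in> sets borel" "emeasure lborel A < \<infinity>"
  shows "lev_approx (\<lambda>x. indicator A x *\<^sub>R c)"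
  unfolding lev_approx_def
proof (intro allI impI)
  fix \<epsilon> :: real assume eps: "\<epsilon> > 0"
  define \<delta> where "\<delta> = \<epsilon> / (2 * (\<bar>c\<bar> + 1))"
  have d: "\<delta> > 0" using eps by (simp add: \<delta>_def)
  obtain U where U: "open U" "A \<subseteq> U" "emeasure lborel (U - A) < ennreal \<delta>"
    using outer_regular_lborel[OF A(1) d] by blast
  have [measurable]: "U \<in> sets borel" using U(1) by simp
  have finU: "emeasure lborel U < \<infinity>"
  proof -
    have "emeasure lborel U \<le> emeasure lborel A + emeasure lborel (U - A)"
      using U(2) A(1) by (metis emeasure_subadditive Un_Diff_cancel sets_lborel sets.Diff Un_absorb1 \<open>U \<in> sets borel\<close>)
    also have "\<dots> < \<infinity>" using A(2) U(3) by (metis ennreal_add_eq_top ennreal_less_top infinity_ennreal_def less_top order_less_trans)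
    finally show ?thesis .
  qed
  \<comment> \<open>The union of the level N cubes contained in U: constant on cubes of level N by
    construction, increasing in N, with union U by \<open>cell_small\<close>.\<close>
  define V where "V N = {y. cell (int N) y \<subseteq> U}" for N
  have levV: "lev (int N) (indicator (V N) :: _ \<Rightarrow> real)" for N
    unfolding lev_def V_def by (auto simp: indicator_def dest: cell_cong)
  have Vm: "V N \<in> sets borel" for N
    using lev_measurable[OF levV[of N]] by (simp add: borel_measurable_indicator_iff)
  have VU: "V N \<subseteq> U" for N unfolding V_def using self_mem_cell by blast
  have inc: "incseq V"
    unfolding incseq_def V_def
  proof (intro allI impI)
    fix m n :: nat assume "m \<le> n"
    then have "cell (int n) y \<subseteq> cell (int m) y" for y
      by (intro cell_subset) simp_all
    then show "{y. cell (int m) y \<subseteq> U} \<subseteq> {y. cell (int n) y \<subseteq> U}" by blast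
  qed
  have un: "(\<Union>N. V N) = U"
    using VU cell_small[OF U(1)] unfolding V_def by blast
  have "(\<lambda>N. measure lborel (V N)) \<longlonglongrightarrow> measure lborel (\<Union>N. V N)"
    using finU un by (intro Lim_measure_incseq inc) (use Vm in auto)
  then have "\<forall>\<^sub>F N in sequentially. dist (measure lborel (V N)) (measure lborel U) < \<delta>"
    unfolding un using d by (rule tendstoD)
  then obtain N where N: "\<bar>measure lborel (V N) - measure lborel U\<bar> < \<delta>"
    using eventually_happens by (fastforce simp: dist_real_def)
  have fm: "U \<in> fmeasurable lborel" "A \<in> fmeasurable lborel" "V N \<in> fmeasurable lborel"
    using finU A Vm VU[of N] by (auto simp: fmeasurable_def intro: le_less_trans[OF emeasure_mono[OF VU]])
  have UA: "measure lborel U - measure lborel A < \<delta>"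
  proof -
    have "measure lborel (U - A) < \<delta>" using U(3) d by (metis emeasure_eq_ennreal_measure ennreal_less_iff measure_nonneg not_less_iff_gr_or_eq ennreal_less_top top.not_eq_extremum order_less_trans)
    then show ?thesis using measurable_measure_Diff[OF fm(1), of A] U(2) A(1) by simp
  qed
  have AI: "integrable lborel (\<lambda>y. indicator A y :: real)" "integrable lborel (\<lambda>y. indicator U y :: real)" "integrable lborel (\<lambda>y. indicator (V N) y :: real)"
    using fm by (auto simp: fmeasurable_def)
  have "(LINT y|lborel. \<bar>indicator A y *\<^sub>R c - c * indicator (V N) y\<bar>) \<le> (LINT y|lborel. \<bar>c\<bar> * ((indicator U y - indicator A y) + (indicator U y - indicator (V N) y)))"
    using U(2) VU[of N] AI by (intro integral_mono) (auto simp: indicator_def)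
  also have "\<dots> = \<bar>c\<bar> * ((measure lborel U - measure lborel A) + (measure lborel U - measure lborel (V N)))"
    using AI by (simp add: lmeasure_integral_UNIV[symmetric])
  also have "\<dots> \<le> \<bar>c\<bar> * (2 * \<delta>)" using UA N by (intro mult_left_mono) linarith+
  also have "\<dots> < \<epsilon>" using eps unfolding \<delta>_def by (simp add: field_simps)
  finally show "\<exists>N g. lev (int N) g \<and> integrable lborel g \<and> (LINT y|lborel. \<bar>indicator A y *\<^sub>R c - g y\<bar>) < \<epsilon>"
    using lev_arith(3)[OF lev_const levV[of N], of c] AI(3) by (intro exI[of _ N] exI[of _ "\<lambda>y. c * indicator (V N) y"]) auto
qed

lemma integrable_lev_approx:
  fixes h :: "real^'n::finite \<Rightarrow> real"
  assumes "integrable lborel h" shows "lev_approx h"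
  using assms
proof (induction rule: integrable_induct)
  case (base A c)
  then show ?case by (intro lev_approx_indicator) auto
next
  case (add f g)
  then show ?case using lev_approx_add by blast
next
  case (lim f s)
  note bd = lim(3) and P = lim(5)
  thm bd
 thm P
 thm lim
  show ?case unfolding lev_approx_def
  proof (intro allI impI)
    fix \<epsilon> :: real assume eps: "\<epsilon> > 0"
    have "(\<lambda>i. LINT y|lborel. \<bar>f y - s i y\<bar>) \<longlonglongrightarrow> (LINT y::real^'n|lborel. 0)"
    proof (rule integral_dominated_convergence[where w = "\<lambda>y. 3 * \<bar>f y\<bar>"])
      show "AE y in lborel. (\<lambda>i. \<bar>f y - s i y\<bar>) \<longlonglongrightarrow> 0"
      proof (rule AE_I2)
        fix y
        have "(\<lambda>i. \<bar>f y - s i y\<bar>) \<longlonglongrightarrow> \<bar>f y - f y\<bar>" by (intro tendsto_intros) (use lim in auto)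
        then show "(\<lambda>i. \<bar>f y - s i y\<bar>) \<longlonglongrightarrow> 0" by simp
      qed
      show "AE y in lborel. norm \<bar>f y - s i y\<bar> \<le> 3 * \<bar>f y\<bar>" for i
        using bd[of _ i] by (intro AE_I2) (smt (verit) UNIV_I real_norm_def space_borel space_lborel)
    qed (use lim in auto)
    then have "\<forall>\<^sub>F i in sequentially. (LINT y|lborel. \<bar>f y - s i y\<bar>) < \<epsilon>/2"
      using eps by (intro order_tendstoD(2)[where y=0]) auto
    then obtain i where i: "(LINT y|lborel. \<bar>f y - s i y\<bar>) < \<epsilon>/2" using eventually_happens by fastforce
    obtain N g where g: "lev (int N) g" "integrable lborel g" "(LINT y|lborel. \<bar>s i y - g y\<bar>) < \<epsilon>/2"
      by (rule lev_approxE[OF P[of i], of "\<epsilon>/2"]) (use eps in auto)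
    have "(LINT y|lborel. \<bar>f y - g y\<bar>) \<le> (LINT y|lborel. \<bar>f y - s i y\<bar> + \<bar>s i y - g y\<bar>)"
      using lim g by (intro integral_mono) auto
    also have "\<dots> = (LINT y|lborel. \<bar>f y - s i y\<bar>) + (LINT y|lborel. \<bar>s i y - g y\<bar>)"
      using lim g by (intro Bochner_Integration.integral_add) auto
    finally show "\<exists>N g. lev (int N) g \<and> integrable lborel g \<and> (LINT y|lborel. \<bar>f y - g y\<bar>) < \<epsilon>"
      using g i by (intro exI[of _ N] exI[of _ g]) auto
  qed
qed

text \<open>The density argument for martingale convergence in mean: a step function is reproduced
  by its averages at fine levels, and averaging is an L^1 contraction on every coarser cell.\<close>

lemma avg_conv_L1:
  fixes f :: "real^'n::finite \<Rightarrow> real"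
  assumes f: "loc_int f"
  shows "(\<lambda>N. avg k (\<lambda>y. \<bar>avg (int N) f y - f y\<bar>) x) \<longlonglongrightarrow> 0"
proof (rule LIMSEQ_I)
  fix r :: real assume r: "r > 0"
  let ?c = "2 powr (real_of_int k * real CARD('n))"
  define h where "h y = indicator (cell k x) y *\<^sub>R f y" for y
  have h: "integrable lborel h" using loc_int_cell[OF f] unfolding h_def set_integrable_def by blast
  have "0 < r / (2 * ?c)" using r by simp
  then obtain N0 g where g: "lev (int N0) g" "integrable lborel g" "(LINT y|lborel. \<bar>h y - g y\<bar>) < r / (2 * ?c)"
    by (rule lev_approxE[OF integrable_lev_approx[OF h]])
  have lg: "loc_int g" using g(1) lev_loc_int by blast
  have fg: "loc_int (\<lambda>y. f y - g y)" using f lg by blast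
  have "norm (avg k (\<lambda>y. \<bar>avg (int N) f y - f y\<bar>) x - 0) < r" if N: "N \<ge> max N0 (nat k)" for N
  proof -
    have levg: "lev (int N) g" using lev_mono[OF g(1)] N by simp
    have kN: "k \<le> int N" using N by linarith
    have pt: "\<bar>avg (int N) f y - f y\<bar> \<le> avg (int N) (\<lambda>y. \<bar>f y - g y\<bar>) y + \<bar>f y - g y\<bar>" for y
    proof -
      have "avg (int N) (\<lambda>y. f y - g y) y = avg (int N) f y - g y"
        using avg_diff[OF f lg] avg_lev[OF levg] by metis
      then show ?thesis using avg_abs_le[OF fg, of "int N" y] by linarith
    qed
    have "avg k (\<lambda>y. \<bar>avg (int N) f y - f y\<bar>) x \<le> avg k (\<lambda>y. avg (int N) (\<lambda>y. \<bar>f y - g y\<bar>) y + \<bar>f y - g y\<bar>) x"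
      by (intro avg_mono_cell pt) (use f fg in auto)
    also have "\<dots> = 2 * avg k (\<lambda>y. \<bar>f y - g y\<bar>) x"
      using fg by (subst avg_add) (auto simp: avg_tower[OF loc_int_abs[OF fg] kN])
    also have "avg k (\<lambda>y. \<bar>f y - g y\<bar>) x = ?c * (LINT y:cell k x|lborel. \<bar>h y - g y\<bar>)"
      unfolding avg_def by (intro arg_cong2[where f="(*)"] set_lebesgue_integral_cong refl) (auto simp: h_def)
    also have "(LINT y:cell k x|lborel. \<bar>h y - g y\<bar>) \<le> (LINT y|lborel. \<bar>h y - g y\<bar>)"
      unfolding set_lebesgue_integral_def using h g(2)
      by (intro integral_mono integrable_mult_indicator) (auto simp: indicator_def)
    finally have "avg k (\<lambda>y. \<bar>avg (int N) f y - f y\<bar>) x \<le> 2 * (?c * (LINT y|lborel. \<bar>h y - g y\<bar>))" by simp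
    also have "\<dots> < r" using g(3) by (simp add: field_simps)
    finally show ?thesis using avg_nonneg[of k x "\<lambda>y. \<bar>avg (int N) f y - f y\<bar>"] by simp
  qed
  then show "\<exists>no. \<forall>N\<ge>no. norm (avg k (\<lambda>y. \<bar>avg (int N) f y - f y\<bar>) x - 0) < r" by blast
qed

lemma avg_L1_AE_subseq:
  fixes u :: "nat \<Rightarrow> real^'n::finite \<Rightarrow> real"
  assumes u: "\<And>i. loc_int (u i)" and c: "(\<lambda>i. avg k (\<lambda>y. \<bar>u i y\<bar>) x) \<longlonglongrightarrow> 0"
  shows "\<exists>r::nat\<Rightarrow>nat. strict_mono r \<and> (AE y in lborel. y \<in> cell k x \<longrightarrow> (\<lambda>i. u (r i) y) \<longlonglongrightarrow> 0)"
proof -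
  let ?c = "2 powr (- (real_of_int k * real CARD('n)))"
  have "(\<lambda>i. ?c * avg k (\<lambda>y. \<bar>u i y\<bar>) x) \<longlonglongrightarrow> ?c * 0" using c by (intro tendsto_intros)
  moreover have "?c * avg k (\<lambda>y. \<bar>u i y\<bar>) x = (LINT y|lborel. norm (indicator (cell k x) y *\<^sub>R u i y))" for i
    by (simp add: avg_def powr_minus set_lebesgue_integral_def abs_mult)
  ultimately have "(\<lambda>i. LINT y|lborel. norm (indicator (cell k x) y *\<^sub>R u i y)) \<longlonglongrightarrow> 0" by simp
  moreover have "integrable lborel (\<lambda>y. indicator (cell k x) y *\<^sub>R u i y)" for i
    using loc_int_cell[OF u] unfolding set_integrable_def by blast
  ultimately obtain r where "strict_mono r" "AE y in lborel. (\<lambda>n. indicator (cell k x) y *\<^sub>R u (r n) y) \<longlonglongrightarrow> 0"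
    using tendsto_L1_AE_subseq[of lborel "\<lambda>i y. indicator (cell k x) y *\<^sub>R u i y"] by auto
  then show ?thesis by (intro exI[of _ r]) (auto elim!: eventually_mono)
qed

text \<open>Convergence in mean gives an almost everywhere convergent subsequence on one cell. This
  replaces the Lebesgue differentiation theorem wherever a limit is afterwards taken by
  Fatou.\<close>

lemma avg_conv_AE_subseq:
  fixes f :: "real^'n::finite \<Rightarrow> real"
  assumes f: "loc_int f"
  shows "\<exists>r::nat\<Rightarrow>nat. strict_mono r \<and> (AE y in lborel. y \<in> cell k x \<longrightarrow> (\<lambda>i. avg (int (r i)) f y) \<longlonglongrightarrow> f y)"
proof -
  have "\<exists>r::nat\<Rightarrow>nat. strict_mono r \<and> (AE y in lborel. y \<in> cell k x \<longrightarrow> (\<lambda>i. avg (int (r i)) f y - f y) \<longlonglongrightarrow> 0)"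
    by (rule avg_L1_AE_subseq[of "\<lambda>N y. avg (int N) f y - f y", OF _ avg_conv_L1[OF f]]) (use f in auto)
  then show ?thesis by (simp add: LIM_zero_iff)
qed

text \<open>Countably many cubes cover the space, so exceptional null sets may depend on the
  cube.\<close>

lemma AE_cells:
  assumes "\<And>x. AE y in lborel. y \<in> cell k x \<longrightarrow> P y"
  shows "AE y::real^'n::finite in lborel. P y"
proof -
  have "AE y in lborel. \<forall>m. y \<in> dcube k m \<longrightarrow> P y"
    unfolding AE_all_countable
  proof
    fix m :: "int^'n"
    obtain x where "dcube k m = cell k x" using dcube_cellE by blast
    then show "AE y in lborel. y \<in> dcube k m \<longrightarrow> P y" using assms[of x] by simp
  qed
  then show ?thesis by (rule eventually_mono) (simp add: mem_dcube)
qed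

lemma avg_zero_AE:
  fixes f :: "real^'n::finite \<Rightarrow> real"
  assumes f: "loc_int f" and z: "\<And>x. avg k (\<lambda>y. \<bar>f y\<bar>) x = 0"
  shows "AE y in lborel. f y = 0"
proof (rule AE_cells)
  fix x
  have "(LINT y|lborel. norm (indicator (cell k x) y *\<^sub>R f y)) = 0"
    using z[of x] by (simp add: avg_def set_lebesgue_integral_def abs_mult)
  then have "AE y in lborel. norm (indicator (cell k x) y *\<^sub>R f y) = 0"
    using loc_int_cell[OF f, of k x] unfolding set_integrable_def
    by (subst (asm) integral_nonneg_eq_0_iff_AE) auto
  then show "AE y in lborel. y \<in> cell k x \<longrightarrow> f y = 0" by (rule eventually_mono) auto
qed

text \<open>The averages of f converge to f in mean, so if all of them vanish then so does f. It
  identifies the limit point in the necessity part.\<close>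

lemma avg_all_zero_AE:
  fixes f :: "real^'n::finite \<Rightarrow> real"
  assumes f: "loc_int f" and z: "\<And>k x. avg k f x = 0"
  shows "AE y in lborel. f y = 0"
proof (rule avg_zero_AE[OF f, of 0])
  fix x
  show "avg 0 (\<lambda>y. \<bar>f y\<bar>) x = 0"
    using avg_conv_L1[OF f, of 0 x] by (simp add: z LIMSEQ_const_iff)
qed

section \<open>Linearity, power inequalities and Hoelder for averages\<close>

lemma avg_lincomb:
  assumes "loc_int f" "loc_int g"
  shows "avg k (\<lambda>y. c * f y + d * g y) x = c * avg k f x + d * avg k g x"
  using avg_add[OF loc_int_cmult[OF assms(1), of c] loc_int_cmult[OF assms(2), of d], of k x] by (simp add: avg_cmult)

lemma avg_affine:
  assumes "loc_int g"
  shows "avg k (\<lambda>y. c + d * g y) x = c + d * avg k g x"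
  using avg_add[OF loc_int_const loc_int_cmult[OF assms, of d], of k c x] by (simp add: avg_cmult)

lemma powr_add_le:
  fixes x y e :: real assumes "x \<ge> 0" "y \<ge> 0" "e > 0"
  shows "(x + y) powr e \<le> 2 powr e * (x powr e + y powr e)"
proof -
  have "(x + y) powr e \<le> (2 * max x y) powr e" using assms by (intro powr_mono2) auto
  also have "\<dots> = 2 powr e * max x y powr e" using assms by (simp add: powr_mult)
  also have "max x y powr e \<le> x powr e + y powr e" by (auto simp: max_def)
  finally show ?thesis by simp
qed

lemma powr_sum_le:
  fixes f :: "'i \<Rightarrow> real" assumes "finite I" "\<And>i. i \<in> I \<Longrightarrow> 0 \<le> f i" "e > 0"
  shows "(\<Sum>i\<in>I. f i) powr e \<le> real (card I) powr e * (\<Sum>i\<in>I. f i powr e)"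
proof (cases "I = {}")
  case False
  define m where "m = Max (f ` I)"
  have mi: "f i \<le> m" if "i \<in> I" for i using that assms(1) by (simp add: m_def)
  have "m \<in> f ` I" unfolding m_def using assms(1) False by (intro Max_in) auto
  then obtain i0 where i0: "i0 \<in> I" "f i0 = m" by auto
  have "(\<Sum>i\<in>I. f i) powr e \<le> (real (card I) * m) powr e"
    using assms mi by (intro powr_mono2 sum_nonneg) (auto intro: sum_bounded_above)
  also have "\<dots> = real (card I) powr e * f i0 powr e" using assms(2)[OF i0(1)] i0(2) by (simp add: powr_mult)
  also have "f i0 powr e \<le> (\<Sum>i\<in>I. f i powr e)" using i0(1) assms(1) by (intro member_le_sum) auto
  finally show ?thesis by (simp add: mult_left_mono)
qed simp

text \<open>Converts exponential integrability into bounds for all power means in the John-Nirenberg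
  argument.\<close>

lemma powr_le_exp:
  fixes x e :: real assumes "x \<ge> 0" "e > 0" shows "x powr e \<le> e powr e * exp x"
proof -
  have "x / e \<le> exp (x / e)" using exp_ge_add_one_self[of "x/e"] by linarith
  then have "(x / e) powr e \<le> exp (x / e) powr e" using assms by (intro powr_mono2) auto
  also have "\<dots> = exp x" using assms by (simp add: powr_def)
  finally show ?thesis using assms by (simp add: powr_divide field_simps)
qed

text \<open>Hoelder in the form in which it is applied: from upper bounds for the two power means
  rather than from the means themselves. It is derived from Young's inequality after division by
  those bounds.\<close>

lemma avg_Holder:
  fixes u v :: "real^'n::finite \<Rightarrow> real"
  assumes r: "r > 1" "s > 1" "1/r + 1/s = 1"
    and u: "u \<in> borel_measurable borel" "\<And>y. 0 \<le> u y" "loc_int (\<lambda>y. u y powr r)"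
    and v: "v \<in> borel_measurable borel" "\<And>y. 0 \<le> v y" "loc_int (\<lambda>y. v y powr s)"
  shows loc_int_Holder: "loc_int (\<lambda>y. u y * v y)"
    and "U > 0 \<Longrightarrow> V \<ge> 0 \<Longrightarrow> avg k (\<lambda>y. u y powr r) x \<le> U powr r \<Longrightarrow> avg k (\<lambda>y. v y powr s) x \<le> V powr s
      \<Longrightarrow> avg k (\<lambda>y. u y * v y) x \<le> U * V"
proof -
  have "loc_int (\<lambda>y. u y powr r * (1/r) + v y powr s * (1/s))" by (intro loc_int_add loc_int_multc u v)
  then show li: "loc_int (\<lambda>y. u y * v y)"
  proof (rule loc_int_bound)
    show "\<bar>u y * v y\<bar> \<le> u y powr r * (1/r) + v y powr s * (1/s)" for y
      using Youngs_inequality[OF r u(2)[of y] v(2)[of y]] u(2)[of y] v(2)[of y] by (simp add: abs_mult)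
  qed (use u v in measurable)
  assume U: "U > 0" and V: "V \<ge> 0" and au: "avg k (\<lambda>y. u y powr r) x \<le> U powr r" and av: "avg k (\<lambda>y. v y powr s) x \<le> V powr s"
  \<comment> \<open>V may be 0, and the normalisation divides by it; so a larger W is used first and
    then decreased to V.\<close>
  have *: "avg k (\<lambda>y. u y * v y) x \<le> U * W" if W: "W > V" for W
  proof -
    have W0: "W > 0" using W V by simp
    have pt: "u y * v y \<le> (U * W / (r * U powr r)) * u y powr r + (U * W / (s * W powr s)) * v y powr s" for y
    proof -
      have "(u y / U) * (v y / W) \<le> (u y / U) powr r / r + (v y / W) powr s / s"
        using u(2) v(2) U W0 by (intro Youngs_inequality r) auto
      then have "U * W * ((u y / U) * (v y / W)) \<le> U * W * ((u y / U) powr r / r + (v y / W) powr s / s)"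
        using U W0 by (intro mult_left_mono) auto
      then show ?thesis using U W0 u(2)[of y] v(2)[of y] by (simp add: powr_divide field_simps)
    qed
    have "avg k (\<lambda>y. u y * v y) x \<le> avg k (\<lambda>y. (U * W / (r * U powr r)) * u y powr r + (U * W / (s * W powr s)) * v y powr s) x"
      by (intro avg_mono_cell pt li loc_int_add loc_int_cmult u(3) v(3))
    also have "\<dots> = (U * W / (r * U powr r)) * avg k (\<lambda>y. u y powr r) x + (U * W / (s * W powr s)) * avg k (\<lambda>y. v y powr s) x"
      by (rule avg_lincomb[OF u(3) v(3)])
    also have "\<dots> \<le> (U * W / (r * U powr r)) * U powr r + (U * W / (s * W powr s)) * W powr s"
    proof -
      have "V powr s \<le> W powr s" using V W r by (intro powr_mono2) auto
      then show ?thesis using av au U W0 r by (intro add_mono mult_left_mono) auto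
    qed
    also have "\<dots> = U * W * (1/r + 1/s)" using U W0 by (simp add: field_simps)
    finally show ?thesis using r by simp
  qed
  show "avg k (\<lambda>y. u y * v y) x \<le> U * V"
  proof (rule field_le_epsilon)
    fix e :: real assume "e > 0"
    then show "avg k (\<lambda>y. u y * v y) x \<le> U * V + e" using *[of "V + e / U"] U by (simp add: distrib_left)
  qed
qed

lemma loc_int_powr_le:
  fixes f :: "real^'n::finite \<Rightarrow> real"
  assumes "loc_int (\<lambda>y. \<bar>f y\<bar> powr t)" "f \<in> borel_measurable borel" "0 \<le> s" "s \<le> t"
  shows "loc_int (\<lambda>y. \<bar>f y\<bar> powr s)"
proof (rule loc_int_bound[of "\<lambda>y. 1 + \<bar>f y\<bar> powr t"])
  show "\<bar>\<bar>f y\<bar> powr s\<bar> \<le> 1 + \<bar>f y\<bar> powr t" for y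
  proof (cases "\<bar>f y\<bar> \<le> 1")
    case True
    then have "\<bar>f y\<bar> powr s \<le> 1" using assms by (intro powr_le1) auto
    then show ?thesis by (simp add: add_increasing2)
  next
    case False
    then have "\<bar>f y\<bar> powr s \<le> \<bar>f y\<bar> powr t" using assms by (intro powr_mono) auto
    then show ?thesis by simp
  qed
qed (use assms in auto)

lemma avg_abs_le_powr:
  fixes f :: "real^'n::finite \<Rightarrow> real"
  assumes "loc_int (\<lambda>y. \<bar>f y\<bar> powr r)" "f \<in> borel_measurable borel" "r > 1" "V \<ge> 0" "avg k (\<lambda>y. \<bar>f y\<bar> powr r) x \<le> V powr r"
  shows "avg k (\<lambda>y. \<bar>f y\<bar>) x \<le> V"
proof -
  have "avg k (\<lambda>y. 1 * \<bar>f y\<bar>) x \<le> 1 * V"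
    by (rule avg_Holder(2)[of "r/(r-1)" r "\<lambda>_. 1" "\<lambda>y. \<bar>f y\<bar>"])
       (use assms in \<open>auto simp: field_simps\<close>)
  then show ?thesis by simp
qed

text \<open>The factor is the ratio of the volumes of the two cells. With the child of a cube it
  produces the \<open>2 ^ CARD('n)\<close> in the jump estimates.\<close>

lemma avg_fine_le:
  fixes g :: "real^'n::finite \<Rightarrow> real"
  assumes g: "loc_int g" "\<And>y. 0 \<le> g y" and kj: "k \<le> j"
  shows "avg j g x \<le> 2 powr (real_of_int (j - k) * real CARD('n)) * avg k g x"
proof -
  have sub: "cell j x \<subseteq> cell k x" using kj by (intro cell_subset) simp_all
  have "(LINT y:cell j x|lborel. g y) \<le> (LINT y:cell k x|lborel. g y)"
    unfolding set_lebesgue_integral_def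
    using loc_int_cell[OF g(1), of j x] loc_int_cell[OF g(1), of k x] g(2) sub
    by (intro integral_mono) (auto simp: set_integrable_def indicator_def)
  then have le: "2 powr (real_of_int j * real CARD('n)) * (LINT y:cell j x|lborel. g y)
     \<le> 2 powr (real_of_int j * real CARD('n)) * (LINT y:cell k x|lborel. g y)" by simp
  have eq: "2 powr (real_of_int j * real CARD('n)) = 2 powr (real_of_int (j - k) * real CARD('n)) * 2 powr (real_of_int k * real CARD('n))"
    by (simp add: powr_add[symmetric] algebra_simps)
  show ?thesis using le unfolding avg_def by (subst (asm) (2) eq) (simp only: mult.assoc)
qed

section \<open>The dyadic maximal function\<close>

text \<open>The dyadic maximal function cut down to the levels from k to k + d. The recursion peels
  off the coarsest level, which suits inductions that descend into subcubes; being constant on cubes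
  of level k + d, it is integrable to every power.\<close>

fun dmax :: "nat \<Rightarrow> int \<Rightarrow> (real^'n::finite \<Rightarrow> real) \<Rightarrow> real^'n \<Rightarrow> real" where
  "dmax 0 k v x = avg k v x"
| "dmax (Suc d) k v x = max (avg k v x) (dmax d (k + 1) v x)"

lemma dmax_ge: "i \<le> d \<Longrightarrow> avg (k + int i) v x \<le> dmax d k v x"
proof (induction d arbitrary: k i)
  case (Suc d)
  show ?case
  proof (cases i)
    case (Suc i')
    then have "avg (k + 1 + int i') v x \<le> dmax d (k+1) v x" using Suc.IH Suc.prems by blast
    then show ?thesis using Suc by (simp add: algebra_simps)
  qed simp
qed simp

lemma lev_dmax: "lev (k + int d) (dmax d k v)"
proof (induction d arbitrary: k)
  case (Suc d)
  have "lev (k + int (Suc d)) (dmax d (k + 1) v)" using Suc.IH[of "k+1"] by (simp add: algebra_simps)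
  moreover have "lev (k + int (Suc d)) (avg k v)" by (rule lev_mono[OF lev_avg]) simp
  ultimately have "lev (k + int (Suc d)) (\<lambda>x. max (avg k v x) (dmax d (k + 1) v x))" by (intro lev_arith)
  then show ?case by simp
next
  case 0
  have "dmax 0 k v = avg k v" by (rule ext) simp
  then show ?case by simp
qed

lemma dmax_nonneg: "(\<And>y. 0 \<le> v y) \<Longrightarrow> 0 \<le> dmax d k v x"
  using dmax_ge[of 0 d k v x] avg_nonneg[of k x v] by force

text \<open>Doob's inequality by the Bellman function method: W(y, x), with y the running maximum and x the
  current average, is affine in x and, once the maximum is updated, lies below its tangent (fact tang,
  which is Young's inequality). So its expectation does not increase from one scale to the next.\<close>

lemma Doob_Bellman:
  fixes v :: "real^'n::finite \<Rightarrow> real"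
  assumes r: "r > 1" "s > 1" "1/r + 1/s = 1" and v: "loc_int v" "\<And>y. 0 \<le> v y"
  defines "W \<equiv> \<lambda>y x::real. y powr r - s * y powr (r-1) * x"
  assumes y: "avg k v x \<le> y"
  shows "avg k (\<lambda>z. W (max y (dmax d k v z)) (avg (k + int d) v z)) x \<le> W y (avg k v x)"
  using y
proof (induction d arbitrary: k x y)
  case 0
  have "avg k (\<lambda>z. W (max y (dmax 0 k v z)) (avg (k + int 0) v z)) x = W (max y (dmax 0 k v x)) (avg (k + int 0) v x)"
    by (intro avg_lev lev_comp2[where h="\<lambda>p q. W (max y p) q"]) simp_all
  then show ?case using 0 by (simp add: max_absorb1)
next
  case (Suc d)
  have y0: "0 \<le> y" using Suc.prems avg_nonneg[of k x v] v by force
  define F where "F z = W (max y (dmax d (k+1) v z)) (avg (k + 1 + int d) v z)" for z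
  have liF: "loc_int F" unfolding F_def
    by (intro lev_loc_int[of "k + 1 + int d"] lev_comp2[where h="\<lambda>p q. W (max y p) q"] lev_dmax lev_avg)
  have tang: "W (max y a) a \<le> y powr r - s * y powr (r-1) * a" if "a \<ge> 0" for a
  proof (cases "a \<le> y")
    case False
    have "y powr (r-1) * a \<le> (y powr (r-1)) powr s / s + a powr r / r"
      using Youngs_inequality[of s r "y powr (r-1)" a] r that by (simp add: add.commute)
    also have "(y powr (r-1)) powr s = y powr r"
    proof -
      have "(r - 1) * s = r" using r by (simp add: field_simps)
      then show ?thesis by (simp add: powr_powr)
    qed
    finally have "s * (y powr (r-1) * a) \<le> s * (y powr r / s + a powr r / r)" using r by (intro mult_left_mono) auto
    also have "\<dots> = y powr r + (s/r) * a powr r" using r(2) by (simp add: distrib_left)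
    also have "s/r = s - 1" using r by (simp add: field_simps)
    finally have "s * (y powr (r-1) * a) \<le> y powr r + (s-1) * a powr r" .
    moreover have "a powr (r-1) * a = a powr r" using powr_mult_base[of a "r-1"] that by (simp add: mult.commute)
    moreover have "W (max y a) a = a powr r - s * (a powr (r-1) * a)" using False by (simp add: W_def max_def mult.assoc)
    ultimately show ?thesis by (simp add: left_diff_distrib mult.assoc)
  qed (simp add: W_def max_def)
  have "avg k (\<lambda>z. W (max y (dmax (Suc d) k v z)) (avg (k + int (Suc d)) v z)) x = avg k F x"
  proof (rule avg_cong)
    fix z assume "z \<in> cell k x"
    then have "avg k v z \<le> y" using avg_cell Suc.prems by metis
    then have "max y (dmax (Suc d) k v z) = max y (dmax d (k+1) v z)" by auto
    then show "W (max y (dmax (Suc d) k v z)) (avg (k + int (Suc d)) v z) = F z" by (simp add: F_def algebra_simps)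
  qed
  also have "\<dots> = avg k (avg (k+1) F) x" by (rule avg_tower[symmetric, OF liF]) simp
  also have "\<dots> \<le> avg k (\<lambda>z. y powr r - s * y powr (r-1) * avg (k+1) v z) x"
  proof (rule avg_mono_cell)
    show "loc_int (\<lambda>z. y powr r - s * y powr (r - 1) * avg (k + 1) v z)"
      by (intro loc_int_diff loc_int_cmult loc_int_avg loc_int_const)
    fix z assume "z \<in> cell k x"
    \<comment> \<open>The running maximum after level k + 1 has been seen. On the cell of z it is a
      constant, so the induction hypothesis applies there with it as starting value.\<close>
    define y' where "y' = max y (avg (k+1) v z)"
    have "avg (k+1) F z = avg (k+1) (\<lambda>w. W (max y' (dmax d (k+1) v w)) (avg (k+1 + int d) v w)) z"
    proof (rule avg_cong)
      fix w assume "w \<in> cell (k+1) z"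
      then have "avg (k+1) v z = avg (k+1) v w" by (rule avg_cell[symmetric])
      also have "\<dots> \<le> dmax d (k+1) v w" using dmax_ge[of 0 d "k+1" v w] by simp
      finally show "F w = W (max y' (dmax d (k+1) v w)) (avg (k+1 + int d) v w)" by (simp add: F_def y'_def max.assoc max_def)
    qed
    also have "\<dots> \<le> W y' (avg (k+1) v z)" by (rule Suc.IH) (simp add: y'_def)
    also have "\<dots> \<le> y powr r - s * y powr (r-1) * avg (k+1) v z"
      unfolding y'_def by (intro tang avg_nonneg v)
    finally show "avg (k+1) F z \<le> y powr r - s * y powr (r-1) * avg (k+1) v z" .
  qed simp
  also have "\<dots> = y powr r - s * y powr (r-1) * avg k (avg (k+1) v) x"
    by (subst avg_diff) (auto simp: avg_cmult)
  also have "\<dots> = W y (avg k v x)" using avg_tower[OF v(1), of k "k+1" x] by (simp add: W_def)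
  finally show ?case .
qed

text \<open>Starting \<open>Doob_Bellman\<close> at y equal to the average makes the right-hand side
  nonpositive, so the mean of Y^r is at most s times the mean of Y^(r-1) v. Young's inequality then
  absorbs half of the left-hand side, which is finite because Y is a step function. The constant
  does not depend on the depth d.\<close>

lemma Doob:
  assumes r: "r > (1::real)"
  shows "\<exists>C>0. \<forall>v::real^'n::finite \<Rightarrow> real. \<forall>k d x. loc_int v \<longrightarrow> (\<forall>y. 0 \<le> v y) \<longrightarrow> loc_int (\<lambda>y. v y powr r) \<longrightarrow>
     avg k (\<lambda>y. dmax d k v y powr r) x \<le> C * avg k (\<lambda>y. v y powr r) x"
proof -
  define s where "s = r / (r - 1)"
  have s: "s > 1" "1/r + 1/s = 1" "(r-1) * s = r" using r by (auto simp: s_def field_simps)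
  \<comment> \<open>With this weight in Young's inequality the Y^r term, multiplied by s, comes back
    with coefficient exactly 1/2.\<close>
  define e where "e = (1/2) powr (1/s)"
  have e: "e > 0" "e powr s = 1/2" using s by (auto simp: e_def powr_powr)
  define C where "C = 2 * (s / (r * e powr r))"
  show ?thesis
  proof (intro exI[of _ C] conjI allI impI)
    show "C > 0" using s r e by (simp add: C_def)
    fix v :: "real^'n \<Rightarrow> real" and k d x
    assume v: "loc_int v" "\<forall>y. 0 \<le> v y" and vr: "loc_int (\<lambda>y. v y powr r)"
    let ?Y = "dmax d k v"
    have Y0: "0 \<le> ?Y z" for z using dmax_nonneg v by blast
    have levY: "lev (k + int d) (\<lambda>z. ?Y z powr c)" for c by (intro lev_powr lev_dmax)
    have li: "loc_int (\<lambda>z. ?Y z powr (r-1) * v z)" by (intro loc_int_lev_mult[OF levY] v)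
    have liY: "loc_int (\<lambda>z. ?Y z powr r)" using lev_loc_int[OF levY] .
    have li2: "loc_int (\<lambda>z. s * ?Y z powr (r-1) * avg (k + int d) v z)"
      by (intro lev_loc_int[of "k + int d"] lev_arith levY lev_avg lev_const)
    have "avg k (\<lambda>z. ?Y z powr r - s * ?Y z powr (r-1) * avg (k + int d) v z) x
        = avg k (\<lambda>z. (max (avg k v x) (?Y z)) powr r - s * (max (avg k v x) (?Y z)) powr (r-1) * avg (k + int d) v z) x"
    proof (rule avg_cong)
      fix z assume "z \<in> cell k x"
      then have "avg k v x = avg k v z" by (rule avg_cell[symmetric])
      also have "\<dots> \<le> ?Y z" using dmax_ge[of 0 d k v z] by simp
      finally show "?Y z powr r - s * ?Y z powr (r-1) * avg (k + int d) v z = (max (avg k v x) (?Y z)) powr r - s * (max (avg k v x) (?Y z)) powr (r-1) * avg (k + int d) v z"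
        by (simp add: max_def)
    qed
    also have "\<dots> \<le> avg k v x powr r - s * avg k v x powr (r-1) * avg k v x"
      using Doob_Bellman[OF r s(1,2) v(1), of k x "avg k v x" d] v(2) by simp
    also have "\<dots> = (1 - s) * avg k v x powr r"
      using powr_mult_base[of "avg k v x" "r-1"] avg_nonneg[of k x v] v(2) by (simp add: algebra_simps)
    also have "\<dots> \<le> 0" using s by (simp add: mult_nonpos_nonneg)
    finally have "avg k (\<lambda>z. ?Y z powr r) x \<le> avg k (\<lambda>z. s * ?Y z powr (r-1) * avg (k + int d) v z) x"
      by (subst (asm) avg_diff[OF liY li2]) simp
    also have "\<dots> = s * avg k (\<lambda>z. ?Y z powr (r-1) * avg (k + int d) v z) x"
      by (simp add: mult.assoc avg_cmult)
    also have "avg k (\<lambda>z. ?Y z powr (r-1) * avg (k + int d) v z) x = avg k (avg (k + int d) (\<lambda>z. ?Y z powr (r-1) * v z)) x"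
      by (intro avg_cong avg_lev_mult[symmetric] levY)
    also have "\<dots> = avg k (\<lambda>z. ?Y z powr (r-1) * v z) x" by (intro avg_tower li) simp
    also have "\<dots> \<le> avg k (\<lambda>z. (1/(2 * s)) * ?Y z powr r + (1/(r * e powr r)) * v z powr r) x"
    proof (rule avg_mono_cell[OF li])
      show "loc_int (\<lambda>z. (1/(2 * s)) * ?Y z powr r + (1/(r * e powr r)) * v z powr r)" by (intro loc_int_add loc_int_cmult liY vr)
      fix z
      have "(v z / e) * (e * ?Y z powr (r-1)) \<le> (v z / e) powr r / r + (e * ?Y z powr (r-1)) powr s / s"
        using v(2) e Y0 by (intro Youngs_inequality r s) auto
      also have "(e * ?Y z powr (r-1)) powr s = (1/2) * ?Y z powr r" using e s Y0 by (simp add: powr_mult powr_powr)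
      finally show "?Y z powr (r-1) * v z \<le> (1/(2 * s)) * ?Y z powr r + (1/(r * e powr r)) * v z powr r"
        using e v(2) by (simp add: powr_divide mult.commute)
    qed
    also have "\<dots> = (1/(2 * s)) * avg k (\<lambda>z. ?Y z powr r) x + (1/(r * e powr r)) * avg k (\<lambda>z. v z powr r) x"
      by (rule avg_lincomb[OF liY vr])
    finally have "avg k (\<lambda>z. ?Y z powr r) x \<le> s * ((1/(2 * s)) * avg k (\<lambda>z. ?Y z powr r) x + (1/(r * e powr r)) * avg k (\<lambda>z. v z powr r) x)"
      using s by simp
    also have "\<dots> = avg k (\<lambda>z. ?Y z powr r) x / 2 + (C/2) * avg k (\<lambda>z. v z powr r) x"
      using s by (simp add: C_def field_simps)
    finally show "avg k (\<lambda>y. dmax d k v y powr r) x \<le> C * avg k (\<lambda>y. v y powr r) x" by simp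
  qed
qed

section \<open>The John--Nirenberg inequality\<close>

definition osc_le :: "(real^'n::finite \<Rightarrow> real) \<Rightarrow> real \<Rightarrow> bool" where
  "osc_le a B \<longleftrightarrow> loc_int a \<and> (\<forall>k x. avg k (\<lambda>y. \<bar>a y - avg k a x\<bar>) x \<le> B)"

text \<open>A child fills the fraction 2^(-n) of its parent, so passing to it costs at most that
  factor in the mean oscillation.\<close>

lemma osc_jump:
  fixes a :: "real^'n::finite \<Rightarrow> real"
  assumes "osc_le a B"
  shows "\<bar>avg (k+1) a x - avg k a x\<bar> \<le> 2 ^ CARD('n) * B"
proof -
  have a: "loc_int a" using assms by (simp add: osc_le_def)
  have "\<bar>avg (k+1) a x - avg k a x\<bar> = \<bar>avg (k+1) (\<lambda>y. a y - avg k a x) x\<bar>"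
    using a by (subst avg_diff) auto
  also have "\<dots> \<le> avg (k+1) (\<lambda>y. \<bar>a y - avg k a x\<bar>) x" by (intro avg_abs_le loc_int_diff loc_int_const a)
  also have "\<dots> \<le> 2 powr (real_of_int (k+1-k) * real CARD('n)) * avg k (\<lambda>y. \<bar>a y - avg k a x\<bar>) x"
    by (rule avg_fine_le) (use a in auto)
  also have "\<dots> = 2 ^ CARD('n) * avg k (\<lambda>y. \<bar>a y - avg k a x\<bar>) x" by (simp add: powr_realpow)
  also have "\<dots> \<le> 2 ^ CARD('n) * B" using assms by (intro mult_left_mono) (auto simp: osc_le_def)
  finally show ?thesis .
qed

text \<open>The induction restarts at the first scale where the averages have moved by more than L. The
  stopping cubes fill at most a quarter of the cube, and the jump into them is at most D.\<close>

lemma avg_exp_osc_le: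
  fixes a :: "real^'n::finite \<Rightarrow> real"
  assumes o: "osc_le a B" and B: "B > 0"
  defines "D \<equiv> 2 ^ CARD('n) * B" and "L \<equiv> 4 * B"
  defines "c \<equiv> ln 2 / (L + D)"
  shows "avg k (\<lambda>y. exp (c * \<bar>avg (k + int d) a y - avg k a x\<bar>)) x \<le> 4"
proof (induction d arbitrary: k x rule: less_induct)
  case (less d)
  have a: "loc_int a" using o by (simp add: osc_le_def)
  \<comment> \<open>The rate c makes a restart cost the factor exp (c (L + D)) = 2. Together with
    the inductive bound 4 this is the 8 below, and 2 + (8/L) B = 4 for L = 4 B closes the
    induction.\<close>
  have c: "c > 0" "exp (c * (L + D)) = 2" "exp (c * L) \<le> 2" and L: "L > 0"
  proof -
    have "D > 0" "L > 0" using B by (auto simp: D_def L_def)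
    then show "c > 0" "L > 0" and *: "exp (c * (L + D)) = 2" by (auto simp: c_def)
    have "c * L \<le> c * (L + D)" using \<open>c > 0\<close> \<open>D > 0\<close> by (intro mult_left_mono) auto
    then show "exp (c * L) \<le> 2" using * by (metis exp_le_cancel_iff)
  qed
  define m where "m = k + int d"
  have liE: "loc_int (\<lambda>z. exp (c * \<bar>avg m a z - b\<bar>))" for b
    by (intro lev_loc_int[of m] lev_comp[where h="\<lambda>w. exp (c * \<bar>w - b\<bar>)"] lev_avg)
  \<comment> \<open>Induction from the finest level m upwards, with an arbitrary reference value b
    in place of the average. Subcubes whose average is within L of b use this induction; the first
    ones that are not use the outer hypothesis, and there the mean of |a - b| is at least L, which
    pays for the constant 8.\<close>
  have inner: "avg (m - int e) (\<lambda>z. exp (c * \<bar>avg m a z - b\<bar>)) y \<le> exp (c * L) + (8/L) * avg (m - int e) (\<lambda>z. \<bar>a z - b\<bar>) y"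
    if "\<bar>avg (m - int e) a y - b\<bar> \<le> L" "e \<le> d" for e b y
    using that
  proof (induction e arbitrary: y)
    case 0
    have "avg m (\<lambda>z. exp (c * \<bar>avg m a z - b\<bar>)) y = exp (c * \<bar>avg m a y - b\<bar>)"
      by (intro avg_lev lev_comp[where h="\<lambda>w. exp (c * \<bar>w - b\<bar>)"] lev_avg)
    also have "\<dots> \<le> exp (c * L)" using 0 c by simp
    finally show ?case using avg_nonneg[of m y "\<lambda>z. \<bar>a z - b\<bar>"] L by (simp add: add_increasing2)
  next
    case (Suc e)
    define k' where "k' = m - int (Suc e)"
    have k1: "m - int e = k' + 1" by (simp add: k'_def)
    have k1': "m = k' + 1 + int e" by (simp add: k'_def)
    have "avg k' (\<lambda>z. exp (c * \<bar>avg m a z - b\<bar>)) y = avg k' (avg (k'+1) (\<lambda>z. exp (c * \<bar>avg m a z - b\<bar>))) y"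
      by (rule avg_tower[symmetric, OF liE]) simp
    also have "\<dots> \<le> avg k' (\<lambda>z. exp (c * L) + (8/L) * avg (k'+1) (\<lambda>z. \<bar>a z - b\<bar>) z) y"
    proof (rule avg_mono_cell)
      show "loc_int (\<lambda>z. exp (c * L) + (8/L) * avg (k'+1) (\<lambda>z. \<bar>a z - b\<bar>) z)"
        by (intro loc_int_add loc_int_cmult loc_int_avg loc_int_const)
      fix z assume z: "z \<in> cell k' y"
      show "avg (k'+1) (\<lambda>z. exp (c * \<bar>avg m a z - b\<bar>)) z \<le> exp (c * L) + (8/L) * avg (k'+1) (\<lambda>z. \<bar>a z - b\<bar>) z"
      proof (cases "\<bar>avg (k'+1) a z - b\<bar> \<le> L")
        case True
        then show ?thesis using Suc.IH[of z] Suc.prems unfolding k1 by simp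
      next
        case False
        have "\<bar>avg (k'+1) a z - b\<bar> = \<bar>avg (k'+1) (\<lambda>w. a w - b) z\<bar>" using a by (subst avg_diff) auto
        also have "\<dots> \<le> avg (k'+1) (\<lambda>w. \<bar>a w - b\<bar>) z" by (intro avg_abs_le loc_int_diff loc_int_const a)
        finally have big: "L \<le> avg (k'+1) (\<lambda>w. \<bar>a w - b\<bar>) z" using False by simp
        have "\<bar>avg (k'+1) a z - b\<bar> \<le> L + D"
          using osc_jump[OF o, of k' z] Suc.prems(1) avg_cell[OF z, of a] unfolding D_def k'_def[symmetric] by linarith
        then have pt: "exp (c * \<bar>avg m a w - b\<bar>) \<le> 2 * exp (c * \<bar>avg m a w - avg (k'+1) a z\<bar>)" for w
        proof -
          have "\<bar>avg m a w - b\<bar> \<le> (L + D) + \<bar>avg m a w - avg (k'+1) a z\<bar>" using \<open>\<bar>avg (k'+1) a z - b\<bar> \<le> L + D\<close> by linarith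
          then have "c * \<bar>avg m a w - b\<bar> \<le> c * ((L + D) + \<bar>avg m a w - avg (k'+1) a z\<bar>)" using c by (intro mult_left_mono) auto
          then have "exp (c * \<bar>avg m a w - b\<bar>) \<le> exp (c * (L + D) + c * \<bar>avg m a w - avg (k'+1) a z\<bar>)" by (simp add: distrib_left)
          then show ?thesis unfolding exp_add c(2) .
        qed
        have "avg (k'+1) (\<lambda>z. exp (c * \<bar>avg m a z - b\<bar>)) z \<le> avg (k'+1) (\<lambda>w. 2 * exp (c * \<bar>avg m a w - avg (k'+1) a z\<bar>)) z"
          by (intro avg_mono_cell pt loc_int_cmult liE)
        also have "\<dots> = 2 * avg (k'+1) (\<lambda>w. exp (c * \<bar>avg m a w - avg (k'+1) a z\<bar>)) z" by (rule avg_cmult)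
        also have "\<dots> \<le> 2 * 4" using less[of e "k'+1" z] Suc.prems(2) unfolding k1' by simp
        also have "\<dots> \<le> (8/L) * avg (k'+1) (\<lambda>w. \<bar>a w - b\<bar>) z" using big L by (simp add: field_simps)
        finally show ?thesis by (simp add: add_increasing)
      qed
    qed simp
    also have "\<dots> = exp (c * L) + (8/L) * avg k' (avg (k'+1) (\<lambda>z. \<bar>a z - b\<bar>)) y"
      by (rule avg_affine) simp
    also have "avg k' (avg (k'+1) (\<lambda>z. \<bar>a z - b\<bar>)) y = avg k' (\<lambda>z. \<bar>a z - b\<bar>) y"
      by (rule avg_tower) (use a in auto)
    finally show ?case unfolding k'_def .
  qed
  have "avg k (\<lambda>z. exp (c * \<bar>avg m a z - avg k a x\<bar>)) x \<le> exp (c * L) + (8/L) * avg k (\<lambda>z. \<bar>a z - avg k a x\<bar>) x"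
    using inner[of d x "avg k a x"] L by (simp add: m_def)
  also have "\<dots> \<le> 2 + (8/L) * B" using o L c by (intro add_mono mult_left_mono) (auto simp: osc_le_def)
  also have "\<dots> = 4" using B by (simp add: L_def)
  finally show ?case by (simp add: m_def)
qed

text \<open>\<open>avg_exp_osc_le\<close> bounds exponential means of the differences of averages,
  hence all their power means; Fatou along a convergent subsequence of averages transfers this to a.
  Since the exponential rate is inversely proportional to B, the bound is linear in B.\<close>

lemma John_Nirenberg:
  assumes e: "e > (0::real)"
  shows "\<exists>C>0. \<forall>(a::real^'n::finite \<Rightarrow> real) B. osc_le a B \<longrightarrow> B > 0 \<longrightarrow>
     (\<forall>k. loc_int (\<lambda>y. \<bar>a y - avg k a y\<bar> powr e)) \<and> loc_int (\<lambda>y. \<bar>a y\<bar> powr e) \<and>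
     (\<forall>k x. avg k (\<lambda>y. \<bar>a y - avg k a y\<bar> powr e) x \<le> (C * B) powr e)"
proof -
  \<comment> \<open>Solves (C B)^e = 4 (e/c)^e for the rate c of \<open>avg_exp_osc_le\<close>; here
    4 is the exponential mean and e^e comes from \<open>powr_le_exp\<close>.\<close>
  define C where "C = e * (4 + 2 ^ CARD('n)) / ln 2 * 4 powr (1/e)"
  have C0: "C > 0" using e by (simp add: C_def add_pos_pos)
  have main: "set_integrable lborel (cell k x) (\<lambda>y. \<bar>a y - avg k a y\<bar> powr e) \<and> avg k (\<lambda>y. \<bar>a y - avg k a y\<bar> powr e) x \<le> (C * B) powr e"
    if o: "osc_le a B" and B: "B > 0" for a :: "real^'n \<Rightarrow> real" and B k x
  proof -
    have a: "loc_int a" using o by (simp add: osc_le_def)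
    define c where "c = ln 2 / (4 * B + 2 ^ CARD('n) * B)"
    have c: "c > 0" using B by (simp add: c_def add_pos_pos)
    have CB: "(C * B) powr e = 4 * (e / c) powr e"
    proof -
      have "C * B = (e / c) * 4 powr (1/e)" by (simp add: C_def c_def field_simps)
      then have "(C * B) powr e = (e / c) powr e * (4 powr (1/e)) powr e" using e c by (simp only: powr_mult)
      then show ?thesis using e by (simp add: powr_powr)
    qed
    obtain r where r: "strict_mono r" "AE y in lborel. y \<in> cell k x \<longrightarrow> (\<lambda>i. avg (int (r i)) a y) \<longlonglongrightarrow> a y"
      using avg_conv_AE_subseq[OF a] by blast
    \<comment> \<open>The shift by \<open>nat \<bar>k\<bar>\<close> guarantees that every level used
      is at least k, as the exponential bound requires.\<close>
    define G where "G i y = \<bar>avg (int (r (i + nat \<bar>k\<bar>))) a y - avg k a y\<bar> powr e" for i y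
    have rk: "\<exists>d. int (r (i + nat \<bar>k\<bar>)) = k + int d" for i
    proof -
      have "r (i + nat \<bar>k\<bar>) \<ge> i + nat \<bar>k\<bar>" using r(1) by (rule seq_suble)
      then have "k \<le> int (r (i + nat \<bar>k\<bar>))" by linarith
      then show ?thesis by (intro exI[of _ "nat (int (r (i + nat \<bar>k\<bar>)) - k)"]) simp
    qed
    have "lev (max k (int (r (i + nat \<bar>k\<bar>)))) (G i)" for i
      unfolding G_def by (intro lev_powr lev_abs lev_arith lev_mono[OF lev_avg]) simp_all
    then have liG: "loc_int (G i)" for i using lev_loc_int by blast
    have bd: "avg k (G i) x \<le> (C * B) powr e" for i
    proof -
      obtain d where d: "int (r (i + nat \<bar>k\<bar>)) = k + int d" using rk by blast
      let ?E = "\<lambda>y. exp (c * \<bar>avg (k + int d) a y - avg k a x\<bar>)"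
      have liE: "loc_int ?E"
        by (intro lev_loc_int[of "k + int d"] lev_comp[where h="\<lambda>w. exp (c * \<bar>w - avg k a x\<bar>)"] lev_avg)
      have "avg k (G i) x \<le> avg k (\<lambda>y. (e / c) powr e * ?E y) x"
      proof (rule avg_mono_cell[OF liG])
        fix y assume y: "y \<in> cell k x"
        have "(c * \<bar>avg (k + int d) a y - avg k a x\<bar>) powr e \<le> e powr e * ?E y"
          using c e by (intro powr_le_exp) auto
        then show "G i y \<le> (e / c) powr e * ?E y"
          unfolding G_def d avg_cell[OF y] using c e by (simp add: powr_mult powr_divide field_simps)
      qed (intro loc_int_cmult liE)
      also have "\<dots> \<le> (e / c) powr e * 4" unfolding avg_cmult
        using avg_exp_osc_le[OF o B, of k d x] by (intro mult_left_mono) (auto simp: c_def)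
      finally show ?thesis using CB by simp
    qed
    show ?thesis
    proof (intro conjI)
      have m: "(\<lambda>y. \<bar>a y - avg k a y\<bar> powr e) \<in> borel_measurable borel" using loc_int_measurable[OF a] by measurable
      have "AE y in lborel. y \<in> cell k x \<longrightarrow> (\<lambda>i. G i y) \<longlonglongrightarrow> \<bar>a y - avg k a y\<bar> powr e"
        using r(2)
      proof eventually_elim
        case (elim y)
        show ?case
        proof
          assume "y \<in> cell k x"
          then have "(\<lambda>i. avg (int (r (i + nat \<bar>k\<bar>))) a y) \<longlonglongrightarrow> a y" using elim LIMSEQ_ignore_initial_segment by blast
          then show "(\<lambda>i. G i y) \<longlonglongrightarrow> \<bar>a y - avg k a y\<bar> powr e" unfolding G_def
            using e by (intro tendsto_powr2 tendsto_intros) auto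
        qed
      qed
      then show "set_integrable lborel (cell k x) (\<lambda>y. \<bar>a y - avg k a y\<bar> powr e)" "avg k (\<lambda>y. \<bar>a y - avg k a y\<bar> powr e) x \<le> (C * B) powr e"
        using avg_fatou[where G=G and k=k and x=x and C="(C * B) powr e", OF liG _ m] bd by (auto simp: G_def)
    qed
  qed
  show ?thesis
  proof (intro exI[of _ C] conjI allI impI C0)
    fix a :: "real^'n \<Rightarrow> real" and B
    assume o: "osc_le a B" and B: "B > 0"
    have a: "loc_int a" using o by (simp add: osc_le_def)
    show li: "loc_int (\<lambda>y. \<bar>a y - avg k a y\<bar> powr e)" for k
      by (rule loc_intI_level[of _ k]) (use main[OF o B] loc_int_measurable[OF a] in auto)
    show "avg k (\<lambda>y. \<bar>a y - avg k a y\<bar> powr e) x \<le> (C * B) powr e" for k x using main[OF o B] by blast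
    have lia: "loc_int (\<lambda>y. \<bar>avg 0 a y\<bar> powr e)" by (intro lev_loc_int[of 0] lev_powr lev_abs lev_avg)
    show "loc_int (\<lambda>y. \<bar>a y\<bar> powr e)"
    proof (rule loc_int_bound)
      show "loc_int (\<lambda>y. 2 powr e * (\<bar>a y - avg 0 a y\<bar> powr e + \<bar>avg 0 a y\<bar> powr e))"
        by (intro loc_int_cmult loc_int_add li lia)
      show "\<bar>\<bar>a y\<bar> powr e\<bar> \<le> 2 powr e * (\<bar>a y - avg 0 a y\<bar> powr e + \<bar>avg 0 a y\<bar> powr e)" for y
      proof -
        have "\<bar>a y\<bar> powr e \<le> (\<bar>a y - avg 0 a y\<bar> + \<bar>avg 0 a y\<bar>) powr e" using e by (intro powr_mono2) auto
        also have "\<dots> \<le> 2 powr e * (\<bar>a y - avg 0 a y\<bar> powr e + \<bar>avg 0 a y\<bar> powr e)" using e by (intro powr_add_le) auto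
        finally show ?thesis by simp
      qed
    qed (use loc_int_measurable[OF a] in measurable)
  qed
qed

section \<open>Weighted sums of martingale increments\<close>

text \<open>The factors \<open>u i\<close> are removed by testing G = sum b_i u_i against g =
  G^(t-1). As b_i is constant at level k + i, only averages of u_i g enter; Hoelder bounds them by U
  (E g^\<rho>)^(1/\<rho>), hence by a maximal function Y independent of i. Young separates sum b_i
  from Y, and Doob returns Y to the mean of G^t, half of which is absorbed. The exponent \<mu>
  depends on t alone.\<close>

lemma avg_sum_dual:
  assumes t: "t > (1::real)"
  shows "\<exists>\<mu>>1. \<exists>C>0. \<forall>(b :: nat \<Rightarrow> real^'n::finite \<Rightarrow> real) u U k d x. U > 0 \<longrightarrow>
     (\<forall>i\<le>d. lev (k + int i) (b i) \<and> (\<forall>y. 0 \<le> b i y) \<and> u i \<in> borel_measurable borel \<and> (\<forall>y. 0 \<le> u i y)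
        \<and> loc_int (\<lambda>y. u i y powr t) \<and> loc_int (\<lambda>y. u i y powr \<mu>) \<and> (\<forall>y. avg (k + int i) (\<lambda>y. u i y powr \<mu>) y \<le> U powr \<mu>)) \<longrightarrow>
     loc_int (\<lambda>y. (\<Sum>i\<le>d. b i y * u i y) powr t) \<and>
     avg k (\<lambda>y. (\<Sum>i\<le>d. b i y * u i y) powr t) x \<le> C * U powr t * avg k (\<lambda>y. (\<Sum>i\<le>d. b i y) powr t) x"
proof -
  define t' where "t' = t / (t - 1)"
  have t': "t' > 1" "1/t + 1/t' = 1" "(t - 1) * t' = t" using t by (auto simp: t'_def field_simps)
  \<comment> \<open>Strictly between 1 and t': above 1 so that its conjugate \<mu> is finite, below
    t' so that \<theta> = t'/\<rho> exceeds 1 and Doob applies to g^\<rho>.\<close>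
  define \<rho> where "\<rho> = (1 + t') / 2"
  have \<rho>: "1 < \<rho>" "\<rho> < t'" using t' by (auto simp: \<rho>_def)
  define \<mu> where "\<mu> = \<rho> / (\<rho> - 1)"
  have \<mu>: "\<mu> > 1" "1/\<mu> + 1/\<rho> = 1" using \<rho> by (auto simp: \<mu>_def field_simps)
  define \<theta> where "\<theta> = t' / \<rho>"
  have \<theta>: "\<theta> > 1" using \<rho> by (simp add: \<theta>_def)
  obtain CD where CD: "CD > 0" "\<And>(v::real^'n \<Rightarrow> real) k d x. loc_int v \<Longrightarrow> (\<And>y. 0 \<le> v y) \<Longrightarrow> loc_int (\<lambda>y. v y powr \<theta>) \<Longrightarrow>
     avg k (\<lambda>y. dmax d k v y powr \<theta>) x \<le> CD * avg k (\<lambda>y. v y powr \<theta>) x"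
    using Doob[OF \<theta>, where 'n='n] by blast
  \<comment> \<open>Chosen so that the weight from Young times the constant from Doob is
    1/2.\<close>
  define e where "e = (t' / (2 * CD)) powr (1/t')"
  have e: "e > 0" "e powr t' * CD / t' = 1/2" using t' CD by (auto simp: e_def powr_powr)
  define C where "C = 2 / (t * e powr t)"
  show ?thesis
  proof (rule exI[of _ \<mu>], intro conjI \<mu>(1), rule exI[of _ C], intro conjI allI impI)
    show "C > 0" using t e by (simp add: C_def)
    fix b u :: "nat \<Rightarrow> real^'n \<Rightarrow> real" and U k d x
    assume U: "U > (0::real)"
    assume H: "\<forall>i\<le>d. lev (k + int i) (b i) \<and> (\<forall>y. 0 \<le> b i y) \<and> u i \<in> borel_measurable borel \<and> (\<forall>y. 0 \<le> u i y)
        \<and> loc_int (\<lambda>y. u i y powr t) \<and> loc_int (\<lambda>y. u i y powr \<mu>) \<and> (\<forall>y. avg (k + int i) (\<lambda>y. u i y powr \<mu>) y \<le> U powr \<mu>)"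
    have b: "lev (k + int i) (b i)" "\<And>y. 0 \<le> b i y" and u: "u i \<in> borel_measurable borel" "\<And>y. 0 \<le> u i y"
      "loc_int (\<lambda>y. u i y powr t)" "loc_int (\<lambda>y. u i y powr \<mu>)" "\<And>y. avg (k + int i) (\<lambda>y. u i y powr \<mu>) y \<le> U powr \<mu>"
      if "i \<le> d" for i using H that by blast+
    define G where "G y = (\<Sum>i\<le>d. b i y * u i y)" for y
    have G0: "0 \<le> G y" for y unfolding G_def by (intro sum_nonneg mult_nonneg_nonneg) (auto intro: b u)
    have Gm [measurable]: "G \<in> borel_measurable borel" unfolding G_def
      by (intro borel_measurable_sum borel_measurable_times) (auto intro: u lev_measurable b(1))
    \<comment> \<open>Finiteness of the mean of G^t must be known beforehand, or half of it could
      not be absorbed.\<close>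
    have liGt: "loc_int (\<lambda>y. G y powr t)"
    proof (rule loc_int_bound)
      show "loc_int (\<lambda>y. real (card {..d}) powr t * (\<Sum>i\<le>d. b i y powr t * u i y powr t))"
      proof (intro loc_int_cmult loc_int_sum)
        show "loc_int (\<lambda>y. b i y powr t * u i y powr t)" if "i \<in> {..d}" for i
          using that by (intro loc_int_lev_mult[of "k + int i"] lev_powr b u) auto
      qed
      show "\<bar>G y powr t\<bar> \<le> real (card {..d}) powr t * (\<Sum>i\<le>d. b i y powr t * u i y powr t)" for y
      proof -
        have "G y powr t \<le> real (card {..d}) powr t * (\<Sum>i\<le>d. (b i y * u i y) powr t)"
          unfolding G_def using t by (intro powr_sum_le mult_nonneg_nonneg) (auto intro: b u)
        also have "(\<Sum>i\<le>d. (b i y * u i y) powr t) = (\<Sum>i\<le>d. b i y powr t * u i y powr t)"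
          by (simp add: powr_mult)
        finally show ?thesis by simp
      qed
    qed simp
    define g where "g y = G y powr (t - 1)" for y
    have gm [measurable]: "g \<in> borel_measurable borel" unfolding g_def by measurable
    have g0: "0 \<le> g y" for y by (simp add: g_def)
    define v where "v y = g y powr \<rho>" for y
    have liv: "loc_int v"
    proof -
      have "(t - 1) * \<rho> \<le> (t - 1) * t'" using \<rho> t by (intro mult_left_mono) auto
      then have "loc_int (\<lambda>y. \<bar>G y\<bar> powr ((t - 1) * \<rho>))"
        using loc_int_powr_le[of G t "(t-1) * \<rho>"] liGt G0 t t' \<rho> by simp
      then show ?thesis unfolding v_def g_def using G0 by (simp add: powr_powr)
    qed
    have v\<theta>: "v y powr \<theta> = G y powr t" for y
    proof -
      have "(t - 1) * \<rho> * \<theta> = t" using t' \<rho> by (simp add: \<theta>_def)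
      then show ?thesis by (simp add: v_def g_def powr_powr)
    qed
    let ?Y = "dmax d k v"
    have Y0: "0 \<le> ?Y y" for y by (rule dmax_nonneg) (simp add: v_def)
    have liug: "loc_int (\<lambda>y. u i y * g y)" if "i \<le> d" for i
      using liv[unfolded v_def[abs_def]] that by (intro loc_int_Holder[OF \<mu>(1) \<rho>(1) \<mu>(2)] u gm g0)
    have ug: "avg (k + int i) (\<lambda>y. u i y * g y) y \<le> U * ?Y y powr (1/\<rho>)" if i: "i \<le> d" for i y
    proof (rule avg_Holder(2)[OF \<mu>(1) \<rho>(1) \<mu>(2)])
      have "avg (k + int i) v y \<le> ?Y y" by (rule dmax_ge[OF i])
      also have "\<dots> = (?Y y powr (1/\<rho>)) powr \<rho>" using \<rho> Y0 by (simp add: powr_powr)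
      finally show "avg (k + int i) (\<lambda>y. g y powr \<rho>) y \<le> (?Y y powr (1/\<rho>)) powr \<rho>" unfolding v_def .
      show "loc_int (\<lambda>y. g y powr \<rho>)" using liv unfolding v_def .
    qed (use i U g0 gm in \<open>auto intro: u\<close>)
    let ?S = "\<lambda>y. \<Sum>i\<le>d. b i y"
    have S0: "0 \<le> ?S y" for y by (intro sum_nonneg) (auto intro: b)
    have levS: "lev (k + int d) ?S" by (intro lev_sum lev_mono[OF b(1)]) auto
    have liSt: "loc_int (\<lambda>y. ?S y powr t)" by (intro lev_loc_int[of "k + int d"] lev_powr levS)
    have liY: "loc_int (\<lambda>y. ?Y y powr \<theta>)" by (intro lev_loc_int[of "k + int d"] lev_powr lev_dmax)
    have levbY: "lev (k + int d) (\<lambda>y. b i y * (U * ?Y y powr (1/\<rho>)))" if "i \<le> d" for i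
      using that by (intro lev_arith(3) lev_powr lev_dmax lev_const lev_mono[OF b(1)]) auto
    have "avg k (\<lambda>y. G y powr t) x = avg k (\<lambda>y. \<Sum>i\<le>d. b i y * (u i y * g y)) x"
    proof (rule avg_cong)
      fix y
      have "G y powr t = G y * g y" using powr_mult_base[of "G y" "t - 1"] G0[of y] by (simp add: g_def)
      then show "G y powr t = (\<Sum>i\<le>d. b i y * (u i y * g y))" by (simp add: G_def sum_distrib_right mult.assoc)
    qed
    also have "\<dots> = (\<Sum>i\<le>d. avg k (\<lambda>y. b i y * (u i y * g y)) x)"
      by (intro avg_sum loc_int_lev_mult[OF b(1) liug]) auto
    also have "\<dots> \<le> (\<Sum>i\<le>d. avg k (\<lambda>y. b i y * (U * ?Y y powr (1/\<rho>))) x)"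
    proof (rule sum_mono)
      fix i assume "i \<in> {..d}"
      then have i: "i \<le> d" by simp
      have "avg k (\<lambda>y. b i y * (u i y * g y)) x = avg k (avg (k + int i) (\<lambda>y. b i y * (u i y * g y))) x"
        by (intro avg_tower[symmetric] loc_int_lev_mult[OF b(1)[OF i] liug[OF i]]) simp
      also have "\<dots> \<le> avg k (\<lambda>y. b i y * (U * ?Y y powr (1/\<rho>))) x"
      proof (rule avg_mono_cell[OF loc_int_avg lev_loc_int[OF levbY[OF i]]])
        fix y
        have "avg (k + int i) (\<lambda>y. b i y * (u i y * g y)) y = b i y * avg (k + int i) (\<lambda>y. u i y * g y) y"
          by (rule avg_lev_mult[OF b(1)[OF i]])
        also have "\<dots> \<le> b i y * (U * ?Y y powr (1/\<rho>))" by (intro mult_left_mono ug b i)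
        finally show "avg (k + int i) (\<lambda>y. b i y * (u i y * g y)) y \<le> b i y * (U * ?Y y powr (1/\<rho>))" .
      qed
      finally show "avg k (\<lambda>y. b i y * (u i y * g y)) x \<le> avg k (\<lambda>y. b i y * (U * ?Y y powr (1/\<rho>))) x" .
    qed
    also have "\<dots> = avg k (\<lambda>y. \<Sum>i\<le>d. b i y * (U * ?Y y powr (1/\<rho>))) x"
      by (intro avg_sum[symmetric] lev_loc_int[OF levbY]) auto
    also have "\<dots> \<le> avg k (\<lambda>y. (U powr t / (t * e powr t)) * ?S y powr t + (e powr t' / t') * ?Y y powr \<theta>) x"
    proof (rule avg_mono_cell)
      show "loc_int (\<lambda>y. \<Sum>i\<le>d. b i y * (U * ?Y y powr (1/\<rho>)))" by (intro loc_int_sum lev_loc_int[OF levbY]) auto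
      show "loc_int (\<lambda>y. (U powr t / (t * e powr t)) * ?S y powr t + (e powr t' / t') * ?Y y powr \<theta>)"
        by (intro loc_int_add loc_int_cmult liSt liY)
      fix y
      have "(\<Sum>i\<le>d. b i y * (U * ?Y y powr (1/\<rho>))) = (U * ?S y / e) * (e * ?Y y powr (1/\<rho>))"
        using e(1) by (subst sum_distrib_right[symmetric]) simp
      also have "\<dots> \<le> (U * ?S y / e) powr t / t + (e * ?Y y powr (1/\<rho>)) powr t' / t'"
        using U S0 e by (intro Youngs_inequality t t') auto
      also have "(U * ?S y / e) powr t / t = (U powr t / (t * e powr t)) * ?S y powr t"
        using U S0[of y] e by (simp add: powr_divide powr_mult)
      also have "(e * ?Y y powr (1/\<rho>)) powr t' / t' = (e powr t' / t') * ?Y y powr \<theta>"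
        using e Y0 by (simp add: powr_mult powr_powr \<theta>_def)
      finally show "(\<Sum>i\<le>d. b i y * (U * ?Y y powr (1/\<rho>))) \<le> (U powr t / (t * e powr t)) * ?S y powr t + (e powr t' / t') * ?Y y powr \<theta>" .
    qed
    also have "\<dots> = (U powr t / (t * e powr t)) * avg k (\<lambda>y. ?S y powr t) x + (e powr t' / t') * avg k (\<lambda>y. ?Y y powr \<theta>) x"
      by (rule avg_lincomb[OF liSt liY])
    also have "\<dots> \<le> (U powr t / (t * e powr t)) * avg k (\<lambda>y. ?S y powr t) x + (e powr t' / t') * (CD * avg k (\<lambda>y. G y powr t) x)"
    proof -
      have "avg k (\<lambda>y. ?Y y powr \<theta>) x \<le> CD * avg k (\<lambda>y. v y powr \<theta>) x"
        by (rule CD(2)[OF liv]) (use liGt in \<open>simp_all only: v\<theta>\<close>, simp add: v_def)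
      then have "avg k (\<lambda>y. ?Y y powr \<theta>) x \<le> CD * avg k (\<lambda>y. G y powr t) x" by (simp add: v\<theta>)
      then show ?thesis using e t' by (intro add_left_mono mult_left_mono) auto
    qed
    also have "(e powr t' / t') * (CD * avg k (\<lambda>y. G y powr t) x) = (e powr t' * CD / t') * avg k (\<lambda>y. G y powr t) x" by simp
    finally have fin: "avg k (\<lambda>y. G y powr t) x \<le> (U powr t / (t * e powr t)) * avg k (\<lambda>y. ?S y powr t) x + 1/2 * avg k (\<lambda>y. G y powr t) x"
      unfolding e(2) .
    have "C * U powr t * avg k (\<lambda>y. ?S y powr t) x = 2 * ((U powr t / (t * e powr t)) * avg k (\<lambda>y. ?S y powr t) x)"
      by (simp add: C_def)
    then have "avg k (\<lambda>y. G y powr t) x \<le> C * U powr t * avg k (\<lambda>y. ?S y powr t) x"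
      using fin by linarith
    then show "loc_int (\<lambda>y. (\<Sum>i\<le>d. b i y * u i y) powr t)"
       "avg k (\<lambda>y. (\<Sum>i\<le>d. b i y * u i y) powr t) x \<le> C * U powr t * avg k (\<lambda>y. (\<Sum>i\<le>d. b i y) powr t) x"
      using liGt by (simp_all add: G_def)
  qed
qed

section \<open>Geometric sums over the scales\<close>

text \<open>The averages of a BMO function drift linearly from scale to scale; this lets an
  arbitrarily small part of the geometric decay pay for the drift.\<close>

lemma linear_le_powr:
  assumes "\<delta> > (0::real)"
  shows "\<exists>C>0. \<forall>v\<ge>0. 1 + v \<le> C * 2 powr (\<delta> * v)"
proof -
  define c where "c = \<delta> * ln 2"
  have c: "c > 0" using assms by (simp add: c_def)
  show ?thesis
  proof (intro exI[of _ "1 + 1/c"] conjI allI impI)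
    show "1 + 1/c > 0" using c by (simp add: add_pos_pos)
    fix v :: real assume v: "v \<ge> 0"
    have "c * v \<le> exp (c * v)" using exp_ge_add_one_self[of "c * v"] by linarith
    then have "v \<le> exp (c * v) / c" using c by (simp add: field_simps)
    moreover have "1 \<le> exp (c * v)" using mult_nonneg_nonneg[of c v] c v by simp
    ultimately have "1 + v \<le> exp (c * v) + exp (c * v) / c" by (rule add_mono[rotated])
    also have "\<dots> = (1 + 1/c) * exp (c * v)" by (simp add: distrib_right)
    also have "exp (c * v) = 2 powr (\<delta> * v)" by (simp add: powr_def c_def mult_ac)
    finally show "1 + v \<le> (1 + 1/c) * 2 powr (\<delta> * v)" .
  qed
qed

lemma summable_powr:
  assumes "\<delta> > (0::real)" shows "summable (\<lambda>i. 2 powr (- \<delta> * real i))"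
proof -
  have "summable (\<lambda>i. (2 powr (- \<delta>)) ^ i)" using assms by (intro summable_geometric) (simp add: powr_less_one)
  moreover have "(2 powr (- \<delta>)) ^ i = 2 powr (- \<delta> * real i)" for i
    by (simp add: powr_realpow[symmetric] powr_powr)
  ultimately show ?thesis by simp
qed

text \<open>The cutoff x is real, since it will be the balance point of two bounds and not an
  integer.\<close>

lemma geo_sum_up:
  assumes a: "\<alpha> > (0::real)"
  shows "\<exists>C>0. \<forall>(J::int set) x. finite J \<longrightarrow> (\<forall>j\<in>J. x \<le> real_of_int j) \<longrightarrow> (\<Sum>j\<in>J. 2 powr (- \<alpha> * real_of_int j)) \<le> C * 2 powr (- \<alpha> * x)"
proof -
  define z where "z = 2 powr (- \<alpha>)"
  have z: "0 < z" "z < 1" using a by (auto simp: z_def powr_less_one)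
  show ?thesis
  proof (intro exI[of _ "1 / (1 - z)"] conjI allI impI)
    fix J :: "int set" and x :: real assume J: "finite J" "\<forall>j\<in>J. x \<le> real_of_int j"
    define h where "h i = \<lceil>x\<rceil> + int i" for i
    define m where "m = nat (Max (insert 0 ((\<lambda>j. j - \<lceil>x\<rceil>) ` J)))"
    have sub: "J \<subseteq> h ` {..m}"
    proof
      fix j assume j: "j \<in> J"
      have "j \<ge> \<lceil>x\<rceil>" using J j by (simp add: ceiling_le_iff)
      moreover have "j - \<lceil>x\<rceil> \<le> Max (insert 0 ((\<lambda>j. j - \<lceil>x\<rceil>) ` J))" using J(1) j by (intro Max_ge) auto
      ultimately show "j \<in> h ` {..m}" unfolding m_def h_def by (intro image_eqI[of _ _ "nat (j - \<lceil>x\<rceil>)"]) auto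
    qed
    have "(\<Sum>j\<in>J. 2 powr (- \<alpha> * real_of_int j)) \<le> (\<Sum>j\<in>h ` {..m}. 2 powr (- \<alpha> * real_of_int j))"
      by (rule sum_mono2[OF _ sub]) auto
    also have "\<dots> = (\<Sum>i\<le>m. 2 powr (- \<alpha> * real_of_int (h i)))"
      by (subst sum.reindex) (auto simp: h_def inj_on_def)
    also have "\<dots> = (\<Sum>i\<le>m. 2 powr (- \<alpha> * real_of_int \<lceil>x\<rceil>) * z ^ i)"
      by (intro sum.cong refl) (simp add: h_def z_def powr_realpow[symmetric] powr_powr powr_add[symmetric] algebra_simps)
    also have "\<dots> = 2 powr (- \<alpha> * real_of_int \<lceil>x\<rceil>) * ((1 - z ^ Suc m) / (1 - z))"
      using z by (subst sum_distrib_left[symmetric], subst sum_gp0) auto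
    also have "\<dots> \<le> 2 powr (- \<alpha> * x) * (1 / (1 - z))"
    proof (intro mult_mono divide_right_mono)
      have "z ^ Suc m \<le> 1" using z by (intro power_le_one) auto
      then show "0 \<le> (1 - z ^ Suc m) / (1 - z)" using z by simp
    qed (use a z in auto)
    finally show "(\<Sum>j\<in>J. 2 powr (- \<alpha> * real_of_int j)) \<le> 1 / (1 - z) * 2 powr (- \<alpha> * x)" by (simp add: mult.commute)
  qed (use z in simp)
qed

lemma geo_sum_down:
  assumes a: "\<sigma> > (0::real)"
  shows "\<exists>C>0. \<forall>(J::int set) x. finite J \<longrightarrow> (\<forall>j\<in>J. real_of_int j \<le> x) \<longrightarrow> (\<Sum>j\<in>J. 2 powr (\<sigma> * real_of_int j)) \<le> C * 2 powr (\<sigma> * x)"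
proof -
  obtain C where C: "C > 0" "\<And>(J::int set) x. finite J \<Longrightarrow> (\<forall>j\<in>J. x \<le> real_of_int j) \<Longrightarrow> (\<Sum>j\<in>J. 2 powr (- \<sigma> * real_of_int j)) \<le> C * 2 powr (- \<sigma> * x)"
    using geo_sum_up[OF a] by blast
  show ?thesis
  proof (intro exI[of _ C] conjI allI impI C(1))
    fix J :: "int set" and x assume J: "finite J" "\<forall>j\<in>J. real_of_int j \<le> x"
    have "(\<Sum>j\<in>J. 2 powr (\<sigma> * real_of_int j)) = (\<Sum>j\<in>uminus ` J. 2 powr (- \<sigma> * real_of_int j))"
      by (subst sum.reindex) auto
    also have "\<dots> \<le> C * 2 powr (- \<sigma> * (-x))" using J by (intro C) auto
    finally show "(\<Sum>j\<in>J. 2 powr (\<sigma> * real_of_int j)) \<le> C * 2 powr (\<sigma> * x)" by simp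
  qed
qed

text \<open>Half of the exponent \<sigma> pays for the linear factor, the other half is
  summed.\<close>

lemma geo_sum_down_linear:
  assumes a: "\<sigma> > (0::real)"
  shows "\<exists>C>0. \<forall>(J::int set) x. finite J \<longrightarrow> (\<forall>j\<in>J. real_of_int j \<le> x) \<longrightarrow>
     (\<Sum>j\<in>J. 2 powr (\<sigma> * real_of_int j) * (1 + (x - real_of_int j))) \<le> C * 2 powr (\<sigma> * x)"
proof -
  have a2: "\<sigma>/2 > 0" using a by simp
  obtain C where C: "C > 0" "\<And>(J::int set) x. finite J \<Longrightarrow> (\<forall>j\<in>J. real_of_int j \<le> x) \<Longrightarrow> (\<Sum>j\<in>J. 2 powr (\<sigma>/2 * real_of_int j)) \<le> C * 2 powr (\<sigma>/2 * x)"
    using geo_sum_down[OF a2] by blast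
  obtain K where K: "K > 0" "\<And>v. v \<ge> 0 \<Longrightarrow> 1 + v \<le> K * 2 powr (\<sigma>/2 * v)"
    using linear_le_powr[OF a2] by blast
  show ?thesis
  proof (intro exI[of _ "K * C"] conjI allI impI)
    show "K * C > 0" using K C by simp
    fix J :: "int set" and x assume J: "finite J" "\<forall>j\<in>J. real_of_int j \<le> x"
    have "(\<Sum>j\<in>J. 2 powr (\<sigma> * real_of_int j) * (1 + (x - real_of_int j))) \<le> (\<Sum>j\<in>J. (K * 2 powr (\<sigma>/2 * x)) * 2 powr (\<sigma>/2 * real_of_int j))"
    proof (rule sum_mono)
      fix j assume "j \<in> J"
      then have v: "x - real_of_int j \<ge> 0" using J by simp
      define v where "v = x - real_of_int j"
      have "1 + v \<le> K * 2 powr (\<sigma>/2 * v)" using v by (intro K) (simp add: v_def)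
      then have "2 powr (\<sigma> * real_of_int j) * (1 + v) \<le> 2 powr (\<sigma> * real_of_int j) * (K * 2 powr (\<sigma>/2 * v))"
        by (intro mult_left_mono) auto
      also have "\<dots> = K * (2 powr (\<sigma> * real_of_int j) * 2 powr (\<sigma>/2 * v))" by simp
      also have "2 powr (\<sigma> * real_of_int j) * 2 powr (\<sigma>/2 * v) = 2 powr (\<sigma>/2 * x) * 2 powr (\<sigma>/2 * real_of_int j)"
        by (simp add: powr_add[symmetric] v_def field_simps)
      finally show "2 powr (\<sigma> * real_of_int j) * (1 + (x - real_of_int j)) \<le> (K * 2 powr (\<sigma>/2 * x)) * 2 powr (\<sigma>/2 * real_of_int j)"
        by (simp add: v_def mult.assoc)
    qed
    also have "\<dots> = (K * 2 powr (\<sigma>/2 * x)) * (\<Sum>j\<in>J. 2 powr (\<sigma>/2 * real_of_int j))" by (rule sum_distrib_left[symmetric])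
    also have "\<dots> \<le> (K * 2 powr (\<sigma>/2 * x)) * (C * 2 powr (\<sigma>/2 * x))" using K J by (intro mult_left_mono C) auto
    also have "\<dots> = K * C * (2 powr (\<sigma>/2 * x) * 2 powr (\<sigma>/2 * x))" by simp
    also have "2 powr (\<sigma>/2 * x) * 2 powr (\<sigma>/2 * x) = 2 powr (\<sigma> * x)" by (simp add: powr_add[symmetric])
    finally show "(\<Sum>j\<in>J. 2 powr (\<sigma> * real_of_int j) * (1 + (x - real_of_int j))) \<le> K * C * 2 powr (\<sigma> * x)" .
  qed
qed

text \<open>Hedberg's trick in discrete form: fine scales are summed with the bound through M, later
  a maximal function, and coarse scales with the bound through N, the Morrey bound.\<close>

lemma Hedberg_sum:
  assumes a: "\<alpha> > (0::real)" and s: "\<sigma> > (0::real)"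
  shows "\<exists>C>0. \<forall>(J::int set) b M N. finite J \<longrightarrow> 0 \<le> M \<longrightarrow> 0 < N \<longrightarrow>
    (\<forall>j\<in>J. 0 \<le> b j \<and> b j \<le> 2 powr (- \<alpha> * real_of_int j) * M \<and> b j \<le> 2 powr (\<sigma> * real_of_int j) * N) \<longrightarrow>
    (\<Sum>j\<in>J. b j) \<le> C * (M powr (\<sigma> / (\<alpha> + \<sigma>)) * N powr (\<alpha> / (\<alpha> + \<sigma>)))"
proof -
  obtain C1 where C1: "C1 > 0" "\<And>(J::int set) x. finite J \<Longrightarrow> (\<forall>j\<in>J. x \<le> real_of_int j) \<Longrightarrow> (\<Sum>j\<in>J. 2 powr (- \<alpha> * real_of_int j)) \<le> C1 * 2 powr (- \<alpha> * x)"
    using geo_sum_up[OF a] by blast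
  obtain C2 where C2: "C2 > 0" "\<And>(J::int set) x. finite J \<Longrightarrow> (\<forall>j\<in>J. real_of_int j \<le> x) \<Longrightarrow> (\<Sum>j\<in>J. 2 powr (\<sigma> * real_of_int j)) \<le> C2 * 2 powr (\<sigma> * x)"
    using geo_sum_down[OF s] by blast
  show ?thesis
  proof (intro exI[of _ "C1 + C2"] conjI allI impI)
    show "C1 + C2 > 0" using C1 C2 by simp
    fix J :: "int set" and b and M N :: real
    assume J: "finite J" and M: "0 \<le> M" and N: "0 < N" and bj: "\<forall>j\<in>J. 0 \<le> b j \<and> b j \<le> 2 powr (- \<alpha> * real_of_int j) * M \<and> b j \<le> 2 powr (\<sigma> * real_of_int j) * N"
    define w where "w = M powr (\<sigma> / (\<alpha> + \<sigma>)) * N powr (\<alpha> / (\<alpha> + \<sigma>))"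
    show "(\<Sum>j\<in>J. b j) \<le> (C1 + C2) * w"
    proof (cases "M = 0")
      case True
      then have "b j = 0" if "j \<in> J" for j using bj that by force
      then have "(\<Sum>j\<in>J. b j) = 0" by simp
      then show ?thesis using C1 C2 by (simp add: w_def)
    next
      case False
      then have M: "M > 0" using M by simp
      \<comment> \<open>The scale at which both bounds agree: 2^(-\<alpha> x) M = 2^(\<sigma> x)
        N.\<close>
      define x where "x = log 2 (M / N) / (\<alpha> + \<sigma>)"
      have x2: "2 powr (c * x) = M powr (c / (\<alpha> + \<sigma>)) * N powr (- c / (\<alpha> + \<sigma>))" for c
      proof -
        have "2 powr (c * x) = (2 powr (log 2 (M/N))) powr (c / (\<alpha> + \<sigma>))" by (simp add: x_def powr_powr mult.commute)
        also have "\<dots> = (M / N) powr (c / (\<alpha> + \<sigma>))" using M N by simp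
        also have "\<dots> = M powr (c / (\<alpha> + \<sigma>)) * N powr (- c / (\<alpha> + \<sigma>))" using M N by (simp add: powr_divide powr_minus_divide)
        finally show ?thesis .
      qed
      have e1: "M * 2 powr (- \<alpha> * x) = w"
      proof -
        have "M * 2 powr (- \<alpha> * x) = M powr 1 * M powr (- \<alpha> / (\<alpha> + \<sigma>)) * N powr (\<alpha> / (\<alpha> + \<sigma>))" using M unfolding x2 by simp
        also have "M powr 1 * M powr (- \<alpha> / (\<alpha> + \<sigma>)) = M powr (\<sigma> / (\<alpha> + \<sigma>))"
        proof -
          have "1 + - \<alpha> / (\<alpha> + \<sigma>) = \<sigma> / (\<alpha> + \<sigma>)" using a s by (simp add: field_simps)
          then show ?thesis by (metis powr_add)
        qed
        finally show ?thesis by (simp add: w_def)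
      qed
      have e2: "N * 2 powr (\<sigma> * x) = w"
      proof -
        have "N * 2 powr (\<sigma> * x) = (N powr 1 * N powr (- \<sigma> / (\<alpha> + \<sigma>))) * M powr (\<sigma> / (\<alpha> + \<sigma>))" using N unfolding x2 by simp
        also have "N powr 1 * N powr (- \<sigma> / (\<alpha> + \<sigma>)) = N powr (\<alpha> / (\<alpha> + \<sigma>))"
        proof -
          have "1 + - \<sigma> / (\<alpha> + \<sigma>) = \<alpha> / (\<alpha> + \<sigma>)" using a s by (simp add: field_simps)
          then show ?thesis by (metis powr_add)
        qed
        finally show ?thesis by (simp add: w_def mult.commute)
      qed
      let ?J1 = "{j\<in>J. x \<le> real_of_int j}" and ?J2 = "{j\<in>J. \<not> x \<le> real_of_int j}"
      have "(\<Sum>j\<in>J. b j) = (\<Sum>j\<in>?J1. b j) + (\<Sum>j\<in>?J2. b j)"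
        using J by (subst sum.union_disjoint[symmetric]) (auto intro: sum.cong)
      also have "(\<Sum>j\<in>?J1. b j) \<le> (\<Sum>j\<in>?J1. M * 2 powr (- \<alpha> * real_of_int j))"
        using bj by (intro sum_mono) (auto simp: mult.commute)
      also have "\<dots> = M * (\<Sum>j\<in>?J1. 2 powr (- \<alpha> * real_of_int j))" by (rule sum_distrib_left[symmetric])
      also have "\<dots> \<le> M * (C1 * 2 powr (- \<alpha> * x))" using J M by (intro mult_left_mono C1) auto
      also have "\<dots> = C1 * w" unfolding e1[symmetric] by simp
      also have "(\<Sum>j\<in>?J2. b j) \<le> (\<Sum>j\<in>?J2. N * 2 powr (\<sigma> * real_of_int j))"
        using bj by (intro sum_mono) (auto simp: mult.commute)
      also have "\<dots> = N * (\<Sum>j\<in>?J2. 2 powr (\<sigma> * real_of_int j))" by (rule sum_distrib_left[symmetric])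
      also have "\<dots> \<le> N * (C2 * 2 powr (\<sigma> * x))" using J N by (intro mult_left_mono C2) auto
      also have "\<dots> = C2 * w" unfolding e2[symmetric] by simp
      finally show ?thesis by (simp add: distrib_right)
    qed
  qed
qed

section \<open>Boundedness of the truncated commutators\<close>

text \<open>The bound N for the Morrey norm, rescaled to averages: a cube of level k has volume
  2 powr (- k n).\<close>

definition mbd :: "real \<Rightarrow> real \<Rightarrow> (real^'n::finite \<Rightarrow> real) \<Rightarrow> real \<Rightarrow> bool" where
  "mbd p q f N \<longleftrightarrow> f \<in> borel_measurable borel \<and> loc_int (\<lambda>y. \<bar>f y\<bar> powr q) \<and>
     (\<forall>k x. avg k (\<lambda>y. \<bar>f y\<bar> powr q) x \<le> (N * 2 powr (real_of_int k * real CARD('n) / p)) powr q)"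

lemma mbdD:
  fixes f :: "real^'n::finite \<Rightarrow> real"
  assumes "mbd p q f N"
  shows "f \<in> borel_measurable borel" "loc_int (\<lambda>y. \<bar>f y\<bar> powr q)"
    "avg k (\<lambda>y. \<bar>f y\<bar> powr q) x \<le> (N * 2 powr (real_of_int k * real CARD('n) / p)) powr q"
  using assms by (auto simp: mbd_def)

lemma mbd_loc_int_powr:
  assumes "mbd p q f N" "0 \<le> r" "r \<le> q" shows "loc_int (\<lambda>y. \<bar>f y\<bar> powr r)"
  using loc_int_powr_le[OF mbdD(2,1)[OF assms(1)]] assms by blast

lemma mbd_loc_int:
  assumes "mbd p q f N" "1 \<le> q" shows "loc_int f"
proof -
  have "loc_int (\<lambda>y. \<bar>f y\<bar> powr 1)" using mbd_loc_int_powr[OF assms(1), of 1] assms(2) by simp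
  then show ?thesis by (rule loc_int_bound) (use mbdD(1)[OF assms(1)] in auto)
qed

lemma mbd_avg_powr:
  fixes f :: "real^'n::finite \<Rightarrow> real"
  assumes "mbd p q f N" "1 \<le> r" "r < q" "N \<ge> 0"
  shows "avg k (\<lambda>y. \<bar>f y\<bar> powr r) x \<le> (N * 2 powr (real_of_int k * real CARD('n) / p)) powr r"
proof -
  let ?V = "N * 2 powr (real_of_int k * real CARD('n) / p)"
  have "avg k (\<lambda>y. \<bar>\<bar>f y\<bar> powr r\<bar>) x \<le> ?V powr r"
  proof (rule avg_abs_le_powr[where r="q/r"])
    show "loc_int (\<lambda>y. \<bar>\<bar>f y\<bar> powr r\<bar> powr (q/r))" "avg k (\<lambda>y. \<bar>\<bar>f y\<bar> powr r\<bar> powr (q/r)) x \<le> (?V powr r) powr (q/r)"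
      using mbdD[OF assms(1)] assms by (simp_all add: powr_powr)
  qed (use mbdD(1)[OF assms(1)] assms in auto)
  then show ?thesis by simp
qed

lemma mbd_avg_abs:
  fixes f :: "real^'n::finite \<Rightarrow> real"
  assumes "mbd p q f N" "1 < q" "N \<ge> 0"
  shows "avg k (\<lambda>y. \<bar>f y\<bar>) x \<le> N * 2 powr (real_of_int k * real CARD('n) / p)"
  using mbd_avg_powr[OF assms(1), of 1 k x] assms by simp

text \<open>The \<open>itself\<close> argument carries the dimension, so that the numerical
  relations can be instantiated at other exponents; the necessity part does this with Lebesgue
  exponents.\<close>

definition morrey_exps :: "'n::finite itself \<Rightarrow> real \<Rightarrow> real \<Rightarrow> real \<Rightarrow> real \<Rightarrow> real \<Rightarrow> bool" where
  "morrey_exps T \<alpha> p q s t \<longleftrightarrow> 0 < \<alpha> \<and> 1 < q \<and> q \<le> p \<and> 1 < t \<and> t \<le> s \<and>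
     1/s = 1/p - \<alpha> / real CARD('n) \<and> t/s = q/p"

text \<open>Here \<open>u j\<close> stands for |a - E_j a| plus a constant. For levels j < k the
  growth condition moves \<open>u j\<close> to \<open>u k\<close>, and the Morrey bound of f sums
  geometrically against the linear loss. For levels j >= k \<open>avg_sum_dual\<close> removes
  \<open>u j\<close>, and what remains is estimated by Hedberg's method with the maximal function of
  |f|^r.\<close>

lemma scale_sum_bound:
  assumes ex: "morrey_exps TYPE('n::finite) \<alpha> p q s t" and r: "1 < r" "r < q"
  shows "\<exists>\<mu>>1. \<exists>C>0. \<forall>(f::real^'n \<Rightarrow> real) N u U J k x. mbd p q f N \<longrightarrow> N > 0 \<longrightarrow> U > 0 \<longrightarrow> finite J \<longrightarrow>
     (\<forall>j. u j \<in> borel_measurable borel \<and> (\<forall>y. 0 \<le> u j y) \<and> loc_int (\<lambda>y. u j y powr t) \<and> loc_int (\<lambda>y. u j y powr \<mu>) \<and>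
        (\<forall>y. avg j (\<lambda>y. u j y powr t) y \<le> U powr t) \<and> (\<forall>y. avg j (\<lambda>y. u j y powr \<mu>) y \<le> U powr \<mu>) \<and>
        (\<forall>i y. j \<le> i \<longrightarrow> u j y \<le> u i y + U * real_of_int (i - j))) \<longrightarrow>
     loc_int (\<lambda>y. (\<Sum>j\<in>J. 2 powr (- \<alpha> * real_of_int j) * (avg j (\<lambda>z. \<bar>f z\<bar> powr r) y) powr (1/r) * u j y) powr t) \<and>
     avg k (\<lambda>y. (\<Sum>j\<in>J. 2 powr (- \<alpha> * real_of_int j) * (avg j (\<lambda>z. \<bar>f z\<bar> powr r) y) powr (1/r) * u j y) powr t) x
       \<le> (C * U * N * 2 powr (real_of_int k * real CARD('n) / s)) powr t"
proof -
  let ?n = "real CARD('n)"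
  have n: "?n > 0" by simp
  have ep: "0 < \<alpha>" "1 < q" "q \<le> p" "1 < t" "t \<le> s" "1/s = 1/p - \<alpha> / ?n" "t/s = q/p"
    using ex by (auto simp: morrey_exps_def)
  \<comment> \<open>The rate left over at coarse scales once the weight 2^(-\<alpha> j) has been
    paid from the Morrey growth n/p.\<close>
  define \<sigma> where "\<sigma> = ?n / s"
  have \<sigma>: "\<sigma> > 0" using ep n by (simp add: \<sigma>_def)
  have np: "\<alpha> + \<sigma> = ?n / p"
  proof -
    have "\<sigma> = ?n * (1/s)" by (simp add: \<sigma>_def)
    also have "\<dots> = ?n / p - \<alpha>" unfolding ep(6) using n by (simp add: right_diff_distrib)
    finally show ?thesis by simp
  qed
  have pos: "p > 0" "s > 0" "t > 0" "q > 0" "r > 0" using ep r by auto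
  \<comment> \<open>Here t/s = q/p enters: raised to the power t, Hedberg's bound contains exactly
    the power q of the maximal function, and by the next fact the power t - q of N.\<close>
  have ps: "\<sigma> / (\<alpha> + \<sigma>) * t = q"
  proof -
    have "\<sigma> / (\<alpha> + \<sigma>) = p / s" unfolding np using n pos by (simp add: \<sigma>_def)
    then have "\<sigma> / (\<alpha> + \<sigma>) * t = p * (t / s)" by simp
    then show ?thesis unfolding ep(7) using pos by simp
  qed
  have ps2: "\<alpha> / (\<alpha> + \<sigma>) * t = t - q"
  proof -
    have "\<alpha> / (\<alpha> + \<sigma>) + \<sigma> / (\<alpha> + \<sigma>) = 1" using ep \<sigma> by (simp add: add_divide_distrib[symmetric])
    then have "\<alpha> / (\<alpha> + \<sigma>) * t + \<sigma> / (\<alpha> + \<sigma>) * t = t" by (metis distrib_right mult_1)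
    then show ?thesis using ps by simp
  qed
  obtain \<mu> C1 where \<mu>: "\<mu> > 1" and C1: "C1 > 0" and dual:
    "\<And>(b :: nat \<Rightarrow> real^'n \<Rightarrow> real) u U k d x. U > 0 \<Longrightarrow>
     (\<forall>i\<le>d. lev (k + int i) (b i) \<and> (\<forall>y. 0 \<le> b i y) \<and> u i \<in> borel_measurable borel \<and> (\<forall>y. 0 \<le> u i y)
        \<and> loc_int (\<lambda>y. u i y powr t) \<and> loc_int (\<lambda>y. u i y powr \<mu>) \<and> (\<forall>y. avg (k + int i) (\<lambda>y. u i y powr \<mu>) y \<le> U powr \<mu>)) \<Longrightarrow>
     loc_int (\<lambda>y. (\<Sum>i\<le>d. b i y * u i y) powr t) \<and>
     avg k (\<lambda>y. (\<Sum>i\<le>d. b i y * u i y) powr t) x \<le> C1 * U powr t * avg k (\<lambda>y. (\<Sum>i\<le>d. b i y) powr t) x"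
    using avg_sum_dual[OF ep(4), where 'n='n] by (elim exE conjE) blast
  \<comment> \<open>The reason for r < q: the maximal function of |f|^r is bounded in exponent q/r,
    which returns the mean of |f|^q.\<close>
  have qr: "q/r > 1" using r by simp
  obtain C2 where C2: "C2 > 0" "\<And>(v::real^'n \<Rightarrow> real) k d x. loc_int v \<Longrightarrow> (\<And>y. 0 \<le> v y) \<Longrightarrow> loc_int (\<lambda>y. v y powr (q/r)) \<Longrightarrow>
     avg k (\<lambda>y. dmax d k v y powr (q/r)) x \<le> C2 * avg k (\<lambda>y. v y powr (q/r)) x"
    using Doob[OF qr, where 'n='n] by blast
  obtain C3 where C3: "C3 > 0" "\<And>(J::int set) b M N. finite J \<Longrightarrow> 0 \<le> M \<Longrightarrow> 0 < N \<Longrightarrow>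
    (\<forall>j\<in>J. 0 \<le> b j \<and> b j \<le> 2 powr (- \<alpha> * real_of_int j) * M \<and> b j \<le> 2 powr (\<sigma> * real_of_int j) * N) \<Longrightarrow>
    (\<Sum>j\<in>J. b j) \<le> C3 * (M powr (\<sigma> / (\<alpha> + \<sigma>)) * N powr (\<alpha> / (\<alpha> + \<sigma>)))"
    using Hedberg_sum[OF ep(1) \<sigma>] by blast
  obtain C4 where C4: "C4 > 0" "\<And>(J::int set) x. finite J \<Longrightarrow> (\<forall>j\<in>J. real_of_int j \<le> x) \<Longrightarrow>
     (\<Sum>j\<in>J. 2 powr (\<sigma> * real_of_int j) * (1 + (x - real_of_int j))) \<le> C4 * 2 powr (\<sigma> * x)"
    using geo_sum_down_linear[OF \<sigma>] by blast
  define K where "K = 2 powr t * (C4 powr t * (2 powr t * 2) + C1 * (C3 powr t * C2))"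
  have K: "K > 0" using C1 C2 C3 C4 by (simp add: K_def add_pos_pos)
  show ?thesis
  proof (rule exI[of _ \<mu>], intro conjI \<mu>, rule exI[of _ "K powr (1/t)"], intro conjI allI impI)
    show "K powr (1/t) > 0" using K by simp
    fix f :: "real^'n \<Rightarrow> real" and N :: real and u :: "int \<Rightarrow> real^'n \<Rightarrow> real" and U :: real and J :: "int set" and k x
    assume f: "mbd p q f N" and N: "N > 0" and U: "U > 0" and J: "finite J"
    assume H: "\<forall>j. u j \<in> borel_measurable borel \<and> (\<forall>y. 0 \<le> u j y) \<and> loc_int (\<lambda>y. u j y powr t) \<and> loc_int (\<lambda>y. u j y powr \<mu>) \<and>
        (\<forall>y. avg j (\<lambda>y. u j y powr t) y \<le> U powr t) \<and> (\<forall>y. avg j (\<lambda>y. u j y powr \<mu>) y \<le> U powr \<mu>) \<and>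
        (\<forall>i y. j \<le> i \<longrightarrow> u j y \<le> u i y + U * real_of_int (i - j))"
    have u: "u j \<in> borel_measurable borel" "0 \<le> u j y" "loc_int (\<lambda>y. u j y powr t)" "loc_int (\<lambda>y. u j y powr \<mu>)"
       "avg j (\<lambda>y. u j y powr t) y \<le> U powr t" "avg j (\<lambda>y. u j y powr \<mu>) y \<le> U powr \<mu>"
       "j \<le> i \<Longrightarrow> u j y \<le> u i y + U * real_of_int (i - j)" for i j y
      using H by blast+
    define v where "v y = \<bar>f y\<bar> powr r" for y
    have v0: "0 \<le> v y" for y by (simp add: v_def)
    have liv: "loc_int v" unfolding v_def using mbd_loc_int_powr[OF f] r by simp
    have vq: "v y powr (q/r) = \<bar>f y\<bar> powr q" for y using r by (simp add: v_def powr_powr)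
    define D where "D j y = avg j v y powr (1/r)" for j y
    have levD': "lev j (D j)" for j unfolding D_def by (intro lev_powr lev_avg)
    have D0: "0 \<le> D j y" for j y by (simp add: D_def)
    have DN: "D j y \<le> N * 2 powr (real_of_int j * ?n / p)" for j y
    proof -
      have "avg j v y \<le> (N * 2 powr (real_of_int j * ?n / p)) powr r"
        unfolding v_def using mbd_avg_powr[OF f, of r] r N by simp
      then have "D j y \<le> ((N * 2 powr (real_of_int j * ?n / p)) powr r) powr (1/r)"
        unfolding D_def using pos avg_nonneg[of j y v] v0 by (intro powr_mono2) auto
      then show ?thesis using N pos by (simp add: powr_powr)
    qed
    have wD: "2 powr (- \<alpha> * real_of_int j) * D j y \<le> 2 powr (\<sigma> * real_of_int j) * N" for j y
    proof -
      have "2 powr (- \<alpha> * real_of_int j) * D j y \<le> 2 powr (- \<alpha> * real_of_int j) * (N * 2 powr (real_of_int j * ?n / p))"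
        by (intro mult_left_mono DN) simp
      also have "\<dots> = N * 2 powr (- \<alpha> * real_of_int j + real_of_int j * ?n / p)" by (simp only: powr_add mult_ac)
      also have "- \<alpha> * real_of_int j + real_of_int j * ?n / p = \<sigma> * real_of_int j"
      proof -
        have "real_of_int j * ?n / p = real_of_int j * (\<alpha> + \<sigma>)" unfolding np by simp
        then show ?thesis by (simp add: algebra_simps)
      qed
      finally show ?thesis by (simp add: mult.commute)
    qed
    let ?w = "\<lambda>j y. 2 powr (- \<alpha> * real_of_int j) * D j y"
    let ?F = "\<lambda>y. \<Sum>j\<in>J. ?w j y * u j y"
    have fin_eq: "(\<Sum>j\<in>J. 2 powr (- \<alpha> * real_of_int j) * (avg j (\<lambda>z. \<bar>f z\<bar> powr r) y) powr (1/r) * u j y) = ?F y" for y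
      by (simp add: D_def v_def[abs_def])
    have levw: "lev j (\<lambda>y. c * D j y)" for c j by (intro lev_arith(3) lev_const levD')
    have w0: "0 \<le> ?w j y" for j y using D0 by simp
    have F0: "0 \<le> ?F y" for y by (intro sum_nonneg mult_nonneg_nonneg w0 u)
    have Fm: "?F \<in> borel_measurable borel"
      by (intro borel_measurable_sum borel_measurable_times) (auto intro: u lev_measurable[OF levw] lev_measurable[OF levD'])
    define J1 where "J1 = {j\<in>J. j < k}"
    define J2 where "J2 = {j\<in>J. k \<le> j}"
    have J12: "finite J1" "finite J2" using J by (auto simp: J1_def J2_def)
    \<comment> \<open>The depth of the finest level of J below k. The levels of J need not be
      consecutive; the gaps are filled by setting \<open>b\<close> to 0 there.\<close>
    define d where "d = nat (Max (insert k J) - k)"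
    define b where "b i = (\<lambda>y. if k + int i \<in> J then ?w (k + int i) y else 0)" for i
    have levb: "lev (k + int i) (b i)" for i unfolding b_def by (cases "k + int i \<in> J") (simp_all add: levw)
    have b0: "0 \<le> b i y" for i y using w0[of "k + int i" y] by (simp add: b_def)
    have J2eq: "J2 \<subseteq> (\<lambda>i. k + int i) ` {..d}"
    proof
      fix j assume j: "j \<in> J2"
      then have "j \<le> Max (insert k J)" using J by (intro Max_ge) (auto simp: J2_def)
      then show "j \<in> (\<lambda>i. k + int i) ` {..d}" using j unfolding d_def J2_def
        by (intro image_eqI[of _ _ "nat (j - k)"]) auto
    qed
    have S2: "(\<Sum>j\<in>J2. ?w j y * h j) = (\<Sum>i\<le>d. b i y * h (k + int i))" for y and h :: "int \<Rightarrow> real"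
    proof -
      have "(\<Sum>i\<le>d. b i y * h (k + int i)) = (\<Sum>j\<in>(\<lambda>i. k + int i) ` {..d}. (if j \<in> J then ?w j y else 0) * h j)"
        by (subst sum.reindex) (auto simp: inj_on_def b_def)
      also have "\<dots> = (\<Sum>j\<in>J2. (if j \<in> J then ?w j y else 0) * h j)"
        using J2eq by (intro sum.mono_neutral_right) (auto simp: J2_def)
      also have "\<dots> = (\<Sum>j\<in>J2. ?w j y * h j)" by (intro sum.cong) (auto simp: J2_def)
      finally show ?thesis by simp
    qed
    have Fsplit: "?F y = (\<Sum>j\<in>J1. ?w j y * u j y) + (\<Sum>i\<le>d. b i y * u (k + int i) y)" for y
    proof -
      have "?F y = (\<Sum>j\<in>J1. ?w j y * u j y) + (\<Sum>j\<in>J2. ?w j y * u j y)"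
        using J by (subst sum.union_disjoint[symmetric]) (auto simp: J1_def J2_def intro: sum.cong)
      then show ?thesis using S2[of y "\<lambda>j. u j y"] by simp
    qed
    let ?G = "\<lambda>y. \<Sum>i\<le>d. b i y * u (k + int i) y"
    let ?c1 = "N * C4 * 2 powr (\<sigma> * real_of_int k)"
    have c1: "?c1 > 0" using N C4 by simp
    have G: "loc_int (\<lambda>y. ?G y powr t)" "avg k (\<lambda>y. ?G y powr t) x \<le> C1 * U powr t * avg k (\<lambda>y. (\<Sum>i\<le>d. b i y) powr t) x"
      using dual[OF U, of d k b "\<lambda>i. u (k + int i)" x] levb b0 u by auto
    have S1: "(\<Sum>j\<in>J1. ?w j y * u j y) \<le> ?c1 * (u k y + U)" for y
    proof -
      \<comment> \<open>On coarse scales the Morrey bound \<open>wD\<close> is used for the averages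
        of f, and the distance k - j measures how much \<open>u j\<close> can exceed
        \<open>u k\<close>.\<close>
      have "(\<Sum>j\<in>J1. ?w j y * u j y) \<le> (\<Sum>j\<in>J1. (N * (u k y + U)) * (2 powr (\<sigma> * real_of_int j) * (1 + (real_of_int k - real_of_int j))))"
      proof (rule sum_mono)
        fix j assume j: "j \<in> J1"
        then have kj: "0 \<le> real_of_int k - real_of_int j" by (simp add: J1_def)
        have "u j y \<le> u k y + U * real_of_int (k - j)" using j by (intro u) (simp add: J1_def)
        also have "\<dots> \<le> (u k y + U) * (1 + (real_of_int k - real_of_int j))"
          using mult_nonneg_nonneg[OF u(2)[of k y] kj] U by (simp add: algebra_simps)
        finally have "?w j y * u j y \<le> (2 powr (\<sigma> * real_of_int j) * N) * ((u k y + U) * (1 + (real_of_int k - real_of_int j)))"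
          using u(2) N by (intro mult_mono wD) auto
        then show "?w j y * u j y \<le> (N * (u k y + U)) * (2 powr (\<sigma> * real_of_int j) * (1 + (real_of_int k - real_of_int j)))"
          by (simp add: mult_ac)
      qed
      also have "\<dots> = (N * (u k y + U)) * (\<Sum>j\<in>J1. 2 powr (\<sigma> * real_of_int j) * (1 + (real_of_int k - real_of_int j)))"
        by (rule sum_distrib_left[symmetric])
      also have "\<dots> \<le> (N * (u k y + U)) * (C4 * 2 powr (\<sigma> * real_of_int k))"
        using N U u(2)[of k y] J12 by (intro mult_left_mono C4) (auto simp: J1_def)
      finally show ?thesis by (simp add: mult_ac)
    qed
    let ?H = "\<lambda>y. (?c1 powr t * 2 powr t * 2 powr t) * (u k y powr t + U powr t) + 2 powr t * ?G y powr t"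
    have G0: "0 \<le> ?G y" for y by (intro sum_nonneg mult_nonneg_nonneg b0 u)
    have liH: "loc_int ?H" by (intro loc_int_add loc_int_cmult G(1) u loc_int_const)
    have pt: "?F y powr t \<le> ?H y" for y
    proof -
      have "?F y powr t \<le> (?c1 * (u k y + U) + ?G y) powr t"
      proof (rule powr_mono2)
        show "0 \<le> t" using pos by simp
        show "0 \<le> ?F y" by (rule F0)
        show "?F y \<le> ?c1 * (u k y + U) + ?G y" unfolding Fsplit[of y] using S1[of y] by simp
      qed
      also have "\<dots> \<le> 2 powr t * ((?c1 * (u k y + U)) powr t + ?G y powr t)"
      proof (rule powr_add_le)
        show "0 \<le> ?c1 * (u k y + U)" by (rule mult_nonneg_nonneg[OF less_imp_le[OF c1]]) (use u(2)[of k y] U in simp)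
      qed (use G0 pos in auto)
      also have "\<dots> \<le> 2 powr t * (?c1 powr t * (2 powr t * (u k y powr t + U powr t)) + ?G y powr t)"
      proof -
        have "(?c1 * (u k y + U)) powr t = ?c1 powr t * (u k y + U) powr t" by (rule powr_mult)
        also have "\<dots> \<le> ?c1 powr t * (2 powr t * (u k y powr t + U powr t))"
          by (rule mult_left_mono[OF powr_add_le]) (use u(2) U pos in auto)
        finally show ?thesis by (intro mult_left_mono add_right_mono) auto
      qed
      also have "\<dots> = ?H y"
      proof -
        have "z * (c * (z * w) + g) = (c * z * z) * w + z * g" for z c w g :: real by (simp add: algebra_simps)
        then show ?thesis .
      qed
      finally show ?thesis .
    qed
    have liF: "loc_int (\<lambda>y. ?F y powr t)"
    proof (rule loc_int_bound[OF liH])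
      show "(\<lambda>y. ?F y powr t) \<in> borel_measurable borel" using Fm by measurable
      show "\<bar>?F y powr t\<bar> \<le> ?H y" for y using pt[of y] by (simp only: abs_of_nonneg[OF powr_ge_zero])
    qed
    have bS: "avg k (\<lambda>y. (\<Sum>i\<le>d. b i y) powr t) x \<le> C3 powr t * C2 * N powr t * 2 powr (real_of_int k * ?n / p * q)"
    proof -
      let ?Y = "dmax d k v"
      have Y0: "0 \<le> ?Y y" for y by (rule dmax_nonneg[OF v0])
      have liY: "loc_int (\<lambda>y. ?Y y powr (q/r))" by (intro lev_loc_int[of "k + int d"] lev_powr lev_dmax)
      have liS: "loc_int (\<lambda>y. (\<Sum>i\<le>d. b i y) powr t)"
        by (intro lev_loc_int[of "k + int d"] lev_powr lev_sum lev_mono[OF levb]) auto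
      have ptS: "(\<Sum>i\<le>d. b i y) powr t \<le> (C3 powr t * N powr (t - q)) * ?Y y powr (q/r)" for y
      proof -
        have "(\<Sum>j\<in>J2. ?w j y) \<le> C3 * ((?Y y powr (1/r)) powr (\<sigma> / (\<alpha> + \<sigma>)) * N powr (\<alpha> / (\<alpha> + \<sigma>)))"
        proof (rule C3(2)[OF J12(2) _ N], simp, intro ballI conjI w0 wD)
          fix j assume "j \<in> J2"
          then obtain i where i: "i \<le> d" "j = k + int i" using J2eq by auto
          have "D j y \<le> ?Y y powr (1/r)" unfolding D_def i(2)
            using pos avg_nonneg[of "k + int i" y v] v0 by (intro powr_mono2 dmax_ge i) auto
          then show "?w j y \<le> 2 powr (- \<alpha> * real_of_int j) * ?Y y powr (1/r)" by (intro mult_left_mono) auto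
        qed
        also have "(\<Sum>j\<in>J2. ?w j y) = (\<Sum>i\<le>d. b i y)" using S2[of y "\<lambda>_. 1"] by simp
        finally have "(\<Sum>i\<le>d. b i y) powr t \<le> (C3 * ((?Y y powr (1/r)) powr (\<sigma> / (\<alpha> + \<sigma>)) * N powr (\<alpha> / (\<alpha> + \<sigma>)))) powr t"
          using pos by (intro powr_mono2 sum_nonneg b0) auto
        also have "\<dots> = C3 powr t * (?Y y powr (1/r * (\<sigma> / (\<alpha> + \<sigma>) * t)) * N powr (\<alpha> / (\<alpha> + \<sigma>) * t))"
          by (simp add: powr_mult powr_powr mult.assoc)
        finally show ?thesis unfolding ps ps2 by (simp add: mult_ac)
      qed
      have "avg k (\<lambda>y. (\<Sum>i\<le>d. b i y) powr t) x \<le> avg k (\<lambda>y. (C3 powr t * N powr (t - q)) * ?Y y powr (q/r)) x"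
        by (intro avg_mono_cell ptS liS loc_int_cmult liY)
      also have "\<dots> = (C3 powr t * N powr (t - q)) * avg k (\<lambda>y. ?Y y powr (q/r)) x" by (rule avg_cmult)
      also have "\<dots> \<le> (C3 powr t * N powr (t - q)) * (C2 * avg k (\<lambda>y. v y powr (q/r)) x)"
        by (intro mult_left_mono C2(2)[OF liv v0]) (use mbdD(2)[OF f] in \<open>auto simp: vq\<close>)
      also have "\<dots> \<le> (C3 powr t * N powr (t - q)) * (C2 * (N * 2 powr (real_of_int k * ?n / p)) powr q)"
        unfolding vq using C2 by (intro mult_left_mono mbdD(3)[OF f]) auto
      also have "\<dots> = C3 powr t * C2 * (N powr (t - q) * N powr q) * 2 powr (real_of_int k * ?n / p * q)"
        by (simp add: powr_mult powr_powr)
      also have "N powr (t - q) * N powr q = N powr t" by (simp add: powr_add[symmetric])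
      finally show ?thesis .
    qed
    have e1: "real_of_int k * ?n / p * q = \<sigma> * real_of_int k * t"
    proof -
      have "real_of_int k * ?n / p * q = real_of_int k * ?n * (q/p)" by simp
      also have "\<dots> = real_of_int k * ?n * (t/s)" unfolding ep(7) ..
      finally show ?thesis by (simp add: \<sigma>_def)
    qed
    have "avg k (\<lambda>y. ?F y powr t) x \<le> avg k ?H x" by (intro avg_mono_cell pt liF liH)
    also have "\<dots> = (?c1 powr t * 2 powr t * 2 powr t) * avg k (\<lambda>y. u k y powr t + U powr t) x + 2 powr t * avg k (\<lambda>y. ?G y powr t) x"
      by (intro avg_lincomb G(1) loc_int_add u loc_int_const)
    also have "avg k (\<lambda>y. u k y powr t + U powr t) x = avg k (\<lambda>y. u k y powr t) x + U powr t"
      using avg_add[OF u(3)[of k] loc_int_const] by simp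
    also have "(?c1 powr t * 2 powr t * 2 powr t) * (avg k (\<lambda>y. u k y powr t) x + U powr t) + 2 powr t * avg k (\<lambda>y. ?G y powr t) x
       \<le> (?c1 powr t * 2 powr t * 2 powr t) * (U powr t + U powr t) + 2 powr t * (C1 * U powr t * (C3 powr t * C2 * N powr t * 2 powr (real_of_int k * ?n / p * q)))"
      using C1 bS by (intro add_mono mult_left_mono order_trans[OF G(2)] u) auto
    also have "\<dots> = K * (U powr t * N powr t * 2 powr (\<sigma> * real_of_int k * t))"
    proof -
      have c: "?c1 powr t = N powr t * C4 powr t * 2 powr (\<sigma> * real_of_int k * t)" by (simp add: powr_mult powr_powr)
      have "(n' * c4 * X * z * z) * (u' + u') + z * (C1 * u' * (c3 * C2 * n' * X)) = (z * (c4 * (z * 2) + C1 * (c3 * C2))) * (u' * n' * X)"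
        for n' c4 X z u' c3 :: real by (simp add: algebra_simps)
      then show ?thesis unfolding e1 c K_def .
    qed
    also have "\<dots> = (K powr (1/t) * U * N * 2 powr (real_of_int k * ?n / s)) powr t"
      using K pos by (simp add: powr_mult powr_powr \<sigma>_def mult_ac)
    finally show "loc_int (\<lambda>y. (\<Sum>j\<in>J. 2 powr (- \<alpha> * real_of_int j) * (avg j (\<lambda>z. \<bar>f z\<bar> powr r) y) powr (1/r) * u j y) powr t)"
      "avg k (\<lambda>y. (\<Sum>j\<in>J. 2 powr (- \<alpha> * real_of_int j) * (avg j (\<lambda>z. \<bar>f z\<bar> powr r) y) powr (1/r) * u j y) powr t) x
       \<le> (K powr (1/t) * U * N * 2 powr (real_of_int k * real CARD('n) / s)) powr t"
      unfolding fin_eq using liF by simp_all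
  qed
qed

section \<open>Operations preserving a Morrey bound\<close>

lemma mbd_dominated:
  fixes h :: "real^'n::finite \<Rightarrow> real"
  assumes h: "h \<in> borel_measurable borel" and le: "\<And>y. \<bar>h y\<bar> \<le> F y" and F: "loc_int (\<lambda>y. F y powr t)" and t: "t > 0"
    and bd: "\<And>k x. avg k (\<lambda>y. F y powr t) x \<le> (K * 2 powr (real_of_int k * real CARD('n) / s)) powr t"
  shows "mbd s t h K"
  unfolding mbd_def
proof (intro conjI allI h)
  have pt: "\<bar>h y\<bar> powr t \<le> F y powr t" for y using le t by (intro powr_mono2) auto
  show li: "loc_int (\<lambda>y. \<bar>h y\<bar> powr t)"
    by (rule loc_int_bound[OF F]) (use h pt in auto)
  fix k x
  have "avg k (\<lambda>y. \<bar>h y\<bar> powr t) x \<le> avg k (\<lambda>y. F y powr t) x" by (intro avg_mono_cell li F pt)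
  then show "avg k (\<lambda>y. \<bar>h y\<bar> powr t) x \<le> (K * 2 powr (real_of_int k * real CARD('n) / s)) powr t"
    using bd order_trans by blast
qed

lemma mbd_le:
  assumes "mbd s t g K" "h \<in> borel_measurable borel" "\<And>y. \<bar>h y\<bar> \<le> \<bar>g y\<bar>" "t > 0"
  shows "mbd s t h K"
  using mbd_dominated[OF assms(2,3) mbdD(2)[OF assms(1)] assms(4) mbdD(3)[OF assms(1)]] .

lemma mbd_mono:
  fixes g :: "real^'n::finite \<Rightarrow> real"
  assumes "mbd s t g K" "0 \<le> K" "K \<le> K'" "t > 0" shows "mbd s t g K'"
  unfolding mbd_def
proof (intro conjI allI mbdD(1,2)[OF assms(1)])
  fix k x
  have "(K * 2 powr (real_of_int k * real CARD('n) / s)) powr t \<le> (K' * 2 powr (real_of_int k * real CARD('n) / s)) powr t"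
    using assms by (intro powr_mono2 mult_right_mono) auto
  then show "avg k (\<lambda>y. \<bar>g y\<bar> powr t) x \<le> (K' * 2 powr (real_of_int k * real CARD('n) / s)) powr t"
    using mbdD(3)[OF assms(1)] order_trans by blast
qed

lemma mbd_cmult:
  fixes g :: "real^'n::finite \<Rightarrow> real"
  assumes "mbd s t g K" "0 \<le> K" shows "mbd s t (\<lambda>y. c * g y) (\<bar>c\<bar> * K)"
proof -
  have "(\<lambda>y. \<bar>c * g y\<bar> powr t) = (\<lambda>y. \<bar>c\<bar> powr t * \<bar>g y\<bar> powr t)" by (simp add: abs_mult powr_mult)
  then show ?thesis using assms(1) unfolding mbd_def
    by (auto simp: avg_cmult powr_mult mult.assoc intro!: mult_left_mono)
qed

lemma mbd_cong_AE:
  assumes "mbd s t g K" "h \<in> borel_measurable borel" "AE y in lborel. h y = g y"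
  shows "mbd s t h K"
proof -
  note g = mbdD[OF assms(1)]
  have ae: "AE y in lborel. \<bar>h y\<bar> powr t = \<bar>g y\<bar> powr t" using assms(3) by eventually_elim simp
  have "loc_int (\<lambda>y. \<bar>h y\<bar> powr t)" using assms(2) by (intro loc_int_cong_AE[OF g(2) _ ae]) simp
  moreover have "avg k (\<lambda>y. \<bar>h y\<bar> powr t) x = avg k (\<lambda>y. \<bar>g y\<bar> powr t) x" for k x
    using assms(2) g(1) by (intro avg_cong_AE ae) simp_all
  ultimately show ?thesis unfolding mbd_def using assms(2) g(3) by simp
qed

text \<open>Lower semicontinuity of the Morrey norm: bounds that are uniform over truncations pass
  to the series.\<close>

lemma mbd_fatou:
  fixes h :: "real^'n::finite \<Rightarrow> real"
  assumes G: "\<And>i::nat. mbd s t (G i) K" and h: "h \<in> borel_measurable borel" and K: "t > 0"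
    and lim: "AE y in lborel. (\<lambda>i. G i y) \<longlonglongrightarrow> h y"
  shows "mbd s t h K"
proof -
  have *: "set_integrable lborel (cell k x) (\<lambda>y. \<bar>h y\<bar> powr t) \<and> avg k (\<lambda>y. \<bar>h y\<bar> powr t) x \<le> (K * 2 powr (real_of_int k * real CARD('n) / s)) powr t" for k x
  proof -
    have "AE y in lborel. y \<in> cell k x \<longrightarrow> (\<lambda>i. \<bar>G i y\<bar> powr t) \<longlonglongrightarrow> \<bar>h y\<bar> powr t"
      using lim
    proof eventually_elim
      case (elim y)
      then show ?case using K by (intro impI tendsto_powr2 tendsto_intros) auto
    qed
    then show ?thesis
      using avg_fatou[where G="\<lambda>i y. \<bar>G i y\<bar> powr t" and g="\<lambda>y. \<bar>h y\<bar> powr t" and k=k and x=x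
          and C="(K * 2 powr (real_of_int k * real CARD('n) / s)) powr t"] mbdD[OF G] h by simp
  qed
  then have "loc_int (\<lambda>y. \<bar>h y\<bar> powr t)" using h by (intro loc_intI_level[of _ 0]) auto
  then show ?thesis unfolding mbd_def using * h by blast
qed

section \<open>Truncated fractional integrals and commutators\<close>

lemma osc_steps:
  fixes a :: "real^'n::finite \<Rightarrow> real"
  assumes "osc_le a B"
  shows "\<bar>avg (k + int i) a x - avg k a x\<bar> \<le> 2 ^ CARD('n) * B * real i"
proof (induction i)
  case (Suc i)
  have "avg (k + int (Suc i)) a x - avg k a x = (avg (k + int i + 1) a x - avg (k + int i) a x) + (avg (k + int i) a x - avg k a x)"
    by (simp add: algebra_simps)
  then show ?case using osc_jump[OF assms, of "k + int i" x] Suc by (simp add: algebra_simps)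
qed simp

lemma osc_nonneg: "osc_le a B \<Longrightarrow> 0 \<le> B"
  unfolding osc_le_def by (meson avg_nonneg abs_ge_zero order_trans)

lemma osc_int_steps:
  fixes a :: "real^'n::finite \<Rightarrow> real"
  assumes "osc_le a B" "j \<le> i"
  shows "\<bar>avg i a x - avg j a x\<bar> \<le> 2 ^ CARD('n) * B * real_of_int (i - j)"
  using osc_steps[OF assms(1), of j "nat (i - j)" x] assms(2) by simp

text \<open>The truncated fractional integral without the factor 2^\<alpha> - 1 of the Abel
  summation. The level set J is arbitrary, so a single level is also an instance.\<close>

definition scale_sum :: "real \<Rightarrow> int set \<Rightarrow> (real^'n::finite \<Rightarrow> real) \<Rightarrow> real^'n \<Rightarrow> real" where
  "scale_sum \<alpha> J f y = (\<Sum>j\<in>J. 2 powr (- \<alpha> * real_of_int j) * avg j f y)"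

definition scale_comm :: "real \<Rightarrow> (real^'n::finite \<Rightarrow> real) \<Rightarrow> int set \<Rightarrow> (real^'n \<Rightarrow> real) \<Rightarrow> real^'n \<Rightarrow> real" where
  "scale_comm \<alpha> a J f y = (\<Sum>j\<in>J. 2 powr (- \<alpha> * real_of_int j) * (a y * avg j f y - avg j (\<lambda>z. a z * f z) y))"

lemma avg_abs_le_avg_powr:
  fixes f :: "real^'n::finite \<Rightarrow> real"
  assumes "loc_int (\<lambda>y. \<bar>f y\<bar> powr r)" "f \<in> borel_measurable borel" "r > 1"
  shows "avg k (\<lambda>y. \<bar>f y\<bar>) x \<le> avg k (\<lambda>y. \<bar>f y\<bar> powr r) x powr (1/r)"
proof (rule avg_abs_le_powr[OF assms])
  have "0 \<le> avg k (\<lambda>y. \<bar>f y\<bar> powr r) x" by (intro avg_nonneg) simp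
  then show "avg k (\<lambda>y. \<bar>f y\<bar> powr r) x \<le> (avg k (\<lambda>y. \<bar>f y\<bar> powr r) x powr (1/r)) powr r"
    using assms(3) by (simp add: powr_powr)
qed simp

text \<open>The case u = 1 of \<open>scale_sum_bound\<close>, in which the growth condition is
  trivial. It will be applied to indicator functions.\<close>

lemma scale_sum_Morrey:
  assumes ex: "morrey_exps TYPE('n::finite) \<alpha> p q s t"
  shows "\<exists>C>0. \<forall>(f::real^'n \<Rightarrow> real) N J. mbd p q f N \<longrightarrow> N > 0 \<longrightarrow> finite J \<longrightarrow>
     mbd s t (\<lambda>y. scale_sum \<alpha> J (\<lambda>z. \<bar>f z\<bar>) y) (C * N)"
proof -
  have q: "1 < q" "1 < t" using ex by (auto simp: morrey_exps_def)
  define r where "r = (1 + q) / 2"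
  have r: "1 < r" "r < q" using q by (auto simp: r_def)
  obtain \<mu> C where C: "C > 0" "\<And>(f::real^'n \<Rightarrow> real) N u U J k x. mbd p q f N \<Longrightarrow> N > 0 \<Longrightarrow> U > 0 \<Longrightarrow> finite J \<Longrightarrow>
     (\<forall>j. u j \<in> borel_measurable borel \<and> (\<forall>y. 0 \<le> u j y) \<and> loc_int (\<lambda>y. u j y powr t) \<and> loc_int (\<lambda>y. u j y powr \<mu>) \<and>
        (\<forall>y. avg j (\<lambda>y. u j y powr t) y \<le> U powr t) \<and> (\<forall>y. avg j (\<lambda>y. u j y powr \<mu>) y \<le> U powr \<mu>) \<and>
        (\<forall>i y. j \<le> i \<longrightarrow> u j y \<le> u i y + U * real_of_int (i - j))) \<Longrightarrow>
     loc_int (\<lambda>y. (\<Sum>j\<in>J. 2 powr (- \<alpha> * real_of_int j) * (avg j (\<lambda>z. \<bar>f z\<bar> powr r) y) powr (1/r) * u j y) powr t) \<and>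
     avg k (\<lambda>y. (\<Sum>j\<in>J. 2 powr (- \<alpha> * real_of_int j) * (avg j (\<lambda>z. \<bar>f z\<bar> powr r) y) powr (1/r) * u j y) powr t) x
       \<le> (C * U * N * 2 powr (real_of_int k * real CARD('n) / s)) powr t"
    using scale_sum_bound[OF ex r] by (elim exE conjE) blast
  show ?thesis
  proof (intro exI[of _ C] conjI allI impI C(1))
    fix f :: "real^'n \<Rightarrow> real" and N J assume f: "mbd p q f N" and N: "N > 0" and J: "finite (J::int set)"
    let ?F = "\<lambda>y. \<Sum>j\<in>J. 2 powr (- \<alpha> * real_of_int j) * (avg j (\<lambda>z. \<bar>f z\<bar> powr r) y) powr (1/r)"
    have F: "loc_int (\<lambda>y. ?F y powr t)" "\<And>k x. avg k (\<lambda>y. ?F y powr t) x \<le> (C * N * 2 powr (real_of_int k * real CARD('n) / s)) powr t"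
      using C(2)[OF f N zero_less_one J, of "\<lambda>_ _. 1"] by auto
    show "mbd s t (\<lambda>y. scale_sum \<alpha> J (\<lambda>z. \<bar>f z\<bar>) y) (C * N)"
    proof (rule mbd_dominated[OF _ _ F(1) _ F(2)])
      show "(\<lambda>y. scale_sum \<alpha> J (\<lambda>z. \<bar>f z\<bar>) y) \<in> borel_measurable borel" unfolding scale_sum_def by measurable
      fix y
      have "\<bar>scale_sum \<alpha> J (\<lambda>z. \<bar>f z\<bar>) y\<bar> = scale_sum \<alpha> J (\<lambda>z. \<bar>f z\<bar>) y"
        unfolding scale_sum_def by (intro abs_of_nonneg sum_nonneg mult_nonneg_nonneg avg_nonneg) auto
      also have "\<dots> \<le> ?F y" unfolding scale_sum_def
        using r by (intro sum_mono mult_left_mono avg_abs_le_avg_powr mbd_loc_int_powr[OF f] mbdD(1)[OF f]) auto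
      finally show "\<bar>scale_sum \<alpha> J (\<lambda>z. \<bar>f z\<bar>) y\<bar> \<le> ?F y" .
    qed (use q in simp)
  qed
qed

text \<open>Hoelder with the conjugate of r against the John-Nirenberg bound for |a - E_j
  a|.\<close>

lemma BMO_mult:
  assumes r: "r > (1::real)"
  shows "\<exists>C>0. \<forall>(a::real^'n::finite \<Rightarrow> real) B f. osc_le a B \<longrightarrow> B > 0 \<longrightarrow> f \<in> borel_measurable borel \<longrightarrow> loc_int (\<lambda>y. \<bar>f y\<bar> powr r) \<longrightarrow>
     loc_int (\<lambda>y. a y * f y) \<and> (\<forall>j. loc_int (\<lambda>y. \<bar>a y - avg j a y\<bar> * \<bar>f y\<bar>)) \<and>
     (\<forall>j x. avg j (\<lambda>y. \<bar>a y - avg j a y\<bar> * \<bar>f y\<bar>) x \<le> C * B * avg j (\<lambda>y. \<bar>f y\<bar> powr r) x powr (1/r))"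
proof -
  define r' where "r' = r / (r - 1)"
  have r': "r' > 1" "1/r' + 1/r = 1" using r by (auto simp: r'_def field_simps)
  then have "r' > 0" by simp
  from John_Nirenberg[OF this, where 'n='n] obtain C where C: "C > 0"
    "\<And>(a::real^'n \<Rightarrow> real) B k. osc_le a B \<Longrightarrow> B > 0 \<Longrightarrow> loc_int (\<lambda>y. \<bar>a y - avg k a y\<bar> powr r')"
    "\<And>(a::real^'n \<Rightarrow> real) B. osc_le a B \<Longrightarrow> B > 0 \<Longrightarrow> loc_int (\<lambda>y. \<bar>a y\<bar> powr r')"
    "\<And>(a::real^'n \<Rightarrow> real) B k x. osc_le a B \<Longrightarrow> B > 0 \<Longrightarrow> avg k (\<lambda>y. \<bar>a y - avg k a y\<bar> powr r') x \<le> (C * B) powr r'"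
    by blast
  show ?thesis
  proof (intro exI[of _ C] conjI allI impI C(1))
    fix a f :: "real^'n \<Rightarrow> real" and B
    assume a: "osc_le a B" and B: "B > 0" and f: "f \<in> borel_measurable borel" and fr: "loc_int (\<lambda>y. \<bar>f y\<bar> powr r)"
    have am: "a \<in> borel_measurable borel" using a by (simp add: osc_le_def loc_int_measurable)
    have "loc_int (\<lambda>y. \<bar>a y\<bar> * \<bar>f y\<bar>)"
      by (rule loc_int_Holder[OF r'(1) r r'(2)]) (use am f fr C(3)[OF a B] in auto)
    then show "loc_int (\<lambda>y. a y * f y)" by (rule loc_int_bound) (use am f in \<open>auto simp: abs_mult\<close>)
    show "loc_int (\<lambda>y. \<bar>a y - avg j a y\<bar> * \<bar>f y\<bar>)" for j
      by (rule loc_int_Holder[OF r'(1) r r'(2)]) (use am f fr C(2)[OF a B] in auto)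
    fix j x
    have nn: "0 \<le> avg j (\<lambda>y. \<bar>f y\<bar> powr r) x" by (intro avg_nonneg) simp
    show "avg j (\<lambda>y. \<bar>a y - avg j a y\<bar> * \<bar>f y\<bar>) x \<le> C * B * avg j (\<lambda>y. \<bar>f y\<bar> powr r) x powr (1/r)"
      by (rule avg_Holder(2)[OF r'(1) r r'(2)])
        (use am f fr C(1) B C(2,4)[OF a B] nn r in \<open>auto simp: powr_powr\<close>)
  qed
qed

text \<open>The identity a E_j f - E_j (a f) = (a - E_j a) E_j f - E_j ((a - E_j a) f) bounds each
  term by (E_j |f|^r)^(1/r) times |a - E_j a| + const B. This is the form that
  \<open>scale_sum_bound\<close> treats.\<close>

lemma scale_comm_Morrey:
  assumes ex: "morrey_exps TYPE('n::finite) \<alpha> p q s t"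
  shows "\<exists>C>0. \<forall>(a::real^'n \<Rightarrow> real) B f N J. osc_le a B \<longrightarrow> B > 0 \<longrightarrow> mbd p q f N \<longrightarrow> N > 0 \<longrightarrow> finite J \<longrightarrow>
     mbd s t (scale_comm \<alpha> a J f) (C * B * N)"
proof -
  have q: "1 < q" "1 < t" using ex by (auto simp: morrey_exps_def)
  define r where "r = (1 + q) / 2"
  have r: "1 < r" "r < q" using q by (auto simp: r_def)
  obtain \<mu> C where \<mu>: "\<mu> > 1" and C: "C > 0" "\<And>(f::real^'n \<Rightarrow> real) N u U J k x. mbd p q f N \<Longrightarrow> N > 0 \<Longrightarrow> U > 0 \<Longrightarrow> finite J \<Longrightarrow>
     (\<forall>j. u j \<in> borel_measurable borel \<and> (\<forall>y. 0 \<le> u j y) \<and> loc_int (\<lambda>y. u j y powr t) \<and> loc_int (\<lambda>y. u j y powr \<mu>) \<and>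
        (\<forall>y. avg j (\<lambda>y. u j y powr t) y \<le> U powr t) \<and> (\<forall>y. avg j (\<lambda>y. u j y powr \<mu>) y \<le> U powr \<mu>) \<and>
        (\<forall>i y. j \<le> i \<longrightarrow> u j y \<le> u i y + U * real_of_int (i - j))) \<Longrightarrow>
     loc_int (\<lambda>y. (\<Sum>j\<in>J. 2 powr (- \<alpha> * real_of_int j) * (avg j (\<lambda>z. \<bar>f z\<bar> powr r) y) powr (1/r) * u j y) powr t) \<and>
     avg k (\<lambda>y. (\<Sum>j\<in>J. 2 powr (- \<alpha> * real_of_int j) * (avg j (\<lambda>z. \<bar>f z\<bar> powr r) y) powr (1/r) * u j y) powr t) x
       \<le> (C * U * N * 2 powr (real_of_int k * real CARD('n) / s)) powr t"
    using scale_sum_bound[OF ex r] by (elim exE conjE) blast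
  obtain CH where CH: "CH > 0" "\<And>(a::real^'n \<Rightarrow> real) B f. osc_le a B \<Longrightarrow> B > 0 \<Longrightarrow> f \<in> borel_measurable borel \<Longrightarrow> loc_int (\<lambda>y. \<bar>f y\<bar> powr r) \<Longrightarrow>
     loc_int (\<lambda>y. a y * f y) \<and> (\<forall>j. loc_int (\<lambda>y. \<bar>a y - avg j a y\<bar> * \<bar>f y\<bar>)) \<and>
     (\<forall>j x. avg j (\<lambda>y. \<bar>a y - avg j a y\<bar> * \<bar>f y\<bar>) x \<le> CH * B * avg j (\<lambda>y. \<bar>f y\<bar> powr r) x powr (1/r))"
    using BMO_mult[OF r(1), where 'n='n] by blast
  have JN: "\<exists>C>0. \<forall>(a::real^'n \<Rightarrow> real) B. osc_le a B \<longrightarrow> B > 0 \<longrightarrow>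
     (\<forall>k. loc_int (\<lambda>y. \<bar>a y - avg k a y\<bar> powr e)) \<and> (\<forall>k x. avg k (\<lambda>y. \<bar>a y - avg k a y\<bar> powr e) x \<le> (C * B) powr e)" if "e > 1" for e
    using John_Nirenberg[of e, where 'n='n] that by fastforce
  obtain Ct where Ct: "Ct > 0" "\<And>(a::real^'n \<Rightarrow> real) B. osc_le a B \<Longrightarrow> B > 0 \<Longrightarrow>
     (\<forall>k. loc_int (\<lambda>y. \<bar>a y - avg k a y\<bar> powr t)) \<and> (\<forall>k x. avg k (\<lambda>y. \<bar>a y - avg k a y\<bar> powr t) x \<le> (Ct * B) powr t)"
    using JN[OF q(2)] by blast
  obtain Cm where Cm: "Cm > 0" "\<And>(a::real^'n \<Rightarrow> real) B. osc_le a B \<Longrightarrow> B > 0 \<Longrightarrow>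
     (\<forall>k. loc_int (\<lambda>y. \<bar>a y - avg k a y\<bar> powr \<mu>)) \<and> (\<forall>k x. avg k (\<lambda>y. \<bar>a y - avg k a y\<bar> powr \<mu>) x \<le> (Cm * B) powr \<mu>)"
    using JN[OF \<mu>] by blast
  \<comment> \<open>The 4 pays for splitting the power of a sum and for merging the two resulting
    bounds, a factor 2 each; \<open>2 ^ CARD('n)\<close> covers the drift of the averages in the
    growth condition.\<close>
  define K where "K = 4 * (Ct + Cm + CH + 2 ^ CARD('n))"
  have K: "K > 0" using Ct Cm CH by (simp add: K_def add_pos_pos)
  show ?thesis
  proof (intro exI[of _ "C * K"] conjI allI impI)
    show "C * K > 0" using C K by simp
    fix a f :: "real^'n \<Rightarrow> real" and B N and J :: "int set"
    assume a: "osc_le a B" and B: "B > 0" and f: "mbd p q f N" and N: "N > 0" and J: "finite J"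
    have la: "loc_int a" using a by (simp add: osc_le_def)
    have am: "a \<in> borel_measurable borel" using la by (rule loc_int_measurable)
    note fm = mbdD(1)[OF f]
    have fr: "loc_int (\<lambda>y. \<bar>f y\<bar> powr r)" using mbd_loc_int_powr[OF f] r by simp
    have lf: "loc_int f" using mbd_loc_int[OF f] q by simp
    define U where "U = K * B"
    have U: "U > 0" using K B by (simp add: U_def)
    \<comment> \<open>The oscillation comes from the first term of the identity, the constant
      \<open>CH * B\<close> from the average in the second.\<close>
    define u where "u j y = \<bar>a y - avg j a y\<bar> + CH * B" for j y
    have e_bound: "loc_int (\<lambda>y. u j y powr e) \<and> avg j (\<lambda>y. u j y powr e) x \<le> U powr e"
      if e: "e > 1" and li: "\<forall>k. loc_int (\<lambda>y. \<bar>a y - avg k a y\<bar> powr e)"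
        and bd: "\<forall>k x. avg k (\<lambda>y. \<bar>a y - avg k a y\<bar> powr e) x \<le> (c * B) powr e" and c: "0 < c" "4 * (c + CH) \<le> K" for e c j x
    proof -
      let ?H = "\<lambda>y. 2 powr e * (\<bar>a y - avg j a y\<bar> powr e + (CH * B) powr e)"
      have liH: "loc_int ?H" by (intro loc_int_cmult loc_int_add loc_int_const) (use li in blast)
      have pt: "u j y powr e \<le> ?H y" for y unfolding u_def using CH B e by (intro powr_add_le) auto
      have liu: "loc_int (\<lambda>y. u j y powr e)"
        by (rule loc_int_bound[OF liH]) (use pt am in \<open>auto simp: u_def\<close>)
      have "avg j (\<lambda>y. u j y powr e) x \<le> avg j ?H x" by (intro avg_mono_cell pt liu liH)
      also have "\<dots> = 2 powr e * (avg j (\<lambda>y. \<bar>a y - avg j a y\<bar> powr e) x + (CH * B) powr e)"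
        unfolding avg_cmult using avg_add[of "\<lambda>y. \<bar>a y - avg j a y\<bar> powr e" "\<lambda>_. (CH * B) powr e" j x] li by simp
      also have "\<dots> \<le> 2 powr e * ((c * B) powr e + (CH * B) powr e)"
        using bd by (intro mult_left_mono add_mono) auto
      also have "\<dots> \<le> 2 powr e * (2 powr e * ((c + CH) * B) powr e)"
      proof (rule mult_left_mono)
        have "(c * B) powr e \<le> ((c + CH) * B) powr e" "(CH * B) powr e \<le> ((c + CH) * B) powr e"
          using c CH B e by (auto intro!: powr_mono2 mult_right_mono)
        moreover have "2 \<le> 2 powr e" using powr_mono[of 1 e 2] e by simp
        then have "2 * ((c + CH) * B) powr e \<le> 2 powr e * ((c + CH) * B) powr e" by (intro mult_right_mono) auto
        ultimately show "(c * B) powr e + (CH * B) powr e \<le> 2 powr e * ((c + CH) * B) powr e" by linarith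
      qed simp
      also have "\<dots> = (4 * (c + CH) * B) powr e"
      proof -
        have eq: "4 * (c + CH) * B = 2 * (2 * ((c + CH) * B))" by simp
        show ?thesis unfolding eq by (simp only: powr_mult)
      qed
      also have "\<dots> \<le> U powr e" unfolding U_def using c CH B e by (intro powr_mono2 mult_right_mono) auto
      finally show ?thesis using liu by simp
    qed
    let ?F = "\<lambda>y. \<Sum>j\<in>J. 2 powr (- \<alpha> * real_of_int j) * (avg j (\<lambda>z. \<bar>f z\<bar> powr r) y) powr (1/r) * u j y"
    have H: "\<forall>j. u j \<in> borel_measurable borel \<and> (\<forall>y. 0 \<le> u j y) \<and> loc_int (\<lambda>y. u j y powr t) \<and> loc_int (\<lambda>y. u j y powr \<mu>) \<and>
        (\<forall>y. avg j (\<lambda>y. u j y powr t) y \<le> U powr t) \<and> (\<forall>y. avg j (\<lambda>y. u j y powr \<mu>) y \<le> U powr \<mu>) \<and>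
        (\<forall>i y. j \<le> i \<longrightarrow> u j y \<le> u i y + U * real_of_int (i - j))"
    proof (intro allI conjI impI)
      fix j
      show "u j \<in> borel_measurable borel" unfolding u_def[abs_def] using am by measurable
      show "0 \<le> u j y" for y using CH B by (simp add: u_def)
      have Kt: "4 * (Ct + CH) \<le> K" "4 * (Cm + CH) \<le> K" "2 ^ CARD('n) \<le> K" using Ct Cm CH by (auto simp: K_def)
      show "loc_int (\<lambda>y. u j y powr t)" "avg j (\<lambda>y. u j y powr t) y \<le> U powr t" for y
        using e_bound[OF q(2), of Ct] Ct(2)[OF a B] Ct(1) Kt by blast+
      show "loc_int (\<lambda>y. u j y powr \<mu>)" "avg j (\<lambda>y. u j y powr \<mu>) y \<le> U powr \<mu>" for y
        using e_bound[OF \<mu>, of Cm] Cm(2)[OF a B] Cm(1) Kt by blast+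
      fix i y assume ji: "j \<le> i"
      have "\<bar>avg i a y - avg j a y\<bar> \<le> 2 ^ CARD('n) * B * real_of_int (i - j)" by (rule osc_int_steps[OF a ji])
      also have "\<dots> \<le> U * real_of_int (i - j)" unfolding U_def using Kt B ji by (intro mult_right_mono) auto
      finally show "u j y \<le> u i y + U * real_of_int (i - j)" unfolding u_def by linarith
    qed
    note F = C(2)[OF f N U J H]
    show "mbd s t (scale_comm \<alpha> a J f) (C * K * B * N)"
    proof (rule mbd_dominated)
      show "scale_comm \<alpha> a J f \<in> borel_measurable borel" unfolding scale_comm_def[abs_def] using am fm by measurable
      show "loc_int (\<lambda>y. ?F y powr t)" using F by blast
      show "avg k (\<lambda>y. ?F y powr t) x \<le> (C * K * B * N * 2 powr (real_of_int k * real CARD('n) / s)) powr t" for k x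
        using F[of k x] by (simp add: U_def mult.assoc)
      show "t > 0" using q by simp
      fix y
      let ?D = "\<lambda>j. avg j (\<lambda>z. \<bar>f z\<bar> powr r) y powr (1/r)"
      note bm = CH(2)[OF a B fm fr]
      have trm: "\<bar>a y * avg j f y - avg j (\<lambda>z. a z * f z) y\<bar> \<le> ?D j * u j y" for j
      proof -
        have af: "loc_int (\<lambda>z. a z * f z)" using bm by blast
        have lf2: "loc_int (\<lambda>z. avg j a z * f z)" by (rule loc_int_lev_mult[OF lev_avg lf])
        have "avg j (\<lambda>z. (a z - avg j a z) * f z) y = avg j (\<lambda>z. a z * f z - avg j a z * f z) y" by (simp add: left_diff_distrib)
        also have "\<dots> = avg j (\<lambda>z. a z * f z) y - avg j a y * avg j f y"
          unfolding avg_diff[OF af lf2] by (simp add: avg_lev_mult[OF lev_avg])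
        finally have eq: "a y * avg j f y - avg j (\<lambda>z. a z * f z) y = (a y - avg j a y) * avg j f y - avg j (\<lambda>z. (a z - avg j a z) * f z) y"
          by (simp add: algebra_simps)
        have li: "loc_int (\<lambda>z. (a z - avg j a z) * f z)"
          using loc_int_diff[OF af lf2] by (simp add: left_diff_distrib)
        have 1: "\<bar>avg j f y\<bar> \<le> ?D j"
          using avg_abs_le[OF lf, of j y] avg_abs_le_avg_powr[OF fr fm r(1), of j y] by linarith
        have "\<bar>avg j (\<lambda>z. (a z - avg j a z) * f z) y\<bar> \<le> avg j (\<lambda>z. \<bar>a z - avg j a z\<bar> * \<bar>f z\<bar>) y"
          using avg_abs_le[OF li, of j y] by (simp add: abs_mult)
        also have "\<dots> \<le> CH * B * ?D j" using bm by blast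
        finally have 2: "\<bar>avg j (\<lambda>z. (a z - avg j a z) * f z) y\<bar> \<le> CH * B * ?D j" .
        have 3: "\<bar>(a y - avg j a y) * avg j f y\<bar> \<le> \<bar>a y - avg j a y\<bar> * ?D j"
          unfolding abs_mult using 1 by (intro mult_left_mono) auto
        have 4: "?D j * u j y = \<bar>a y - avg j a y\<bar> * ?D j + CH * B * ?D j" by (simp add: u_def algebra_simps)
        show ?thesis unfolding eq 4 using 2 3 by linarith
      qed
      have "\<bar>scale_comm \<alpha> a J f y\<bar> \<le> (\<Sum>j\<in>J. \<bar>2 powr (- \<alpha> * real_of_int j) * (a y * avg j f y - avg j (\<lambda>z. a z * f z) y)\<bar>)"
        unfolding scale_comm_def by (rule sum_abs)
      also have "\<dots> \<le> ?F y"
      proof (rule sum_mono)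
        fix j
        have "\<bar>2 powr (- \<alpha> * real_of_int j) * (a y * avg j f y - avg j (\<lambda>z. a z * f z) y)\<bar> = 2 powr (- \<alpha> * real_of_int j) * \<bar>a y * avg j f y - avg j (\<lambda>z. a z * f z) y\<bar>"
          by (simp add: abs_mult)
        also have "\<dots> \<le> 2 powr (- \<alpha> * real_of_int j) * (?D j * u j y)" by (intro mult_left_mono trm) simp
        finally show "\<bar>2 powr (- \<alpha> * real_of_int j) * (a y * avg j f y - avg j (\<lambda>z. a z * f z) y)\<bar> \<le> 2 powr (- \<alpha> * real_of_int j) * ?D j * u j y"
          by (simp only: mult.assoc)
      qed
      finally show "\<bar>scale_comm \<alpha> a J f y\<bar> \<le> ?F y" .
    qed
  qed
qed

section \<open>Series of locally integrable functions\<close>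

text \<open>Tonelli on the unit cells, which are countably many.\<close>

lemma AE_summable:
  fixes g :: "nat \<Rightarrow> real^'n::finite \<Rightarrow> real"
  assumes g: "\<And>i. loc_int (g i)" and s: "\<And>x. summable (\<lambda>i. avg 0 (\<lambda>y. \<bar>g i y\<bar>) x)"
  shows "AE y in lborel. summable (\<lambda>i. \<bar>g i y\<bar>)"
proof (rule AE_cells[of 0])
  fix x :: "real^'n"
  have gm [measurable]: "g i \<in> borel_measurable borel" for i using g loc_int_measurable by blast
  have "(\<integral>\<^sup>+ y. (\<Sum>i. ennreal \<bar>g i y\<bar> * indicator (cell 0 x) y) \<partial>lborel) = (\<Sum>i. \<integral>\<^sup>+ y\<in>cell 0 x. ennreal \<bar>g i y\<bar> \<partial>lborel)"
    by (rule nn_integral_suminf) measurable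
  also have "\<dots> = (\<Sum>i. ennreal (avg 0 (\<lambda>y. \<bar>g i y\<bar>) x))"
    by (subst nn_avg[OF loc_int_cell[OF loc_int_abs[OF g]]]) auto
  also have "\<dots> = ennreal (\<Sum>i. avg 0 (\<lambda>y. \<bar>g i y\<bar>) x)"
    using s by (intro suminf_ennreal2) (auto intro: avg_nonneg)
  finally have "(\<integral>\<^sup>+ y. (\<Sum>i. ennreal \<bar>g i y\<bar> * indicator (cell 0 x) y) \<partial>lborel) \<noteq> \<infinity>" by simp
  then have "AE y in lborel. (\<Sum>i. ennreal \<bar>g i y\<bar> * indicator (cell 0 x) y) \<noteq> \<infinity>"
    by (rule nn_integral_noteq_infinite[rotated]) measurable
  then show "AE y in lborel. y \<in> cell 0 x \<longrightarrow> summable (\<lambda>i. \<bar>g i y\<bar>)"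
  proof eventually_elim
    case (elim y)
    show ?case
    proof
      assume "y \<in> cell 0 x"
      then have "(\<Sum>i. ennreal \<bar>g i y\<bar>) \<noteq> top" using elim by simp
      then show "summable (\<lambda>i. \<bar>g i y\<bar>)" by (intro summable_suminf_not_top) auto
    qed
  qed
qed

text \<open>On each cell the error of a partial sum is dominated by the tail of the summable means,
  by Fatou over the longer partial sums. Convergence almost everywhere and in mean come from the
  same hypothesis.\<close>

lemma series_L1:
  fixes g :: "nat \<Rightarrow> real^'n::finite \<Rightarrow> real"
  assumes g: "\<And>i. loc_int (g i)" and s: "\<And>k x. summable (\<lambda>i. avg k (\<lambda>y. \<bar>g i y\<bar>) x)"
  shows "loc_int (\<lambda>y. \<Sum>i. g i y)" "AE y in lborel. (\<lambda>i. g i y) sums (\<Sum>i. g i y)"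
    "(\<lambda>m. avg k (\<lambda>y. \<bar>(\<Sum>i<m. g i y) - (\<Sum>i. g i y)\<bar>) x) \<longlonglongrightarrow> 0"
proof -
  let ?h = "\<lambda>y. \<Sum>i. g i y"
  have gm [measurable]: "g i \<in> borel_measurable borel" for i using g loc_int_measurable by blast
  have hm [measurable]: "?h \<in> borel_measurable borel" by measurable
  show ae: "AE y in lborel. (\<lambda>i. g i y) sums ?h y"
    using AE_summable[OF g s] by eventually_elim (auto intro: summable_sums summable_rabs_cancel)
  define tail where "tail k x m = (\<Sum>i. avg k (\<lambda>y. \<bar>g (i + m) y\<bar>) x)" for k x m
  have tail_lim: "tail k x \<longlonglongrightarrow> 0" for k x
    unfolding tail_def[abs_def] using suminf_exist_split2[OF s] by simp
  have tail0: "0 \<le> tail k x m" for k x m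
    unfolding tail_def by (intro suminf_nonneg avg_nonneg) (auto intro!: summable_ignore_initial_segment[OF s])
  have lis: "loc_int (\<lambda>y. \<Sum>i<m. g i y)" for m using g by blast
  have *: "set_integrable lborel (cell k x) (\<lambda>y. \<bar>(\<Sum>i<m. g i y) - ?h y\<bar>) \<and> avg k (\<lambda>y. \<bar>(\<Sum>i<m. g i y) - ?h y\<bar>) x \<le> tail k x m" for k x m
  proof -
    define G where "G l y = \<bar>(\<Sum>i<m. g i y) - (\<Sum>i<l+m. g i y)\<bar>" for l y
    have liG: "loc_int (G l)" for l unfolding G_def by (intro loc_int_abs loc_int_diff lis)
    have bd: "avg k (G l) x \<le> tail k x m" for l
    proof -
      have pt: "G l y \<le> (\<Sum>i<l. \<bar>g (i + m) y\<bar>)" for y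
      proof -
        have "(\<Sum>i<l+m. g i y) = (\<Sum>i<m. g i y) + (\<Sum>i<l. g (i + m) y)"
          by (induction l) auto
        then show ?thesis unfolding G_def by (simp add: sum_abs)
      qed
      have "avg k (G l) x \<le> avg k (\<lambda>y. \<Sum>i<l. \<bar>g (i + m) y\<bar>) x" by (intro avg_mono_cell pt liG loc_int_sum loc_int_abs g)
      also have "\<dots> = (\<Sum>i<l. avg k (\<lambda>y. \<bar>g (i + m) y\<bar>) x)" by (intro avg_sum loc_int_abs g)
      also have "\<dots> \<le> tail k x m" unfolding tail_def
        by (intro sum_le_suminf summable_ignore_initial_segment[OF s] avg_nonneg) auto
      finally show ?thesis .
    qed
    have "AE y in lborel. y \<in> cell k x \<longrightarrow> (\<lambda>l. G l y) \<longlonglongrightarrow> \<bar>(\<Sum>i<m. g i y) - ?h y\<bar>"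
      using ae
    proof eventually_elim
      case (elim y)
      then have "(\<lambda>l. \<Sum>i<l+m. g i y) \<longlonglongrightarrow> ?h y" unfolding sums_def by (rule LIMSEQ_ignore_initial_segment)
      then show ?case unfolding G_def by (intro impI tendsto_intros)
    qed
    then show ?thesis
      using avg_fatou[where G=G and k=k and x=x and C="tail k x m" and g="\<lambda>y. \<bar>(\<Sum>i<m. g i y) - ?h y\<bar>"] liG bd tail0 by (simp add: G_def)
  qed
  have "set_integrable lborel (cell 0 x) ?h" for x
  proof -
    have "set_integrable lborel (cell 0 x) (\<lambda>y. \<bar>?h y\<bar>)" using conjunct1[OF *[of 0 x 0]] by simp
    then show ?thesis by (rule set_integrable_bound) (simp_all add: set_borel_measurable_def)
  qed
  then show "loc_int ?h" by (intro loc_intI_level[of _ 0] hm)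
  show "(\<lambda>m. avg k (\<lambda>y. \<bar>(\<Sum>i<m. g i y) - ?h y\<bar>) x) \<longlonglongrightarrow> 0"
  proof (rule tendsto_sandwich[OF _ _ tendsto_const tail_lim[of k x]])
    show "\<forall>\<^sub>F m in sequentially. 0 \<le> avg k (\<lambda>y. \<bar>(\<Sum>i<m. g i y) - ?h y\<bar>) x"
      by (intro always_eventually allI avg_nonneg abs_ge_zero)
    show "\<forall>\<^sub>F m in sequentially. avg k (\<lambda>y. \<bar>(\<Sum>i<m. g i y) - ?h y\<bar>) x \<le> tail k x m"
      using * by (intro always_eventually allI) blast
  qed
qed

section \<open>Local convergence\<close>

lemma cell_compactE:
  obtains K where "compact K" "cell j (x::real^'n::finite) \<subseteq> K"
  using that[OF compact_closure[THEN iffD2, OF bounded_cell] closure_subset] by blast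

lemma Lloc_iff: "f \<in> Lloc r \<longleftrightarrow> f \<in> borel_measurable borel \<and> loc_int (\<lambda>y. \<bar>f y\<bar> powr r)"
  for f :: "real^'n::finite \<Rightarrow> real"
proof
  assume f: "f \<in> Lloc r"
  then have m: "f \<in> borel_measurable borel" by (simp add: Lloc_def)
  have "loc_int (\<lambda>y. \<bar>f y\<bar> powr r)" unfolding loc_int_def
  proof (intro conjI allI)
    fix j and x :: "real^'n"
    obtain K where "compact K" "cell j x \<subseteq> K" by (rule cell_compactE[of j x])
    then have "set_integrable lborel K (\<lambda>y. \<bar>f y\<bar> powr r)" using f by (simp add: Lloc_def)
    then show "set_integrable lborel (cell j x) (\<lambda>y. \<bar>f y\<bar> powr r)"
      by (rule set_integrable_subset) (use \<open>cell j x \<subseteq> K\<close> in simp_all)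
  qed (use m in measurable)
  then show "f \<in> borel_measurable borel \<and> loc_int (\<lambda>y. \<bar>f y\<bar> powr r)" using m by simp
next
  assume f: "f \<in> borel_measurable borel \<and> loc_int (\<lambda>y. \<bar>f y\<bar> powr r)"
  have "set_integrable lborel K (\<lambda>y. \<bar>f y\<bar> powr r)" if K: "compact K" for K
  proof -
    have "K \<subseteq> (\<Union>m\<in>idx 0 ` K. dcube 0 m)" by (auto simp: mem_dcube)
    moreover have "set_integrable lborel (\<Union>m\<in>idx 0 ` K. dcube 0 m) (\<lambda>y. \<bar>f y\<bar> powr r)"
      using f K by (intro set_integrable_UN finite_idx_image compact_imp_bounded loc_int_dcube) auto
    moreover have "K \<in> sets lborel" using K by (simp add: borel_compact)
    ultimately show ?thesis by (intro set_integrable_subset[of lborel _ _ K])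
  qed
  then show "f \<in> Lloc r" using f by (simp add: Lloc_def)
qed

text \<open>A compact set meets finitely many unit cells, so convergence on the cells of level 0 is
  enough.\<close>

lemma Lloc_convI:
  fixes g :: "real^'n::finite \<Rightarrow> real"
  assumes g: "g \<in> borel_measurable borel" "loc_int (\<lambda>y. \<bar>g y\<bar> powr r)" and S: "\<And>M. S M \<in> borel_measurable borel"
    and li: "\<And>M. loc_int (\<lambda>y. \<bar>S M y - g y\<bar> powr r)" and lim: "\<And>x. (\<lambda>M. avg 0 (\<lambda>y. \<bar>S M y - g y\<bar> powr r) x) \<longlonglongrightarrow> 0"
  shows "Lloc_conv r S g"
  unfolding Lloc_conv_def
proof (intro conjI allI impI)
  show "g \<in> Lloc r" using g by (simp add: Lloc_iff)
  show "S M \<in> borel_measurable lborel" for M using S by simp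
  fix K :: "(real^'n) set" assume K: "compact K"
  have fin: "finite (idx 0 ` K)" using K by (intro finite_idx_image compact_imp_bounded)
  have cl: "(\<lambda>M. \<integral>\<^sup>+ y\<in>dcube 0 m. ennreal (\<bar>S M y - g y\<bar> powr r) \<partial>lborel) \<longlonglongrightarrow> 0" for m
  proof -
    obtain x where x: "dcube 0 m = cell 0 x" using dcube_cellE by blast
    have "(\<lambda>M. ennreal (avg 0 (\<lambda>y. \<bar>S M y - g y\<bar> powr r) x)) \<longlonglongrightarrow> ennreal 0" by (intro tendsto_ennrealI lim)
    then show ?thesis unfolding x by (subst nn_avg[OF loc_int_cell[OF li]]) auto
  qed
  have "(\<lambda>M. \<Sum>m\<in>idx 0 ` K. \<integral>\<^sup>+ y\<in>dcube 0 m. ennreal (\<bar>S M y - g y\<bar> powr r) \<partial>lborel) \<longlonglongrightarrow> (\<Sum>m\<in>idx 0 ` K. 0)"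
    by (intro tendsto_sum cl)
  then have lim2: "(\<lambda>M. \<Sum>m\<in>idx 0 ` K. \<integral>\<^sup>+ y\<in>dcube 0 m. ennreal (\<bar>S M y - g y\<bar> powr r) \<partial>lborel) \<longlonglongrightarrow> 0" by simp
  show "(\<lambda>M. \<integral>\<^sup>+ y\<in>K. ennreal (\<bar>S M y - g y\<bar> powr r) \<partial>lborel) \<longlonglongrightarrow> 0"
  proof (rule tendsto_sandwich[OF _ _ tendsto_const lim2])
    show "\<forall>\<^sub>F M in sequentially. (\<integral>\<^sup>+ y\<in>K. ennreal (\<bar>S M y - g y\<bar> powr r) \<partial>lborel)
       \<le> (\<Sum>m\<in>idx 0 ` K. \<integral>\<^sup>+ y\<in>dcube 0 m. ennreal (\<bar>S M y - g y\<bar> powr r) \<partial>lborel)"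
    proof (intro always_eventually allI)
      fix M
      have [measurable]: "S M \<in> borel_measurable borel" "g \<in> borel_measurable borel" using S g by auto
      have "(\<integral>\<^sup>+ y\<in>K. ennreal (\<bar>S M y - g y\<bar> powr r) \<partial>lborel) \<le> (\<integral>\<^sup>+ y. (\<Sum>m\<in>idx 0 ` K. ennreal (\<bar>S M y - g y\<bar> powr r) * indicator (dcube 0 m) y) \<partial>lborel)"
      proof (rule nn_integral_mono)
        fix y
        show "ennreal (\<bar>S M y - g y\<bar> powr r) * indicator K y \<le> (\<Sum>m\<in>idx 0 ` K. ennreal (\<bar>S M y - g y\<bar> powr r) * indicator (dcube 0 m) y)"
        proof (cases "y \<in> K")
          case True
          have "ennreal (\<bar>S M y - g y\<bar> powr r) * indicator K y = ennreal (\<bar>S M y - g y\<bar> powr r) * indicator (dcube 0 (idx 0 y)) y"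
            using True by (simp add: mem_dcube)
          also have "\<dots> \<le> (\<Sum>m\<in>idx 0 ` K. ennreal (\<bar>S M y - g y\<bar> powr r) * indicator (dcube 0 m) y)"
            using True fin by (intro member_le_sum[where f="\<lambda>m. ennreal (\<bar>S M y - g y\<bar> powr r) * indicator (dcube 0 m) y"]) auto
          finally show ?thesis .
        qed simp
      qed
      also have "\<dots> = (\<Sum>m\<in>idx 0 ` K. \<integral>\<^sup>+ y\<in>dcube 0 m. ennreal (\<bar>S M y - g y\<bar> powr r) \<partial>lborel)"
        by (rule nn_integral_sum) measurable
      finally show "(\<integral>\<^sup>+ y\<in>K. ennreal (\<bar>S M y - g y\<bar> powr r) \<partial>lborel) \<le> (\<Sum>m\<in>idx 0 ` K. \<integral>\<^sup>+ y\<in>dcube 0 m. ennreal (\<bar>S M y - g y\<bar> powr r) \<partial>lborel)" .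
    qed
  qed simp
qed

text \<open>\<open>Lloc_lim\<close> selects an unspecified limit; uniqueness up to null sets is all
  that can be known about it.\<close>

lemma Lloc_conv_unique:
  fixes g g' :: "real^'n::finite \<Rightarrow> real"
  assumes c: "Lloc_conv r S g" "Lloc_conv r S g'" and r: "r > 0"
  shows "AE y in lborel. g y = g' y"
proof (rule AE_cells[of 0])
  fix x :: "real^'n"
  obtain K where K: "compact K" "cell 0 x \<subseteq> K" by (rule cell_compactE[of 0 x])
  have [measurable]: "g \<in> borel_measurable borel" "g' \<in> borel_measurable borel" "\<And>M. S M \<in> borel_measurable borel" "K \<in> sets borel"
    using c K by (auto simp: Lloc_conv_def Lloc_def borel_compact)
  let ?I = "\<lambda>h M. \<integral>\<^sup>+ y\<in>K. ennreal (\<bar>S M y - h y\<bar> powr r) \<partial>lborel"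
  have le: "(\<integral>\<^sup>+ y\<in>K. ennreal (\<bar>g y - g' y\<bar> powr r) \<partial>lborel) \<le> ennreal (2 powr r) * (?I g M + ?I g' M)" for M
  proof -
    have "(\<integral>\<^sup>+ y\<in>K. ennreal (\<bar>g y - g' y\<bar> powr r) \<partial>lborel)
       \<le> (\<integral>\<^sup>+ y. ennreal (2 powr r) * (ennreal (\<bar>S M y - g y\<bar> powr r) * indicator K y + ennreal (\<bar>S M y - g' y\<bar> powr r) * indicator K y) \<partial>lborel)"
    proof (rule nn_integral_mono)
      fix y
      have "\<bar>g y - g' y\<bar> powr r \<le> (\<bar>S M y - g y\<bar> + \<bar>S M y - g' y\<bar>) powr r" using r by (intro powr_mono2) auto
      also have "\<dots> \<le> 2 powr r * (\<bar>S M y - g y\<bar> powr r + \<bar>S M y - g' y\<bar> powr r)" using r by (intro powr_add_le) auto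
      finally have "ennreal (\<bar>g y - g' y\<bar> powr r) \<le> ennreal (2 powr r) * (ennreal (\<bar>S M y - g y\<bar> powr r) + ennreal (\<bar>S M y - g' y\<bar> powr r))"
        by (simp add: ennreal_mult[symmetric] ennreal_plus[symmetric] del: ennreal_plus)
      then show "ennreal (\<bar>g y - g' y\<bar> powr r) * indicator K y \<le> ennreal (2 powr r) * (ennreal (\<bar>S M y - g y\<bar> powr r) * indicator K y + ennreal (\<bar>S M y - g' y\<bar> powr r) * indicator K y)"
        by (auto simp: indicator_def)
    qed
    also have "\<dots> = ennreal (2 powr r) * (?I g M + ?I g' M)"
      by (subst nn_integral_cmult, measurable, subst nn_integral_add, measurable)
    finally show ?thesis .
  qed
  have "(\<lambda>M. ennreal (2 powr r) * (?I g M + ?I g' M)) \<longlonglongrightarrow> ennreal (2 powr r) * (0 + 0)"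
    using c K by (intro ennreal_tendsto_cmult tendsto_add) (auto simp: Lloc_conv_def)
  then have "(\<integral>\<^sup>+ y\<in>K. ennreal (\<bar>g y - g' y\<bar> powr r) \<partial>lborel) \<le> 0"
    using le by (intro LIMSEQ_le_const) auto
  then have "(\<integral>\<^sup>+ y\<in>K. ennreal (\<bar>g y - g' y\<bar> powr r) \<partial>lborel) = 0" by simp
  then have "AE y in lborel. ennreal (\<bar>g y - g' y\<bar> powr r) * indicator K y = 0"
    by (subst (asm) nn_integral_0_iff_AE) auto
  then show "AE y in lborel. y \<in> cell 0 x \<longrightarrow> g y = g' y"
    by eventually_elim (use K r in \<open>auto simp: indicator_def split: if_splits\<close>)
qed

lemma Lloc_lim_eq:
  fixes g :: "real^'n::finite \<Rightarrow> real"
  assumes "Lloc_conv r S g" "r > 0"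
  shows "AE y in lborel. Lloc_lim r S y = g y" "Lloc_lim r S \<in> borel_measurable borel"
proof -
  have "Lloc_conv r S (Lloc_lim r S)" unfolding Lloc_lim_def using assms(1) someI[of "Lloc_conv r S" g] by auto
  then show "AE y in lborel. Lloc_lim r S y = g y" "Lloc_lim r S \<in> borel_measurable borel"
    using Lloc_conv_unique[OF _ assms] by (auto simp: Lloc_conv_def Lloc_def)
qed

section \<open>Haar expansions\<close>

lemma idx_half: "idx j x $ i = idx (j + 1) x $ i div 2"
proof -
  have "x$i * 2 powr real_of_int j = (x$i * 2 powr real_of_int (j + 1)) / real_of_int 2"
    by (simp add: powr_add)
  then show ?thesis unfolding idx_def vec_lambda_beta by (simp only: floor_divide_real_eq_div)
qed

text \<open>The one-dimensional Haar function only sees which half of the interval contains the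
  point, that is, the coordinate of the index one level finer: 2l for the left half and 2l + 1 for
  the right one.\<close>

lemma haar1_idx:
  "haar1 e (2 powr real_of_int j * x$i - real_of_int l) =
     (if idx (j + 1) x $ i = 2 * l then 1 else if idx (j + 1) x $ i = 2 * l + 1 then (if e then -1 else 1) else 0)"
proof -
  define X where "X = 2 powr real_of_int j * x$i"
  have X: "idx (j + 1) x $ i = \<lfloor>2 * X\<rfloor>" by (simp add: idx_def X_def powr_add mult_ac)
  have "\<lfloor>2 * X\<rfloor> = 2 * l \<longleftrightarrow> 0 \<le> 2 * (X - real_of_int l) \<and> 2 * (X - real_of_int l) < 1"
    by (simp add: floor_eq_iff) linarith
  moreover have "\<lfloor>2 * X\<rfloor> = 2 * l + 1 \<longleftrightarrow> 1 \<le> 2 * (X - real_of_int l) \<and> 2 * (X - real_of_int l) < 2"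
    by (simp add: floor_eq_iff) linarith
  ultimately show ?thesis unfolding X X_def[symmetric] haar1_def by (auto simp: indicator_def)
qed

lemma haar_idx:
  fixes x :: "real^'n::finite"
  shows "haar e j m x = 2 powr (real_of_int j * real CARD('n) / 2) *
     (\<Prod>i\<in>UNIV. if idx (j + 1) x $ i = 2 * (m$i) then 1 else if idx (j + 1) x $ i = 2 * (m$i) + 1 then (if e i then -1 else 1) else 0)"
  by (simp add: haar_def haar1_idx)

lemma lev_haar: "lev (j + 1) (haar e j m)"
  unfolding lev_def by (intro allI impI) (simp only: haar_idx)

lemma haar_eq_0: "idx j x \<noteq> m \<Longrightarrow> haar e j m x = 0"
proof -
  assume "idx j x \<noteq> m"
  then obtain i where i: "idx (j + 1) x $ i div 2 \<noteq> m $ i" unfolding vec_eq_iff idx_half[of j x] by blast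
  define P where "P i = (if idx (j + 1) x $ i = 2 * (m$i) then 1 else if idx (j + 1) x $ i = 2 * (m$i) + 1 then (if e i then -1 else 1) else (0::real))" for i
  have "P i = 0" using i by (auto simp: P_def)
  then have "prod P UNIV = 0" by (intro prod_zero finite) blast
  then show ?thesis unfolding haar_idx P_def[abs_def] by simp
qed

lemma prod_if_const: "finite I \<Longrightarrow> (\<Prod>i\<in>I. if P i then c else (0::real)) = (if \<forall>i\<in>I. P i then c ^ card I else 0)"
  by (induction I rule: finite_induct) auto

text \<open>Over all sign patterns e the sum factorises into two-term sums, one per coordinate, each
  being 2 or 0 according as x and y share the half interval. This gives the kernel of E_{j+1} on the
  cube; the excluded pattern \<open>\<lambda>_. False\<close> gives that of E_j.\<close>

lemma haar_kernel:
  fixes x y :: "real^'n::finite"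
  shows "(\<Sum>e\<in>haar_E. haar e j m y * haar e j m x) =
    (if idx j x = m \<and> idx (j+1) y = idx (j+1) x then 2 powr (real_of_int (j+1) * real CARD('n)) else 0)
    - (if idx j x = m \<and> idx j y = m then 2 powr (real_of_int j * real CARD('n)) else 0)"
proof -
  define s where "s e z i = (if idx (j + 1) z $ i = 2 * (m$i) then 1 else if idx (j + 1) z $ i = 2 * (m$i) + 1 then (if e then -1 else 1) else (0::real))"
    for e :: bool and z :: "real^'n" and i
  let ?c = "2 powr (real_of_int j * real CARD('n))"
  have hh: "haar e j m y * haar e j m x = ?c * (\<Prod>i\<in>UNIV. s (e i) y i * s (e i) x i)" for e
  proof -
    have "2 powr (real_of_int j * real CARD('n) / 2) * 2 powr (real_of_int j * real CARD('n) / 2) = ?c"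
      by (simp add: powr_add[symmetric])
    then show ?thesis unfolding haar_idx s_def[symmetric] by (simp add: prod.distrib mult_ac)
  qed
  have all: "(\<Sum>e\<in>UNIV. haar e j m y * haar e j m x) = (if idx j x = m \<and> idx (j+1) y = idx (j+1) x then 2 powr (real_of_int (j+1) * real CARD('n)) else 0)"
  proof -
    have "(\<Sum>e\<in>UNIV. haar e j m y * haar e j m x) = ?c * (\<Sum>e\<in>PiE UNIV (\<lambda>_. UNIV). \<Prod>i\<in>UNIV. s (e i) y i * s (e i) x i)"
      unfolding hh by (simp add: sum_distrib_left)
    also have "(\<Sum>e\<in>PiE UNIV (\<lambda>_. UNIV). \<Prod>i\<in>UNIV. s (e i) y i * s (e i) x i) = (\<Prod>i\<in>UNIV. \<Sum>b\<in>UNIV. s b y i * s b x i)"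
      by (rule prod_sum_PiE[symmetric]) auto
    also have "\<dots> = (\<Prod>i\<in>UNIV. if idx (j+1) y $ i = idx (j+1) x $ i \<and> idx (j+1) x $ i div 2 = m $ i then 2 else 0)"
    proof (rule prod.cong[OF refl])
      fix i
      have "idx (j+1) x $ i div 2 = m $ i \<longleftrightarrow> idx (j+1) x $ i = 2 * (m$i) \<or> idx (j+1) x $ i = 2 * (m$i) + 1" by presburger
      then show "(\<Sum>b\<in>UNIV. s b y i * s b x i) = (if idx (j+1) y $ i = idx (j+1) x $ i \<and> idx (j+1) x $ i div 2 = m $ i then 2 else 0)"
        unfolding UNIV_bool s_def by auto
    qed
    also have "\<dots> = (if idx j x = m \<and> idx (j+1) y = idx (j+1) x then 2 ^ CARD('n) else 0)"
      by (subst prod_if_const) (auto simp: vec_eq_iff idx_half[of j x])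
    finally show ?thesis by (simp add: powr_add powr_realpow distrib_right)
  qed
  have one: "haar (\<lambda>_. False) j m y * haar (\<lambda>_. False) j m x = (if idx j x = m \<and> idx j y = m then ?c else 0)"
  proof -
    have "(\<Prod>i\<in>UNIV. s False y i * s False x i) = (\<Prod>i\<in>UNIV. if idx (j+1) y $ i div 2 = m $ i \<and> idx (j+1) x $ i div 2 = m $ i then 1 else 0)"
    proof (rule prod.cong[OF refl])
      fix i
      have "a div 2 = m $ i \<longleftrightarrow> a = 2 * (m$i) \<or> a = 2 * (m$i) + 1" for a :: int by presburger
      then show "s False y i * s False x i = (if idx (j+1) y $ i div 2 = m $ i \<and> idx (j+1) x $ i div 2 = m $ i then 1 else 0)"
        unfolding s_def by auto
    qed
    also have "\<dots> = (if idx j x = m \<and> idx j y = m then 1 else 0)"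
      by (subst prod_if_const) (auto simp: vec_eq_iff idx_half[of j])
    finally show ?thesis unfolding hh by simp
  qed
  have "(\<Sum>e\<in>UNIV. haar e j m y * haar e j m x) = haar (\<lambda>_. False) j m y * haar (\<lambda>_. False) j m x + (\<Sum>e\<in>UNIV - {\<lambda>_. False}. haar e j m y * haar e j m x)"
    by (rule sum.remove) auto
  moreover have "UNIV - {\<lambda>_. False} = (haar_E :: ('n \<Rightarrow> bool) set)" by (auto simp: haar_E_def)
  ultimately show ?thesis using all one by simp
qed

lemma integrable_haar:
  fixes f :: "real^'n::finite \<Rightarrow> real"
  assumes "loc_int f" shows "integrable lborel (\<lambda>y. f y * haar e j m y)"
proof -
  have "set_integrable lborel (dcube j m) (\<lambda>y. haar e j m y * f y)"
    by (intro loc_int_dcube loc_int_lev_mult[OF lev_haar] assms)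
  moreover have eq: "(\<lambda>y. indicator (dcube j m) y *\<^sub>R (haar e j m y * f y)) = (\<lambda>y. f y * haar e j m y)"
  proof
    fix y
    show "indicator (dcube j m) y *\<^sub>R (haar e j m y * f y) = f y * haar e j m y"
      using haar_eq_0[of j y m e] by (cases "idx j y = m") (auto simp: mem_dcube)
  qed
  ultimately show ?thesis unfolding set_integrable_def eq by blast
qed

text \<open>Integration of f against \<open>haar_kernel\<close>: the Haar functions of level j
  project onto the martingale increment.\<close>

lemma haar_sum_pairing:
  fixes f :: "real^'n::finite \<Rightarrow> real"
  assumes f: "loc_int f"
  shows "(\<Sum>e\<in>haar_E. pairing f (haar e j (idx j x)) * haar e j (idx j x) x) = avg (j+1) f x - avg j f x"
proof -
  let ?m = "idx j x"
  have int: "integrable lborel (\<lambda>y. indicator (cell i x) y *\<^sub>R f y)" for i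
    using loc_int_cell[OF f] by (simp add: set_integrable_def)
  have "(\<Sum>e\<in>haar_E. pairing f (haar e j ?m) * haar e j ?m x) = (\<Sum>e\<in>haar_E. LINT y|lborel. f y * haar e j ?m y * haar e j ?m x)"
    by (simp add: pairing_def)
  also have "\<dots> = (LINT y|lborel. (\<Sum>e\<in>haar_E. f y * haar e j ?m y * haar e j ?m x))"
    by (intro Bochner_Integration.integral_sum[symmetric] integrable_mult_left integrable_haar f)
  also have "\<dots> = (LINT y|lborel. 2 powr (real_of_int (j+1) * real CARD('n)) * (indicator (cell (j+1) x) y *\<^sub>R f y)
      - 2 powr (real_of_int j * real CARD('n)) * (indicator (cell j x) y *\<^sub>R f y))"
  proof (rule Bochner_Integration.integral_cong[OF refl])
    fix y
    have "(\<Sum>e\<in>haar_E. f y * haar e j ?m y * haar e j ?m x) = f y * (\<Sum>e\<in>haar_E. haar e j ?m y * haar e j ?m x)"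
      by (simp add: sum_distrib_left mult.assoc)
    then show "(\<Sum>e\<in>haar_E. f y * haar e j ?m y * haar e j ?m x) = 2 powr (real_of_int (j+1) * real CARD('n)) * (indicator (cell (j+1) x) y *\<^sub>R f y)
      - 2 powr (real_of_int j * real CARD('n)) * (indicator (cell j x) y *\<^sub>R f y)"
      unfolding haar_kernel by (auto simp: indicator_def mem_cell algebra_simps)
  qed
  also have "\<dots> = avg (j+1) f x - avg j f x"
    using int by (simp add: avg_def set_lebesgue_integral_def)
  finally show ?thesis .
qed

text \<open>At a given x only the cube containing x contributes to the infinite sum over m, so
  summability is never an issue. The weight may depend on the level only.\<close>

lemma haar_partial_eq:
  fixes f :: "real^'n::finite \<Rightarrow> real"
  assumes f: "loc_int f" and c: "\<And>e j m. c e j m = w j * pairing f (haar e j m)"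
  shows "haar_partial c M x = (\<Sum>j\<in>{- int M..int M}. w j * (avg (j+1) f x - avg j f x))"
proof -
  have "(\<Sum>\<^sub>\<infinity> m\<in>UNIV. c e j m * haar e j m x) = c e j (idx j x) * haar e j (idx j x) x" for e j
  proof -
    have "(\<Sum>\<^sub>\<infinity> m\<in>UNIV. c e j m * haar e j m x) = (\<Sum>\<^sub>\<infinity> m\<in>{idx j x}. c e j m * haar e j m x)"
      by (rule infsum_cong_neutral) (auto simp: haar_eq_0)
    then show ?thesis by simp
  qed
  then have "haar_partial c M x = (\<Sum>e\<in>haar_E. \<Sum>j\<in>{- int M..int M}. w j * (pairing f (haar e j (idx j x)) * haar e j (idx j x) x))"
    by (simp add: haar_partial_def c mult.assoc)
  also have "\<dots> = (\<Sum>j\<in>{- int M..int M}. \<Sum>e\<in>haar_E. w j * (pairing f (haar e j (idx j x)) * haar e j (idx j x) x))"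
    by (rule sum.swap)
  also have "\<dots> = (\<Sum>j\<in>{- int M..int M}. w j * (avg (j+1) f x - avg j f x))"
    by (simp only: sum_distrib_left[symmetric] haar_sum_pairing[OF f])
  finally show ?thesis .
qed

section \<open>The dyadic fractional integral as a series of averages\<close>

text \<open>Levels i and -i are joined into one term, so that the symmetric truncations are the
  partial sums of an ordinary series; the guard keeps level 0 from being counted twice.\<close>

definition frac_term :: "real \<Rightarrow> (real^'n::finite \<Rightarrow> real) \<Rightarrow> nat \<Rightarrow> real^'n \<Rightarrow> real" where
  "frac_term \<alpha> f i y = 2 powr (- \<alpha> * real i) * avg (int i) f y + (if i = 0 then 0 else 2 powr (\<alpha> * real i) * avg (- int i) f y)"

definition frac_series :: "real \<Rightarrow> (real^'n::finite \<Rightarrow> real) \<Rightarrow> real^'n \<Rightarrow> real" where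
  "frac_series \<alpha> f y = (\<Sum>i. frac_term \<alpha> f i y)"

text \<open>At fine levels the weight 2^(-\<alpha> i) already decays; only the coarse averages have
  to be controlled, and this is the condition on them.\<close>

definition frac_adm :: "real \<Rightarrow> (real^'n::finite \<Rightarrow> real) \<Rightarrow> bool" where
  "frac_adm \<alpha> f \<longleftrightarrow> loc_int f \<and> (\<forall>x. summable (\<lambda>i. 2 powr (\<alpha> * real i) * \<bar>avg (- int i) f x\<bar>))"

lemma sum_sym_Suc:
  "(\<Sum>j\<in>{- int (Suc M)..int (Suc M)}. g j) = g (int (Suc M)) + (g (- int (Suc M)) + (\<Sum>j\<in>{- int M..int M}. g j))"
    for g :: "int \<Rightarrow> real"
proof -
  have eq: "{- int (Suc M)..int (Suc M)} = insert (int (Suc M)) (insert (- int (Suc M)) {- int M..int M})" by auto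
  have "int (Suc M) \<notin> insert (- int (Suc M)) {- int M..int M}" "- int (Suc M) \<notin> {- int M..int M}" by auto
  then show ?thesis unfolding eq by simp
qed

lemma frac_term_sum: "(\<Sum>i<Suc M. frac_term \<alpha> f i y) = scale_sum \<alpha> {- int M..int M} f y"
proof (induction M)
  case 0
  show ?case by (simp add: frac_term_def scale_sum_def)
next
  case (Suc M)
  have r: "- \<alpha> * real_of_int (- int (Suc M)) = \<alpha> * real (Suc M)" "- \<alpha> * real_of_int (int (Suc M)) = - \<alpha> * real (Suc M)"
    by (simp_all add: algebra_simps)
  have "scale_sum \<alpha> {- int (Suc M)..int (Suc M)} f y = scale_sum \<alpha> {- int M..int M} f y + frac_term \<alpha> f (Suc M) y"
    unfolding scale_sum_def sum_sym_Suc frac_term_def r by simp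
  then show ?case using Suc by simp
qed

lemma loc_int_frac_term: "loc_int (frac_term \<alpha> f i)"
proof -
  have "loc_int (\<lambda>y. 2 powr (- \<alpha> * real i) * avg (int i) f y + (if i = 0 then 0 else 2 powr (\<alpha> * real i)) * avg (- int i) f y)"
    by (intro loc_int_add loc_int_cmult loc_int_avg)
  moreover have "frac_term \<alpha> f i = (\<lambda>y. 2 powr (- \<alpha> * real i) * avg (int i) f y + (if i = 0 then 0 else 2 powr (\<alpha> * real i)) * avg (- int i) f y)"
    by (auto simp: frac_term_def)
  ultimately show ?thesis by simp
qed

lemma avg_abs_avg_le: "loc_int f \<Longrightarrow> k \<le> j \<Longrightarrow> avg k (\<lambda>y. \<bar>avg j f y\<bar>) x \<le> avg k (\<lambda>y. \<bar>f y\<bar>) x"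
proof -
  assume f: "loc_int f" and kj: "k \<le> j"
  have "avg k (\<lambda>y. \<bar>avg j f y\<bar>) x \<le> avg k (avg j (\<lambda>y. \<bar>f y\<bar>)) x"
    by (intro avg_mono_cell avg_abs_le f loc_int_abs loc_int_avg)
  also have "\<dots> = avg k (\<lambda>y. \<bar>f y\<bar>) x" by (intro avg_tower loc_int_abs f kj)
  finally show ?thesis .
qed

lemma avg_abs_avg_coarse: "j \<le> k \<Longrightarrow> avg k (\<lambda>y. \<bar>avg j f y\<bar>) x = \<bar>avg j f x\<bar>"
  by (intro avg_lev lev_abs lev_mono[OF lev_avg])

text \<open>On a cell of level k the fine half of a term is bounded by contraction and a geometric
  weight. The coarse half is constant on the cell as soon as i >= |k|, and summable by
  admissibility.\<close>

lemma frac_series_L1: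
  fixes f :: "real^'n::finite \<Rightarrow> real"
  assumes adm: "frac_adm \<alpha> f" and a: "\<alpha> > 0"
  shows "loc_int (frac_series \<alpha> f)"
    "AE y in lborel. (\<lambda>M. scale_sum \<alpha> {- int M..int M} f y) \<longlonglongrightarrow> frac_series \<alpha> f y"
    "(\<lambda>M. avg k (\<lambda>y. \<bar>scale_sum \<alpha> {- int M..int M} f y - frac_series \<alpha> f y\<bar>) x) \<longlonglongrightarrow> 0"
proof -
  have f: "loc_int f" and sm: "summable (\<lambda>i. 2 powr (\<alpha> * real i) * \<bar>avg (- int i) f x\<bar>)" for x
    using adm by (auto simp: frac_adm_def)
  have s: "summable (\<lambda>i. avg k (\<lambda>y. \<bar>frac_term \<alpha> f i y\<bar>) x)" for k x
  proof (rule summable_comparison_test_ev)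
    have "summable (\<lambda>i. (2 powr (- \<alpha>)) ^ i)" using a by (intro summable_geometric) (simp add: powr_less_one)
    moreover have "(2 powr (- \<alpha>)) ^ i = 2 powr (- \<alpha> * real i)" for i
      by (simp add: powr_realpow[symmetric] powr_powr)
    ultimately have "summable (\<lambda>i. 2 powr (- \<alpha> * real i))" by simp
    then show "summable (\<lambda>i. 2 powr (- \<alpha> * real i) * avg k (\<lambda>y. \<bar>f y\<bar>) x + 2 powr (\<alpha> * real i) * \<bar>avg (- int i) f x\<bar>)"
      by (intro summable_add summable_mult2 sm)
    show "\<forall>\<^sub>F i in sequentially. norm (avg k (\<lambda>y. \<bar>frac_term \<alpha> f i y\<bar>) x) \<le> 2 powr (- \<alpha> * real i) * avg k (\<lambda>y. \<bar>f y\<bar>) x + 2 powr (\<alpha> * real i) * \<bar>avg (- int i) f x\<bar>"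
      using eventually_ge_at_top[of "nat \<bar>k\<bar>"]
    proof eventually_elim
      case (elim i)
      then have ik: "k \<le> int i" "- int i \<le> k" by linarith+
      have "norm (avg k (\<lambda>y. \<bar>frac_term \<alpha> f i y\<bar>) x) = avg k (\<lambda>y. \<bar>frac_term \<alpha> f i y\<bar>) x"
        using avg_nonneg[of k x "\<lambda>y. \<bar>frac_term \<alpha> f i y\<bar>"] by simp
      also have "\<dots> \<le> avg k (\<lambda>y. 2 powr (- \<alpha> * real i) * \<bar>avg (int i) f y\<bar> + 2 powr (\<alpha> * real i) * \<bar>avg (- int i) f y\<bar>) x"
      proof (intro avg_mono_cell loc_int_abs loc_int_frac_term loc_int_add loc_int_cmult loc_int_avg)
        fix y
        show "\<bar>frac_term \<alpha> f i y\<bar> \<le> 2 powr (- \<alpha> * real i) * \<bar>avg (int i) f y\<bar> + 2 powr (\<alpha> * real i) * \<bar>avg (- int i) f y\<bar>"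
          unfolding frac_term_def by (rule order_trans[OF abs_triangle_ineq]) (auto simp: abs_mult)
      qed
      also have "\<dots> = 2 powr (- \<alpha> * real i) * avg k (\<lambda>y. \<bar>avg (int i) f y\<bar>) x + 2 powr (\<alpha> * real i) * \<bar>avg (- int i) f x\<bar>"
        unfolding avg_lincomb[OF loc_int_abs[OF loc_int_avg] loc_int_abs[OF loc_int_avg]] avg_abs_avg_coarse[OF ik(2)] ..
      also have "\<dots> \<le> 2 powr (- \<alpha> * real i) * avg k (\<lambda>y. \<bar>f y\<bar>) x + 2 powr (\<alpha> * real i) * \<bar>avg (- int i) f x\<bar>"
        using avg_abs_avg_le[OF f ik(1)] by (intro add_right_mono mult_left_mono) auto
      finally show ?case .
    qed
  qed
  note S = series_L1[of "frac_term \<alpha> f", OF loc_int_frac_term s]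
  have eq: "frac_series \<alpha> f = (\<lambda>y. \<Sum>i. frac_term \<alpha> f i y)" by (auto simp: frac_series_def)
  show "loc_int (frac_series \<alpha> f)" using S(1) unfolding eq .
  show "AE y in lborel. (\<lambda>M. scale_sum \<alpha> {- int M..int M} f y) \<longlonglongrightarrow> frac_series \<alpha> f y"
    using S(2)
  proof eventually_elim
    case (elim y)
    then have "(\<lambda>M. \<Sum>i<Suc M. frac_term \<alpha> f i y) \<longlonglongrightarrow> frac_series \<alpha> f y"
      unfolding sums_def frac_series_def by (rule LIMSEQ_Suc)
    then show ?case by (simp only: frac_term_sum)
  qed
  have "(\<lambda>M. avg k (\<lambda>y. \<bar>(\<Sum>i<Suc M. frac_term \<alpha> f i y) - frac_series \<alpha> f y\<bar>) x) \<longlonglongrightarrow> 0"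
    using LIMSEQ_Suc[OF S(3)] unfolding frac_series_def .
  then show "(\<lambda>M. avg k (\<lambda>y. \<bar>scale_sum \<alpha> {- int M..int M} f y - frac_series \<alpha> f y\<bar>) x) \<longlonglongrightarrow> 0"
    by (simp only: frac_term_sum)
qed

text \<open>Shifting the index in the sum of 2^(-\<alpha> j) A(j+1) multiplies the weight by
  2^\<alpha>; the two boundary terms sit at the levels M + 1 and -M.\<close>

lemma Abel_sum:
  "(\<Sum>j\<in>{- int M..int M}. 2 powr (- \<alpha> * real_of_int j) * (A (j+1) - A j)) =
    (2 powr \<alpha> - 1) * (\<Sum>j\<in>{- int M..int M}. 2 powr (- \<alpha> * real_of_int j) * A j)
    + 2 powr (- \<alpha> * real M) * A (int M + 1) - 2 powr \<alpha> * (2 powr (\<alpha> * real M) * A (- int M))" for A :: "int \<Rightarrow> real"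
proof (induction M)
  case 0
  show ?case by (simp add: algebra_simps)
next
  case (Suc M)
  have p: "2 powr (- \<alpha> * real (Suc M)) = 2 powr (- \<alpha> * real M) / 2 powr \<alpha>" "2 powr (\<alpha> * real (Suc M)) = 2 powr (\<alpha> * real M) * 2 powr \<alpha>"
    by (simp_all add: powr_add powr_diff powr_minus distrib_left field_simps)
  have e: "- int (Suc M) + 1 = - int M" "int (Suc M) = int M + 1" by auto
  have r: "- \<alpha> * real_of_int (int (Suc M)) = - \<alpha> * real (Suc M)" "- \<alpha> * real_of_int (- int (Suc M)) = \<alpha> * real (Suc M)" by (simp_all add: algebra_simps)
  show ?case unfolding sum_sym_Suc r p Suc.IH e(1)
    by (simp add: e(2) field_simps)
qed

text \<open>By \<open>Abel_sum\<close> the Haar truncations differ from the truncated series by two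
  boundary terms. The fine one vanishes through its weight, the coarse one because the terms of the
  admissibility series tend to 0.\<close>

lemma frac_int_eq:
  fixes f :: "real^'n::finite \<Rightarrow> real"
  assumes adm: "frac_adm \<alpha> f" and a: "\<alpha> > 0"
  shows "AE y in lborel. frac_int \<alpha> f y = (2 powr \<alpha> - 1) * frac_series \<alpha> f y" "frac_int \<alpha> f \<in> borel_measurable borel"
proof -
  have f: "loc_int f" and sm: "summable (\<lambda>i. 2 powr (\<alpha> * real i) * \<bar>avg (- int i) f x\<bar>)" for x
    using adm by (auto simp: frac_adm_def)
  define c where "c = (\<lambda>e j m. measure lborel (dcube j (m::int^'n)) powr (\<alpha> / real CARD('n)) * pairing f (haar e j m))"
  define \<kappa> where "\<kappa> = 2 powr \<alpha> - 1"
  have \<kappa>: "\<kappa> > 0" using powr_less_mono[of 0 \<alpha> 2] a by (simp add: \<kappa>_def)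
  have hp: "haar_partial c M y = \<kappa> * scale_sum \<alpha> {- int M..int M} f y + 2 powr (- \<alpha> * real M) * avg (int M + 1) f y
      - 2 powr \<alpha> * (2 powr (\<alpha> * real M) * avg (- int M) f y)" for M y
  proof -
    have "c e j m = 2 powr (- \<alpha> * real_of_int j) * pairing f (haar e j m)" for e j m
      unfolding c_def measure_dcube by (simp add: powr_powr mult.commute)
    then have 1: "haar_partial c M y = (\<Sum>j\<in>{- int M..int M}. 2 powr (- \<alpha> * real_of_int j) * (avg (j+1) f y - avg j f y))"
      by (rule haar_partial_eq[OF f])
    show ?thesis unfolding 1 scale_sum_def \<kappa>_def by (rule Abel_sum)
  qed
  note FS = frac_series_L1[OF adm a]
  let ?g = "\<lambda>y. \<kappa> * frac_series \<alpha> f y"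
  have liS: "loc_int (scale_sum \<alpha> {- int M..int M} f)" for M
    unfolding scale_sum_def[abs_def] by (intro loc_int_sum loc_int_cmult loc_int_avg)
  have lip: "loc_int (haar_partial c M)" for M
  proof -
    have "haar_partial c M = (\<lambda>y. \<kappa> * scale_sum \<alpha> {- int M..int M} f y + 2 powr (- \<alpha> * real M) * avg (int M + 1) f y
      - 2 powr \<alpha> * (2 powr (\<alpha> * real M) * avg (- int M) f y))" using hp by auto
    moreover have "loc_int \<dots>" by (intro loc_int_diff loc_int_add loc_int_cmult liS loc_int_avg)
    ultimately show ?thesis by simp
  qed
  have lig: "loc_int ?g" using FS(1) by (rule loc_int_cmult)
  have "Lloc_conv 1 (haar_partial c) ?g"
  proof (rule Lloc_convI)
    show "?g \<in> borel_measurable borel" "haar_partial c M \<in> borel_measurable borel" for M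
      using lig lip loc_int_measurable by blast+
    show "loc_int (\<lambda>y. \<bar>?g y\<bar> powr 1)" using loc_int_abs[OF lig] by simp
    show "loc_int (\<lambda>y. \<bar>haar_partial c M y - ?g y\<bar> powr 1)" for M using loc_int_abs[OF loc_int_diff[OF lip lig]] by simp
    fix x
    let ?e = "\<lambda>M y. \<bar>scale_sum \<alpha> {- int M..int M} f y - frac_series \<alpha> f y\<bar>"
    let ?b = "\<lambda>M. \<kappa> * avg 0 (?e M) x + (2 powr (- \<alpha> * real M) * avg 0 (\<lambda>y. \<bar>f y\<bar>) x + 2 powr \<alpha> * (2 powr (\<alpha> * real M) * \<bar>avg (- int M) f x\<bar>))"
    have lie: "loc_int (?e M)" for M by (intro loc_int_abs loc_int_diff liS FS(1))
    have le: "avg 0 (\<lambda>y. \<bar>haar_partial c M y - ?g y\<bar>) x \<le> ?b M" for M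
    proof -
      have "avg 0 (\<lambda>y. \<bar>haar_partial c M y - ?g y\<bar>) x \<le> avg 0 (\<lambda>y. \<kappa> * ?e M y + 1 * (2 powr (- \<alpha> * real M) * \<bar>avg (int M + 1) f y\<bar> + (2 powr \<alpha> * 2 powr (\<alpha> * real M)) * \<bar>avg (- int M) f y\<bar>)) x"
      proof (intro avg_mono_cell loc_int_abs loc_int_diff lip lig loc_int_add loc_int_cmult lie liS FS(1) loc_int_avg)
        fix y
        have "haar_partial c M y - ?g y = \<kappa> * (scale_sum \<alpha> {- int M..int M} f y - frac_series \<alpha> f y) + (2 powr (- \<alpha> * real M) * avg (int M + 1) f y - (2 powr \<alpha> * 2 powr (\<alpha> * real M)) * avg (- int M) f y)"
          unfolding hp by (simp add: algebra_simps)
        then have "\<bar>haar_partial c M y - ?g y\<bar> \<le> \<bar>\<kappa> * (scale_sum \<alpha> {- int M..int M} f y - frac_series \<alpha> f y)\<bar> + (\<bar>2 powr (- \<alpha> * real M) * avg (int M + 1) f y\<bar> + \<bar>(2 powr \<alpha> * 2 powr (\<alpha> * real M)) * avg (- int M) f y\<bar>)"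
          by linarith
        then show "\<bar>haar_partial c M y - ?g y\<bar> \<le> \<kappa> * ?e M y + 1 * (2 powr (- \<alpha> * real M) * \<bar>avg (int M + 1) f y\<bar> + (2 powr \<alpha> * 2 powr (\<alpha> * real M)) * \<bar>avg (- int M) f y\<bar>)"
          using \<kappa> by (simp add: abs_mult)
      qed
      also have "\<dots> = \<kappa> * avg 0 (?e M) x + 1 * (2 powr (- \<alpha> * real M) * avg 0 (\<lambda>y. \<bar>avg (int M + 1) f y\<bar>) x + (2 powr \<alpha> * 2 powr (\<alpha> * real M)) * avg 0 (\<lambda>y. \<bar>avg (- int M) f y\<bar>) x)"
        by (subst avg_lincomb[OF lie], intro loc_int_add loc_int_cmult loc_int_abs loc_int_avg,
            subst avg_lincomb[OF loc_int_abs[OF loc_int_avg] loc_int_abs[OF loc_int_avg]], rule refl)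
      also have "avg 0 (\<lambda>y. \<bar>avg (- int M) f y\<bar>) x = \<bar>avg (- int M) f x\<bar>" by (rule avg_abs_avg_coarse) simp
      also have "\<kappa> * avg 0 (?e M) x + 1 * (2 powr (- \<alpha> * real M) * avg 0 (\<lambda>y. \<bar>avg (int M + 1) f y\<bar>) x + (2 powr \<alpha> * 2 powr (\<alpha> * real M)) * \<bar>avg (- int M) f x\<bar>) \<le> ?b M"
        using avg_abs_avg_le[OF f, of 0 "int M + 1" x] by (simp add: mult_left_mono mult.assoc)
      finally show ?thesis .
    qed
    have "(\<lambda>M. 2 powr (- \<alpha> * real M)) \<longlonglongrightarrow> 0"
    proof -
      have "(\<lambda>M. (2 powr (- \<alpha>)) ^ M) \<longlonglongrightarrow> 0" using a by (intro LIMSEQ_realpow_zero) (auto simp: powr_less_one)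
      then show ?thesis by (simp add: powr_realpow[symmetric] powr_powr)
    qed
    then have "?b \<longlonglongrightarrow> \<kappa> * 0 + (0 * avg 0 (\<lambda>y. \<bar>f y\<bar>) x + 2 powr \<alpha> * 0)"
      by (intro tendsto_intros FS(3) summable_LIMSEQ_zero[OF sm])
    then have bl: "?b \<longlonglongrightarrow> 0" by simp
    have "(\<lambda>M. avg 0 (\<lambda>y. \<bar>haar_partial c M y - ?g y\<bar>) x) \<longlonglongrightarrow> 0"
    proof (rule tendsto_sandwich[OF _ _ tendsto_const bl])
      show "\<forall>\<^sub>F M in sequentially. 0 \<le> avg 0 (\<lambda>y. \<bar>haar_partial c M y - ?g y\<bar>) x"
        by (intro always_eventually allI avg_nonneg abs_ge_zero)
    qed (intro always_eventually allI le)
    then show "(\<lambda>M. avg 0 (\<lambda>y. \<bar>haar_partial c M y - ?g y\<bar> powr 1) x) \<longlonglongrightarrow> 0" by simp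
  qed
  from Lloc_lim_eq[OF this] show "AE y in lborel. frac_int \<alpha> f y = (2 powr \<alpha> - 1) * frac_series \<alpha> f y" "frac_int \<alpha> f \<in> borel_measurable borel"
    by (simp_all add: frac_int_def c_def \<kappa>_def)
qed

text \<open>Interpolation between convergence in mean and boundedness of the t-th power means; the
  strict inequality q < t is what makes it work.\<close>

lemma avg_conv_Lq:
  fixes G :: "real^'n::finite \<Rightarrow> real"
  assumes m: "G \<in> borel_measurable borel" and li: "loc_int (\<lambda>y. \<bar>G y\<bar> powr t)" and q: "1 \<le> q" "q < t"
  shows "(\<lambda>N. avg k (\<lambda>y. \<bar>avg (int N) G y - G y\<bar> powr q) x) \<longlonglongrightarrow> 0"
    "loc_int (\<lambda>y. \<bar>avg j G y - G y\<bar> powr q)"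
proof -
  have t: "t > 1" using q by simp
  have lG: "loc_int G"
  proof -
    have "loc_int (\<lambda>y. \<bar>G y\<bar> powr 1)" using loc_int_powr_le[OF li m, of 1] t by simp
    then show ?thesis by (rule loc_int_bound) (use m in auto)
  qed
  have pt: "\<bar>avg j G y - G y\<bar> powr t \<le> 2 powr t * (avg j (\<lambda>y. \<bar>G y\<bar> powr t) y + \<bar>G y\<bar> powr t)" for j y
  proof -
    have nn: "0 \<le> avg j (\<lambda>y. \<bar>G y\<bar> powr t) y" by (intro avg_nonneg) simp
    have "\<bar>avg j G y\<bar> \<le> avg j (\<lambda>y. \<bar>G y\<bar> powr t) y powr (1/t)"
      using avg_abs_le[OF lG, of j y] avg_abs_le_avg_powr[OF li m t, of j y] by linarith
    then have "\<bar>avg j G y\<bar> powr t \<le> (avg j (\<lambda>y. \<bar>G y\<bar> powr t) y powr (1/t)) powr t" using t by (intro powr_mono2) auto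
    then have 1: "\<bar>avg j G y\<bar> powr t \<le> avg j (\<lambda>y. \<bar>G y\<bar> powr t) y" using t nn by (simp add: powr_powr)
    have "\<bar>avg j G y - G y\<bar> powr t \<le> (\<bar>avg j G y\<bar> + \<bar>G y\<bar>) powr t" using t by (intro powr_mono2) auto
    also have "\<dots> \<le> 2 powr t * (\<bar>avg j G y\<bar> powr t + \<bar>G y\<bar> powr t)" using t by (intro powr_add_le) auto
    also have "\<dots> \<le> 2 powr t * (avg j (\<lambda>y. \<bar>G y\<bar> powr t) y + \<bar>G y\<bar> powr t)" using 1 by (intro mult_left_mono add_right_mono) auto
    finally show ?thesis .
  qed
  have liH: "loc_int (\<lambda>y. 2 powr t * (avg j (\<lambda>y. \<bar>G y\<bar> powr t) y + \<bar>G y\<bar> powr t))" for j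
    by (intro loc_int_cmult loc_int_add loc_int_avg li)
  have lit: "loc_int (\<lambda>y. \<bar>avg j G y - G y\<bar> powr t)" for j
    by (rule loc_int_bound[OF liH[of j]]) (use pt m in auto)
  show liq: "loc_int (\<lambda>y. \<bar>avg j G y - G y\<bar> powr q)" for j
    by (rule loc_int_powr_le[OF lit]) (use m q in auto)
  have bt: "avg k (\<lambda>y. \<bar>avg (int N) G y - G y\<bar> powr t) x \<le> 2 powr t * (2 * avg k (\<lambda>y. \<bar>G y\<bar> powr t) x)" if "k \<le> int N" for N
  proof -
    have "avg k (\<lambda>y. \<bar>avg (int N) G y - G y\<bar> powr t) x \<le> avg k (\<lambda>y. 2 powr t * (avg (int N) (\<lambda>y. \<bar>G y\<bar> powr t) y + \<bar>G y\<bar> powr t)) x"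
      by (intro avg_mono_cell pt lit liH)
    also have "\<dots> = 2 powr t * (avg k (avg (int N) (\<lambda>y. \<bar>G y\<bar> powr t)) x + avg k (\<lambda>y. \<bar>G y\<bar> powr t) x)"
      unfolding avg_cmult by (subst avg_add[OF loc_int_avg li]) simp
    also have "avg k (avg (int N) (\<lambda>y. \<bar>G y\<bar> powr t)) x = avg k (\<lambda>y. \<bar>G y\<bar> powr t) x" by (rule avg_tower[OF li that])
    finally show ?thesis by simp
  qed
  define T where "T = 2 powr t * (2 * avg k (\<lambda>y. \<bar>G y\<bar> powr t) x) + 1"
  have T: "T > 0" unfolding T_def using avg_nonneg[of k x "\<lambda>y. \<bar>G y\<bar> powr t"] by (simp add: add_nonneg_pos)
  show "(\<lambda>N. avg k (\<lambda>y. \<bar>avg (int N) G y - G y\<bar> powr q) x) \<longlonglongrightarrow> 0"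
  proof (rule LIMSEQ_I)
    fix e :: real assume e: "e > 0"
    \<comment> \<open>The height above which the t-th power bound alone makes the contribution at
      most e/2, since l^(q-t) T = e/2.\<close>
    define l where "l = (2 * T / e) powr (1 / (t - q))"
    have l: "l > 0" "l powr (q - t) * T = e / 2"
    proof -
      show "l > 0" using T e by (simp add: l_def)
      have "l powr (q - t) = (2 * T / e) powr (- 1)"
        unfolding l_def powr_powr using q by (intro arg_cong2[where f="(powr)"] refl) (simp add: field_simps)
      then show "l powr (q - t) * T = e / 2" using T e by (simp add: powr_minus)
    qed
    have ptl: "z powr q \<le> l powr (q - 1) * z + l powr (q - t) * z powr t" if "z \<ge> 0" for z
    proof (cases "z \<le> l")
      case True
      have "z powr q = z * z powr (q - 1)" using powr_mult_base[OF that, of "q - 1"] by simp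
      also have "\<dots> \<le> z * l powr (q - 1)" using True that q by (intro mult_left_mono powr_mono2) auto
      finally show ?thesis by (simp add: mult.commute add_increasing2)
    next
      case False
      have "z powr q = z powr (q - t) * z powr t" by (simp add: powr_add[symmetric])
      also have "\<dots> \<le> l powr (q - t) * z powr t" using False l q by (intro mult_right_mono powr_mono2') auto
      finally show ?thesis using that by (simp add: add_increasing)
    qed
    have "(\<lambda>N. avg k (\<lambda>y. \<bar>avg (int N) G y - G y\<bar>) x) \<longlonglongrightarrow> 0" by (rule avg_conv_L1[OF lG])
    then have "\<forall>\<^sub>F N in sequentially. avg k (\<lambda>y. \<bar>avg (int N) G y - G y\<bar>) x < e / (2 * l powr (q - 1))"
      using e l by (intro order_tendstoD(2)[where y=0]) auto
    then have "\<forall>\<^sub>F N in sequentially. norm (avg k (\<lambda>y. \<bar>avg (int N) G y - G y\<bar> powr q) x - 0) < e"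
      using eventually_ge_at_top[of "nat k"]
    proof eventually_elim
      case (elim N)
      let ?D = "\<lambda>y. \<bar>avg (int N) G y - G y\<bar>"
      have liD: "loc_int ?D" using lG by (intro loc_int_abs loc_int_diff loc_int_avg)
      have "avg k (\<lambda>y. ?D y powr q) x \<le> avg k (\<lambda>y. l powr (q - 1) * ?D y + l powr (q - t) * ?D y powr t) x"
        by (intro avg_mono_cell ptl liq loc_int_add loc_int_cmult liD lit) simp
      also have "\<dots> = l powr (q - 1) * avg k ?D x + l powr (q - t) * avg k (\<lambda>y. ?D y powr t) x"
        by (rule avg_lincomb[OF liD lit])
      also have "\<dots> < e / 2 + l powr (q - t) * T"
      proof (rule add_less_le_mono)
        show "l powr (q - 1) * avg k ?D x < e / 2" using elim(1) l by (simp add: field_simps)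
        show "l powr (q - t) * avg k (\<lambda>y. ?D y powr t) x \<le> l powr (q - t) * T"
        proof (rule mult_left_mono)
          have "k \<le> int N" using elim(2) by linarith
          then show "avg k (\<lambda>y. ?D y powr t) x \<le> T" using bt[of N] unfolding T_def by simp
        qed simp
      qed
      also have "\<dots> = e" using l by simp
      finally have "avg k (\<lambda>y. ?D y powr q) x < e" .
      moreover have "0 \<le> avg k (\<lambda>y. ?D y powr q) x" by (intro avg_nonneg) simp
      ultimately show ?case by simp
    qed
    then show "\<exists>no. \<forall>N\<ge>no. norm (avg k (\<lambda>y. \<bar>avg (int N) G y - G y\<bar> powr q) x - 0) < e"
      by (simp add: eventually_sequentially)
  qed
qed

section \<open>The commutator as a limit of truncations\<close>

lemma morrey_exps_gap:
  assumes "morrey_exps TYPE('n::finite) \<alpha> p q s t"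
  shows "\<alpha> - real CARD('n) / p = - (real CARD('n) / s)"
proof -
  have "1/s = 1/p - \<alpha> / real CARD('n)" using assms by (simp add: morrey_exps_def)
  then have "real CARD('n) * (1/s) = real CARD('n) * (1/p - \<alpha> / real CARD('n))" by simp
  then show ?thesis by (simp add: right_diff_distrib)
qed

text \<open>Averages of f at level -i decay like 2^(-i n/p), which beats the weight 2^(\<alpha> i)
  by the rate \<sigma> = n/s. For a f there is in addition the linear drift of the averages of a,
  paid for by half of that rate.\<close>

lemma frac_adm_Morrey:
  fixes f :: "real^'n::finite \<Rightarrow> real"
  assumes ex: "morrey_exps TYPE('n) \<alpha> p q s t" and f: "mbd p q f N" and N: "N \<ge> 0"
  shows "frac_adm \<alpha> f"
    and "osc_le a B \<Longrightarrow> B > 0 \<Longrightarrow> frac_adm \<alpha> (\<lambda>z. a z * f z)"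
proof -
  let ?n = "real CARD('n)"
  have ep: "0 < \<alpha>" "1 < q" "q \<le> p" "1 < t" "t \<le> s" using ex by (auto simp: morrey_exps_def)
  define \<sigma> where "\<sigma> = ?n / s"
  have \<sigma>: "\<sigma> > 0" using ep by (simp add: \<sigma>_def)
  have w: "2 powr (\<alpha> * real i) * (N * 2 powr (real_of_int (- int i) * ?n / p)) = N * 2 powr (- \<sigma> * real i)" for i
  proof -
    have "\<alpha> * real i + real_of_int (- int i) * ?n / p = (\<alpha> - ?n / p) * real i" by (simp add: left_diff_distrib)
    also have "\<dots> = - \<sigma> * real i" unfolding morrey_exps_gap[OF ex] \<sigma>_def ..
    finally have "2 powr (\<alpha> * real i) * 2 powr (real_of_int (- int i) * ?n / p) = 2 powr (- \<sigma> * real i)"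
      by (simp only: powr_add[symmetric])
    then show ?thesis by simp
  qed
  have lf: "loc_int f" using mbd_loc_int[OF f] ep by simp
  have fa: "\<bar>avg j f x\<bar> \<le> N * 2 powr (real_of_int j * ?n / p)" for j x
    using avg_abs_le[OF lf, of j x] mbd_avg_abs[OF f ep(2) N, of j x] by linarith
  show "frac_adm \<alpha> f" unfolding frac_adm_def
  proof (intro conjI allI lf)
    fix x
    show "summable (\<lambda>i. 2 powr (\<alpha> * real i) * \<bar>avg (- int i) f x\<bar>)"
    proof (rule summable_comparison_test')
      show "summable (\<lambda>i. N * 2 powr (- \<sigma> * real i))" by (intro summable_mult summable_powr \<sigma>)
      fix i
      have "2 powr (\<alpha> * real i) * \<bar>avg (- int i) f x\<bar> \<le> 2 powr (\<alpha> * real i) * (N * 2 powr (real_of_int (- int i) * ?n / p))"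
        by (intro mult_left_mono fa) simp
      then show "norm (2 powr (\<alpha> * real i) * \<bar>avg (- int i) f x\<bar>) \<le> N * 2 powr (- \<sigma> * real i)" unfolding w by simp
    qed
  qed
  assume a: "osc_le a B" and B: "B > 0"
  define r where "r = (1 + q) / 2"
  have r: "1 < r" "r < q" using ep by (auto simp: r_def)
  have la: "loc_int a" using a by (simp add: osc_le_def)
  obtain CH where CH: "CH > 0" "\<And>(a::real^'n \<Rightarrow> real) B f. osc_le a B \<Longrightarrow> B > 0 \<Longrightarrow> f \<in> borel_measurable borel \<Longrightarrow> loc_int (\<lambda>y. \<bar>f y\<bar> powr r) \<Longrightarrow>
     loc_int (\<lambda>y. a y * f y) \<and> (\<forall>j. loc_int (\<lambda>y. \<bar>a y - avg j a y\<bar> * \<bar>f y\<bar>)) \<and>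
     (\<forall>j x. avg j (\<lambda>y. \<bar>a y - avg j a y\<bar> * \<bar>f y\<bar>) x \<le> CH * B * avg j (\<lambda>y. \<bar>f y\<bar> powr r) x powr (1/r))"
    using BMO_mult[OF r(1), where 'n='n] by blast
  have fr: "loc_int (\<lambda>y. \<bar>f y\<bar> powr r)" using mbd_loc_int_powr[OF f] r by simp
  note bm = CH(2)[OF a B mbdD(1)[OF f] fr]
  have af: "loc_int (\<lambda>z. a z * f z)" using bm by blast
  show "frac_adm \<alpha> (\<lambda>z. a z * f z)" unfolding frac_adm_def
  proof (intro conjI allI af)
    fix x
    define D where "D = 2 ^ CARD('n) * B"
    have D: "D > 0" using B by (simp add: D_def)
    have "\<sigma>/2 > 0" using \<sigma> by simp
    from linear_le_powr[OF this] obtain C where C: "C > 0" "\<And>v. v \<ge> 0 \<Longrightarrow> 1 + v \<le> C * 2 powr (\<sigma>/2 * v)" by blast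
    define A where "A = \<bar>avg 0 a x\<bar> + D + CH * B"
    have A: "A > 0" using D CH B by (simp add: A_def add_nonneg_pos)
    show "summable (\<lambda>i. 2 powr (\<alpha> * real i) * \<bar>avg (- int i) (\<lambda>z. a z * f z) x\<bar>)"
    proof (rule summable_comparison_test')
      show "summable (\<lambda>i. (A * N * C) * 2 powr (- (\<sigma>/2) * real i))" by (intro summable_mult summable_powr) (use \<sigma> in simp)
      fix i :: nat
      let ?j = "- int i"
      have aj: "\<bar>avg ?j a x\<bar> \<le> \<bar>avg 0 a x\<bar> + D * real i"
        using osc_int_steps[OF a, of ?j 0 x] unfolding D_def by simp
      have Dr: "avg ?j (\<lambda>y. \<bar>f y\<bar> powr r) x powr (1/r) \<le> N * 2 powr (real_of_int ?j * ?n / p)"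
      proof -
        have nn: "0 \<le> avg ?j (\<lambda>y. \<bar>f y\<bar> powr r) x" by (intro avg_nonneg) simp
        have "avg ?j (\<lambda>y. \<bar>f y\<bar> powr r) x \<le> (N * 2 powr (real_of_int ?j * ?n / p)) powr r"
          by (rule mbd_avg_powr[OF f]) (use r N in auto)
        then have "avg ?j (\<lambda>y. \<bar>f y\<bar> powr r) x powr (1/r) \<le> ((N * 2 powr (real_of_int ?j * ?n / p)) powr r) powr (1/r)"
          using nn r by (intro powr_mono2) auto
        also have "\<dots> = N * 2 powr (real_of_int ?j * ?n / p)" using N r by (simp add: powr_powr)
        finally show ?thesis .
      qed
      have lf2: "loc_int (\<lambda>z. avg ?j a z * f z)" by (rule loc_int_lev_mult[OF lev_avg lf])
      have "avg ?j (\<lambda>z. (a z - avg ?j a z) * f z) x = avg ?j (\<lambda>z. a z * f z - avg ?j a z * f z) x" by (simp add: left_diff_distrib)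
      also have "\<dots> = avg ?j (\<lambda>z. a z * f z) x - avg ?j a x * avg ?j f x"
        unfolding avg_diff[OF af lf2] by (simp add: avg_lev_mult[OF lev_avg])
      finally have eq: "avg ?j (\<lambda>z. a z * f z) x = avg ?j a x * avg ?j f x + avg ?j (\<lambda>z. (a z - avg ?j a z) * f z) x" by simp
      have li: "loc_int (\<lambda>z. (a z - avg ?j a z) * f z)" using loc_int_diff[OF af lf2] by (simp add: left_diff_distrib)
      have "\<bar>avg ?j (\<lambda>z. (a z - avg ?j a z) * f z) x\<bar> \<le> avg ?j (\<lambda>z. \<bar>a z - avg ?j a z\<bar> * \<bar>f z\<bar>) x"
        using avg_abs_le[OF li, of ?j x] by (simp add: abs_mult)
      also have "\<dots> \<le> CH * B * avg ?j (\<lambda>y. \<bar>f y\<bar> powr r) x powr (1/r)" using bm by blast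
      also have "\<dots> \<le> CH * B * (N * 2 powr (real_of_int ?j * ?n / p))" using CH B by (intro mult_left_mono Dr) auto
      finally have 2: "\<bar>avg ?j (\<lambda>z. (a z - avg ?j a z) * f z) x\<bar> \<le> CH * B * (N * 2 powr (real_of_int ?j * ?n / p))" .
      have 1: "\<bar>avg ?j a x * avg ?j f x\<bar> \<le> (\<bar>avg 0 a x\<bar> + D * real i) * (N * 2 powr (real_of_int ?j * ?n / p))"
        unfolding abs_mult by (rule mult_mono[OF aj fa]) (use D in auto)
      have 3: "\<bar>avg 0 a x\<bar> + D * real i + CH * B \<le> A * (1 + real i)"
      proof -
        have "0 \<le> (\<bar>avg 0 a x\<bar> + CH * B) * real i" using CH B by simp
        then show ?thesis unfolding A_def using D by (simp add: algebra_simps)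
      qed
      have "2 powr (\<alpha> * real i) * \<bar>avg ?j (\<lambda>z. a z * f z) x\<bar> \<le> 2 powr (\<alpha> * real i) * ((\<bar>avg 0 a x\<bar> + D * real i + CH * B) * (N * 2 powr (real_of_int ?j * ?n / p)))"
        unfolding eq using 1 2 by (intro mult_left_mono) (simp_all add: distrib_right)
      also have "\<dots> = (\<bar>avg 0 a x\<bar> + D * real i + CH * B) * (2 powr (\<alpha> * real i) * (N * 2 powr (real_of_int ?j * ?n / p)))"
        by (simp only: mult_ac)
      also have "\<dots> = (\<bar>avg 0 a x\<bar> + D * real i + CH * B) * (N * 2 powr (- \<sigma> * real i))" unfolding w ..
      also have "\<dots> \<le> (A * (1 + real i)) * (N * 2 powr (- \<sigma> * real i))" using N by (intro mult_right_mono 3) auto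
      also have "\<dots> \<le> (A * (C * 2 powr (\<sigma>/2 * real i))) * (N * 2 powr (- \<sigma> * real i))"
        using A N C(2)[of "real i"] by (intro mult_right_mono mult_left_mono) auto
      also have "\<dots> = (A * N * C) * (2 powr (\<sigma>/2 * real i) * 2 powr (- \<sigma> * real i))" by (simp only: mult_ac)
      also have "2 powr (\<sigma>/2 * real i) * 2 powr (- \<sigma> * real i) = 2 powr (- (\<sigma>/2) * real i)"
        by (simp add: powr_add[symmetric])
      finally show "norm (2 powr (\<alpha> * real i) * \<bar>avg (- int i) (\<lambda>z. a z * f z) x\<bar>) \<le> (A * N * C) * 2 powr (- (\<sigma>/2) * real i)" by simp
    qed
  qed
qed

text \<open>A concrete function to compute with in place of \<open>commutator\<close>, whose values
  come from two nested unspecified limits.\<close>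

definition comm_series :: "real \<Rightarrow> (real^'n::finite \<Rightarrow> real) \<Rightarrow> (real^'n \<Rightarrow> real) \<Rightarrow> real^'n \<Rightarrow> real" where
  "comm_series \<alpha> a f y = (2 powr \<alpha> - 1) * (a y * frac_series \<alpha> f y - frac_series \<alpha> (\<lambda>z. a z * f z) y)"

lemma scale_comm_eq: "scale_comm \<alpha> a J f y = a y * scale_sum \<alpha> J f y - scale_sum \<alpha> J (\<lambda>z. a z * f z) y"
  unfolding scale_comm_def scale_sum_def
  by (simp add: sum_distrib_left sum_subtractf[symmetric] algebra_simps)

lemma comm_series_lim:
  fixes f :: "real^'n::finite \<Rightarrow> real"
  assumes ex: "morrey_exps TYPE('n) \<alpha> p q s t" and f: "mbd p q f N" and N: "N \<ge> 0" and a: "osc_le a B"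
  shows "AE y in lborel. (\<lambda>M. (2 powr \<alpha> - 1) * scale_comm \<alpha> a {- int M..int M} f y) \<longlonglongrightarrow> comm_series \<alpha> a f y"
    "comm_series \<alpha> a f \<in> borel_measurable borel"
proof -
  have \<alpha>: "\<alpha> > 0" using ex by (simp add: morrey_exps_def)
  \<comment> \<open>The quantitative lemmas want a positive oscillation bound, and B may be 0 for
    constant a; B + 1 is always admissible.\<close>
  have a': "osc_le a (B + 1)" using a unfolding osc_le_def by (meson add_increasing2 zero_le_one)
  have B': "B + 1 > 0" using osc_nonneg[OF a] by simp
  note A1 = frac_adm_Morrey(1)[OF ex f N] and A2 = frac_adm_Morrey(2)[OF ex f N a' B']
  have am: "a \<in> borel_measurable borel" using a by (simp add: osc_le_def loc_int_measurable)
  show "AE y in lborel. (\<lambda>M. (2 powr \<alpha> - 1) * scale_comm \<alpha> a {- int M..int M} f y) \<longlonglongrightarrow> comm_series \<alpha> a f y"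
    using frac_series_L1(2)[OF A1 \<alpha>] frac_series_L1(2)[OF A2 \<alpha>]
    by eventually_elim (auto simp: scale_comm_eq comm_series_def intro!: tendsto_intros)
  show "comm_series \<alpha> a f \<in> borel_measurable borel" unfolding comm_series_def[abs_def]
    using am loc_int_measurable[OF frac_series_L1(1)[OF A1 \<alpha>]] loc_int_measurable[OF frac_series_L1(1)[OF A2 \<alpha>]] by measurable
qed

lemma powr_minus_1_pos: "\<alpha> > 0 \<Longrightarrow> 0 < 2 powr \<alpha> - (1::real)"
  using powr_less_mono[of 0 \<alpha> 2] by simp

text \<open>The truncated bounds are uniform in the truncation, so Fatou carries them over.
  Linearity in B is what later allows approximation of a in BMO.\<close>

lemma comm_series_Morrey:
  assumes ex: "morrey_exps TYPE('n::finite) \<alpha> p q s t"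
  shows "\<exists>C>0. \<forall>(a::real^'n \<Rightarrow> real) B f N. osc_le a B \<longrightarrow> B > 0 \<longrightarrow> mbd p q f N \<longrightarrow> N > 0 \<longrightarrow>
     mbd s t (comm_series \<alpha> a f) (C * B * N)"
proof -
  have t: "t > 0" "\<alpha> > 0" using ex by (auto simp: morrey_exps_def)
  let ?k = "2 powr \<alpha> - 1"
  have k: "?k > 0" using powr_minus_1_pos t by blast
  obtain C where C: "C > 0" "\<And>(a::real^'n \<Rightarrow> real) B f N J. osc_le a B \<Longrightarrow> B > 0 \<Longrightarrow> mbd p q f N \<Longrightarrow> N > 0 \<Longrightarrow> finite J \<Longrightarrow>
     mbd s t (scale_comm \<alpha> a J f) (C * B * N)"
    using scale_comm_Morrey[OF ex] by blast
  show ?thesis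
  proof (intro exI[of _ "?k * C"] conjI allI impI)
    show "?k * C > 0" using k C by simp
    fix a f :: "real^'n \<Rightarrow> real" and B N
    assume a: "osc_le a B" and B: "B > 0" and f: "mbd p q f N" and N: "N > 0"
    have "mbd s t (\<lambda>y. ?k * scale_comm \<alpha> a {- int M..int M} f y) (\<bar>?k\<bar> * (C * B * N))" for M
      using C(1) B N by (intro mbd_cmult C(2)[OF a B f N]) auto
    then have "mbd s t (\<lambda>y. ?k * scale_comm \<alpha> a {- int M..int M} f y) (?k * C * B * N)" for M using k by (simp add: mult.assoc)
    then show "mbd s t (comm_series \<alpha> a f) (?k * C * B * N)"
      by (rule mbd_fatou) (use comm_series_lim[OF ex f less_imp_le[OF N] a] t in auto)
  qed
qed

text \<open>The outer Haar expansion of g = a I f - I (a f) carries weight 1, so its truncations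
  telescope to E_{M+1} g - E_{-M} g. The first part tends to g in L^q on cells, as g has local t-th
  powers and q < t; the second decays at the rate n/s by the Morrey bound of g.\<close>

lemma commutator_eq:
  fixes f :: "real^'n::finite \<Rightarrow> real"
  assumes ex: "morrey_exps TYPE('n) \<alpha> p q s t" and f: "mbd p q f N" and a: "osc_le a B"
  shows "AE y in lborel. commutator q \<alpha> a f y = comm_series \<alpha> a f y" "commutator q \<alpha> a f \<in> borel_measurable borel"
proof -
  have ep: "0 < \<alpha>" "1 < q" "q \<le> p" "1 < t" "t \<le> s" "t/s = q/p" "1/s = 1/p - \<alpha> / real CARD('n)" using ex by (auto simp: morrey_exps_def)
  \<comment> \<open>\<alpha> > 0 gives p < s, and t = q s/p turns this into q < t.\<close>
  have qt: "q < t"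
  proof -
    have "1/s < 1/p" unfolding ep(7) using ep(1) by simp
    moreover have "1/p \<le> 1/s" if "s \<le> p" using that ep by (intro frac_le) auto
    ultimately have "p < s" by fastforce
    moreover have "t = q * (s / p)" using ep by (simp add: field_simps)
    moreover have "q * 1 < q * (s / p)" using \<open>p < s\<close> ep by (intro mult_strict_left_mono) auto
    ultimately show ?thesis by simp
  qed
  \<comment> \<open>The bound in \<open>mbd\<close> is not assumed to be positive here; it is
    replaced by |N| + 1.\<close>
  obtain N' where f': "mbd p q f N'" "N' > 0"
  proof
    have "mbd p q f \<bar>N\<bar>" unfolding mbd_def
    proof (intro conjI allI mbdD(1,2)[OF f])
      fix k x
      have "(N * 2 powr (real_of_int k * real CARD('n) / p)) powr q \<le> (\<bar>N\<bar> * 2 powr (real_of_int k * real CARD('n) / p)) powr q"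
        by (cases "N \<ge> 0") (simp_all add: powr_mult powr_def ln_minus)
      then show "avg k (\<lambda>y. \<bar>f y\<bar> powr q) x \<le> (\<bar>N\<bar> * 2 powr (real_of_int k * real CARD('n) / p)) powr q"
        using mbdD(3)[OF f, of k x] by linarith
    qed
    then show "mbd p q f (\<bar>N\<bar> + 1)" by (rule mbd_mono) (use ep in auto)
  qed simp
  note N0 = less_imp_le[OF f'(2)]
  have a': "osc_le a (B + 1)" using a unfolding osc_le_def by (meson add_increasing2 zero_le_one)
  have B': "B + 1 > 0" using osc_nonneg[OF a] by simp
  have am [measurable]: "a \<in> borel_measurable borel" using a by (simp add: osc_le_def loc_int_measurable)
  note A1 = frac_adm_Morrey(1)[OF ex f'(1) N0] and A2 = frac_adm_Morrey(2)[OF ex f'(1) N0 a' B']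
  define g where "g = (\<lambda>y. a y * frac_int \<alpha> f y - frac_int \<alpha> (\<lambda>z. a z * f z) y)"
  let ?T = "comm_series \<alpha> a f"
  have gm: "g \<in> borel_measurable borel" unfolding g_def
    using frac_int_eq(2)[OF A1 ep(1)] frac_int_eq(2)[OF A2 ep(1)] by measurable
  have gT: "AE y in lborel. g y = ?T y"
    using frac_int_eq(1)[OF A1 ep(1)] frac_int_eq(1)[OF A2 ep(1)]
    by eventually_elim (simp add: g_def comm_series_def right_diff_distrib mult.left_commute)
  obtain C where "C > 0" and C: "mbd s t ?T (C * (B + 1) * N')"
    using comm_series_Morrey[OF ex] a' B' f' by blast
  define K where "K = C * (B + 1) * N'"
  have K: "K > 0" using \<open>C > 0\<close> B' f' by (simp add: K_def)
  have g: "mbd s t g K" unfolding K_def by (rule mbd_cong_AE[OF C gm gT])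
  have lg: "loc_int g" using mbd_loc_int[OF g] ep by simp
  define c where "c = (\<lambda>(e::'n \<Rightarrow> bool) j m. pairing g (haar e j m))"
  have hp: "haar_partial c M y = avg (int M + 1) g y - avg (- int M) g y" for M y
  proof -
    have "haar_partial c M y = (\<Sum>j\<in>{- int M..int M}. 1 * (avg (j+1) g y - avg j g y))"
      by (rule haar_partial_eq[OF lg]) (simp add: c_def)
    also have "\<dots> = avg (int M + 1) g y - avg (- int M) g y"
    proof (induction M)
      case (Suc M)
      have "- int (Suc M) + 1 = - int M" "int (Suc M) = int M + 1" by auto
      then show ?case unfolding sum_sym_Suc Suc by (simp add: add.commute)
    qed (simp add: add.commute)
    finally show ?thesis .
  qed
  have lcq: "loc_int (\<lambda>y. \<bar>haar_partial c M y - g y\<bar> powr q)"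
    and bq: "avg 0 (\<lambda>y. \<bar>haar_partial c M y - g y\<bar> powr q) x
       \<le> 2 powr q * (avg 0 (\<lambda>y. \<bar>avg (int (Suc M)) g y - g y\<bar> powr q) x + \<bar>avg (- int M) g x\<bar> powr q)" for M x
  proof -
    let ?H = "\<lambda>y. 2 powr q * (\<bar>avg (int (Suc M)) g y - g y\<bar> powr q + \<bar>avg (- int M) g y\<bar> powr q)"
    note L = avg_conv_Lq(2)[OF gm mbdD(2)[OF g] less_imp_le[OF ep(2)] qt]
    have levq: "lev (- int M) (\<lambda>y. \<bar>avg (- int M) g y\<bar> powr q)" by (intro lev_powr lev_abs lev_avg)
    have liH: "loc_int ?H" by (intro loc_int_cmult loc_int_add L lev_loc_int[OF levq])
    have pt: "\<bar>haar_partial c M y - g y\<bar> powr q \<le> ?H y" for y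
    proof -
      have "\<bar>haar_partial c M y - g y\<bar> powr q \<le> (\<bar>avg (int (Suc M)) g y - g y\<bar> + \<bar>avg (- int M) g y\<bar>) powr q"
        unfolding hp using ep by (intro powr_mono2) (auto simp: add.commute)
      also have "\<dots> \<le> ?H y" using ep by (intro powr_add_le) auto
      finally show ?thesis .
    qed
    have m: "haar_partial c M \<in> borel_measurable borel"
      using hp[of M] by (subst measurable_cong[where g="\<lambda>y. avg (int M + 1) g y - avg (- int M) g y"]) auto
    show li: "loc_int (\<lambda>y. \<bar>haar_partial c M y - g y\<bar> powr q)"
      by (rule loc_int_bound[OF liH]) (use pt gm m in auto)
    have "avg 0 (\<lambda>y. \<bar>haar_partial c M y - g y\<bar> powr q) x \<le> avg 0 ?H x" by (intro avg_mono_cell pt li liH)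
    also have "\<dots> = 2 powr q * (avg 0 (\<lambda>y. \<bar>avg (int (Suc M)) g y - g y\<bar> powr q) x + avg 0 (\<lambda>y. \<bar>avg (- int M) g y\<bar> powr q) x)"
      unfolding avg_cmult by (subst avg_add[OF L lev_loc_int[OF levq]]) simp
    also have "avg 0 (\<lambda>y. \<bar>avg (- int M) g y\<bar> powr q) x = \<bar>avg (- int M) g x\<bar> powr q"
      by (intro avg_lev lev_mono[OF levq]) simp
    finally show "avg 0 (\<lambda>y. \<bar>haar_partial c M y - g y\<bar> powr q) x
       \<le> 2 powr q * (avg 0 (\<lambda>y. \<bar>avg (int (Suc M)) g y - g y\<bar> powr q) x + \<bar>avg (- int M) g x\<bar> powr q)" .
  qed
  have "Lloc_conv q (haar_partial c) g"
  proof (rule Lloc_convI[OF gm _ _ lcq])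
    show "loc_int (\<lambda>y. \<bar>g y\<bar> powr q)" using mbd_loc_int_powr[OF g] qt ep by simp
    show "haar_partial c M \<in> borel_measurable borel" for M
      using hp[of M] by (subst measurable_cong[where g="\<lambda>y. avg (int M + 1) g y - avg (- int M) g y"]) auto
    fix x
    have 1: "(\<lambda>M. avg 0 (\<lambda>y. \<bar>avg (int (Suc M)) g y - g y\<bar> powr q) x) \<longlonglongrightarrow> 0"
      by (rule LIMSEQ_Suc[OF avg_conv_Lq(1)[OF gm mbdD(2)[OF g] less_imp_le[OF ep(2)] qt]])
    have 2: "(\<lambda>M. \<bar>avg (- int M) g x\<bar>) \<longlonglongrightarrow> 0"
    proof (rule tendsto_sandwich[OF _ _ tendsto_const])
      show "(\<lambda>M. K * 2 powr (- (real CARD('n) / s) * real M)) \<longlonglongrightarrow> 0"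
        using summable_LIMSEQ_zero[OF summable_powr[of "real CARD('n) / s"]] ep by (intro tendsto_mult_right_zero) auto
      show "\<forall>\<^sub>F M in sequentially. \<bar>avg (- int M) g x\<bar> \<le> K * 2 powr (- (real CARD('n) / s) * real M)"
      proof (intro always_eventually allI)
        fix M
        have "\<bar>avg (- int M) g x\<bar> \<le> K * 2 powr (real_of_int (- int M) * real CARD('n) / s)"
          using avg_abs_le[OF lg, of "- int M" x] mbd_avg_abs[OF g ep(4) less_imp_le[OF K], of "- int M" x] by linarith
        then show "\<bar>avg (- int M) g x\<bar> \<le> K * 2 powr (- (real CARD('n) / s) * real M)" by (simp add: mult.commute)
      qed
    qed auto
    have 4: "(\<lambda>M. \<bar>avg (- int M) g x\<bar> powr q) \<longlonglongrightarrow> 0 powr q"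
      by (rule tendsto_powr2[OF 2 tendsto_const]) (use ep in auto)
    then have "(\<lambda>M. 2 powr q * (avg 0 (\<lambda>y. \<bar>avg (int (Suc M)) g y - g y\<bar> powr q) x + \<bar>avg (- int M) g x\<bar> powr q)) \<longlonglongrightarrow> 2 powr q * (0 + 0 powr q)"
      by (intro tendsto_mult tendsto_const tendsto_add 1 4)
    then have 3: "(\<lambda>M. 2 powr q * (avg 0 (\<lambda>y. \<bar>avg (int (Suc M)) g y - g y\<bar> powr q) x + \<bar>avg (- int M) g x\<bar> powr q)) \<longlonglongrightarrow> 0" by simp
    show "(\<lambda>M. avg 0 (\<lambda>y. \<bar>haar_partial c M y - g y\<bar> powr q) x) \<longlonglongrightarrow> 0"
    proof (rule tendsto_sandwich[OF _ _ tendsto_const 3])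
      show "\<forall>\<^sub>F M in sequentially. 0 \<le> avg 0 (\<lambda>y. \<bar>haar_partial c M y - g y\<bar> powr q) x"
        by (intro always_eventually allI avg_nonneg powr_ge_zero)
    qed (intro always_eventually allI bq)
  qed
  note L = Lloc_lim_eq[OF this]
  have ceq: "commutator q \<alpha> a f = Lloc_lim q (haar_partial c)" unfolding commutator_def c_def g_def ..
  show "commutator q \<alpha> a f \<in> borel_measurable borel" unfolding ceq using L(2) ep by simp
  have "AE y in lborel. commutator q \<alpha> a f y = g y" unfolding ceq using L(1) ep by simp
  then show "AE y in lborel. commutator q \<alpha> a f y = ?T y" using gT by eventually_elim simp
qed

section \<open>Morrey and BMO norms in terms of averages\<close>

lemma Morrey_cell:
  fixes f :: "real^'n::finite \<Rightarrow> real"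
  assumes "q > 0"
  shows "measure lborel (cell k x) powr (1/p - 1/q) * (LINT y:cell k x|lborel. \<bar>f y\<bar> powr q) powr (1/q)
     = 2 powr (- (real_of_int k * real CARD('n) / p)) * avg k (\<lambda>y. \<bar>f y\<bar> powr q) x powr (1/q)"
proof -
  let ?m = "real_of_int k * real CARD('n)"
  have "(LINT y:cell k x|lborel. \<bar>f y\<bar> powr q) = 2 powr (- ?m) * avg k (\<lambda>y. \<bar>f y\<bar> powr q) x"
    by (simp add: avg_def powr_minus)
  then have "measure lborel (cell k x) powr (1/p - 1/q) * (LINT y:cell k x|lborel. \<bar>f y\<bar> powr q) powr (1/q)
     = (2 powr (- ?m * (1/p - 1/q)) * 2 powr (- ?m * (1/q))) * avg k (\<lambda>y. \<bar>f y\<bar> powr q) x powr (1/q)"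
    by (simp add: measure_cell powr_powr powr_mult)
  also have "2 powr (- ?m * (1/p - 1/q)) * 2 powr (- ?m * (1/q)) = 2 powr (- (?m / p))"
    by (simp add: powr_add[symmetric] algebra_simps)
  finally show ?thesis .
qed

text \<open>The factor |Q|^(1/p - 1/q) turns integrals into averages and leaves the volume power
  2^(-k n/p), which \<open>mbd\<close> places on the other side.\<close>

lemma Morrey_cell_le:
  fixes f :: "real^'n::finite \<Rightarrow> real"
  assumes q: "q > 0" and N: "N \<ge> 0"
  shows "measure lborel (cell k x) powr (1/p - 1/q) * (LINT y:cell k x|lborel. \<bar>f y\<bar> powr q) powr (1/q) \<le> N
    \<longleftrightarrow> avg k (\<lambda>y. \<bar>f y\<bar> powr q) x \<le> (N * 2 powr (real_of_int k * real CARD('n) / p)) powr q"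
proof -
  let ?m = "real_of_int k * real CARD('n) / p" and ?A = "avg k (\<lambda>y. \<bar>f y\<bar> powr q) x"
  have A: "?A \<ge> 0" by (intro avg_nonneg) simp
  have "2 powr (- ?m) * ?A powr (1/q) \<le> N \<longleftrightarrow> ?A powr (1/q) \<le> N * 2 powr ?m"
    by (simp add: powr_minus field_simps)
  also have "\<dots> \<longleftrightarrow> ?A \<le> (N * 2 powr ?m) powr q"
  proof
    assume "?A powr (1/q) \<le> N * 2 powr ?m"
    then have "(?A powr (1/q)) powr q \<le> (N * 2 powr ?m) powr q" using q by (intro powr_mono2) auto
    then show "?A \<le> (N * 2 powr ?m) powr q" using q A by (simp add: powr_powr)
  next
    assume "?A \<le> (N * 2 powr ?m) powr q"
    then have "?A powr (1/q) \<le> ((N * 2 powr ?m) powr q) powr (1/q)" using q A by (intro powr_mono2) auto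
    then show "?A powr (1/q) \<le> N * 2 powr ?m" using q N by (simp add: powr_powr)
  qed
  finally show ?thesis unfolding Morrey_cell[OF q] .
qed

lemma mbd_Morrey:
  fixes f :: "real^'n::finite \<Rightarrow> real"
  assumes "mbd p q f N" "q > 0" "N \<ge> 0"
  shows "f \<in> morrey p q" "morrey_norm p q f \<le> N"
proof -
  have le: "measure lborel Q powr (1/p - 1/q) * (LINT x:Q|lborel. \<bar>f x\<bar> powr q) powr (1/q) \<le> N" if D: "Q \<in> dyadic_cubes" for Q
  proof -
    obtain k x where Q: "Q = cell k x" using D by (auto simp: dyadic_cubes_eq)
    show ?thesis unfolding Q by (rule iffD2[OF Morrey_cell_le[OF assms(2,3)] mbdD(3)[OF assms(1)]])
  qed
  then show "f \<in> morrey p q" using mbdD[OF assms(1)] unfolding morrey_def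
    by (auto simp: Lloc_iff intro!: bdd_aboveI2)
  have "dyadic_cubes \<noteq> ({} :: (real^'n) set set)" by (auto simp: dyadic_cubes_def)
  then show "morrey_norm p q f \<le> N" unfolding morrey_norm_def by (rule cSUP_least) (rule le)
qed

lemma Morrey_mbd:
  fixes f :: "real^'n::finite \<Rightarrow> real"
  assumes "f \<in> morrey p q" "q > 0"
  shows "0 \<le> morrey_norm p q f" "mbd p q f (morrey_norm p q f)"
proof -
  have bdd: "bdd_above ((\<lambda>Q. measure lborel Q powr (1/p - 1/q) * (LINT x:Q|lborel. \<bar>f x\<bar> powr q) powr (1/q)) ` dyadic_cubes)"
    using assms(1) by (simp add: morrey_def)
  have le: "measure lborel (cell k x) powr (1/p - 1/q) * (LINT y:cell k x|lborel. \<bar>f y\<bar> powr q) powr (1/q) \<le> morrey_norm p q f" for k x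
    unfolding morrey_norm_def by (rule cSUP_upper[OF _ bdd]) (auto simp: dyadic_cubes_eq)
  show nn: "0 \<le> morrey_norm p q f"
    by (rule order_trans[OF _ le[of 0 0]]) simp
  show "mbd p q f (morrey_norm p q f)" unfolding mbd_def
    using assms(1) iffD1[OF Morrey_cell_le[OF assms(2) nn] le] by (auto simp: morrey_def Lloc_iff)
qed

text \<open>The cubes through x are exactly one per level, so the supremum runs over the
  integers.\<close>

lemma msharp_eq:
  fixes a :: "real^'n::finite \<Rightarrow> real"
  shows "msharp a x = (SUP j. ereal (avg j (\<lambda>y. \<bar>a y - avg j a x\<bar>) x))"
proof -
  have "{Q \<in> dyadic_cubes. x \<in> Q} = range (\<lambda>j. cell j x)"
    by (auto simp: dyadic_cubes_eq mem_cell) (metis cell_cong rangeI)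
  then show ?thesis unfolding msharp_def by (simp add: image_comp mean_cell)
qed

lemma lev_osc: "lev j (\<lambda>x. avg j (\<lambda>y. \<bar>a y - avg j a x\<bar>) x)"
  unfolding lev_def
proof (intro allI impI)
  fix x y :: "real^'a" assume "idx j x = idx j y"
  then have m: "x \<in> cell j y" by (simp add: mem_cell)
  show "avg j (\<lambda>z. \<bar>a z - avg j a x\<bar>) x = avg j (\<lambda>z. \<bar>a z - avg j a y\<bar>) y"
    unfolding avg_cell[OF m] ..
qed

lemma msharp_measurable: "msharp a \<in> borel_measurable lborel"
proof -
  have [measurable]: "(\<lambda>x. avg j (\<lambda>y. \<bar>a y - avg j a x\<bar>) x) \<in> borel_measurable borel" for j
    using lev_measurable[OF lev_osc] .
  have "(\<lambda>x. SUP j. ereal (avg j (\<lambda>y. \<bar>a y - avg j a x\<bar>) x)) \<in> borel_measurable borel"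
    by (intro borel_measurable_SUP) auto
  then show ?thesis by (simp add: msharp_eq[abs_def])
qed

text \<open>The oscillation over a cube is constant on that cube, and a cube has positive measure;
  therefore no cube can hide in the exceptional null set of the essential supremum.\<close>

lemma bmo_norm_le_iff:
  fixes a :: "real^'n::finite \<Rightarrow> real"
  shows "bmo_norm a \<le> ereal B \<longleftrightarrow> (\<forall>k x. avg k (\<lambda>y. \<bar>a y - avg k a x\<bar>) x \<le> B)"
proof
  assume B: "bmo_norm a \<le> ereal B"
  show "\<forall>k x. avg k (\<lambda>y. \<bar>a y - avg k a x\<bar>) x \<le> B"
  proof (intro allI)
    fix k and x :: "real^'n"
    have ae: "AE y in lborel. msharp a y \<le> ereal B"
      using esssup_AE[where M=lborel and f="msharp a"] B unfolding bmo_norm_def by (auto elim!: eventually_mono)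
    have "\<exists>y\<in>cell k x. msharp a y \<le> ereal B"
    proof (rule ccontr)
      assume "\<not> (\<exists>y\<in>cell k x. msharp a y \<le> ereal B)"
      then have "AE y in lborel. y \<notin> cell k x" using ae by (auto elim!: eventually_mono)
      then have "emeasure lborel (cell k x) = 0" by (subst (asm) AE_iff_measurable[where N="cell k x"]) auto
      then show False by (simp add: emeasure_cell)
    qed
    then obtain y where y: "y \<in> cell k x" "msharp a y \<le> ereal B" by blast
    have "ereal (avg k (\<lambda>z. \<bar>a z - avg k a y\<bar>) y) \<le> msharp a y" unfolding msharp_eq by (rule SUP_upper) simp
    then have "avg k (\<lambda>z. \<bar>a z - avg k a y\<bar>) y \<le> B" using y(2) order_trans by fastforce
    then show "avg k (\<lambda>z. \<bar>a z - avg k a x\<bar>) x \<le> B" using levD[OF lev_osc y(1)] by metis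
  qed
next
  assume "\<forall>k x. avg k (\<lambda>y. \<bar>a y - avg k a x\<bar>) x \<le> B"
  then have "msharp a x \<le> ereal B" for x unfolding msharp_eq by (intro SUP_least) simp
  then show "bmo_norm a \<le> ereal B" unfolding bmo_norm_def
    by (intro esssup_I msharp_measurable AE_I2)
qed

lemma Lloc_1: "a \<in> Lloc 1 \<longleftrightarrow> loc_int a" for a :: "real^'n::finite \<Rightarrow> real"
proof
  assume "a \<in> Lloc 1"
  then have "a \<in> borel_measurable borel" "loc_int (\<lambda>y. \<bar>a y\<bar>)" by (auto simp: Lloc_iff)
  then show "loc_int a" by (auto intro: loc_int_bound)
next
  assume "loc_int a"
  then show "a \<in> Lloc 1" using loc_int_abs[of a] by (simp add: Lloc_iff loc_int_measurable)
qed

lemma osc_le_iff: "osc_le a B \<longleftrightarrow> loc_int a \<and> bmo_norm a \<le> ereal B"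
  by (simp add: osc_le_def bmo_norm_le_iff)

lemma BMO_osc: "a \<in> BMO \<Longrightarrow> \<exists>B. osc_le a B"
proof -
  assume "a \<in> BMO"
  then have "loc_int a" "bmo_norm a < \<infinity>" by (auto simp: BMO_def Lloc_1)
  then show ?thesis unfolding osc_le_iff
    by (cases "bmo_norm a") auto
qed

section \<open>Sufficiency\<close>

text \<open>A crude factor 4 in place of Minkowski's inequality: the bounds are only ever needed up
  to constants.\<close>

lemma mbd_add:
  fixes u v :: "real^'n::finite \<Rightarrow> real"
  assumes u: "mbd s t u K1" and v: "mbd s t v K2" and K: "0 \<le> K1" "0 \<le> K2" and t: "1 \<le> t"
  shows "mbd s t (\<lambda>y. u y + v y) (4 * (K1 + K2))"
proof -
  note um = mbdD[OF u] and vm = mbdD[OF v]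
  let ?H = "\<lambda>y. 2 powr t * (\<bar>u y\<bar> powr t + \<bar>v y\<bar> powr t)"
  have liH: "loc_int ?H" by (intro loc_int_cmult loc_int_add um vm)
  have pt: "\<bar>u y + v y\<bar> powr t \<le> ?H y" for y
  proof -
    have "\<bar>u y + v y\<bar> powr t \<le> (\<bar>u y\<bar> + \<bar>v y\<bar>) powr t" using t by (intro powr_mono2) auto
    also have "\<dots> \<le> ?H y" using t by (intro powr_add_le) auto
    finally show ?thesis .
  qed
  have li: "loc_int (\<lambda>y. \<bar>u y + v y\<bar> powr t)"
    by (rule loc_int_bound[OF liH]) (use pt um vm in auto)
  show ?thesis unfolding mbd_def
  proof (intro conjI allI li)
    show "(\<lambda>y. u y + v y) \<in> borel_measurable borel" using um vm by simp
    fix k x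
    let ?X = "2 powr (real_of_int k * real CARD('n) / s)"
    have "avg k (\<lambda>y. \<bar>u y + v y\<bar> powr t) x \<le> avg k ?H x" by (intro avg_mono_cell pt li liH)
    also have "\<dots> = 2 powr t * (avg k (\<lambda>y. \<bar>u y\<bar> powr t) x + avg k (\<lambda>y. \<bar>v y\<bar> powr t) x)"
      unfolding avg_cmult using avg_add[OF um(2) vm(2)] by simp
    also have "\<dots> \<le> 2 powr t * ((K1 * ?X) powr t + (K2 * ?X) powr t)"
      by (intro mult_left_mono add_mono um vm) simp
    also have "\<dots> \<le> 2 powr t * (2 powr t * ((K1 + K2) * ?X) powr t)"
    proof (rule mult_left_mono)
      have "(K1 * ?X) powr t \<le> ((K1 + K2) * ?X) powr t" "(K2 * ?X) powr t \<le> ((K1 + K2) * ?X) powr t"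
        using K t by (auto intro!: powr_mono2 mult_right_mono)
      moreover have "2 \<le> 2 powr t" using powr_mono[of 1 t 2] t by simp
      then have "2 * ((K1 + K2) * ?X) powr t \<le> 2 powr t * ((K1 + K2) * ?X) powr t" by (intro mult_right_mono) auto
      ultimately show "(K1 * ?X) powr t + (K2 * ?X) powr t \<le> 2 powr t * ((K1 + K2) * ?X) powr t" by linarith
    qed simp
    also have "\<dots> = (4 * (K1 + K2) * ?X) powr t"
    proof -
      have eq: "4 * (K1 + K2) * ?X = 2 * (2 * ((K1 + K2) * ?X))" by simp
      show ?thesis unfolding eq by (simp only: powr_mult)
    qed
    finally show "avg k (\<lambda>y. \<bar>u y + v y\<bar> powr t) x \<le> (4 * (K1 + K2) * ?X) powr t" .
  qed
qed

lemma mbd_diff: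
  fixes u v :: "real^'n::finite \<Rightarrow> real"
  assumes u: "mbd s t u K1" and v: "mbd s t v K2" and K: "0 \<le> K1" "0 \<le> K2" and t: "1 \<le> t"
  shows "mbd s t (\<lambda>y. u y - v y) (4 * (K1 + K2))"
proof -
  have "mbd s t (\<lambda>y. - v y) K2" by (rule mbd_le[OF v]) (use mbdD(1)[OF v] t in auto)
  from mbd_add[OF u this K t] show ?thesis by simp
qed

text \<open>Riesz-Fischer: a rapidly Cauchy subsequence has summable increments and converges almost
  everywhere, and Fatou turns the Cauchy bounds into bounds for the distance to the limit.\<close>

lemma mbd_complete:
  fixes H :: "nat \<Rightarrow> real^'n::finite \<Rightarrow> real"
  assumes t: "t > 1" and Hm: "\<And>k. H k \<in> borel_measurable borel"
    and C: "\<And>\<epsilon>. \<epsilon> > 0 \<Longrightarrow> \<exists>k0. \<forall>k\<ge>k0. \<forall>l\<ge>k0. mbd s t (\<lambda>y. H k y - H l y) \<epsilon>"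
  shows "\<exists>h. h \<in> borel_measurable borel \<and> (\<forall>\<epsilon>>0. \<exists>k0. \<forall>k\<ge>k0. mbd s t (\<lambda>y. H k y - h y) \<epsilon>)"
proof -
  have "\<exists>k0. \<forall>k\<ge>k0. \<forall>l\<ge>k0. mbd s t (\<lambda>y. H k y - H l y) ((1/2) ^ i)" for i
    using C[of "(1/2) ^ i"] by simp
  then obtain m where m: "\<And>i k l. k \<ge> m i \<Longrightarrow> l \<ge> m i \<Longrightarrow> mbd s t (\<lambda>y. H k y - H l y) ((1/2) ^ i)" by metis
  \<comment> \<open>Both \<open>r i\<close> and \<open>r (Suc i)\<close> are at least
    \<open>m i\<close>, so consecutive differences along r are bounded by (1/2)^i;
    \<open>r i \<ge> i\<close> lets the subsequence pass every threshold.\<close>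
  define r where "r i = i + (\<Sum>l\<le>i. m l)" for i
  have rm: "r i \<ge> m i" "r i \<ge> i" "r (Suc i) \<ge> m i" for i
  proof -
    have "m i \<le> (\<Sum>l\<le>i. m l)" by (rule member_le_sum) auto
    then show "r i \<ge> m i" "r i \<ge> i" "r (Suc i) \<ge> m i" by (auto simp: r_def)
  qed
  define g where "g i y = H (r (Suc i)) y - H (r i) y" for i y
  have gm: "mbd s t (g i) ((1/2) ^ i)" for i unfolding g_def by (intro m rm)
  have lig: "loc_int (g i)" for i using mbd_loc_int[OF gm] t by simp
  have "AE y in lborel. summable (\<lambda>i. \<bar>g i y\<bar>)"
  proof (rule AE_summable[OF lig])
    fix x
    show "summable (\<lambda>i. avg 0 (\<lambda>y. \<bar>g i y\<bar>) x)"
    proof (rule summable_comparison_test')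
      show "summable (\<lambda>i. (1/2) ^ i :: real)" by (intro summable_geometric) simp
      fix i
      show "norm (avg 0 (\<lambda>y. \<bar>g i y\<bar>) x) \<le> (1/2) ^ i"
      proof -
        have "avg 0 (\<lambda>y. \<bar>g i y\<bar>) x \<le> (1/2) ^ i * 2 powr (real_of_int 0 * real CARD('n) / s)"
          by (rule mbd_avg_abs[OF gm t]) simp
        moreover have "0 \<le> avg 0 (\<lambda>y. \<bar>g i y\<bar>) x" by (rule avg_nonneg) simp
        ultimately show ?thesis by simp
      qed
    qed
  qed
  then have conv: "AE y in lborel. (\<lambda>i. H (r i) y) \<longlonglongrightarrow> lim (\<lambda>i. H (r i) y)"
  proof eventually_elim
    case (elim y)
    then have "(\<lambda>i. g i y) sums (\<Sum>i. g i y)" by (rule summable_sums[OF summable_rabs_cancel])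
    moreover have "(\<Sum>i<n. g i y) = H (r n) y - H (r 0) y" for n
      unfolding g_def by (rule sum_lessThan_telescope)
    ultimately have "(\<lambda>n. H (r n) y - H (r 0) y) \<longlonglongrightarrow> (\<Sum>i. g i y)" by (simp add: sums_def)
    then have "(\<lambda>n. (H (r n) y - H (r 0) y) + H (r 0) y) \<longlonglongrightarrow> (\<Sum>i. g i y) + H (r 0) y" by (intro tendsto_intros)
    then have "convergent (\<lambda>n. H (r n) y)" by (auto simp: convergent_def)
    then show ?case by (simp add: convergent_LIMSEQ_iff)
  qed
  define h where "h y = lim (\<lambda>i. H (r i) y)" for y
  have hm: "h \<in> borel_measurable borel" unfolding h_def[abs_def]
    by (rule borel_measurable_lim_metric) (rule Hm)
  show ?thesis
  proof (intro exI[of _ h] conjI hm allI impI)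
    fix \<epsilon> :: real assume "\<epsilon> > 0"
    from C[OF this] obtain k0 where k0: "\<And>k l. k \<ge> k0 \<Longrightarrow> l \<ge> k0 \<Longrightarrow> mbd s t (\<lambda>y. H k y - H l y) \<epsilon>" by blast
    have "mbd s t (\<lambda>y. H k y - h y) \<epsilon>" if k: "k \<ge> k0" for k
    proof (rule mbd_fatou[where G="\<lambda>i y. H k y - H (r (i + k0)) y"])
      show "mbd s t (\<lambda>y. H k y - H (r (i + k0)) y) \<epsilon>" for i
        using k rm(2)[of "i + k0"] by (intro k0) auto
      show "(\<lambda>y. H k y - h y) \<in> borel_measurable borel" using Hm hm by simp
      show "AE y in lborel. (\<lambda>i. H k y - H (r (i + k0)) y) \<longlonglongrightarrow> H k y - h y"
        using conv
      proof eventually_elim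
        case (elim y)
        then have "(\<lambda>i. H (r (i + k0)) y) \<longlonglongrightarrow> h y" unfolding h_def by (rule LIMSEQ_ignore_initial_segment)
        then show ?case by (intro tendsto_intros)
      qed
    qed (use t in simp)
    then show "\<exists>k0. \<forall>k\<ge>k0. mbd s t (\<lambda>y. H k y - h y) \<epsilon>" by blast
  qed
qed

lemma diagonal_convergent:
  fixes X :: "nat \<Rightarrow> nat \<Rightarrow> real"
  assumes b: "\<And>k n. \<bar>X k n\<bar> \<le> b n"
  shows "\<exists>r. strict_mono r \<and> (\<forall>n. convergent (\<lambda>k. X (r k) n))"
proof -
  interpret subseqs "\<lambda>n s. convergent (\<lambda>k. X (s k) n)"
  proof
    fix n and s :: "nat \<Rightarrow> nat"
    have "bounded (range (\<lambda>k. X (s k) n))" unfolding bounded_iff using b by auto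
    then obtain l r' where "strict_mono r'" "((\<lambda>k. X (s k) n) \<circ> r') \<longlonglongrightarrow> l"
      using bounded_imp_convergent_subsequence by blast
    then show "\<exists>r'. strict_mono r' \<and> convergent (\<lambda>k. X ((s \<circ> r') k) n)"
      by (auto simp: convergent_def o_def)
  qed
  show ?thesis
  proof (intro exI[of _ diagseq] conjI subseq_diagseq allI)
    fix n
    have "convergent (\<lambda>k. X ((diagseq \<circ> ((+) (Suc n))) k) n)"
    proof (rule diagseq_holds)
      fix r s :: "nat \<Rightarrow> nat" and n assume "strict_mono r" "convergent (\<lambda>k. X (s k) n)"
      then show "convergent (\<lambda>k. X ((s \<circ> r) k) n)"
        using convergent_subseq_convergent[of "\<lambda>k. X (s k) n" r] by (simp add: o_def)
    qed
    then have "convergent (\<lambda>k. X (diagseq (k + Suc n)) n)" by (simp add: o_def add.commute)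
    then show "convergent (\<lambda>k. X (diagseq k) n)" using convergent_ignore_initial_segment[of "\<lambda>k. X (diagseq k) n" "Suc n"] by simp
  qed
qed

text \<open>There are countably many cubes and the averages over each are bounded, so one diagonal
  subsequence serves all cubes at once.\<close>

lemma avg_convergent_subseq:
  fixes F :: "nat \<Rightarrow> real^'n::finite \<Rightarrow> real"
  assumes F: "\<And>k. mbd p q (F k) N" and q: "q > 1" and N: "N \<ge> 0"
  shows "\<exists>r. strict_mono r \<and> (\<forall>j x. convergent (\<lambda>k. avg j (F (r k)) x))"
proof -
  \<comment> \<open>One point in each cube, the cubes being enumerated by the countability of pairs
    of a level and an index vector.\<close>
  define z where "z n = (SOME y. idx (fst (from_nat n :: int \<times> (int^'n))) y = snd (from_nat n :: int \<times> (int^'n)))" for n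
  define j where "j n = fst (from_nat n :: int \<times> (int^'n))" for n
  have li: "loc_int (F k)" for k using mbd_loc_int[OF F] q by simp
  have "\<bar>avg (j n) (F k) (z n)\<bar> \<le> N * 2 powr (real_of_int (j n) * real CARD('n) / p)" for k n
    using avg_abs_le[OF li[of k], of "j n" "z n"] mbd_avg_abs[OF F[of k] q N, of "j n" "z n"] by linarith
  then have "\<exists>r. strict_mono r \<and> (\<forall>n. convergent (\<lambda>k. avg (j n) (F (r k)) (z n)))"
    by (rule diagonal_convergent)
  then obtain r where r: "strict_mono r" "\<And>n. convergent (\<lambda>k. avg (j n) (F (r k)) (z n))" by blast
  have "convergent (\<lambda>k. avg i (F (r k)) x)" for i x
  proof -
    define n where "n = to_nat (i, idx i x)"
    have n: "j n = i" "from_nat n = (i, idx i x)" by (simp_all add: n_def j_def)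
    have "idx i (z n) = idx i x" unfolding z_def n(2) using someI[of "\<lambda>y. idx i y = idx i x" x] by simp
    then have "avg i (F (r k)) (z n) = avg i (F (r k)) x" for k by (intro avg_cell) (simp add: mem_cell)
    then show ?thesis using r(2)[of n] n(1) by simp
  qed
  then show ?thesis using r(1) by blast
qed

text \<open>On cubes of level k >= 0 the average is at most 1. On larger cubes it is at most the
  measure of S over the volume, and q <= p makes this decay sufficient.\<close>

lemma mbd_indicator:
  fixes S :: "(real^'n::finite) set"
  assumes S: "S \<in> sets borel" "emeasure lborel S < \<infinity>" and pq: "1 \<le> q" "q \<le> p"
  shows "mbd p q (indicator S) (1 + measure lborel S)"
proof -
  let ?\<mu> = "measure lborel S" and ?n = "real CARD('n)"
  have eq: "(\<lambda>y. \<bar>indicator S y\<bar> powr q) = (indicator S :: real^'n \<Rightarrow> real)" using pq by (auto simp: indicator_def)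
  have sm: "(indicator S :: real^'n \<Rightarrow> real) \<in> borel_measurable borel" using S by simp
  have li: "loc_int (indicator S)" by (rule loc_int_bound[of "\<lambda>_. 1"]) (use sm in \<open>auto simp: indicator_def\<close>)
  show ?thesis unfolding mbd_def eq
  proof (intro conjI allI sm li)
    fix k and x :: "real^'n"
    have \<mu>: "0 \<le> ?\<mu>" by simp
    show "avg k (indicator S) x \<le> ((1 + ?\<mu>) * 2 powr (real_of_int k * ?n / p)) powr q"
    proof (cases "k \<ge> 0")
      case True
      have "avg k (indicator S) x \<le> avg k (\<lambda>_. 1) x" by (rule avg_mono_cell[OF li]) (auto simp: indicator_def)
      also have "\<dots> \<le> ((1 + ?\<mu>) * 2 powr (real_of_int k * ?n / p)) powr q"
      proof -
        have "1 \<le> 2 powr (real_of_int k * ?n / p)" using True pq by (intro ge_one_powr_ge_zero) auto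
        then have "1 * 1 \<le> (1 + ?\<mu>) * 2 powr (real_of_int k * ?n / p)" using \<mu> by (intro mult_mono) auto
        then have "1 \<le> ((1 + ?\<mu>) * 2 powr (real_of_int k * ?n / p)) powr q" using pq by (intro ge_one_powr_ge_zero) auto
        then show ?thesis by simp
      qed
      finally show ?thesis .
    next
      case False
      have "avg k (indicator S) x \<le> 2 powr (real_of_int k * ?n) * ?\<mu>"
      proof -
        have "(LINT y:cell k x|lborel. indicator S y) = measure lborel (cell k x \<inter> S)"
          by (simp add: set_lebesgue_integral_def indicator_inter_arith[symmetric])
        also have "\<dots> \<le> ?\<mu>" using S by (intro measure_mono_fmeasurable) (auto simp: fmeasurable_def)
        finally show ?thesis unfolding avg_def by (intro mult_left_mono) auto
      qed
      also have "\<dots> \<le> (2 powr (real_of_int k * ?n / p)) powr q * (1 + ?\<mu>) powr q"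
      proof (rule mult_mono)
        have "real_of_int k * ?n \<le> real_of_int k * ?n / p * q"
        proof -
          have "real_of_int k * ?n * 1 \<le> real_of_int k * ?n * (q / p)" using False pq
            by (intro mult_left_mono_neg) (auto simp: mult_nonpos_nonneg)
          then show ?thesis by simp
        qed
        then show "2 powr (real_of_int k * ?n) \<le> (2 powr (real_of_int k * ?n / p)) powr q"
          unfolding powr_powr by (intro powr_mono) auto
        have "(1 + ?\<mu>) powr 1 \<le> (1 + ?\<mu>) powr q" using \<mu> pq by (intro powr_mono) auto
        then show "?\<mu> \<le> (1 + ?\<mu>) powr q" using \<mu> by simp
      qed auto
      also have "\<dots> = ((1 + ?\<mu>) * 2 powr (real_of_int k * ?n / p)) powr q" by (simp add: powr_mult)
      finally show ?thesis .
    qed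
  qed
qed

lemma osc_le_bounded:
  fixes g :: "real^'n::finite \<Rightarrow> real"
  assumes "loc_int g" "\<And>y. \<bar>g y\<bar> \<le> c"
  shows "osc_le g (2 * c)"
  unfolding osc_le_def
proof (intro conjI allI assms(1))
  fix k x
  have b: "\<bar>avg k g x\<bar> \<le> c"
  proof -
    have "\<bar>avg k g x\<bar> \<le> avg k (\<lambda>y. \<bar>g y\<bar>) x" by (rule avg_abs_le[OF assms(1)])
    also have "\<dots> \<le> avg k (\<lambda>y. c) x" by (intro avg_mono_cell loc_int_abs assms loc_int_const)
    finally show ?thesis by simp
  qed
  have "avg k (\<lambda>y. \<bar>g y - avg k g x\<bar>) x \<le> avg k (\<lambda>y. 2 * c) x"
    by (intro avg_mono_cell loc_int_abs loc_int_diff assms(1) loc_int_const) (use assms(2) b in \<open>smt (verit)\<close>)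
  then show "avg k (\<lambda>y. \<bar>g y - avg k g x\<bar>) x \<le> 2 * c" by simp
qed

text \<open>Of an element of the span only two facts are used: it is constant on the cubes of some
  level, and its support is bounded.\<close>

lemma haar_span_simple:
  fixes g :: "real^'n::finite \<Rightarrow> real"
  assumes "g \<in> haar_span"
  shows "\<exists>K. lev K g \<and> bounded {y. g y \<noteq> 0}"
proof -
  obtain S c where S: "finite S" and g: "g = (\<lambda>x. \<Sum>(e,j,m)\<in>S. c (e,j,m) * haar e j m x)"
    using assms by (auto simp: haar_span_def)
  show ?thesis unfolding g using S
  proof (induction S rule: finite_induct)
    case empty
    show ?case by (intro exI[of _ 0]) simp
  next
    case (insert v S)
    obtain e j m where v: "v = (e, j, m)" using prod_cases3 by blast
    let ?h = "\<lambda>x. c (e,j,m) * haar e j m x" and ?g = "\<lambda>x. \<Sum>(e,j,m)\<in>S. c (e,j,m) * haar e j m x"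
    obtain K where K: "lev K ?g" "bounded {y. ?g y \<noteq> 0}" using insert.IH by blast
    have eq: "(\<lambda>x. \<Sum>(e,j,m)\<in>insert v S. c (e,j,m) * haar e j m x) = (\<lambda>x. ?h x + ?g x)"
      using insert.hyps by (simp add: v)
    have "lev (max K (j + 1)) (\<lambda>x. ?h x + ?g x)"
      by (intro lev_arith(1,3) lev_const lev_mono[OF lev_haar] lev_mono[OF K(1)]) auto
    moreover have "bounded {y. ?h y + ?g y \<noteq> 0}"
    proof (rule bounded_subset)
      show "bounded (dcube j m \<union> {y. ?g y \<noteq> 0})" using K(2) bounded_dcube by simp
      show "{y. ?h y + ?g y \<noteq> 0} \<subseteq> dcube j m \<union> {y. ?g y \<noteq> 0}"
      proof
        fix y assume y: "y \<in> {y. ?h y + ?g y \<noteq> 0}"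
        show "y \<in> dcube j m \<union> {y. ?g y \<noteq> 0}"
        proof (cases "idx j y = m")
          case False
          then have hz: "?h y = 0" by (simp add: haar_eq_0)
          have "?g y \<noteq> 0" using y unfolding mem_Collect_eq hz by simp
          then show ?thesis by blast
        qed (simp add: mem_dcube)
      qed
    qed
    moreover have "{y. ?h y + ?g y \<noteq> 0} = {y. (\<Sum>(e,j,m)\<in>insert v S. c (e,j,m) * haar e j m y) \<noteq> 0}"
      using fun_cong[OF eq] by (simp only:)
    ultimately show ?case unfolding eq by (intro exI[of _ "max K (j + 1)"] conjI) (simp_all only:)
  qed
qed

lemma lev_bounded_support:
  fixes g :: "real^'n::finite \<Rightarrow> real"
  assumes g: "lev K g" and b: "bounded {y. g y \<noteq> 0}"
  obtains c where "c > 0" "\<And>y. \<bar>g y\<bar> \<le> c"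
proof -
  let ?B = "{y. g y \<noteq> 0}"
  have "g ` ?B \<subseteq> (\<lambda>m. g (SOME x. idx K x = m)) ` (idx K ` ?B)"
  proof
    fix w assume "w \<in> g ` ?B"
    then obtain y where y: "y \<in> ?B" "w = g y" by blast
    have "idx K (SOME x. idx K x = idx K y) = idx K y" by (rule someI[of _ y]) simp
    then have "g (SOME x. idx K x = idx K y) = g y" using g unfolding lev_def by blast
    then have "w = (\<lambda>m. g (SOME x. idx K x = m)) (idx K y)" using y by simp
    moreover have "idx K y \<in> idx K ` ?B" using y by blast
    ultimately show "w \<in> (\<lambda>m. g (SOME x. idx K x = m)) ` (idx K ` ?B)" by (rule image_eqI)
  qed
  then have "finite (g ` ?B)" by (rule finite_subset) (intro finite_imageI finite_idx_image b)
  then have "bounded (g ` ?B)" by (rule finite_imp_bounded)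
  then obtain c where c: "\<And>w. w \<in> g ` ?B \<Longrightarrow> norm w \<le> c" unfolding bounded_iff by blast
  have "\<bar>g y\<bar> \<le> \<bar>c\<bar> + 1" for y
  proof (cases "g y = 0")
    case False
    then have "\<bar>g y\<bar> \<le> c" using c[of "g y"] by auto
    then show ?thesis by simp
  qed simp
  then show ?thesis using that[of "\<bar>c\<bar> + 1"] by fastforce
qed

text \<open>Linearity is exact for the truncations and passes to the almost everywhere
  limits.\<close>

lemma comm_series_diff:
  fixes f f' :: "real^'n::finite \<Rightarrow> real"
  assumes ex: "morrey_exps TYPE('n) \<alpha> p q s t" and f: "mbd p q f N" "mbd p q f' N" "N \<ge> 0" and a: "osc_le a B"
  shows "AE y in lborel. comm_series \<alpha> a f y - comm_series \<alpha> a f' y = comm_series \<alpha> a (\<lambda>z. f z - f' z) y"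
proof -
  have q: "q \<ge> 1" using ex by (auto simp: morrey_exps_def)
  have d: "mbd p q (\<lambda>z. f z - f' z) (4 * (N + N))" by (rule mbd_diff[OF f(1,2,3,3) q])
  have a': "osc_le a (B + 1)" using a unfolding osc_le_def by (meson add_increasing2 zero_le_one)
  have B': "B + 1 > 0" using osc_nonneg[OF a] by simp
  have li: "loc_int f" "loc_int f'" using mbd_loc_int f q by blast+
  have li2: "loc_int (\<lambda>z. a z * f z)" "loc_int (\<lambda>z. a z * f' z)"
    using frac_adm_Morrey(2)[OF ex f(1,3) a' B'] frac_adm_Morrey(2)[OF ex f(2,3) a' B'] by (auto simp: frac_adm_def)
  have lin: "scale_comm \<alpha> a J (\<lambda>z. f z - f' z) y = scale_comm \<alpha> a J f y - scale_comm \<alpha> a J f' y" for J y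
    unfolding scale_comm_def right_diff_distrib avg_diff[OF li] avg_diff[OF li2]
    by (simp add: sum_subtractf[symmetric] algebra_simps)
  have N8: "0 \<le> 4 * (N + N)" using f by simp
  show ?thesis
    using comm_series_lim(1)[OF ex f(1,3) a] comm_series_lim(1)[OF ex f(2,3) a] comm_series_lim(1)[OF ex d N8 a]
  proof eventually_elim
    case (elim y)
    let ?k = "2 powr \<alpha> - 1"
    have "(\<lambda>M. ?k * scale_comm \<alpha> a {- int M..int M} f y - ?k * scale_comm \<alpha> a {- int M..int M} f' y) \<longlonglongrightarrow> comm_series \<alpha> a f y - comm_series \<alpha> a f' y"
      by (intro tendsto_diff elim)
    then have "(\<lambda>M. ?k * scale_comm \<alpha> a {- int M..int M} (\<lambda>z. f z - f' z) y) \<longlonglongrightarrow> comm_series \<alpha> a f y - comm_series \<alpha> a f' y"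
      unfolding lin right_diff_distrib .
    then show ?case using elim(3) LIMSEQ_unique by blast
  qed
qed

text \<open>Additivity in the symbol, again read off from the truncations. It separates a step
  function from a remainder of small BMO norm.\<close>

lemma comm_series_split:
  fixes f :: "real^'n::finite \<Rightarrow> real"
  assumes ex: "morrey_exps TYPE('n) \<alpha> p q s t" and f: "mbd p q f N" "N \<ge> 0" and a: "osc_le (\<lambda>z. a z - g z) B" and g: "osc_le g B'"
    and ag: "osc_le a B''"
  shows "AE y in lborel. comm_series \<alpha> a f y = comm_series \<alpha> (\<lambda>z. a z - g z) f y + comm_series \<alpha> g f y"
proof -
  have step: "osc_le b (C + 1) \<and> C + 1 > 0" if "osc_le b C" for b :: "real^'n \<Rightarrow> real" and C
    using that osc_nonneg[OF that] unfolding osc_le_def by (smt (verit))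
  have li2: "loc_int (\<lambda>z. a z * f z)" "loc_int (\<lambda>z. g z * f z)"
    using frac_adm_Morrey(2)[OF ex f] step[OF ag] step[OF g] by (auto simp: frac_adm_def)
  have lin: "scale_comm \<alpha> (\<lambda>z. a z - g z) J f y = scale_comm \<alpha> a J f y - scale_comm \<alpha> g J f y" for J y
    unfolding scale_comm_def left_diff_distrib avg_diff[OF li2]
    by (simp add: sum_subtractf[symmetric] algebra_simps)
  show ?thesis
    using comm_series_lim(1)[OF ex f a] comm_series_lim(1)[OF ex f g] comm_series_lim(1)[OF ex f ag]
  proof eventually_elim
    case (elim y)
    let ?k = "2 powr \<alpha> - 1"
    have "(\<lambda>M. ?k * scale_comm \<alpha> (\<lambda>z. a z - g z) {- int M..int M} f y + ?k * scale_comm \<alpha> g {- int M..int M} f y)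
        \<longlonglongrightarrow> comm_series \<alpha> (\<lambda>z. a z - g z) f y + comm_series \<alpha> g f y"
      by (intro tendsto_add elim)
    then have "(\<lambda>M. ?k * scale_comm \<alpha> a {- int M..int M} f y) \<longlonglongrightarrow> comm_series \<alpha> (\<lambda>z. a z - g z) f y + comm_series \<alpha> g f y"
      unfolding lin by (simp add: right_diff_distrib)
    then show ?case using elim(3) LIMSEQ_unique by blast
  qed
qed

lemma scale_sum_singleton: "scale_sum \<alpha> {K} f y = 2 powr (- \<alpha> * real_of_int K) * avg K f y"
  by (simp add: scale_sum_def)

text \<open>For a symbol g of level K the levels j >= K drop out, because E_j commutes with
  multiplication by g. At coarser levels g E_j f is controlled by the weighted sum of coarse
  averages, and E_j (g f) = E_j (g E_K f) only involves the level K averages on the support. The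
  commutator is thus dominated by e times scale sums of an indicator.\<close>

lemma comm_simple_small:
  fixes g :: "real^'n::finite \<Rightarrow> real"
  assumes ex: "morrey_exps TYPE('n) \<alpha> p q s t" and g: "lev K g" "bounded {y. g y \<noteq> 0}"
  shows "\<exists>C>0. \<forall>f N e. mbd p q f N \<longrightarrow> N \<ge> 0 \<longrightarrow> e > 0 \<longrightarrow> (\<forall>y. g y \<noteq> 0 \<longrightarrow> \<bar>avg K f y\<bar> \<le> e) \<longrightarrow>
     (\<forall>y M. g y \<noteq> 0 \<longrightarrow> (\<Sum>j\<in>{- int M..<K}. 2 powr (- \<alpha> * real_of_int j) * \<bar>avg j f y\<bar>) \<le> e) \<longrightarrow>
     mbd s t (comm_series \<alpha> g f) (C * e)"
proof -
  have ep: "0 < \<alpha>" "1 < q" "q \<le> p" "1 < t" "t \<le> s" using ex by (auto simp: morrey_exps_def)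
  obtain c where c: "c > 0" "\<And>y. \<bar>g y\<bar> \<le> c" using lev_bounded_support[OF g] by blast
  define S where "S = {y. g y \<noteq> 0}"
  have levS: "lev K (indicator S :: real^'n \<Rightarrow> real)"
    using lev_comp[OF g(1), of "\<lambda>w. of_bool (w \<noteq> 0) :: real"] by (simp add: S_def indicator_def[abs_def])
  have Sm: "S \<in> sets borel" using lev_measurable[OF levS] by (simp add: borel_measurable_indicator_iff)
  have Sf: "emeasure lborel S < \<infinity>" using emeasure_bounded_finite g(2) unfolding S_def by blast
  define NS where "NS = 1 + measure lborel S"
  have NS: "NS > 0" "mbd p q (indicator S :: real^'n \<Rightarrow> real) NS" using mbd_indicator[OF Sm Sf] ep by (auto simp: NS_def add_pos_nonneg)
  have lg: "loc_int g" using lev_loc_int[OF g(1)] .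
  have og: "osc_le g (2 * c)" by (rule osc_le_bounded[OF lg c(2)])
  obtain C0 where C0: "C0 > 0" "\<And>(f::real^'n \<Rightarrow> real) N J. mbd p q f N \<Longrightarrow> N > 0 \<Longrightarrow> finite J \<Longrightarrow>
     mbd s t (\<lambda>y. scale_sum \<alpha> J (\<lambda>z. \<bar>f z\<bar>) y) (C0 * N)"
    using scale_sum_Morrey[OF ex] by blast
  have C0': "mbd s t (\<lambda>y. scale_sum \<alpha> J (indicator S) y) (C0 * NS)" if "finite J" for J
    using C0(2)[OF NS(2,1) that] by simp
  let ?k = "2 powr \<alpha> - 1"
  have k: "?k > 0" using powr_minus_1_pos ep by blast
  define C where "C = ?k * (4 * (c * 2 powr (\<alpha> * real_of_int K) * (C0 * NS) + c * (C0 * NS)))"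
  show ?thesis
  proof (intro exI[of _ C] conjI allI impI)
    show "C > 0" using k c C0 NS by (simp add: C_def add_pos_pos)
    fix f N and e :: real
    assume f: "mbd p q f N" and N: "N \<ge> 0" and e: "e > 0" and e1: "\<forall>y. g y \<noteq> 0 \<longrightarrow> \<bar>avg K f y\<bar> \<le> e"
      and e2: "\<forall>y M. g y \<noteq> 0 \<longrightarrow> (\<Sum>j\<in>{- int M..<K}. 2 powr (- \<alpha> * real_of_int j) * \<bar>avg j f y\<bar>) \<le> e"
    have lf: "loc_int f" using mbd_loc_int[OF f] ep by simp
    have lgf: "loc_int (\<lambda>z. g z * f z)" by (rule loc_int_lev_mult[OF g(1) lf])
    have liS: "loc_int (indicator S :: real^'n \<Rightarrow> real)" using lev_loc_int[OF levS] .
    have gS: "\<bar>g y\<bar> \<le> c * indicator S y" for y using c(2)[of y] c(1) by (auto simp: S_def indicator_def)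
    let ?w = "\<lambda>j. 2 powr (- \<alpha> * real_of_int j)"
    have bnd: "\<bar>scale_comm \<alpha> g {- int M..int M} f y\<bar> \<le>
        \<bar>(e * (c * 2 powr (\<alpha> * real_of_int K))) * scale_sum \<alpha> {K} (indicator S) y + (e * c) * scale_sum \<alpha> {- int M..int M} (indicator S) y\<bar>" for M y
    proof -
      let ?J = "{- int M..int M}"
      have z: "g y * avg j f y - avg j (\<lambda>z. g z * f z) y = 0" if "K \<le> j" for j
        using avg_lev_mult[OF lev_mono[OF g(1) that], of f y] by simp
      \<comment> \<open>By the tower property g f may be averaged to level K first, where g factors
        out and only the small averages of f remain.\<close>
      have t2: "\<bar>avg j (\<lambda>z. g z * f z) y\<bar> \<le> (e * c) * avg j (indicator S) y" if jK: "j \<le> K" for j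
      proof -
        have "avg j (\<lambda>z. g z * f z) y = avg j (avg K (\<lambda>z. g z * f z)) y" by (rule avg_tower[symmetric, OF lgf jK])
        then have "\<bar>avg j (\<lambda>z. g z * f z) y\<bar> \<le> avg j (\<lambda>z. \<bar>avg K (\<lambda>z. g z * f z) z\<bar>) y"
          using avg_abs_le[OF loc_int_avg, of j K "\<lambda>z. g z * f z" y] by simp
        also have "\<dots> \<le> avg j (\<lambda>z. (e * c) * indicator S z) y"
        proof (intro avg_mono_cell loc_int_abs loc_int_avg loc_int_cmult liS)
          fix z
          have "avg K (\<lambda>z. g z * f z) z = g z * avg K f z" by (rule avg_lev_mult[OF g(1)])
          moreover have "\<bar>g z * avg K f z\<bar> \<le> (e * c) * indicator S z"
          proof (cases "g z = 0")
            case False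
            then have "\<bar>g z\<bar> * \<bar>avg K f z\<bar> \<le> c * e" using e1 c by (intro mult_mono) auto
            then show ?thesis using False by (simp add: abs_mult S_def mult.commute)
          qed (simp add: S_def)
          ultimately show "\<bar>avg K (\<lambda>z. g z * f z) z\<bar> \<le> (e * c) * indicator S z" by simp
        qed
        finally show ?thesis by (simp only: avg_cmult)
      qed
      have t1: "(\<Sum>j\<in>{j\<in>?J. j < K}. ?w j * \<bar>g y * avg j f y\<bar>) \<le> (e * c) * indicator S y"
      proof (cases "g y = 0")
        case False
        have "(\<Sum>j\<in>{j\<in>?J. j < K}. ?w j * \<bar>g y * avg j f y\<bar>) \<le> (\<Sum>j\<in>{- int M..<K}. ?w j * \<bar>g y * avg j f y\<bar>)"
          by (rule sum_mono2) auto
        also have "\<dots> = \<bar>g y\<bar> * (\<Sum>j\<in>{- int M..<K}. ?w j * \<bar>avg j f y\<bar>)"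
          by (simp add: sum_distrib_left abs_mult mult_ac)
        also have "\<dots> \<le> c * e" using c e2 False by (intro mult_mono sum_nonneg) auto
        finally show ?thesis using False by (simp add: S_def mult.commute)
      qed (simp add: S_def)
      have "\<bar>scale_comm \<alpha> g ?J f y\<bar> = \<bar>\<Sum>j\<in>{j\<in>?J. j < K}. ?w j * (g y * avg j f y - avg j (\<lambda>z. g z * f z) y)\<bar>"
        unfolding scale_comm_def
      proof (rule arg_cong[where f=abs], rule sum.mono_neutral_right)
        show "\<forall>i\<in>?J - {j\<in>?J. j < K}. ?w i * (g y * avg i f y - avg i (\<lambda>z. g z * f z) y) = 0"
        proof
          fix i assume "i \<in> ?J - {j\<in>?J. j < K}"
          then have "K \<le> i" by auto
          show "?w i * (g y * avg i f y - avg i (\<lambda>z. g z * f z) y) = 0" unfolding z[OF \<open>K \<le> i\<close>] by simp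
        qed
      qed auto
      also have "\<dots> \<le> (\<Sum>j\<in>{j\<in>?J. j < K}. \<bar>?w j * (g y * avg j f y - avg j (\<lambda>z. g z * f z) y)\<bar>)" by (rule sum_abs)
      also have "\<dots> \<le> (\<Sum>j\<in>{j\<in>?J. j < K}. ?w j * \<bar>g y * avg j f y\<bar> + ?w j * ((e * c) * avg j (indicator S) y))"
      proof (rule sum_mono)
        fix j assume j: "j \<in> {j\<in>?J. j < K}"
        have "\<bar>g y * avg j f y - avg j (\<lambda>z. g z * f z) y\<bar> \<le> \<bar>g y * avg j f y\<bar> + (e * c) * avg j (indicator S) y"
          using t2[of j] j by (smt (verit) mem_Collect_eq)
        then have "?w j * \<bar>g y * avg j f y - avg j (\<lambda>z. g z * f z) y\<bar> \<le> ?w j * (\<bar>g y * avg j f y\<bar> + (e * c) * avg j (indicator S) y)"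
          by (intro mult_left_mono) auto
        then show "\<bar>?w j * (g y * avg j f y - avg j (\<lambda>z. g z * f z) y)\<bar> \<le> ?w j * \<bar>g y * avg j f y\<bar> + ?w j * ((e * c) * avg j (indicator S) y)"
          by (simp add: abs_mult distrib_left)
      qed
      also have "\<dots> = (\<Sum>j\<in>{j\<in>?J. j < K}. ?w j * \<bar>g y * avg j f y\<bar>) + (\<Sum>j\<in>{j\<in>?J. j < K}. ?w j * ((e * c) * avg j (indicator S) y))"
        by (rule sum.distrib)
      also have "\<dots> \<le> (e * c) * indicator S y + (\<Sum>j\<in>?J. ?w j * ((e * c) * avg j (indicator S) y))"
      proof (rule add_mono[OF t1], rule sum_mono2)
        fix j
        have "0 \<le> avg j (indicator S) y" by (rule avg_nonneg) simp
        then show "0 \<le> ?w j * ((e * c) * avg j (indicator S) y)" using e c by simp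
      qed auto
      also have "(\<Sum>j\<in>?J. ?w j * ((e * c) * avg j (indicator S) y)) = (e * c) * scale_sum \<alpha> ?J (indicator S) y"
        unfolding scale_sum_def by (simp add: sum_distrib_left mult_ac)
      \<comment> \<open>The multiple of the indicator of S is rewritten as a scale sum over the
        single level K, so that one Morrey bound covers both parts.\<close>
      also have "(e * c) * indicator S y = (e * (c * 2 powr (\<alpha> * real_of_int K))) * scale_sum \<alpha> {K} (indicator S) y"
        unfolding scale_sum_singleton avg_lev[OF levS] by (simp add: powr_minus)
      finally show ?thesis by simp
    qed
    have lim: "AE y in lborel. (\<lambda>M. ?k * scale_comm \<alpha> g {- int M..int M} f y) \<longlonglongrightarrow> comm_series \<alpha> g f y"
      and cm: "comm_series \<alpha> g f \<in> borel_measurable borel" using comm_series_lim[OF ex f N og] by auto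
    have "mbd s t (\<lambda>y. ?k * scale_comm \<alpha> g {- int M..int M} f y) (C * e)" for M
    proof -
      let ?a = "e * (c * 2 powr (\<alpha> * real_of_int K))" and ?b = "e * c"
      have CN: "0 \<le> C0 * NS" using C0 NS by simp
      have ab: "?a > 0" "?b > 0" using e c by auto
      have "mbd s t (\<lambda>y. ?a * scale_sum \<alpha> {K} (indicator S) y + ?b * scale_sum \<alpha> {- int M..int M} (indicator S) y) (4 * (\<bar>?a\<bar> * (C0 * NS) + \<bar>?b\<bar> * (C0 * NS)))"
        using ep CN by (intro mbd_add mbd_cmult C0') auto
      then have "mbd s t (scale_comm \<alpha> g {- int M..int M} f) (4 * (\<bar>?a\<bar> * (C0 * NS) + \<bar>?b\<bar> * (C0 * NS)))"
      proof (rule mbd_le)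
        show "scale_comm \<alpha> g {- int M..int M} f \<in> borel_measurable borel" unfolding scale_comm_def[abs_def]
          using loc_int_measurable[OF lg] by measurable
      qed (use bnd ep in auto)
      then have "mbd s t (\<lambda>y. ?k * scale_comm \<alpha> g {- int M..int M} f y) (\<bar>?k\<bar> * (4 * (\<bar>?a\<bar> * (C0 * NS) + \<bar>?b\<bar> * (C0 * NS))))"
        using CN by (intro mbd_cmult) auto
      moreover have "\<bar>?k\<bar> * (4 * (\<bar>?a\<bar> * (C0 * NS) + \<bar>?b\<bar> * (C0 * NS))) = C * e"
      proof -
        have "\<bar>?k\<bar> = ?k" "\<bar>?a\<bar> = ?a" "\<bar>?b\<bar> = ?b" using ab k by linarith+
        then show ?thesis unfolding C_def by (simp only: distrib_left distrib_right mult_ac)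
      qed
      ultimately show ?thesis by simp
    qed
    then show "mbd s t (comm_series \<alpha> g f) (C * e)" by (rule mbd_fatou[OF _ cm _ lim]) (use ep in simp)
  qed
qed

lemma VMO_compact:
  fixes a :: "real^'n::finite \<Rightarrow> real"
  assumes ex: "morrey_exps TYPE('n) \<alpha> p q s t" and a: "a \<in> VMO"
  shows "compact_op p q s t (commutator q \<alpha> a)"
proof -
  let ?n = "real CARD('n)"
  have ep: "0 < \<alpha>" "1 < q" "q \<le> p" "1 < t" "t \<le> s" using ex by (auto simp: morrey_exps_def)
  define \<sigma> where "\<sigma> = ?n / s"
  have \<sigma>: "\<sigma> > 0" using ep by (simp add: \<sigma>_def)
  have aB: "a \<in> BMO" using a by (simp add: VMO_def)
  obtain B where B: "osc_le a B" using BMO_osc[OF aB] by blast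
  have la: "loc_int a" using B by (simp add: osc_le_def)
  obtain C where C: "C > 0" "\<And>(a::real^'n \<Rightarrow> real) B f N. osc_le a B \<Longrightarrow> B > 0 \<Longrightarrow> mbd p q f N \<Longrightarrow> N > 0 \<Longrightarrow>
     mbd s t (comm_series \<alpha> a f) (C * B * N)"
    using comm_series_Morrey[OF ex] by blast
  have a': "osc_le a (B + 1)" using B unfolding osc_le_def by (meson add_increasing2 zero_le_one)
  have B': "B + 1 > 0" using osc_nonneg[OF B] by simp
  show ?thesis unfolding compact_op_def
  proof (intro conjI allI ballI impI)
    fix f :: "real^'n \<Rightarrow> real" assume fm: "f \<in> morrey p q"
    have f: "mbd p q f (morrey_norm p q f)" "0 \<le> morrey_norm p q f" using Morrey_mbd[OF fm] ep by simp_all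
    define N where "N = morrey_norm p q f + 1"
    have N: "mbd p q f N" "N > 0" using mbd_mono[OF f, of N] f(2) ep by (auto simp: N_def)
    have "mbd s t (commutator q \<alpha> a f) (C * (B + 1) * N)"
      using commutator_eq[OF ex f(1) B] by (intro mbd_cong_AE[OF C(2)[OF a' B' N]])
    then show "commutator q \<alpha> a f \<in> morrey s t" by (rule mbd_Morrey) (use ep C B' N in auto)
  next
    fix F :: "nat \<Rightarrow> real^'n \<Rightarrow> real"
    assume F: "(\<forall>k. F k \<in> morrey p q) \<and> bdd_above (range (\<lambda>k. morrey_norm p q (F k)))"
    then obtain N0 where N0: "\<And>k. morrey_norm p q (F k) \<le> N0" by (auto simp: bdd_above_def)
    define N where "N = max N0 1"
    have N: "N > 0" "N \<ge> 0" by (auto simp: N_def)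
    have FN: "mbd p q (F k) N" for k
      by (rule mbd_mono[OF Morrey_mbd(2,1)]) (use F N0[of k] ep in \<open>auto simp: N_def\<close>)
    obtain r where r: "strict_mono r" "\<And>j x. convergent (\<lambda>k. avg j (F (r k)) x)"
      using avg_convergent_subseq[where F=F, OF FN ep(2) N(2)] by blast
    have liF: "loc_int (F k)" for k using mbd_loc_int[OF FN] ep by simp
    define H where "H k = commutator q \<alpha> a (F (r k))" for k
    have Hm: "H k \<in> borel_measurable borel" for k unfolding H_def by (rule commutator_eq[OF ex FN B])
    let ?f = "\<lambda>k l z. F (r k) z - F (r l) z"
    have fN: "mbd p q (?f k l) (8 * N)" for k l using mbd_diff[OF FN FN N(2) N(2)] ep by simp
    have li: "loc_int (?f k l)" for k l using liF by blast
    have Hd: "AE y in lborel. H k y - H l y = comm_series \<alpha> a (?f k l) y" for k l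
      using commutator_eq(1)[OF ex FN[of "r k"] B] commutator_eq(1)[OF ex FN[of "r l"] B] comm_series_diff[OF ex FN[of "r k"] FN[of "r l"] N(2) B]
      by eventually_elim (simp add: H_def)
    have Cauchy: "\<exists>k0. \<forall>k\<ge>k0. \<forall>l\<ge>k0. mbd s t (\<lambda>y. H k y - H l y) \<epsilon>" if \<epsilon>: "\<epsilon> > 0" for \<epsilon>
    proof -
      \<comment> \<open>The factor 4 of \<open>mbd_add\<close> and the bound 8 N for differences of
        the sequence are anticipated here; the remainder a - g then contributes \<epsilon>/2, and
        \<open>e\<close> below gives the other half to g.\<close>
      define \<delta> where "\<delta> = \<epsilon> / (8 * (C * (8 * N)))"
      have \<delta>: "\<delta> > 0" using \<epsilon> C N by (simp add: \<delta>_def)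
      obtain g where g: "g \<in> haar_span" "bmo_norm (\<lambda>x. a x - g x) < ereal \<delta>" using a \<delta> unfolding VMO_def by blast
      obtain K where K: "lev K g" "bounded {y. g y \<noteq> 0}" using haar_span_simple[OF g(1)] by blast
      have lg: "loc_int g" using lev_loc_int[OF K(1)] .
      obtain c where c: "c > 0" "\<And>y. \<bar>g y\<bar> \<le> c" using lev_bounded_support[OF K] by blast
      have og: "osc_le g (2 * c)" by (rule osc_le_bounded[OF lg c(2)])
      have oag: "osc_le (\<lambda>x. a x - g x) \<delta>" unfolding osc_le_iff using g(2) la lg by auto
      obtain C' where C': "C' > 0" "\<And>f N e. mbd p q f N \<Longrightarrow> N \<ge> 0 \<Longrightarrow> e > 0 \<Longrightarrow> (\<forall>y. g y \<noteq> 0 \<longrightarrow> \<bar>avg K f y\<bar> \<le> e) \<Longrightarrow>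
         (\<forall>y M. g y \<noteq> 0 \<longrightarrow> (\<Sum>j\<in>{- int M..<K}. 2 powr (- \<alpha> * real_of_int j) * \<bar>avg j f y\<bar>) \<le> e) \<Longrightarrow>
         mbd s t (comm_series \<alpha> g f) (C' * e)"
        using comm_simple_small[OF ex K] by blast
      define e where "e = \<epsilon> / (8 * C')"
      have e: "e > 0" using \<epsilon> C' by (simp add: e_def)
      obtain C4 where C4: "C4 > 0" "\<And>(J::int set) x. finite J \<Longrightarrow> (\<forall>j\<in>J. real_of_int j \<le> x) \<Longrightarrow> (\<Sum>j\<in>J. 2 powr (\<sigma> * real_of_int j)) \<le> C4 * 2 powr (\<sigma> * x)"
        using geo_sum_down[OF \<sigma>] by blast
      have "(\<lambda>L. (8 * N * C4) * 2 powr (- \<sigma> * real L)) \<longlonglongrightarrow> 0"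
        by (intro tendsto_mult_right_zero summable_LIMSEQ_zero[OF summable_powr[OF \<sigma>]])
      then have "\<forall>\<^sub>F L in sequentially. (8 * N * C4) * 2 powr (- \<sigma> * real L) < e/2" using e by (intro order_tendstoD) auto
      then have "\<forall>\<^sub>F L in sequentially. (8 * N * C4) * 2 powr (- \<sigma> * real L) < e/2 \<and> nat (- K) \<le> L"
        using eventually_ge_at_top by (rule eventually_conj)
      then obtain L where L: "(8 * N * C4) * 2 powr (- \<sigma> * real L) < e/2" and LK': "nat (- K) \<le> L"
        unfolding eventually_sequentially by blast
      have LK: "- int L \<le> K" using LK' by linarith
      let ?w = "\<lambda>j. 2 powr (- \<alpha> * real_of_int j)"
      \<comment> \<open>One point in each level K cube that meets the support of g. This is a finite
        set, and an average at a level j <= K depends only on that cube.\<close>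
      let ?Y = "(\<lambda>m. SOME x. idx K x = m) ` (idx K ` {y. g y \<noteq> 0})"
      have finY: "finite ?Y" using finite_idx_image[OF K(2)] by blast
      have small: "\<forall>\<^sub>F m in sequentially. \<forall>k\<ge>m. \<forall>l\<ge>m. \<bar>avg j (?f k l) x\<bar> < d" if d: "d > 0" for d j x
      proof -
        have "Cauchy (\<lambda>k. avg j (F (r k)) x)" using r(2) by (simp add: convergent_Cauchy)
        then obtain m where m: "\<And>k l. k \<ge> m \<Longrightarrow> l \<ge> m \<Longrightarrow> \<bar>avg j (F (r k)) x - avg j (F (r l)) x\<bar> < d"
          using d unfolding Cauchy_def dist_real_def by blast
        have "\<bar>avg j (?f k l) x\<bar> < d" if "k \<ge> m" "l \<ge> m" for k l using m[OF that] avg_diff[OF liF liF] by simp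
        then show ?thesis unfolding eventually_sequentially by (intro exI[of _ m]) (meson order_trans)
      qed
      define W where "W = (\<Sum>j\<in>{- int L..<K}. ?w j)"
      have W: "W \<ge> 0" unfolding W_def by (intro sum_nonneg) auto
      \<comment> \<open>The bound \<open>e\<close> serves the single averages of level K; the other
        one makes the weighted sum over the levels from -L to K at most e/2, the 1 guarding against
        W = 0.\<close>
      define d where "d = min e (e / (2 * (W + 1)))"
      have d: "d > 0" using e W by (simp add: d_def)
      have "\<forall>\<^sub>F m in sequentially. \<forall>x\<in>?Y. \<forall>j\<in>{- int L..K}. \<forall>k\<ge>m. \<forall>l\<ge>m. \<bar>avg j (?f k l) x\<bar> < d"
        by (intro eventually_ball_finite finY ballI small d) auto
      then obtain m where m: "\<And>x j k l. x \<in> ?Y \<Longrightarrow> j \<in> {- int L..K} \<Longrightarrow> k \<ge> m \<Longrightarrow> l \<ge> m \<Longrightarrow> \<bar>avg j (?f k l) x\<bar> < d"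
        unfolding eventually_sequentially by (meson order_refl)
      have rep: "\<bar>avg j (?f k l) y\<bar> < d" if "g y \<noteq> 0" "j \<in> {- int L..K}" "k \<ge> m" "l \<ge> m" for y j k l
      proof -
        let ?x = "SOME x. idx K x = idx K y"
        have "idx K ?x = idx K y" by (rule someI[of _ y]) simp
        then have "idx j ?x = idx j y" using that(2) idx_coarse by auto
        then have "avg j (?f k l) ?x = avg j (?f k l) y" by (intro avg_cell) (simp add: mem_cell)
        moreover have "?x \<in> ?Y" using that(1) by blast
        ultimately show ?thesis using m[of ?x j k l] that by simp
      qed
      have main: "mbd s t (\<lambda>y. H k y - H l y) \<epsilon>" if k: "k \<ge> m" "l \<ge> m" for k l
      proof -
        have 1: "mbd s t (comm_series \<alpha> g (?f k l)) (C' * e)"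
        proof (rule C'(2)[OF fN _ e])
          show "0 \<le> 8 * N" using N by simp
          show "\<forall>y. g y \<noteq> 0 \<longrightarrow> \<bar>avg K (?f k l) y\<bar> \<le> e"
          proof (intro allI impI)
            fix y assume "g y \<noteq> 0"
            then have "\<bar>avg K (?f k l) y\<bar> < d" using LK k by (intro rep) auto
            then show "\<bar>avg K (?f k l) y\<bar> \<le> e" by (simp add: d_def)
          qed
          show "\<forall>y M. g y \<noteq> 0 \<longrightarrow> (\<Sum>j\<in>{- int M..<K}. ?w j * \<bar>avg j (?f k l) y\<bar>) \<le> e"
          proof (intro allI impI)
            fix y M assume y: "g y \<noteq> 0"
            have h: "(\<Sum>j\<in>{- int L..<K}. ?w j * \<bar>avg j (?f k l) y\<bar>) \<le> e/2"
            proof -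
              have "(\<Sum>j\<in>{- int L..<K}. ?w j * \<bar>avg j (?f k l) y\<bar>) \<le> (\<Sum>j\<in>{- int L..<K}. ?w j * d)"
                using y k by (intro sum_mono mult_left_mono less_imp_le[OF rep]) auto
              also have "\<dots> = W * d" by (simp add: W_def sum_distrib_right)
              also have "\<dots> \<le> W * (e / (2 * (W + 1)))" using W by (intro mult_left_mono) (auto simp: d_def)
              also have "\<dots> \<le> e/2" using W e by (simp add: field_simps)
              finally show ?thesis .
            qed
            have tl: "(\<Sum>j\<in>{- int M..<- int L}. ?w j * \<bar>avg j (?f k l) y\<bar>) \<le> e/2"
            proof -
              have "?w j * \<bar>avg j (?f k l) y\<bar> \<le> 8 * N * 2 powr (\<sigma> * real_of_int j)" for j
              proof -
                have "\<bar>avg j (?f k l) y\<bar> \<le> 8 * N * 2 powr (real_of_int j * ?n / p)"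
                  using avg_abs_le[OF li[of k l], of j y] mbd_avg_abs[OF fN[of k l] ep(2), of j y] N by linarith
                then have "?w j * \<bar>avg j (?f k l) y\<bar> \<le> ?w j * (8 * N * 2 powr (real_of_int j * ?n / p))" by (intro mult_left_mono) auto
                also have "\<dots> = 8 * N * 2 powr (- \<alpha> * real_of_int j + real_of_int j * ?n / p)" by (simp only: powr_add mult_ac)
                also have "- \<alpha> * real_of_int j + real_of_int j * ?n / p = - (\<alpha> - ?n / p) * real_of_int j" by (simp add: algebra_simps)
                also have "\<dots> = \<sigma> * real_of_int j" unfolding morrey_exps_gap[OF ex] \<sigma>_def by simp
                finally show ?thesis .
              qed
              then have "(\<Sum>j\<in>{- int M..<- int L}. ?w j * \<bar>avg j (?f k l) y\<bar>) \<le> (\<Sum>j\<in>{- int M..<- int L}. 8 * N * 2 powr (\<sigma> * real_of_int j))"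
                by (intro sum_mono)
              also have "\<dots> = 8 * N * (\<Sum>j\<in>{- int M..<- int L}. 2 powr (\<sigma> * real_of_int j))" by (rule sum_distrib_left[symmetric])
              also have "\<dots> \<le> 8 * N * (C4 * 2 powr (\<sigma> * (- real L)))"
                using N by (intro mult_left_mono C4(2)) auto
              also have "\<dots> \<le> e/2" using L by (simp add: mult.assoc)
              finally show ?thesis .
            qed
            have "(\<Sum>j\<in>{- int M..<K}. ?w j * \<bar>avg j (?f k l) y\<bar>) \<le> (\<Sum>j\<in>{- int M..<- int L} \<union> {- int L..<K}. ?w j * \<bar>avg j (?f k l) y\<bar>)"
              by (rule sum_mono2) auto
            also have "\<dots> = (\<Sum>j\<in>{- int M..<- int L}. ?w j * \<bar>avg j (?f k l) y\<bar>) + (\<Sum>j\<in>{- int L..<K}. ?w j * \<bar>avg j (?f k l) y\<bar>)"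
              by (rule sum.union_disjoint) auto
            finally show "(\<Sum>j\<in>{- int M..<K}. ?w j * \<bar>avg j (?f k l) y\<bar>) \<le> e" using h tl by linarith
          qed
        qed
        have 2: "mbd s t (comm_series \<alpha> (\<lambda>x. a x - g x) (?f k l)) (C * \<delta> * (8 * N))"
          using N by (intro C(2)[OF oag \<delta> fN]) simp
        have 3: "mbd s t (\<lambda>y. comm_series \<alpha> (\<lambda>x. a x - g x) (?f k l) y + comm_series \<alpha> g (?f k l) y) (4 * (C * \<delta> * (8 * N) + C' * e))"
          using C C' \<delta> e N ep by (intro mbd_add[OF 2 1]) auto
        have "4 * (C * \<delta> * (8 * N) + C' * e) = \<epsilon>" using C C' N by (simp add: \<delta>_def e_def field_simps)
        moreover have "AE y in lborel. H k y - H l y = comm_series \<alpha> (\<lambda>x. a x - g x) (?f k l) y + comm_series \<alpha> g (?f k l) y"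
          using Hd[of k l] comm_series_split[OF ex fN[of k l] _ oag og B] N by (auto elim: eventually_elim2)
        ultimately show ?thesis using mbd_cong_AE[OF 3] Hm by simp
      qed
      then show ?thesis by blast
    qed
    obtain h where h: "h \<in> borel_measurable borel" "\<And>\<epsilon>. \<epsilon> > 0 \<Longrightarrow> \<exists>k0. \<forall>k\<ge>k0. mbd s t (\<lambda>y. H k y - h y) \<epsilon>"
      using mbd_complete[OF ep(4) Hm Cauchy] by blast
    have Hk: "mbd s t (H k) (C * (B + 1) * N)" for k unfolding H_def
      using commutator_eq[OF ex FN B] by (intro mbd_cong_AE[OF C(2)[OF a' B' FN N(1)]])
    have "h \<in> morrey s t"
    proof -
      obtain k where k: "mbd s t (\<lambda>y. H k y - h y) 1" using h(2)[of 1] by auto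
      have "mbd s t (\<lambda>y. H k y - (H k y - h y)) (4 * (C * (B + 1) * N + 1))"
        using C B' N ep by (intro mbd_diff[OF Hk k]) auto
      then have "mbd s t h (4 * (C * (B + 1) * N + 1))" by simp
      then show ?thesis by (rule mbd_Morrey) (use C B' N ep in auto)
    qed
    moreover have "(\<lambda>k. morrey_norm s t (\<lambda>x. commutator q \<alpha> a (F (r k)) x - h x)) \<longlonglongrightarrow> 0"
    proof (rule LIMSEQ_I)
      fix \<epsilon> :: real assume "\<epsilon> > 0"
      then obtain k0 where k0: "\<And>k. k \<ge> k0 \<Longrightarrow> mbd s t (\<lambda>y. H k y - h y) (\<epsilon>/2)" using h(2)[of "\<epsilon>/2"] by auto
      have "norm (morrey_norm s t (\<lambda>x. commutator q \<alpha> a (F (r k)) x - h x) - 0) < \<epsilon>" if "k \<ge> k0" for k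
      proof -
        have m: "(\<lambda>y. H k y - h y) \<in> morrey s t" "morrey_norm s t (\<lambda>y. H k y - h y) \<le> \<epsilon>/2"
          using mbd_Morrey[OF k0[OF that]] ep \<open>\<epsilon> > 0\<close> by auto
        have "0 \<le> morrey_norm s t (\<lambda>y. H k y - h y)" using Morrey_mbd(1)[OF m(1)] ep by simp
        then show ?thesis using m(2) \<open>\<epsilon> > 0\<close> unfolding H_def by simp
      qed
      then show "\<exists>no. \<forall>k\<ge>no. norm (morrey_norm s t (\<lambda>x. commutator q \<alpha> a (F (r k)) x - h x) - 0) < \<epsilon>" by blast
    qed
    ultimately show "\<exists>r g. strict_mono r \<and> g \<in> morrey s t \<and> (\<lambda>k. morrey_norm s t (\<lambda>x. commutator q \<alpha> a (F (r k)) x - g x)) \<longlonglongrightarrow> 0"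
      using r(1) by blast
  qed
qed

section \<open>A criterion for dyadic VMO\<close>

text \<open>A fixed point eventually lies in a cube touching the origin, whose index has coordinate
  -1 or 0 according to the sign of the coordinate of x.\<close>

lemma idx_coarse_box:
  fixes x :: "real^'n::finite"
  shows "\<exists>N0. \<forall>N\<ge>N0. \<forall>i. idx (- int N) x $ i \<in> {-1, 0}"
proof -
  obtain N0 :: nat where N0: "norm x < 2 ^ N0" using real_arch_pow[of 2 "norm x"] by auto
  show ?thesis
  proof (intro exI[of _ N0] allI impI)
    fix N i assume N: "N0 \<le> N"
    have "\<bar>x$i\<bar> \<le> norm x" by (rule component_le_norm_cart)
    also have "\<dots> < 2 ^ N0" by (rule N0)
    also have "(2::real) ^ N0 \<le> 2 ^ N" using N by (intro power_increasing) auto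
    finally have "\<bar>x$i\<bar> < 2 ^ N" .
    then have "\<bar>x$i * 2 powr real_of_int (- int N)\<bar> < 1" by (simp add: powr_minus powr_realpow abs_mult field_simps)
    then have "- 1 \<le> x$i * 2 powr real_of_int (- int N)" "x$i * 2 powr real_of_int (- int N) < 1" by linarith+
    then have "\<lfloor>x$i * 2 powr real_of_int (- int N)\<rfloor> = -1 \<or> \<lfloor>x$i * 2 powr real_of_int (- int N)\<rfloor> = 0" by linarith
    then show "idx (- int N) x $ i \<in> {-1, 0}" by (simp add: idx_def)
  qed
qed

text \<open>No dyadic cube meets two orthants, so an exhaustion by dyadic sets needs the \<open>2^n\<close> cubes that touch
  the origin.\<close>

definition dyadic_box :: "nat \<Rightarrow> (real^'n::finite) set" where
  "dyadic_box N = {x. \<forall>i. idx (- int N) x $ i \<in> {-1, 0}}"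

lemma dyadic_box_cong: "idx (- int N) x = idx (- int N) y \<Longrightarrow> x \<in> dyadic_box N \<longleftrightarrow> y \<in> dyadic_box N"
  by (simp add: dyadic_box_def)

lemma bounded_dyadic_box: "bounded (dyadic_box N :: (real^'n::finite) set)"
proof -
  have "dyadic_box N \<subseteq> (\<Union>m\<in>{m::int^'n. \<forall>i. m$i \<in> {-1, 0}}. dcube (- int N) m)"
    by (auto simp: dyadic_box_def mem_dcube)
  moreover have "bounded (\<Union>m\<in>{m::int^'n. \<forall>i. m$i \<in> {-1, 0}}. dcube (- int N) m)"
    by (intro bounded_UN finite_vec_range ballI bounded_dcube) simp
  ultimately show ?thesis by (rule bounded_subset[rotated])
qed

text \<open>Any constant may replace the mean at the price of a factor 2, so a convenient centre can
  be chosen in each situation.\<close>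

lemma avg_osc_le:
  assumes b: "loc_int b" and le: "avg k (\<lambda>y. \<bar>b y - c\<bar>) x \<le> e"
  shows "avg k (\<lambda>y. \<bar>b y - avg k b x\<bar>) x \<le> 2 * e"
proof -
  have lc: "loc_int (\<lambda>y. b y - c)" using b by (intro loc_int_diff loc_int_const)
  have "\<bar>avg k b x - c\<bar> = \<bar>avg k (\<lambda>y. b y - c) x\<bar>" by (subst avg_diff[OF b loc_int_const]) simp
  also have "\<dots> \<le> avg k (\<lambda>y. \<bar>b y - c\<bar>) x" by (rule avg_abs_le[OF lc])
  finally have 1: "\<bar>avg k b x - c\<bar> \<le> e" using le by linarith
  have "avg k (\<lambda>y. \<bar>b y - avg k b x\<bar>) x \<le> avg k (\<lambda>y. \<bar>b y - c\<bar> + e) x"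
    by (intro avg_mono_cell loc_int_add loc_int_abs loc_int_diff b loc_int_const) (use 1 in linarith)
  also have "\<dots> = avg k (\<lambda>y. \<bar>b y - c\<bar>) x + e" by (subst avg_add[OF loc_int_abs[OF lc] loc_int_const]) simp
  finally show ?thesis using le by linarith
qed

lemma telescope_int:
  "(\<Sum>j\<in>{- int M..int M}. A (j+1) - A j) = A (int M + 1) - A (- int M)" for A :: "int \<Rightarrow> real"
proof (induction M)
  case (Suc M)
  have "- int (Suc M) + 1 = - int M" "int (Suc M) = int M + 1" by auto
  then show ?case unfolding sum_sym_Suc Suc by (simp add: add.commute)
qed (simp add: add.commute)

text \<open>A cube of level at least -N is either inside the box or disjoint from it. Taking all
  Haar terms of levels -N to N inside the box, the sum telescopes there and vanishes
  elsewhere.\<close>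

lemma box_truncation_haar_span:
  fixes a :: "real^'n::finite \<Rightarrow> real"
  assumes a: "loc_int a"
  shows "(\<lambda>x. if x \<in> dyadic_box N then avg (int N + 1) a x - avg (- int N) a x else 0) \<in> haar_span"
proof -
  let ?P = "SIGMA j:{- int N..int N}. idx j ` (dyadic_box N :: (real^'n) set)"
  let ?S = "(haar_E :: ('n \<Rightarrow> bool) set) \<times> ?P"
  have fin: "finite ?P" by (intro finite_SigmaI finite_idx_image bounded_dyadic_box) simp
  then have finS: "finite ?S" by simp
  have "(\<Sum>(e,j,m)\<in>?S. pairing a (haar e j m) * haar e j m x) = (if x \<in> dyadic_box N then avg (int N + 1) a x - avg (- int N) a x else 0)" for x
  proof -
    have "(\<Sum>(e,j,m)\<in>?S. pairing a (haar e j m) * haar e j m x) = (\<Sum>e\<in>haar_E. \<Sum>(j,m)\<in>?P. pairing a (haar e j m) * haar e j m x)"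
      by (simp add: sum.cartesian_product)
    also have "\<dots> = (\<Sum>e\<in>haar_E. \<Sum>j\<in>{- int N..int N}. \<Sum>m\<in>idx j ` dyadic_box N. pairing a (haar e j m) * haar e j m x)"
      by (intro sum.cong refl sum.Sigma[symmetric] ballI finite_idx_image bounded_dyadic_box) simp_all
    also have "\<dots> = (\<Sum>e\<in>haar_E. \<Sum>j\<in>{- int N..int N}. if x \<in> dyadic_box N then pairing a (haar e j (idx j x)) * haar e j (idx j x) x else 0)"
    proof (intro sum.cong refl)
      fix e and j :: int assume j: "j \<in> {- int N..int N}"
      show "(\<Sum>m\<in>idx j ` dyadic_box N. pairing a (haar e j m) * haar e j m x) = (if x \<in> dyadic_box N then pairing a (haar e j (idx j x)) * haar e j (idx j x) x else 0)"
      proof (cases "x \<in> dyadic_box N")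
        case True
        have "(\<Sum>m\<in>idx j ` dyadic_box N. pairing a (haar e j m) * haar e j m x) = (\<Sum>m\<in>{idx j x}. pairing a (haar e j m) * haar e j m x)"
          using True by (intro sum.mono_neutral_right finite_idx_image bounded_dyadic_box) (auto simp: haar_eq_0)
        then show ?thesis using True by simp
      next
        case False
        have "haar e j m x = 0" if m: "m \<in> idx j ` dyadic_box N" for m
        proof (rule haar_eq_0)
          obtain y where y: "y \<in> dyadic_box N" "m = idx j y" using m by blast
          show "idx j x \<noteq> m"
          proof
            assume "idx j x = m"
            then have "idx j x = idx j y" by (simp only: y(2))
            moreover have "- int N \<le> j" using j by simp
            ultimately have "idx (- int N) x = idx (- int N) y" by (rule idx_coarse)
            from dyadic_box_cong[OF this] show False using False y(1) by simp
          qed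
        qed
        then show ?thesis using False by simp
      qed
    qed
    also have "\<dots> = (if x \<in> dyadic_box N then (\<Sum>j\<in>{- int N..int N}. \<Sum>e\<in>haar_E. pairing a (haar e j (idx j x)) * haar e j (idx j x) x) else 0)"
      by (subst sum.swap) simp
    finally show ?thesis by (simp only: haar_sum_pairing[OF a] telescope_int[where A="\<lambda>j. avg j a x"])
  qed
  then have "(\<lambda>x. if x \<in> dyadic_box N then avg (int N + 1) a x - avg (- int N) a x else 0) = (\<lambda>x. \<Sum>(e,j,m)\<in>?S. (\<lambda>(e,j,m). pairing a (haar e j m)) (e,j,m) * haar e j m x)"
    by auto
  then show ?thesis unfolding haar_span_def using finS
    by (intro CollectI exI[of _ ?S] exI[of _ "\<lambda>(e,j,m). pairing a (haar e j m)"]) auto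
qed

text \<open>The truncated Haar expansion g is taken so large that every cube of big oscillation lies
  in the box with level in the truncation range. On any cube a - g then reduces, up to a constant,
  to pieces of a whose oscillation is small.\<close>

lemma VMO_of_finite:
  fixes a :: "real^'n::finite \<Rightarrow> real"
  assumes aB: "a \<in> BMO" and fin: "\<And>\<epsilon>. \<epsilon> > 0 \<Longrightarrow> finite {(j, idx j x) |j x. avg j (\<lambda>y. \<bar>a y - avg j a x\<bar>) x > \<epsilon>}"
  shows "a \<in> VMO"
  unfolding VMO_def
proof (intro CollectI conjI aB allI impI)
  fix \<epsilon> :: real assume "\<epsilon> > 0"
  \<comment> \<open>On very large cubes three pieces of size e occur, \<open>avg_osc_le\<close>
    doubles this to 6 e, and 7 makes the final inequality strict.\<close>
  define e where "e = \<epsilon> / 7"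
  have e: "e > 0" using \<open>\<epsilon> > 0\<close> by (simp add: e_def)
  have a: "loc_int a" using aB by (simp add: BMO_def Lloc_1)
  define Bad where "Bad = {(j, idx j x) |j x. avg j (\<lambda>y. \<bar>a y - avg j a x\<bar>) x > e}"
  define P where "P jm N \<longleftrightarrow> fst jm \<in> {- int N..int N} \<and> dcube (fst jm) (snd jm) \<subseteq> dyadic_box N" for jm :: "int \<times> (int^'n)" and N
  have finBad: "finite Bad" unfolding Bad_def by (rule fin[OF e])
  have "\<forall>jm\<in>Bad. \<exists>N0::nat. \<forall>N\<ge>N0. P jm N"
  proof
    fix jm assume "jm \<in> Bad"
    then obtain j x where jx: "jm = (j, idx j x)" unfolding Bad_def by blast
    obtain N0 where N0: "\<forall>N\<ge>N0. \<forall>i. idx (- int N) x $ i \<in> {-1, 0}" using idx_coarse_box by blast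
    show "\<exists>N0::nat. \<forall>N\<ge>N0. P jm N"
      unfolding P_def
    proof (intro exI[of _ "N0 + nat \<bar>j\<bar>"] allI impI conjI)
      fix N assume N: "N0 + nat \<bar>j\<bar> \<le> N"
      then have jN: "- int N \<le> j" "j \<le> int N" by linarith+
      then show "fst jm \<in> {- int N..int N}" by (simp add: jx)
      have x: "x \<in> dyadic_box N" using N0 N by (simp add: dyadic_box_def)
      show "dcube (fst jm) (snd jm) \<subseteq> dyadic_box N"
      proof
        fix y assume "y \<in> dcube (fst jm) (snd jm)"
        then have "idx j y = idx j x" by (simp add: jx mem_dcube)
        then have "idx (- int N) y = idx (- int N) x" using jN(1) by (rule idx_coarse)
        then show "y \<in> dyadic_box N" using x dyadic_box_cong by blast
      qed
    qed
  qed
  from bchoice[OF this] obtain N0 :: "int \<times> (int^'n) \<Rightarrow> nat" where N0: "\<forall>jm\<in>Bad. \<forall>N\<ge>N0 jm. P jm N" by blast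
  \<comment> \<open>The sum over the finite set of bad cubes dominates every individual
    threshold.\<close>
  define N where "N = (\<Sum>jm\<in>Bad. N0 jm)"
  have N: "P jm N" if jm: "jm \<in> Bad" for jm
  proof -
    have "N0 jm \<le> N" unfolding N_def by (rule member_le_sum[OF jm _ finBad]) simp
    then show ?thesis using N0 jm by blast
  qed
  have good: "avg j (\<lambda>y. \<bar>a y - avg j a x\<bar>) x \<le> e" if "j \<notin> {- int N..int N} \<or> x \<notin> dyadic_box N" for j x
  proof (rule ccontr)
    assume "\<not> avg j (\<lambda>y. \<bar>a y - avg j a x\<bar>) x \<le> e"
    then have "avg j (\<lambda>y. \<bar>a y - avg j a x\<bar>) x > e" by simp
    then have "(j, idx j x) \<in> Bad" unfolding Bad_def by blast
    from N[OF this] have "j \<in> {- int N..int N}" "dcube j (idx j x) \<subseteq> dyadic_box N" unfolding P_def by simp_all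
    moreover have "x \<in> dcube j (idx j x)" by (simp add: mem_dcube)
    ultimately have "j \<in> {- int N..int N}" "x \<in> dyadic_box N" by blast+
    then show False using that by blast
  qed
  define g where "g = (\<lambda>x. if x \<in> dyadic_box N then avg (int N + 1) a x - avg (- int N) a x else 0)"
  have g: "g \<in> haar_span" unfolding g_def by (rule box_truncation_haar_span[OF a])
  have box: "(y \<in> dyadic_box N \<longleftrightarrow> x \<in> dyadic_box N) \<and> avg (- int N) a y = avg (- int N) a x"
    if "y \<in> cell k x" "- int N \<le> k" for x y :: "real^'n" and k
  proof -
    have i: "idx (- int N) y = idx (- int N) x" by (rule idx_coarse[OF _ that(2)]) (use that(1) in \<open>simp add: mem_cell\<close>)
    have "y \<in> cell (- int N) x" unfolding mem_cell by (rule i)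
    then show ?thesis using dyadic_box_cong[OF i] avg_cell by blast
  qed
  have levg: "lev (int N + 1) g" unfolding lev_def
  proof (intro allI impI)
    fix x y :: "real^'n" assume xy: "idx (int N + 1) x = idx (int N + 1) y"
    then have "x \<in> cell (int N + 1) y" by (simp add: mem_cell)
    from box[OF this] have "x \<in> dyadic_box N \<longleftrightarrow> y \<in> dyadic_box N" "avg (- int N) a x = avg (- int N) a y"
      by simp_all
    moreover have "avg (int N + 1) a x = avg (int N + 1) a y" using xy by (intro avg_cell) (simp add: mem_cell)
    ultimately show "g x = g y" by (simp add: g_def)
  qed
  have lg: "loc_int g" by (rule lev_loc_int[OF levg])
  have lb: "loc_int (\<lambda>y. a y - g y)" using a lg by (rule loc_int_diff)
  \<comment> \<open>Level N + 1 is beyond the truncation range, so all its cubes are good; averaging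
    over larger cells keeps the bound.\<close>
  have fine: "avg k (\<lambda>y. \<bar>a y - avg (int N + 1) a y\<bar>) x \<le> e" if k: "k \<le> int N + 1" for k x
  proof -
    have li: "loc_int (\<lambda>y. \<bar>a y - avg (int N + 1) a y\<bar>)" by (intro loc_int_abs loc_int_diff a loc_int_avg)
    have "avg k (\<lambda>y. \<bar>a y - avg (int N + 1) a y\<bar>) x = avg k (avg (int N + 1) (\<lambda>y. \<bar>a y - avg (int N + 1) a y\<bar>)) x"
      by (rule avg_tower[symmetric, OF li k])
    also have "\<dots> \<le> avg k (\<lambda>_. e) x"
    proof (intro avg_mono_cell loc_int_avg loc_int_const)
      fix z
      have "avg (int N + 1) (\<lambda>y. \<bar>a y - avg (int N + 1) a y\<bar>) z = avg (int N + 1) (\<lambda>y. \<bar>a y - avg (int N + 1) a z\<bar>) z"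
        by (intro avg_cong) (simp add: avg_cell)
      then show "avg (int N + 1) (\<lambda>y. \<bar>a y - avg (int N + 1) a y\<bar>) z \<le> e" using good[of "int N + 1" z] by simp
    qed
    finally show ?thesis by simp
  qed
  have "avg k (\<lambda>y. \<bar>(a y - g y) - avg k (\<lambda>y. a y - g y) x\<bar>) x \<le> 6 * e" for k x
  proof -
    consider (small) "k \<ge> int N + 1" | (mid_in) "k \<in> {- int N..int N}" "x \<in> dyadic_box N"
      | (mid_out) "k \<in> {- int N..int N}" "x \<notin> dyadic_box N" | (big) "k < - int N" by force
    then have "\<exists>c. avg k (\<lambda>y. \<bar>(a y - g y) - c\<bar>) x \<le> 3 * e"
    proof cases
      case small
      have "avg k (\<lambda>y. \<bar>(a y - g y) - (avg k a x - g x)\<bar>) x = avg k (\<lambda>y. \<bar>a y - avg k a x\<bar>) x"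
      proof (rule avg_cong)
        fix y assume "y \<in> cell k x"
        then have "g y = g x" using levD[OF lev_mono[OF levg small]] by blast
        then show "\<bar>(a y - g y) - (avg k a x - g x)\<bar> = \<bar>a y - avg k a x\<bar>" by simp
      qed
      also have "\<dots> \<le> e" using small by (intro good) auto
      finally show ?thesis using e by (intro exI[of _ "avg k a x - g x"]) linarith
    next
      case mid_in
      have "avg k (\<lambda>y. \<bar>(a y - g y) - avg (- int N) a x\<bar>) x = avg k (\<lambda>y. \<bar>a y - avg (int N + 1) a y\<bar>) x"
      proof (rule avg_cong)
        fix y assume "y \<in> cell k x"
        from box[OF this] have "y \<in> dyadic_box N" "avg (- int N) a y = avg (- int N) a x"
          using mid_in by simp_all
        then show "\<bar>(a y - g y) - avg (- int N) a x\<bar> = \<bar>a y - avg (int N + 1) a y\<bar>" by (simp add: g_def)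
      qed
      also have "\<dots> \<le> e" using mid_in by (intro fine) auto
      finally show ?thesis using e by (intro exI[of _ "avg (- int N) a x"]) linarith
    next
      case mid_out
      have "avg k (\<lambda>y. \<bar>(a y - g y) - avg k a x\<bar>) x = avg k (\<lambda>y. \<bar>a y - avg k a x\<bar>) x"
      proof (rule avg_cong)
        fix y assume "y \<in> cell k x"
        from box[OF this] have "y \<notin> dyadic_box N" using mid_out by simp
        then show "\<bar>(a y - g y) - avg k a x\<bar> = \<bar>a y - avg k a x\<bar>" by (simp add: g_def)
      qed
      also have "\<dots> \<le> e" using mid_out by (intro good) auto
      finally show ?thesis using e by (intro exI[of _ "avg k a x"]) linarith
    next
      case big
      let ?c = "avg k a x"
      let ?f1 = "\<lambda>y. \<bar>a y - ?c\<bar>" and ?f2 = "\<lambda>y. \<bar>a y - avg (int N + 1) a y\<bar>" and ?f3 = "\<lambda>y. \<bar>avg (- int N) a y - ?c\<bar>"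
      have l: "loc_int ?f1" "loc_int ?f2" "loc_int ?f3" by (intro loc_int_abs loc_int_diff a loc_int_avg loc_int_const)+
      have 1: "avg k ?f1 x \<le> e" using big by (intro good) auto
      have 2: "avg k ?f2 x \<le> e" using big by (intro fine) auto
      have 3: "avg k ?f3 x \<le> e"
      proof -
        have "avg (- int N) (\<lambda>y. a y - ?c) y = avg (- int N) a y - ?c" for y
          using avg_diff[OF a loc_int_const[of ?c]] by simp
        then have "avg k ?f3 x = avg k (\<lambda>y. \<bar>avg (- int N) (\<lambda>y. a y - ?c) y\<bar>) x" by simp
        also have "\<dots> \<le> avg k ?f1 x" using big by (intro avg_abs_avg_le loc_int_diff a loc_int_const) auto
        finally show ?thesis using 1 by linarith
      qed
      \<comment> \<open>Outside the box g = 0 and the first summand suffices; inside, a - g - c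
        splits into the second summand and the difference in the third, which is controlled by
        contraction of averages.\<close>
      have "avg k (\<lambda>y. \<bar>(a y - g y) - ?c\<bar>) x \<le> avg k (\<lambda>y. ?f1 y + (?f2 y + ?f3 y)) x"
        by (intro avg_mono_cell loc_int_abs[OF loc_int_diff[OF lb loc_int_const]] loc_int_add l) (auto simp: g_def)
      also have "\<dots> = avg k ?f1 x + (avg k ?f2 x + avg k ?f3 x)"
        using avg_add[OF l(1) loc_int_add[OF l(2,3)]] avg_add[OF l(2,3)] by simp
      finally show ?thesis using 1 2 3 by (intro exI[of _ ?c]) linarith
    qed
    then obtain c where "avg k (\<lambda>y. \<bar>(a y - g y) - c\<bar>) x \<le> 3 * e" by blast
    from avg_osc_le[OF lb this] show ?thesis by simp
  qed
  then have "bmo_norm (\<lambda>y. a y - g y) \<le> ereal (6 * e)" unfolding bmo_norm_le_iff by blast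
  also have "\<dots> < ereal \<epsilon>" using e by (simp add: e_def)
  finally show "\<exists>g\<in>haar_span. bmo_norm (\<lambda>x. a x - g x) < ereal \<epsilon>" using g by blast
qed

section \<open>Convergence in mean of the truncations\<close>

lemma avg_dominated:
  fixes G :: "nat \<Rightarrow> real^'n::finite \<Rightarrow> real"
  assumes G: "\<And>i. G i \<in> borel_measurable borel" and g: "g \<in> borel_measurable borel"
    and b: "\<And>i y. \<bar>G i y\<bar> \<le> c" and lim: "AE y in lborel. (\<lambda>i. G i y) \<longlonglongrightarrow> g y"
  shows "(\<lambda>i. avg k (G i) x) \<longlonglongrightarrow> avg k g x"
proof -
  have "(\<lambda>i. LINT y|lborel. indicator (cell k x) y *\<^sub>R G i y) \<longlonglongrightarrow> (LINT y|lborel. indicator (cell k x) y *\<^sub>R g y)"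
  proof (rule integral_dominated_convergence[where w="\<lambda>y. c * indicator (cell k x) y"])
    show "integrable lborel (\<lambda>y. c * indicator (cell k x) y)" by (simp add: emeasure_cell)
    show "AE y in lborel. (\<lambda>i. indicator (cell k x) y *\<^sub>R G i y) \<longlonglongrightarrow> indicator (cell k x) y *\<^sub>R g y"
      using lim by eventually_elim (intro tendsto_intros)
    show "AE y in lborel. norm (indicator (cell k x) y *\<^sub>R G i y) \<le> c * indicator (cell k x) y" for i
      using b[of i] by (auto simp: indicator_def)
  qed (use G g in measurable)
  then show ?thesis unfolding avg_def set_lebesgue_integral_def by (intro tendsto_intros)
qed

text \<open>Vitali's theorem on a cell: bounded t-th power means with t > 1 give uniform
  integrability. The truncation at height l converges by domination, and the excess is small
  uniformly in i.\<close>

lemma Vitali_avg: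
  fixes G :: "nat \<Rightarrow> real^'n::finite \<Rightarrow> real"
  assumes G: "\<And>i. mbd s t (G i) K" and h: "mbd s t h K" and K: "K \<ge> 0" and t: "t > 1"
    and lim: "AE y in lborel. (\<lambda>i. G i y) \<longlonglongrightarrow> h y"
  shows "(\<lambda>i. avg k (\<lambda>y. \<bar>G i y - h y\<bar>) x) \<longlonglongrightarrow> 0"
proof (rule LIMSEQ_I)
  fix e :: real assume e: "e > 0"
  let ?D = "\<lambda>i y. \<bar>G i y - h y\<bar>"
  have d: "mbd s t (\<lambda>y. G i y - h y) (4 * (K + K))" for i using t K by (intro mbd_diff G h) auto
  have lD: "loc_int (?D i)" for i using mbd_loc_int[OF d] t by (intro loc_int_abs) simp
  have lDt: "loc_int (\<lambda>y. ?D i y powr t)" for i using mbdD(2)[OF d] .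
  define T where "T = (4 * (K + K) * 2 powr (real_of_int k * real CARD('n) / s)) powr t + 1"
  have T: "T > 0" by (simp add: T_def add_nonneg_pos)
  \<comment> \<open>Balances the tail: l^(1-t) T = e/2.\<close>
  define l where "l = (2 * T / e) powr (1 / (t - 1))"
  have l: "l > 0" "l powr (1 - t) * T = e / 2"
  proof -
    show "l > 0" using T e by (simp add: l_def)
    have "l powr (1 - t) = (2 * T / e) powr (- 1)"
      unfolding l_def powr_powr using t by (intro arg_cong2[where f="(powr)"] refl) (simp add: field_simps)
    then show "l powr (1 - t) * T = e / 2" using T e by (simp add: powr_minus)
  qed
  have "(\<lambda>i. avg k (\<lambda>y. min (?D i y) l) x) \<longlonglongrightarrow> avg k (\<lambda>_. 0) x"
  proof (rule avg_dominated[where c=l])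
    show "AE y in lborel. (\<lambda>i. min (?D i y) l) \<longlonglongrightarrow> 0"
      using lim
    proof eventually_elim
      case (elim y)
      have "(\<lambda>i. min (?D i y) l) \<longlonglongrightarrow> min \<bar>h y - h y\<bar> l" by (intro tendsto_intros elim)
      then show ?case using l by simp
    qed
  qed (use mbdD(1)[OF G] mbdD(1)[OF h] l in auto)
  then have "\<forall>\<^sub>F i in sequentially. avg k (\<lambda>y. min (?D i y) l) x < e / 2"
    using e by (intro order_tendstoD(2)[where y=0]) auto
  then obtain i0 where i0: "\<And>i. i \<ge> i0 \<Longrightarrow> avg k (\<lambda>y. min (?D i y) l) x < e / 2"
    unfolding eventually_sequentially by blast
  have "norm (avg k (?D i) x - 0) < e" if "i \<ge> i0" for i
  proof -
    have lm: "loc_int (\<lambda>y. min (?D i y) l)"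
      by (rule loc_int_bound[OF lD[of i]]) (use mbdD(1)[OF G] mbdD(1)[OF h] l in auto)
    have pt: "z \<le> 1 * min z l + l powr (1 - t) * z powr t" if z: "z \<ge> 0" for z
    proof (cases "z \<le> l")
      case False
      have "z = z powr (1 - t) * z powr t" using False l by (simp add: powr_add[symmetric])
      also have "\<dots> \<le> l powr (1 - t) * z powr t" using False l t by (intro mult_right_mono powr_mono2') auto
      finally show ?thesis using z l by (simp add: add_increasing)
    qed (simp add: min_def)
    have "avg k (?D i) x \<le> avg k (\<lambda>y. 1 * min (?D i y) l + l powr (1 - t) * ?D i y powr t) x"
      by (intro avg_mono_cell pt lD loc_int_add loc_int_cmult lm lDt) simp
    also have "\<dots> = 1 * avg k (\<lambda>y. min (?D i y) l) x + l powr (1 - t) * avg k (\<lambda>y. ?D i y powr t) x"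
      by (rule avg_lincomb[OF lm lDt])
    also have "\<dots> < e / 2 + l powr (1 - t) * T"
    proof (rule add_less_le_mono)
      show "1 * avg k (\<lambda>y. min (?D i y) l) x < e / 2" using i0[OF that] by simp
      show "l powr (1 - t) * avg k (\<lambda>y. ?D i y powr t) x \<le> l powr (1 - t) * T"
        using mbdD(3)[OF d, of k i x] unfolding T_def by (intro mult_left_mono) auto
    qed
    also have "\<dots> = e" using l by simp
    finally have "avg k (?D i) x < e" .
    moreover have "0 \<le> avg k (?D i) x" by (intro avg_nonneg) simp
    ultimately show ?thesis by simp
  qed
  then show "\<exists>no. \<forall>i\<ge>no. norm (avg k (?D i) x - 0) < e" by blast
qed

text \<open>Identities for averages of the commutator can now be proved on truncations, where they
  are finite sums, and then passed to the limit.\<close>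

lemma comm_series_avg_lim:
  fixes f :: "real^'n::finite \<Rightarrow> real"
  assumes ex: "morrey_exps TYPE('n) \<alpha> p q s t" and f: "mbd p q f N" "N \<ge> 0" and a: "osc_le a B"
  shows "(\<lambda>M. (2 powr \<alpha> - 1) * avg k (scale_comm \<alpha> a {- int M..int M} f) x) \<longlonglongrightarrow> avg k (comm_series \<alpha> a f) x"
proof -
  have ep: "0 < \<alpha>" "1 < q" "1 < t" using ex by (auto simp: morrey_exps_def)
  let ?k = "2 powr \<alpha> - 1"
  have kp: "?k > 0" using powr_minus_1_pos ep by blast
  have a': "osc_le a (B + 1)" using a unfolding osc_le_def by (meson add_increasing2 zero_le_one)
  have B': "B + 1 > 0" using osc_nonneg[OF a] by simp
  have f': "mbd p q f (N + 1)" "N + 1 > 0" using mbd_mono[OF f(1,2), of "N + 1"] f(2) ep by auto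
  obtain C1 where C1: "C1 > 0" "\<And>J. finite J \<Longrightarrow> mbd s t (scale_comm \<alpha> a J f) (C1 * (B + 1) * (N + 1))"
    using scale_comm_Morrey[OF ex] a' B' f' by blast
  obtain C2 where C2: "C2 > 0" "mbd s t (comm_series \<alpha> a f) (C2 * (B + 1) * (N + 1))"
    using comm_series_Morrey[OF ex] a' B' f' by blast
  define A1 where "A1 = C1 * (B + 1) * (N + 1)"
  define A2 where "A2 = C2 * (B + 1) * (N + 1)"
  have A1: "0 \<le> A1" "mbd s t (scale_comm \<alpha> a J f) A1" if "finite J" for J
    unfolding A1_def using C1(2)[OF that] less_imp_le[OF C1(1)] B' f'(2) by auto
  have A2: "0 \<le> A2" "mbd s t (comm_series \<alpha> a f) A2"
    unfolding A2_def using C2 B' f'(2) by auto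
  define K where "K = ?k * A1 + A2"
  have kA: "0 \<le> ?k * A1" using A1(1)[of "{}"] kp by simp
  have K: "K \<ge> 0" "?k * A1 \<le> K" "A2 \<le> K" unfolding K_def using kA A2(1) by linarith+
  have m1: "mbd s t (\<lambda>y. ?k * scale_comm \<alpha> a {- int M..int M} f y) K" for M
  proof (rule mbd_mono)
    have "\<bar>?k\<bar> = ?k" using kp by linarith
    then show "mbd s t (\<lambda>y. ?k * scale_comm \<alpha> a {- int M..int M} f y) (?k * A1)"
      using mbd_cmult[OF A1(2,1), of "{- int M..int M}" "{- int M..int M}" ?k] by simp
  qed (use kA K ep in auto)
  have m2: "mbd s t (comm_series \<alpha> a f) K"
    by (rule mbd_mono[OF A2(2,1) K(3)]) (use ep in simp)
  have l1: "loc_int (\<lambda>y. ?k * scale_comm \<alpha> a {- int M..int M} f y)" for M using mbd_loc_int[OF m1] ep by simp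
  have l2: "loc_int (comm_series \<alpha> a f)" using mbd_loc_int[OF m2] ep by simp
  have V: "(\<lambda>M. avg k (\<lambda>y. \<bar>?k * scale_comm \<alpha> a {- int M..int M} f y - comm_series \<alpha> a f y\<bar>) x) \<longlonglongrightarrow> 0"
    by (rule Vitali_avg[OF m1 m2 K(1) ep(3) comm_series_lim(1)[OF ex f a]])
  have "(\<lambda>M. avg k (\<lambda>y. ?k * scale_comm \<alpha> a {- int M..int M} f y) x - avg k (comm_series \<alpha> a f) x) \<longlonglongrightarrow> 0"
  proof (rule Lim_null_comparison[OF _ V], intro always_eventually allI)
    fix M
    show "norm (avg k (\<lambda>y. ?k * scale_comm \<alpha> a {- int M..int M} f y) x - avg k (comm_series \<alpha> a f) x)
       \<le> avg k (\<lambda>y. \<bar>?k * scale_comm \<alpha> a {- int M..int M} f y - comm_series \<alpha> a f y\<bar>) x"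
      using avg_abs_le[OF loc_int_diff[OF l1[of M] l2], of k x] avg_diff[OF l1[of M] l2, of k x] by simp
  qed
  then show ?thesis unfolding avg_cmult by (rule LIM_zero_cancel)
qed

section \<open>Testing the commutator on cubes\<close>

lemma avg_indicator_cell:
  fixes u :: "real^'n::finite \<Rightarrow> real"
  assumes "idx j y = idx j w" "j \<le> l"
  shows "avg j (\<lambda>z. indicator (cell l w) z * u z) y = 2 powr (real_of_int (j - l) * real CARD('n)) * avg l u w"
proof -
  have sub: "cell l w \<subseteq> cell j y" using assms by (intro cell_subset) (simp_all add: mem_cell)
  have "(LINT z:cell j y|lborel. indicator (cell l w) z * u z) = (LINT z:cell l w|lborel. u z)"
    unfolding set_lebesgue_integral_def
    by (rule Bochner_Integration.integral_cong) (use sub in \<open>auto simp: indicator_def\<close>)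
  moreover have "2 powr (real_of_int j * real CARD('n)) = 2 powr (real_of_int (j - l) * real CARD('n)) * 2 powr (real_of_int l * real CARD('n))"
    by (simp add: powr_add[symmetric] algebra_simps)
  ultimately show ?thesis unfolding avg_def by (simp only: mult.assoc)
qed

lemma avg_indicator_disjoint:
  assumes "\<And>z. z \<in> cell j y \<Longrightarrow> z \<notin> R"
  shows "avg j (\<lambda>z. indicator R z * u z) y = 0"
proof -
  have "avg j (\<lambda>z. indicator R z * u z) y = avg j (\<lambda>_. 0) y"
    by (rule avg_cong) (use assms in \<open>simp add: indicator_def\<close>)
  then show ?thesis by simp
qed

text \<open>Symmetry of a conditional expectation: both sides equal the average of the product of
  the two conditional expectations.\<close>

lemma avg_self_adjoint:
  assumes "loc_int u" "loc_int v" "i \<le> j"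
  shows "avg i (\<lambda>y. u y * avg j v y) x = avg i (\<lambda>y. v y * avg j u y) x"
proof -
  have *: "avg i (\<lambda>y. u y * avg j v y) x = avg i (\<lambda>y. avg j u y * avg j v y) x" if u: "loc_int u" for u v
  proof -
    have li: "loc_int (\<lambda>y. avg j v y * u y)" by (rule loc_int_lev_mult[OF lev_avg u])
    have "avg i (\<lambda>y. avg j v y * u y) x = avg i (avg j (\<lambda>y. avg j v y * u y)) x"
      by (rule avg_tower[symmetric, OF li assms(3)])
    also have "\<dots> = avg i (\<lambda>y. avg j v y * avg j u y) x"
      by (intro avg_cong avg_lev_mult lev_avg)
    finally show ?thesis by (simp add: mult.commute)
  qed
  show ?thesis using *[OF assms(1)] *[OF assms(2)] by (simp add: mult.commute)
qed

text \<open>Multiplication by a and each E_j are symmetric, so their commutator is antisymmetric.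
  The averaging cell must be at least as coarse as all levels in J.\<close>

lemma scale_comm_antisym:
  assumes u: "loc_int u" "loc_int (\<lambda>z. a z * u z)" and v: "loc_int v" "loc_int (\<lambda>z. a z * v z)"
    and J: "\<And>j. j \<in> J \<Longrightarrow> i \<le> j"
  shows "avg i (\<lambda>y. u y * scale_comm \<alpha> a J v y) x = - avg i (\<lambda>y. v y * scale_comm \<alpha> a J u y) x"
proof -
  let ?w = "\<lambda>j. 2 powr (- \<alpha> * real_of_int j)"
  have exp: "avg i (\<lambda>y. u y * scale_comm \<alpha> a J v y) x
     = (\<Sum>j\<in>J. ?w j * (avg i (\<lambda>y. (a y * u y) * avg j v y) x - avg i (\<lambda>y. u y * avg j (\<lambda>z. a z * v z) y) x))"
    if u: "loc_int u" "loc_int (\<lambda>z. a z * u z)" for u v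
  proof -
    have l1: "loc_int (\<lambda>y. (a y * u y) * avg j v y)" for j
      using loc_int_lev_mult[OF lev_avg u(2), of j v] by (simp add: mult.commute)
    have l2: "loc_int (\<lambda>y. u y * avg j (\<lambda>z. a z * v z) y)" for j
      using loc_int_lev_mult[OF lev_avg u(1), of j "\<lambda>z. a z * v z"] by (simp add: mult.commute)
    have "avg i (\<lambda>y. u y * scale_comm \<alpha> a J v y) x = avg i (\<lambda>y. \<Sum>j\<in>J. ?w j * ((a y * u y) * avg j v y - u y * avg j (\<lambda>z. a z * v z) y)) x"
      by (intro avg_cong) (simp add: scale_comm_def sum_distrib_left algebra_simps)
    also have "\<dots> = (\<Sum>j\<in>J. avg i (\<lambda>y. ?w j * ((a y * u y) * avg j v y - u y * avg j (\<lambda>z. a z * v z) y)) x)"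
      by (intro avg_sum loc_int_cmult loc_int_diff l1 l2)
    also have "\<dots> = (\<Sum>j\<in>J. ?w j * (avg i (\<lambda>y. (a y * u y) * avg j v y) x - avg i (\<lambda>y. u y * avg j (\<lambda>z. a z * v z) y) x))"
      unfolding avg_cmult avg_diff[OF l1 l2] ..
    finally show ?thesis .
  qed
  have "(\<Sum>j\<in>J. ?w j * (avg i (\<lambda>y. (a y * u y) * avg j v y) x - avg i (\<lambda>y. u y * avg j (\<lambda>z. a z * v z) y) x))
      = (\<Sum>j\<in>J. - (?w j * (avg i (\<lambda>y. (a y * v y) * avg j u y) x - avg i (\<lambda>y. v y * avg j (\<lambda>z. a z * u z) y) x)))"
  proof (rule sum.cong[OF refl])
    fix j assume "j \<in> J"
    then have ij: "i \<le> j" by (rule J)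
    show "?w j * (avg i (\<lambda>y. (a y * u y) * avg j v y) x - avg i (\<lambda>y. u y * avg j (\<lambda>z. a z * v z) y) x)
      = - (?w j * (avg i (\<lambda>y. (a y * v y) * avg j u y) x - avg i (\<lambda>y. v y * avg j (\<lambda>z. a z * u z) y) x))"
      unfolding avg_self_adjoint[OF u(2) v(1) ij] avg_self_adjoint[OF u(1) v(2) ij] by (simp add: algebra_simps)
  qed
  then show ?thesis unfolding exp[OF u] exp[OF v] by (simp only: sum_negf)
qed

lemma loc_int_indicator_mult:
  fixes a :: "real^'n::finite \<Rightarrow> real"
  assumes "loc_int a" shows "loc_int (indicator (cell l w) :: real^'n \<Rightarrow> real)" "loc_int (\<lambda>z. a z * indicator (cell l w) z)"
proof -
  have lev: "lev l (indicator (cell l w) :: real^'n \<Rightarrow> real)"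
    by (simp add: lev_def indicator_def mem_cell)
  show "loc_int (indicator (cell l w) :: real^'n \<Rightarrow> real)" by (rule lev_loc_int[OF lev])
  show "loc_int (\<lambda>z. a z * indicator (cell l w) z)" using loc_int_lev_mult[OF lev assms] by (simp add: mult.commute)
qed

lemma mbd_indicator_cell:
  assumes "1 \<le> q" "q \<le> p"
  shows "mbd p q (indicator (cell l (w :: real^'n::finite))) (1 + measure lborel (cell l w))"
  using assms by (intro mbd_indicator) (auto simp: emeasure_cell)

lemma osc_le_Suc: "osc_le a B \<Longrightarrow> osc_le a (B + 1) \<and> B + 1 > 0"
proof -
  assume o: "osc_le a B"
  have "avg k (\<lambda>y. \<bar>a y - avg k a x\<bar>) x \<le> B + 1" for k x
  proof -
    have "avg k (\<lambda>y. \<bar>a y - avg k a x\<bar>) x \<le> B" using o unfolding osc_le_def by blast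
    then show ?thesis by linarith
  qed
  then show ?thesis using o osc_nonneg[OF o] by (simp add: osc_le_def)
qed

lemma comm_series_mbd:
  fixes a f :: "real^'n::finite \<Rightarrow> real"
  assumes ex: "morrey_exps TYPE('n) \<alpha> p q s t" and o: "osc_le a B" and f: "mbd p q f N" "N > 0"
  shows "\<exists>K\<ge>0. mbd s t (comm_series \<alpha> a f) K"
proof -
  have B: "osc_le a (B + 1)" "B + 1 > 0" using osc_le_Suc[OF o] by auto
  obtain C where C: "C > 0" and *: "\<forall>(a::real^'n \<Rightarrow> real) B f N. osc_le a B \<longrightarrow> B > 0 \<longrightarrow> mbd p q f N \<longrightarrow> N > 0 \<longrightarrow>
     mbd s t (comm_series \<alpha> a f) (C * B * N)"
    using comm_series_Morrey[OF ex] by (elim exE conjE)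
  have "mbd s t (comm_series \<alpha> a f) (C * (B + 1) * N)" by (intro *[rule_format] B f)
  moreover have "0 \<le> C * (B + 1) * N" using C B f by simp
  ultimately show ?thesis by (intro exI conjI)
qed

lemma comm_series_loc_int:
  fixes a f :: "real^'n::finite \<Rightarrow> real"
  assumes "morrey_exps TYPE('n) \<alpha> p q s t" "osc_le a B" "mbd p q f N" "N > 0"
  shows "loc_int (comm_series \<alpha> a f)"
proof -
  obtain K where "mbd s t (comm_series \<alpha> a f) K" using comm_series_mbd[OF assms] by (elim exE conjE)
  then show ?thesis by (rule mbd_loc_int) (use assms(1) in \<open>simp add: morrey_exps_def\<close>)
qed

text \<open>Antisymmetry exchanges the roles of the two cells: the commutator of one indicator,
  averaged over the other cell, becomes the same quantity with the cells swapped, times the ratio of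
  volumes. The right-hand side then involves a function that depends only on the fixed cell.\<close>

lemma comm_series_dual_bound:
  fixes a :: "real^'n::finite \<Rightarrow> real"
  assumes ex: "morrey_exps TYPE('n) \<alpha> p q s t" and o: "osc_le a B"
  shows "\<bar>avg k (comm_series \<alpha> a (indicator (cell l w))) x\<bar> \<le>
    2 powr (real_of_int k * real CARD('n)) * 2 powr (- real_of_int l * real CARD('n)) * avg l (\<lambda>y. \<bar>comm_series \<alpha> a (indicator (cell k x)) y\<bar>) w"
proof -
  let ?n = "real CARD('n)"
  have ep: "1 \<le> q" "q \<le> p" "1 < t" using ex by (auto simp: morrey_exps_def)
  have a: "loc_int a" using o by (simp add: osc_le_def)
  define u where "u = (indicator (cell k x) :: real^'n \<Rightarrow> real)"
  define v where "v = (indicator (cell l w) :: real^'n \<Rightarrow> real)"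
  have mu: "mbd p q u (1 + measure lborel (cell k x))" and mv: "mbd p q v (1 + measure lborel (cell l w))"
    unfolding u_def v_def using ep by (intro mbd_indicator_cell; simp)+
  have lu: "loc_int u" "loc_int (\<lambda>z. a z * u z)" and lv: "loc_int v" "loc_int (\<lambda>z. a z * v z)"
    unfolding u_def v_def using loc_int_indicator_mult[OF a] by blast+
  let ?S = "\<lambda>M. scale_comm \<alpha> a {- int M..int M}"
  let ?k = "2 powr \<alpha> - 1"
  have m0: "0 \<le> 1 + measure lborel (cell i z)" for i and z :: "real^'n" by simp
  note Lv = comm_series_avg_lim[OF ex mv m0 o, of k x] and Lu = comm_series_avg_lim[OF ex mu m0 o, of l w]
  have lh: "loc_int (comm_series \<alpha> a u)"
    by (rule comm_series_loc_int[OF ex o mu]) (simp add: add_pos_nonneg)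
  have "\<bar>avg k (comm_series \<alpha> a v) x\<bar> \<le> 2 powr (real_of_int k * ?n) * 2 powr (- real_of_int l * ?n) * avg l (\<lambda>y. \<bar>comm_series \<alpha> a u y\<bar>) w"
  proof (cases "\<exists>i. idx i x = idx i w")
    \<comment> \<open>Cells in different orthants have no common ancestor. No average over a cube
      meeting one of them sees the other, so the left-hand side is 0.\<close>
    case False
    have z: "?S M v y = 0" if y: "y \<in> cell k x" for M y
    proof -
      have d: "z \<notin> cell l w" if "z \<in> cell j y" for j z
      proof
        assume "z \<in> cell l w"
        then have zw: "idx l z = idx l w" by (simp only: mem_cell)
        have zy: "idx j z = idx j y" using that by (simp only: mem_cell)
        have yx: "idx k y = idx k x" using y by (simp only: mem_cell)
        define i where "i = min j (min k l)"
        have i: "i \<le> j" "i \<le> k" "i \<le> l" by (simp_all add: i_def)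
        have "idx i x = idx i w"
          using idx_coarse[OF zw i(3)] idx_coarse[OF zy i(1)] idx_coarse[OF yx i(2)] by simp
        then have "\<exists>i. idx i x = idx i w" by (rule exI)
        with False show False by (rule notE)
      qed
      have "avg j v y = 0" "avg j (\<lambda>z. a z * v z) y = 0" for j
        using avg_indicator_disjoint[of j y "cell l w" "\<lambda>_. 1"] avg_indicator_disjoint[of j y "cell l w" a] d
        unfolding v_def by (simp_all add: mult.commute)
      then show ?thesis by (simp add: scale_comm_def)
    qed
    have "avg k (?S M v) x = avg k (\<lambda>_. 0) x" for M by (rule avg_cong) (rule z)
    then have "avg k (?S M v) x = 0" for M by simp
    then have "(\<lambda>M. 0) \<longlonglongrightarrow> avg k (comm_series \<alpha> a v) x" using Lv by simp
    then have "avg k (comm_series \<alpha> a v) x = 0" by (simp add: LIMSEQ_const_iff)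
    then show ?thesis by (simp add: avg_nonneg)
  next
    case True
    then obtain i0 where i0: "idx i0 x = idx i0 w" by blast
    have eq: "avg k (?S M v) x = - (2 powr (real_of_int k * ?n) * 2 powr (- real_of_int l * ?n) * avg l (?S M u) w)" for M
    proof -
      \<comment> \<open>A common ancestor of both cells that is also no finer than any level of the
        truncation, as antisymmetry requires.\<close>
      define i where "i = min (min i0 (- int M)) (min k l)"
      have i: "i \<le> i0" "i \<le> - int M" "i \<le> k" "i \<le> l" by (auto simp: i_def)
      have ixw: "idx i x = idx i w" by (rule idx_coarse[OF i0 i(1)])
      have 1: "avg i (\<lambda>y. u y * ?S M v y) x = 2 powr (real_of_int (i - k) * ?n) * avg k (?S M v) x"
        unfolding u_def by (rule avg_indicator_cell[OF refl i(3)])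
      have 2: "avg i (\<lambda>y. v y * ?S M u y) x = 2 powr (real_of_int (i - l) * ?n) * avg l (?S M u) w"
        unfolding v_def by (rule avg_indicator_cell[OF ixw i(4)])
      have 3: "avg i (\<lambda>y. u y * ?S M v y) x = - avg i (\<lambda>y. v y * ?S M u y) x"
        using i(2) by (intro scale_comm_antisym lu lv) auto
      have p: "2 powr (real_of_int (i - l) * ?n) = 2 powr (real_of_int (i - k) * ?n) * (2 powr (real_of_int k * ?n) * 2 powr (- real_of_int l * ?n))"
        by (simp add: powr_add[symmetric] algebra_simps)
      have "2 powr (real_of_int (i - k) * ?n) * avg k (?S M v) x = 2 powr (real_of_int (i - k) * ?n) * (- (2 powr (real_of_int k * ?n) * 2 powr (- real_of_int l * ?n) * avg l (?S M u) w))"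
        using 3 unfolding 1 2 p by simp
      then show ?thesis by (rule iffD1[OF mult_left_cancel, rotated]) simp
    qed
    let ?c = "2 powr (real_of_int k * ?n) * 2 powr (- real_of_int l * ?n)"
    have "(\<lambda>M. - ?c * (?k * avg l (?S M u) w)) \<longlonglongrightarrow> - ?c * avg l (comm_series \<alpha> a u) w"
      by (intro tendsto_mult_left Lu)
    moreover have "- ?c * (?k * avg l (?S M u) w) = ?k * avg k (?S M v) x" for M
      unfolding eq by (simp add: mult_ac)
    ultimately have "(\<lambda>M. ?k * avg k (?S M v) x) \<longlonglongrightarrow> - ?c * avg l (comm_series \<alpha> a u) w" by simp
    then have "avg k (comm_series \<alpha> a v) x = - ?c * avg l (comm_series \<alpha> a u) w"
      by (rule LIMSEQ_unique[OF Lv])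
    then have "\<bar>avg k (comm_series \<alpha> a v) x\<bar> = ?c * \<bar>avg l (comm_series \<alpha> a u) w\<bar>" by (simp add: abs_mult)
    also have "\<dots> \<le> ?c * avg l (\<lambda>y. \<bar>comm_series \<alpha> a u y\<bar>) w" by (intro mult_left_mono avg_abs_le lh) simp
    finally show ?thesis .
  qed
  then show ?thesis unfolding u_def v_def .
qed

text \<open>On the cell of x only levels coarser than l see the indicator of the sibling, and each
  contributes a positive weight times the same factor a y - \<open>avg l a w\<close>. Hence level l
  - 1, that of the common parent, alone gives a lower bound.\<close>

lemma comm_series_sibling:
  fixes a :: "real^'n::finite \<Rightarrow> real"
  assumes ex: "morrey_exps TYPE('n) \<alpha> p q s t" and o: "osc_le a B"
    and sib: "idx (l - 1) x = idx (l - 1) w" "idx l x \<noteq> idx l w"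
    and big: "avg l (\<lambda>y. \<bar>a y - avg l a x\<bar>) x > \<epsilon>"
  shows "avg l (\<lambda>y. \<bar>comm_series \<alpha> a (indicator (cell l w)) y\<bar>) x
     \<ge> (2 powr \<alpha> - 1) * (2 powr (- \<alpha> * real_of_int (l - 1)) * 2 powr (- real CARD('n))) * (\<epsilon> / 2)"
proof -
  let ?n = "real CARD('n)"
  have ep: "0 < \<alpha>" "1 \<le> q" "q \<le> p" "1 < t" using ex by (auto simp: morrey_exps_def)
  have a: "loc_int a" using o by (simp add: osc_le_def)
  define v where "v = (indicator (cell l w) :: real^'n \<Rightarrow> real)"
  have mv: "mbd p q v (1 + measure lborel (cell l w))" unfolding v_def using ep by (intro mbd_indicator_cell)
  have m0: "0 \<le> 1 + measure lborel (cell l w)" by simp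
  let ?k = "2 powr \<alpha> - 1"
  have k: "?k > 0" using powr_minus_1_pos ep by blast
  define c where "c = 2 powr (- \<alpha> * real_of_int (l - 1)) * 2 powr (- ?n)"
  have c: "c > 0" by (simp add: c_def)
  have lh: "loc_int (comm_series \<alpha> a v)"
    by (rule comm_series_loc_int[OF ex o mv]) (simp add: add_pos_nonneg)
  have low: "c * \<bar>a y - avg l a w\<bar> \<le> \<bar>scale_comm \<alpha> a {- int M..int M} v y\<bar>"
    if y: "y \<in> cell l x" and M: "l - 1 \<in> {- int M..int M}" for y M
  proof -
    let ?J = "{- int M..int M}"
    \<comment> \<open>The nonnegative weight of level j: the weight 2^(-\<alpha> j) times the share
      of the sibling in its ancestor of level j, and 0 from level l on.\<close>
    define d where "d j = (if j < l then 2 powr (- \<alpha> * real_of_int j) * 2 powr (real_of_int (j - l) * ?n) else 0)" for j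
    have trm: "2 powr (- \<alpha> * real_of_int j) * (a y * avg j v y - avg j (\<lambda>z. a z * v z) y) = d j * (a y - avg l a w)" for j
    proof (cases "j < l")
      case True
      have "idx l y = idx l x" using y by (simp only: mem_cell)
      then have "idx j y = idx j x" by (rule idx_coarse) (use True in simp)
      also have "\<dots> = idx j w" by (rule idx_coarse[OF sib(1)]) (use True in simp)
      finally have jw: "idx j y = idx j w" .
      have "avg j v y = 2 powr (real_of_int (j - l) * ?n)"
        using avg_indicator_cell[OF jw less_imp_le[OF True], of "\<lambda>_. 1"] by (simp add: v_def)
      moreover have "avg j (\<lambda>z. a z * v z) y = 2 powr (real_of_int (j - l) * ?n) * avg l a w"
        using avg_indicator_cell[OF jw less_imp_le[OF True], of a] by (simp add: v_def mult.commute)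
      ultimately show ?thesis using True by (simp add: d_def algebra_simps)
    next
      case False
      have dis: "z \<notin> cell l w" if "z \<in> cell j y" for z
      proof
        assume "z \<in> cell l w"
        then have zw: "idx l z = idx l w" by (simp only: mem_cell)
        have "idx j z = idx j y" using that by (simp only: mem_cell)
        then have zy: "idx l z = idx l y" by (rule idx_coarse) (use False in simp)
        have yx: "idx l y = idx l x" using y by (simp only: mem_cell)
        show False using sib(2) unfolding yx[symmetric] zy[symmetric] zw by simp
      qed
      have "avg j v y = 0" "avg j (\<lambda>z. a z * v z) y = 0"
        using avg_indicator_disjoint[of j y "cell l w" "\<lambda>_. 1"] avg_indicator_disjoint[of j y "cell l w" a] dis
        unfolding v_def by (simp_all add: mult.commute)
      then show ?thesis using False by (simp add: d_def)
    qed
    have "c = d (l - 1)" by (simp add: c_def d_def)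
    also have "\<dots> \<le> (\<Sum>j\<in>?J. d j)" using M by (intro member_le_sum) (auto simp: d_def)
    finally have cd: "c \<le> (\<Sum>j\<in>?J. d j)" .
    have "scale_comm \<alpha> a ?J v y = (\<Sum>j\<in>?J. d j) * (a y - avg l a w)"
      unfolding scale_comm_def trm by (rule sum_distrib_right[symmetric])
    then have "\<bar>scale_comm \<alpha> a ?J v y\<bar> = (\<Sum>j\<in>?J. d j) * \<bar>a y - avg l a w\<bar>" using cd c by (simp add: abs_mult)
    then show ?thesis using cd by (simp add: mult_right_mono)
  qed
  have ae: "AE y in lborel. indicator (cell l x) y * (?k * c * \<bar>a y - avg l a w\<bar>) \<le> \<bar>comm_series \<alpha> a v y\<bar>"
    using comm_series_lim(1)[OF ex mv m0 o]
  proof eventually_elim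
    case (elim y)
    have "(\<lambda>M. ?k * scale_comm \<alpha> a {- int M..int M} v y) \<longlonglongrightarrow> comm_series \<alpha> a v y" using elim by simp
    then have L: "(\<lambda>M. \<bar>?k * scale_comm \<alpha> a {- int M..int M} v y\<bar>) \<longlonglongrightarrow> \<bar>comm_series \<alpha> a v y\<bar>" by (rule tendsto_rabs)
    show ?case
    proof (cases "y \<in> cell l x")
      case True
      have "?k * c * \<bar>a y - avg l a w\<bar> \<le> \<bar>comm_series \<alpha> a v y\<bar>"
      proof (rule LIMSEQ_le_const[OF L], intro exI[of _ "nat \<bar>l - 1\<bar>"] allI impI)
        fix M assume "nat \<bar>l - 1\<bar> \<le> M"
        then have "l - 1 \<in> {- int M..int M}" by auto
        from low[OF True this] have "?k * (c * \<bar>a y - avg l a w\<bar>) \<le> ?k * \<bar>scale_comm \<alpha> a {- int M..int M} v y\<bar>"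
          using k by (intro mult_left_mono) auto
        then show "?k * c * \<bar>a y - avg l a w\<bar> \<le> \<bar>?k * scale_comm \<alpha> a {- int M..int M} v y\<bar>"
          using k by (simp add: abs_mult mult.assoc)
      qed
      then show ?thesis using True by simp
    qed simp
  qed
  have lo: "loc_int (\<lambda>y. \<bar>a y - avg l a w\<bar>)" by (intro loc_int_abs loc_int_diff a loc_int_const)
  have levl: "lev l (indicator (cell l x) :: real^'n \<Rightarrow> real)" by (simp add: lev_def indicator_def mem_cell)
  \<comment> \<open>The centre here is the mean over the sibling, not over the cell itself;
    \<open>avg_osc_le\<close> shows that this loses at most a factor 2.\<close>
  have "\<epsilon> / 2 \<le> avg l (\<lambda>y. \<bar>a y - avg l a w\<bar>) x"
  proof (rule ccontr)
    assume "\<not> \<epsilon> / 2 \<le> avg l (\<lambda>y. \<bar>a y - avg l a w\<bar>) x"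
    then have "avg l (\<lambda>y. \<bar>a y - avg l a w\<bar>) x \<le> \<epsilon> / 2" by simp
    from avg_osc_le[OF a this] big show False by simp
  qed
  then have "?k * c * (\<epsilon> / 2) \<le> ?k * c * avg l (\<lambda>y. \<bar>a y - avg l a w\<bar>) x" using k c by (intro mult_left_mono) auto
  also have "\<dots> = avg l (\<lambda>y. ?k * c * \<bar>a y - avg l a w\<bar>) x" by (rule avg_cmult[symmetric])
  also have "\<dots> = avg l (\<lambda>y. indicator (cell l x) y * (?k * c * \<bar>a y - avg l a w\<bar>)) x" by (rule avg_cong) simp
  also have "\<dots> \<le> avg l (\<lambda>y. \<bar>comm_series \<alpha> a v y\<bar>) x"
    by (intro avg_mono_AE loc_int_lev_mult[OF levl] loc_int_cmult lo loc_int_abs lh ae)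
  finally show ?thesis unfolding v_def c_def .
qed

text \<open>The factor is |Q|^(-1/p). Small cubes only see the height of the function; larger ones
  see its mass, and q <= p suffices.\<close>

lemma mbd_normalized_cell:
  fixes w :: "real^'n::finite"
  assumes pq: "1 \<le> q" "q \<le> p"
  shows "mbd p q (\<lambda>y. 2 powr (real_of_int l * real CARD('n) / p) * indicator (cell l w) y) 1"
proof -
  let ?n = "real CARD('n)"
  let ?I = "indicator (cell l w) :: real^'n \<Rightarrow> real"
  have eq: "(\<lambda>y. \<bar>2 powr (real_of_int l * ?n / p) * ?I y\<bar> powr q) = (\<lambda>y. 2 powr (real_of_int l * ?n / p * q) * ?I y)"
    using pq by (auto simp: indicator_def powr_powr)
  have li: "loc_int ?I" using loc_int_indicator_mult(1)[OF loc_int_const] .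
  show ?thesis unfolding mbd_def eq
  proof (intro conjI allI loc_int_cmult li)
    show "(\<lambda>y. 2 powr (real_of_int l * ?n / p) * ?I y) \<in> borel_measurable borel" using loc_int_measurable[OF li] by simp
    fix k and x :: "real^'n"
    have "2 powr (real_of_int l * ?n / p * q) * avg k ?I x \<le> 2 powr (real_of_int k * ?n / p * q)"
    proof (cases "k \<ge> l")
      case True
      have "avg k ?I x \<le> avg k (\<lambda>_. 1) x" by (intro avg_mono_cell li loc_int_const) (auto simp: indicator_def)
      then have "2 powr (real_of_int l * ?n / p * q) * avg k ?I x \<le> 2 powr (real_of_int l * ?n / p * q) * 1"
        by (intro mult_left_mono) simp_all
      also have "\<dots> \<le> 2 powr (real_of_int k * ?n / p * q)"
        using True pq by (simp add: divide_right_mono mult_right_mono)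
      finally show ?thesis .
    next
      case False
      have "avg k ?I x \<le> 2 powr (real_of_int (k - l) * ?n)"
      proof (cases "idx k x = idx k w")
        case True
        have "k \<le> l" using False by simp
        from avg_indicator_cell[OF True this, of "\<lambda>_. 1"] show ?thesis by simp
      next
        case nF: False
        have "z \<notin> cell l w" if "z \<in> cell k x" for z
        proof
          assume "z \<in> cell l w"
          then have "idx l z = idx l w" by (simp only: mem_cell)
          then have zw: "idx k z = idx k w" by (rule idx_coarse) (use False in simp)
          have zx: "idx k z = idx k x" using that by (simp only: mem_cell)
          show False using nF unfolding zx[symmetric] zw by simp
        qed
        then have "avg k (\<lambda>z. ?I z * 1) x = 0" by (rule avg_indicator_disjoint)
        then show ?thesis by simp
      qed
      then have "2 powr (real_of_int l * ?n / p * q) * avg k ?I x \<le> 2 powr (real_of_int l * ?n / p * q) * 2 powr (real_of_int (k - l) * ?n)"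
        by (intro mult_left_mono) simp_all
      also have "\<dots> = 2 powr (real_of_int l * ?n / p * q + real_of_int (k - l) * ?n)" by (rule powr_add[symmetric])
      also have "\<dots> \<le> 2 powr (real_of_int k * ?n / p * q)"
      proof (rule powr_mono)
        have "real_of_int (k - l) * ?n * 1 \<le> real_of_int (k - l) * ?n * (q / p)"
          using False pq by (intro mult_left_mono_neg) (auto simp: mult_nonpos_nonneg)
        also have "\<dots> = real_of_int k * ?n / p * q - real_of_int l * ?n / p * q"
          by (simp add: left_diff_distrib diff_divide_distrib)
        finally show "real_of_int l * ?n / p * q + real_of_int (k - l) * ?n \<le> real_of_int k * ?n / p * q" by simp
      qed simp
      finally show ?thesis .
    qed
    then show "avg k (\<lambda>y. 2 powr (real_of_int l * ?n / p * q) * ?I y) x \<le> (1 * 2 powr (real_of_int k * ?n / p)) powr q"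
      by (simp add: avg_cmult powr_powr)
  qed
qed

text \<open>With equal exponents \<open>mbd\<close> bounds the integral of |h|^s over every cube by
  K^s. Each cube with a large average takes up at least \<delta>^s times its volume, which limits
  the number of such cubes of one level.\<close>

lemma finite_large_averages_level:
  fixes h :: "real^'n::finite \<Rightarrow> real"
  assumes h: "mbd s s h K" and s: "s > 1" and K: "K \<ge> 0" and d: "\<delta> > 0"
  shows "finite {idx l w |w. avg l (\<lambda>y. \<bar>h y\<bar>) w > \<delta>}"
proof -
  let ?n = "real CARD('n)"
  let ?E = "{idx l w |w. avg l (\<lambda>y. \<bar>h y\<bar>) w > \<delta>}"
  define Box where "Box = {b::int^'n. \<forall>i. b$i \<in> {-1, 0}}"
  have finBox: "finite Box" unfolding Box_def by (rule finite_vec_range) simp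
  define H where "H y = \<bar>h y\<bar> powr s" for y
  have liH: "loc_int H" using mbdD(2)[OF h] unfolding H_def .
  have H0: "0 \<le> H y" for y by (simp add: H_def)
  define r where "r = K powr s * 2 powr (real_of_int l * ?n) / \<delta> powr s"
  have bigH: "\<delta> powr s \<le> avg l H w" if "avg l (\<lambda>y. \<bar>h y\<bar>) w > \<delta>" for w
  proof -
    have "\<delta> \<le> avg l H w powr (1/s)"
      using avg_abs_le_avg_powr[OF mbdD(2,1)[OF h] s, of l w] that unfolding H_def by linarith
    then have "\<delta> powr s \<le> (avg l H w powr (1/s)) powr s" using d s by (intro powr_mono2) auto
    then show ?thesis using avg_nonneg[of l w H] H0 s by (simp add: powr_powr)
  qed
  have bound: "card W \<le> nat \<lceil>real (card Box) * r\<rceil>" if W: "W \<subseteq> ?E" "finite W" for W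
  proof -
    have "\<forall>m\<in>W. \<exists>w. idx l w = m \<and> avg l (\<lambda>y. \<bar>h y\<bar>) w > \<delta>" using W by blast
    then obtain w where w: "\<And>m. m \<in> W \<Longrightarrow> idx l (w m) = m" "\<And>m. m \<in> W \<Longrightarrow> avg l (\<lambda>y. \<bar>h y\<bar>) (w m) > \<delta>" by metis
    have "\<forall>m\<in>W. \<exists>N0. \<forall>N\<ge>N0. \<forall>i. idx (- int N) (w m) $ i \<in> {-1, 0}" using idx_coarse_box by blast
    from bchoice[OF this] obtain N0 where N0: "\<forall>m\<in>W. \<forall>N\<ge>N0 m. \<forall>i. idx (- int N) (w m) $ i \<in> {-1, 0}" by blast
    \<comment> \<open>Coarse enough for all the finitely many cubes in question to lie in the cubes
      of level -N at the origin; these are counted one by one below, each with the bound r.\<close>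
    define N where "N = (\<Sum>m\<in>W. N0 m) + nat \<bar>l\<bar>"
    have Nl: "- int N \<le> l" unfolding N_def by linarith
    have wBox: "idx (- int N) (w m) \<in> Box" if m: "m \<in> W" for m
    proof -
      have "N0 m \<le> (\<Sum>m\<in>W. N0 m)" by (rule member_le_sum[OF m _ W(2)]) simp
      then have "N0 m \<le> N" by (simp add: N_def)
      then show ?thesis using N0 m unfolding Box_def by blast
    qed
    have cb: "real (card {m\<in>W. idx (- int N) (w m) = b}) \<le> r" for b
    proof -
      let ?W = "{m\<in>W. idx (- int N) (w m) = b}"
      have finW: "finite ?W" using W(2) by simp
      obtain x where x: "idx (- int N) x = b" using idx_surj by blast
      have li: "loc_int (\<lambda>y. indicator (cell l (w m)) y * H y)" for m
        using loc_int_indicator_mult(2)[OF liH, of l "w m"] by (simp add: mult.commute)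
      have "real (card ?W) * (2 powr (real_of_int (- int N - l) * ?n) * \<delta> powr s) = (\<Sum>m\<in>?W. 2 powr (real_of_int (- int N - l) * ?n) * \<delta> powr s)" by simp
      also have "\<dots> \<le> (\<Sum>m\<in>?W. 2 powr (real_of_int (- int N - l) * ?n) * avg l H (w m))"
        using w(2) by (intro sum_mono mult_left_mono bigH) auto
      also have "\<dots> = (\<Sum>m\<in>?W. avg (- int N) (\<lambda>y. indicator (cell l (w m)) y * H y) x)"
        using x by (intro sum.cong refl avg_indicator_cell[symmetric] Nl) auto
      also have "\<dots> = avg (- int N) (\<lambda>y. \<Sum>m\<in>?W. indicator (cell l (w m)) y * H y) x"
        by (intro avg_sum[symmetric] li)
      also have "\<dots> \<le> avg (- int N) H x"
      proof (intro avg_mono_cell loc_int_sum li liH)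
        fix y
        have "(\<Sum>m\<in>?W. indicator (cell l (w m)) y * H y) \<le> (\<Sum>m\<in>{idx l y}. H y)"
        proof (rule order_trans)
          have "(\<Sum>m\<in>?W. indicator (cell l (w m)) y * H y) = (\<Sum>m\<in>?W. if m = idx l y then H y else 0)"
            by (intro sum.cong refl) (use w(1) in \<open>auto simp: mem_cell indicator_def\<close>)
          also have "\<dots> = (if idx l y \<in> ?W then H y else 0)" using finW by (rule sum.delta)
          finally show "(\<Sum>m\<in>?W. indicator (cell l (w m)) y * H y) \<le> (if idx l y \<in> ?W then H y else 0)" by simp
          show "(if idx l y \<in> ?W then H y else 0) \<le> (\<Sum>m\<in>{idx l y}. H y)" using H0[of y] by simp
        qed
        then show "(\<Sum>m\<in>?W. indicator (cell l (w m)) y * H y) \<le> H y" by simp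
      qed
      also have "\<dots> \<le> (K * 2 powr (real_of_int (- int N) * ?n / s)) powr s" using mbdD(3)[OF h] unfolding H_def .
      also have "\<dots> = K powr s * 2 powr (real_of_int (- int N) * ?n)" using s by (simp add: powr_mult powr_powr)
      also have "\<dots> = r * (2 powr (real_of_int (- int N - l) * ?n) * \<delta> powr s)"
      proof -
        have "2 powr (real_of_int (- int N) * ?n) = 2 powr (real_of_int l * ?n) * 2 powr (real_of_int (- int N - l) * ?n)"
          by (simp add: powr_add[symmetric] algebra_simps)
        then show ?thesis using d by (simp add: r_def)
      qed
      finally show ?thesis by (rule mult_right_le_imp_le) (use d in simp)
    qed
    have "W = (\<Union>b\<in>Box. {m\<in>W. idx (- int N) (w m) = b})" using wBox by blast
    then have "real (card W) = real (card (\<Union>b\<in>Box. {m\<in>W. idx (- int N) (w m) = b}))" by simp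
    also have "\<dots> \<le> real (\<Sum>b\<in>Box. card {m\<in>W. idx (- int N) (w m) = b})"
      unfolding of_nat_le_iff by (rule card_UN_le[OF finBox])
    also have "\<dots> \<le> (\<Sum>b\<in>Box. r)" unfolding of_nat_sum by (rule sum_mono) (rule cb)
    also have "\<dots> = real (card Box) * r" by simp
    finally show ?thesis by linarith
  qed
  then show ?thesis using finite_if_finite_subsets_card_bdd[of ?E] by blast
qed

text \<open>The two exponents on either side of \<open>v0\<close> give decay for large and for small cubes.\<close>

lemma finite_large_averages:
  fixes h :: "real^'n::finite \<Rightarrow> real"
  assumes h: "\<And>v. 0 < v \<Longrightarrow> v < v1 \<Longrightarrow> \<exists>K\<ge>0. mbd (1/v) (1/v) h K" and v0: "0 < v0" "v0 < v1" and v1: "v1 \<le> 1" and d: "\<delta> > 0"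
  shows "finite {(l, idx l w) |l w. 2 powr (- v0 * (real_of_int l * real CARD('n))) * avg l (\<lambda>y. \<bar>h y\<bar>) w > \<delta>}"
proof -
  let ?n = "real CARD('n)"
  \<comment> \<open>Keeps v0 - \<eta> positive and v0 + \<eta> below v1, so that both exponents are
    covered by the hypothesis.\<close>
  define \<eta> where "\<eta> = min (v0 / 2) ((v1 - v0) / 2)"
  have \<eta>: "\<eta> > 0" "0 < v0 - \<eta>" "v0 + \<eta> < v1" 
  proof -
    have le: "\<eta> \<le> v0 / 2" "\<eta> \<le> (v1 - v0) / 2" unfolding \<eta>_def by (rule min.cobounded1, rule min.cobounded2)
    show "0 < v0 - \<eta>" using le(1) v0 by linarith
    have "2 * \<eta> \<le> v1 - v0" using le(2) by simp
    then show "v0 + \<eta> < v1" using v0 by argo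
    show "\<eta> > 0" using v0 by (simp add: \<eta>_def)
  qed
  obtain Ka where Ka: "Ka \<ge> 0" "mbd (1/(v0 + \<eta>)) (1/(v0 + \<eta>)) h Ka" using h[of "v0 + \<eta>"] \<eta> v0 by auto
  obtain Kb where Kb: "Kb \<ge> 0" "mbd (1/(v0 - \<eta>)) (1/(v0 - \<eta>)) h Kb" using h[of "v0 - \<eta>"] \<eta> v0 by auto
  obtain K0 where K0: "K0 \<ge> 0" "mbd (1/v0) (1/v0) h K0" using h[of v0] v0 by auto
  have bd: "2 powr (- v0 * (real_of_int l * ?n)) * avg l (\<lambda>y. \<bar>h y\<bar>) w \<le> K * 2 powr ((v - v0) * (real_of_int l * ?n))"
    if m: "mbd (1/v) (1/v) h K" and v: "0 < v" "v < 1" and K: "K \<ge> 0" for l w v K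
  proof -
    have "avg l (\<lambda>y. \<bar>h y\<bar>) w \<le> K * 2 powr (real_of_int l * ?n / (1/v))"
      by (rule mbd_avg_abs[OF m _ K]) (use v in simp)
    then have "2 powr (- v0 * (real_of_int l * ?n)) * avg l (\<lambda>y. \<bar>h y\<bar>) w \<le> 2 powr (- v0 * (real_of_int l * ?n)) * (K * 2 powr (real_of_int l * ?n / (1/v)))"
      by (intro mult_left_mono) auto
    also have "\<dots> = K * (2 powr (- v0 * (real_of_int l * ?n)) * 2 powr (real_of_int l * ?n / (1/v)))" by simp
    also have "2 powr (- v0 * (real_of_int l * ?n)) * 2 powr (real_of_int l * ?n / (1/v)) = 2 powr ((v - v0) * (real_of_int l * ?n))"
      by (simp add: powr_add[symmetric] algebra_simps)
    finally show ?thesis .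
  qed
  have "(\<lambda>L. (Ka + Kb) * 2 powr (- (\<eta> * ?n) * real L)) \<longlonglongrightarrow> 0"
    by (intro tendsto_mult_right_zero summable_LIMSEQ_zero[OF summable_powr]) (use \<eta> in simp)
  then have "\<forall>\<^sub>F L in sequentially. (Ka + Kb) * 2 powr (- (\<eta> * ?n) * real L) < \<delta>" using d by (intro order_tendstoD) auto
  then obtain L where L: "\<And>L'. L' \<ge> L \<Longrightarrow> (Ka + Kb) * 2 powr (- (\<eta> * ?n) * real L') < \<delta>" unfolding eventually_sequentially by blast
  \<comment> \<open>Large cubes use the exponent v0 + \<eta>, small ones v0 - \<eta>; either way a
    factor 2^(-\<eta> n |l|) is gained, leaving finitely many levels.\<close>
  have small: "2 powr (- v0 * (real_of_int l * ?n)) * avg l (\<lambda>y. \<bar>h y\<bar>) w \<le> \<delta>" if "l \<notin> {- int L..int L}" for l w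
  proof (cases "l < 0")
    case True
    then have Ll: "L \<le> nat (- l)" using that by auto
    have "2 powr (- v0 * (real_of_int l * ?n)) * avg l (\<lambda>y. \<bar>h y\<bar>) w \<le> Ka * 2 powr ((v0 + \<eta> - v0) * (real_of_int l * ?n))"
      by (rule bd[OF Ka(2)]) (use \<eta> v0 v1 Ka in auto)
    also have "(v0 + \<eta> - v0) * (real_of_int l * ?n) = - (\<eta> * ?n) * real (nat (- l))" using True by simp
    also have "Ka * 2 powr (- (\<eta> * ?n) * real (nat (- l))) \<le> (Ka + Kb) * 2 powr (- (\<eta> * ?n) * real (nat (- l)))"
      using Kb by (intro mult_right_mono) auto
    also have "\<dots> < \<delta>" by (rule L[OF Ll])
    finally show ?thesis by simp
  next
    case False
    then have Ll: "L \<le> nat l" using that by auto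
    have "2 powr (- v0 * (real_of_int l * ?n)) * avg l (\<lambda>y. \<bar>h y\<bar>) w \<le> Kb * 2 powr ((v0 - \<eta> - v0) * (real_of_int l * ?n))"
      by (rule bd[OF Kb(2)]) (use \<eta> v0 v1 Kb in auto)
    also have "(v0 - \<eta> - v0) * (real_of_int l * ?n) = - (\<eta> * ?n) * real (nat l)" using False by simp
    also have "Kb * 2 powr (- (\<eta> * ?n) * real (nat l)) \<le> (Ka + Kb) * 2 powr (- (\<eta> * ?n) * real (nat l))"
      using Ka by (intro mult_right_mono) auto
    also have "\<dots> < \<delta>" by (rule L[OF Ll])
    finally show ?thesis by simp
  qed
  have sub: "{(l, idx l w) |l w. 2 powr (- v0 * (real_of_int l * ?n)) * avg l (\<lambda>y. \<bar>h y\<bar>) w > \<delta>}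
    \<subseteq> (SIGMA l:{- int L..int L}. {idx l w |w. avg l (\<lambda>y. \<bar>h y\<bar>) w > \<delta> / 2 powr (- v0 * (real_of_int l * ?n))})"
  proof
    fix b assume "b \<in> {(l, idx l w) |l w. 2 powr (- v0 * (real_of_int l * ?n)) * avg l (\<lambda>y. \<bar>h y\<bar>) w > \<delta>}"
    then obtain l w where b: "b = (l, idx l w)" "2 powr (- v0 * (real_of_int l * ?n)) * avg l (\<lambda>y. \<bar>h y\<bar>) w > \<delta>" by blast
    have "l \<in> {- int L..int L}" using small[of l w] b(2) by linarith
    moreover have "avg l (\<lambda>y. \<bar>h y\<bar>) w > \<delta> / 2 powr (- v0 * (real_of_int l * ?n))"
      using b(2) by (simp add: divide_less_eq mult.commute)
    ultimately show "b \<in> (SIGMA l:{- int L..int L}. {idx l w |w. avg l (\<lambda>y. \<bar>h y\<bar>) w > \<delta> / 2 powr (- v0 * (real_of_int l * ?n))})"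
      unfolding b(1) by blast
  qed
  have s0: "1 < 1/v0" using v0 v1 by simp
  show ?thesis
    by (rule finite_subset[OF sub], intro finite_SigmaI finite_large_averages_level[OF K0(2) s0 K0(1)]) (use d in auto)
qed

section \<open>Necessity\<close>

text \<open>Here \<open>undefined\<close> is merely some fixed coordinate.\<close>

definition sibling :: "int^'n::finite \<Rightarrow> int^'n" where
  "sibling m = (\<chi> i. if i = undefined then (if even (m$i) then m$i + 1 else m$i - 1) else m$i)"

lemma sibling_props: "sibling (sibling m) = m" "sibling m \<noteq> m" "sibling m $ i div 2 = m $ i div 2"
proof -
  show "sibling (sibling m) = m" by (auto simp: sibling_def vec_eq_iff)
  have "sibling m $ undefined \<noteq> m $ undefined" by (simp add: sibling_def)
  then show "sibling m \<noteq> m" by metis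
  show "sibling m $ i div 2 = m $ i div 2" unfolding sibling_def by (auto elim!: evenE oddE)
qed

text \<open>Convergence in Morrey norm forces convergence of the averages over each fixed cell. As
  those of the images tend to 0, the limit is null and the norms tend to 0 along the subsequence,
  which the uniform lower bound on the bad cubes excludes.\<close>

lemma compact_VMO:
  fixes a :: "real^'n::finite \<Rightarrow> real"
  assumes ex: "morrey_exps TYPE('n) \<alpha> p q s t" and aB: "a \<in> BMO"
    and comp: "compact_op p q s t (commutator q \<alpha> a)"
  shows "a \<in> VMO"
proof (rule VMO_of_finite[OF aB], rule ccontr)
  let ?n = "real CARD('n)"
  have ep: "0 < \<alpha>" "1 < q" "q \<le> p" "1 < t" "t \<le> s" "1/s = 1/p - \<alpha> / ?n" using ex by (auto simp: morrey_exps_def)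
  fix \<epsilon> :: real assume \<epsilon>: "\<epsilon> > 0"
  let ?Bad = "{(j, idx j x) |j x. avg j (\<lambda>y. \<bar>a y - avg j a x\<bar>) x > \<epsilon>}"
  assume "infinite ?Bad"
  then obtain b :: "nat \<Rightarrow> int \<times> (int^'n)" where b: "inj b" "range b \<subseteq> ?Bad"
    using infinite_countable_subset by blast
  obtain B where o: "osc_le a B" using BMO_osc[OF aB] by blast
  define l where "l k = fst (b k)" for k
  have "\<exists>x. idx (l k) x = snd (b k) \<and> avg (l k) (\<lambda>y. \<bar>a y - avg (l k) a x\<bar>) x > \<epsilon>" for k
  proof -
    have "b k \<in> ?Bad" using b(2) by (rule subsetD) (rule rangeI)
    then obtain j x where "b k = (j, idx j x)" "avg j (\<lambda>y. \<bar>a y - avg j a x\<bar>) x > \<epsilon>" by (elim CollectE exE conjE)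
    then show ?thesis unfolding l_def by (intro exI[of _ x]) simp
  qed
  then have "\<exists>x. \<forall>k. idx (l k) (x k) = snd (b k) \<and> avg (l k) (\<lambda>y. \<bar>a y - avg (l k) a (x k)\<bar>) (x k) > \<epsilon>"
    by (intro choice allI)
  then obtain x where "\<forall>k. idx (l k) (x k) = snd (b k) \<and> avg (l k) (\<lambda>y. \<bar>a y - avg (l k) a (x k)\<bar>) (x k) > \<epsilon>"
    by (rule exE)
  then have x: "idx (l k) (x k) = snd (b k)" "avg (l k) (\<lambda>y. \<bar>a y - avg (l k) a (x k)\<bar>) (x k) > \<epsilon>" for k
    by simp_all
  have "\<exists>w. \<forall>k. idx (l k) (w k) = sibling (snd (b k))" by (intro choice allI idx_surj)
  then obtain w where "\<forall>k. idx (l k) (w k) = sibling (snd (b k))" by (rule exE)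
  then have w: "idx (l k) (w k) = sibling (snd (b k))" for k by simp
  have sib: "idx (l k - 1) (x k) = idx (l k - 1) (w k)" "idx (l k) (x k) \<noteq> idx (l k) (w k)" for k
  proof -
    have "idx (l k - 1) (x k) $ i = idx (l k - 1) (w k) $ i" for i
      using idx_half[of "l k - 1" "x k" i] idx_half[of "l k - 1" "w k" i] by (simp add: x w sibling_props)
    then show "idx (l k - 1) (x k) = idx (l k - 1) (w k)" by (simp add: vec_eq_iff)
    show "idx (l k) (x k) \<noteq> idx (l k) (w k)" unfolding x w by (rule sibling_props(2)[symmetric])
  qed
  \<comment> \<open>The normalisation |Q|^(-1/p), under which all test functions have Morrey norm at
    most 1.\<close>
  define c where "c k = 2 powr (real_of_int (l k) * ?n / p)" for k
  define F where "F k = (\<lambda>y. c k * indicator (cell (l k) (w k)) y)" for k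
  have F: "mbd p q (F k) 1" for k unfolding F_def c_def using ep by (intro mbd_normalized_cell) auto
  have FM: "F k \<in> morrey p q" "morrey_norm p q (F k) \<le> 1" for k using mbd_Morrey[OF F] ep by auto
  have "bdd_above (range (\<lambda>k. morrey_norm p q (F k)))" using FM(2) by (intro bdd_aboveI2)
  then have "\<exists>(r::nat\<Rightarrow>nat) g. strict_mono r \<and> g \<in> morrey s t \<and> (\<lambda>k. morrey_norm s t (\<lambda>x. commutator q \<alpha> a (F (r k)) x - g x)) \<longlonglongrightarrow> 0"
    by (intro comp[unfolded compact_op_def, THEN conjunct2, rule_format] conjI allI FM(1))
  then obtain r :: "nat \<Rightarrow> nat" and g where r: "strict_mono r" and g: "g \<in> morrey s t"
    and lim: "(\<lambda>k. morrey_norm s t (\<lambda>x. commutator q \<alpha> a (F (r k)) x - g x)) \<longlonglongrightarrow> 0"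
    by (elim exE conjE)
  define H where "H k = commutator q \<alpha> a (F k)" for k
  have HM: "H k \<in> morrey s t" for k 
    unfolding H_def by (rule comp[unfolded compact_op_def, THEN conjunct1, THEN bspec, OF FM(1)])
  have Hm: "mbd s t (H k) (morrey_norm s t (H k))" "0 \<le> morrey_norm s t (H k)" for k by (rule Morrey_mbd[OF HM]; use ep in simp)+
  have gm: "mbd s t g (morrey_norm s t g)" "0 \<le> morrey_norm s t g" by (rule Morrey_mbd[OF g]; use ep in simp)+
  have lH: "loc_int (H k)" for k using mbd_loc_int[OF Hm(1)] ep by simp
  have lg: "loc_int g" using mbd_loc_int[OF gm(1)] ep by simp
  define \<eta> where "\<eta> k = morrey_norm s t (\<lambda>x. H (r k) x - g x)" for k
  have \<eta>lim: "\<eta> \<longlonglongrightarrow> 0" using lim unfolding \<eta>_def H_def .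
  have D: "mbd s t (\<lambda>x. H (r k) x - g x) (\<eta> k)" "0 \<le> \<eta> k" for k
  proof -
    have "mbd s t (\<lambda>x. H (r k) x - g x) (4 * (morrey_norm s t (H (r k)) + morrey_norm s t g))"
      using ep by (intro mbd_diff Hm gm) simp
    then have "(\<lambda>x. H (r k) x - g x) \<in> morrey s t" by (rule mbd_Morrey) (use ep Hm(2)[of "r k"] gm(2) in simp_all)
    from Morrey_mbd[OF this] show "mbd s t (\<lambda>x. H (r k) x - g x) (\<eta> k)" "0 \<le> \<eta> k"
      unfolding \<eta>_def using ep by simp_all
  qed
  have Heq: "AE y in lborel. H k y = comm_series \<alpha> a (F k) y" and Hmeas: "H k \<in> borel_measurable borel" for k
    unfolding H_def by (rule commutator_eq[OF ex F o])+
  have series_scale: "AE y in lborel. comm_series \<alpha> a (F k) y = c k * comm_series \<alpha> a (indicator (cell (l k) (w k))) y" for k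
  proof -
    let ?I = "indicator (cell (l k) (w k)) :: real^'n \<Rightarrow> real"
    have mI: "mbd p q ?I (1 + measure lborel (cell (l k) (w k)))" using ep by (intro mbd_indicator_cell) auto
    have sc: "scale_comm \<alpha> a J (F k) y = c k * scale_comm \<alpha> a J ?I y" for J y
    proof -
      have "avg j (\<lambda>z. a z * (c k * ?I z)) y = c k * avg j (\<lambda>z. a z * ?I z) y" for j
        unfolding avg_cmult[symmetric] by (simp only: mult.left_commute)
      then have "2 powr (- \<alpha> * real_of_int j) * (a y * avg j (\<lambda>z. c k * ?I z) y - avg j (\<lambda>z. a z * (c k * ?I z)) y)
          = c k * (2 powr (- \<alpha> * real_of_int j) * (a y * avg j ?I y - avg j (\<lambda>z. a z * ?I z) y))" for j
        by (simp only: avg_cmult) (simp only: right_diff_distrib mult.left_commute)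
      then show ?thesis unfolding scale_comm_def F_def by (simp only: sum_distrib_left)
    qed
    have m0: "0 \<le> 1 + measure lborel (cell (l k) (w k))" by simp
    show ?thesis using comm_series_lim(1)[OF ex F[of k] zero_le_one o] comm_series_lim(1)[OF ex mI m0 o]
    proof eventually_elim
      case (elim y)
      have "(\<lambda>M. c k * ((2 powr \<alpha> - 1) * scale_comm \<alpha> a {- int M..int M} ?I y)) \<longlonglongrightarrow> c k * comm_series \<alpha> a ?I y"
        by (rule tendsto_mult_left[OF elim(2)])
      then have "(\<lambda>M. (2 powr \<alpha> - 1) * scale_comm \<alpha> a {- int M..int M} (F k) y) \<longlonglongrightarrow> c k * comm_series \<alpha> a ?I y"
        unfolding sc by (simp only: mult.left_commute)
      then show ?case by (rule LIMSEQ_unique[OF elim(1)])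
    qed
  qed
  have HI: "AE y in lborel. H k y = c k * comm_series \<alpha> a (indicator (cell (l k) (w k))) y" for k
    using Heq[of k] series_scale[of k] by eventually_elim simp
  have Im: "comm_series \<alpha> a (indicator (cell i z)) \<in> borel_measurable borel" for i and z :: "real^'n"
    by (rule comm_series_lim(2)[OF ex mbd_indicator_cell _ o]) (use ep in auto)
  have zero: "(\<lambda>k. avg j (H (r k)) z) \<longlonglongrightarrow> 0" for j z
  proof -
    let ?h = "comm_series \<alpha> a (indicator (cell j z))"
    \<comment> \<open>The critical exponent: |Q|^(-1/p) times the volume |Q| from the duality bound
      is |Q|^(1 - 1/p). It lies below 1 - \<alpha>/n because 1/s > 0.\<close>
    define v0 where "v0 = 1 - 1/p"
    have "0 < 1 / s" using ep(4,5) by simp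
    then have "v0 < 1 - \<alpha> / ?n" using ep(6) by (simp add: v0_def)
    moreover have "1 / p < 1" using ep by simp
    ultimately have v0: "0 < v0" "v0 < 1 - \<alpha> / ?n" by (simp_all add: v0_def)
    \<comment> \<open>The boundedness theorem with equal Morrey exponents, the Lebesgue case, puts
      the commutator of one indicator into L^(1/v) for the whole range of v; the source exponent p1
      is dictated by 1/p1 = v + \<alpha>/n.\<close>
    have hv: "\<exists>K\<ge>0. mbd (1/v) (1/v) ?h K" if v: "0 < v" "v < 1 - \<alpha> / ?n" for v
    proof -
      define p1 where "p1 = 1 / (v + \<alpha> / ?n)"
      have an: "0 < \<alpha> / ?n" using ep by simp
      have pos: "0 < v + \<alpha> / ?n" "v + \<alpha> / ?n < 1" using v an by simp_all
      have p1: "1 < p1" using pos unfolding p1_def by (subst less_divide_eq_1_pos)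
      have p1i: "1 / p1 = v + \<alpha> / ?n" by (simp add: p1_def)
      have "v < 1" using pos an by simp
      then have v1: "1 < 1 / v" using v by simp
      have ex1: "morrey_exps TYPE('n) \<alpha> p1 p1 (1/v) (1/v)"
        unfolding morrey_exps_def p1i using p1 v1 v(1) ep(1) by simp
      have mI: "mbd p1 p1 (indicator (cell j z) :: real^'n \<Rightarrow> real) (1 + measure lborel (cell j z))" using p1 by (intro mbd_indicator_cell) auto
      have N1: "0 < 1 + measure lborel (cell j z)" by (simp add: add_pos_nonneg)
      show ?thesis by (rule comm_series_mbd[OF ex1 o mI N1])
    qed
    show ?thesis
    proof (rule LIMSEQ_I)
      fix e :: real assume e: "e > 0"
      let ?cj = "2 powr (real_of_int j * ?n)"
      define \<delta> where "\<delta> = e / (2 * ?cj)"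
      have \<delta>: "\<delta> > 0" using e by (simp add: \<delta>_def)
      define T where "T = {(l, idx l w) |l w. 2 powr (- v0 * (real_of_int l * ?n)) * avg l (\<lambda>y. \<bar>?h y\<bar>) w > \<delta>}"
      have "0 \<le> \<alpha> / ?n" by (intro divide_nonneg_nonneg) (use ep(1) in simp_all)
      then have "1 - \<alpha> / ?n \<le> 1" by linarith
      from finite_large_averages[OF hv v0 this \<delta>] have finT: "finite T" unfolding T_def .
      \<comment> \<open>The siblings are distinct because \<open>sibling\<close> is an involution
        and b is injective; so only finitely many test cubes fall into the exceptional set
        T.\<close>
      define R where "R k = (l k, idx (l k) (w k))" for k
      have injR: "inj R"
      proof (rule injI)
        fix k k' assume "R k = R k'"
        then have "l k = l k'" "sibling (snd (b k)) = sibling (snd (b k'))" unfolding R_def w by auto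
        then have "fst (b k) = fst (b k')" "sibling (sibling (snd (b k))) = sibling (sibling (snd (b k')))"
          unfolding l_def by simp_all
        then have "fst (b k) = fst (b k')" "snd (b k) = snd (b k')" unfolding sibling_props(1) by simp_all
        then have "b k = b k'" by (rule prod_eqI)
        then show "k = k'" using b(1) by (simp add: inj_eq)
      qed
      have "finite (R -` T)" by (rule finite_vimageI[OF finT injR])
      then obtain k0 where k0: "\<forall>k\<in>R -` T. k < k0" unfolding finite_nat_set_iff_bounded by (rule exE)
      have "norm (avg j (H (r k)) z - 0) < e" if k: "k \<ge> k0" for k
      proof -
        define i where "i = r k"
        have "k \<le> r k" using r by (rule seq_suble)
        then have "i \<ge> k0" using k by (simp add: i_def)
        then have notin: "R i \<notin> T" using bspec[OF k0, of i] by (auto simp: not_less[symmetric])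
        have le: "2 powr (- v0 * (real_of_int (l i) * ?n)) * avg (l i) (\<lambda>y. \<bar>?h y\<bar>) (w i) \<le> \<delta>"
        proof (rule leI, rule notI)
          assume "\<delta> < 2 powr (- v0 * (real_of_int (l i) * ?n)) * avg (l i) (\<lambda>y. \<bar>?h y\<bar>) (w i)"
          then have "R i \<in> T" unfolding T_def R_def mem_Collect_eq
            by (intro exI[of _ "l i"] exI[of _ "w i"] conjI) (rule refl)
          with notin show False by (rule notE)
        qed
        have "avg j (H i) z = avg j (\<lambda>y. c i * comm_series \<alpha> a (indicator (cell (l i) (w i))) y) z"
          by (rule avg_cong_AE[OF Hmeas _ HI]) (use Im in measurable)
        also have "\<dots> = c i * avg j (comm_series \<alpha> a (indicator (cell (l i) (w i)))) z" by (rule avg_cmult)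
        finally have "\<bar>avg j (H i) z\<bar> = c i * \<bar>avg j (comm_series \<alpha> a (indicator (cell (l i) (w i)))) z\<bar>" by (simp add: abs_mult c_def)
        also have "\<dots> \<le> c i * (?cj * 2 powr (- real_of_int (l i) * ?n) * avg (l i) (\<lambda>y. \<bar>?h y\<bar>) (w i))"
          by (intro mult_left_mono comm_series_dual_bound[OF ex o]) (simp add: c_def)
        also have "\<dots> = ?cj * ((c i * 2 powr (- real_of_int (l i) * ?n)) * avg (l i) (\<lambda>y. \<bar>?h y\<bar>) (w i))" by (simp only: mult_ac)
        also have "c i * 2 powr (- real_of_int (l i) * ?n) = 2 powr (- v0 * (real_of_int (l i) * ?n))"
          unfolding c_def v0_def by (simp add: powr_add[symmetric] algebra_simps)
        also have "?cj * (2 powr (- v0 * (real_of_int (l i) * ?n)) * avg (l i) (\<lambda>y. \<bar>?h y\<bar>) (w i)) \<le> ?cj * \<delta>"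
          by (intro mult_left_mono le) simp
        also have "\<dots> < e" using e by (simp add: \<delta>_def)
        finally show ?thesis by (simp add: i_def)
      qed
      then show "\<exists>no. \<forall>k\<ge>no. norm (avg j (H (r k)) z - 0) < e" by blast
    qed
  qed
  have "avg j g z = 0" for j z
  proof -
    have "(\<lambda>k. avg j (\<lambda>x. H (r k) x - g x) z) \<longlonglongrightarrow> 0"
    proof (rule Lim_null_comparison)
      show "\<forall>\<^sub>F k in sequentially. norm (avg j (\<lambda>x. H (r k) x - g x) z) \<le> \<eta> k * 2 powr (real_of_int j * ?n / s)"
      proof (intro always_eventually allI)
        fix k
        have "\<bar>avg j (\<lambda>x. H (r k) x - g x) z\<bar> \<le> avg j (\<lambda>x. \<bar>H (r k) x - g x\<bar>) z" by (intro avg_abs_le loc_int_diff lH lg)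
        also have "\<dots> \<le> \<eta> k * 2 powr (real_of_int j * ?n / s)" by (rule mbd_avg_abs[OF D(1) ep(4) D(2)])
        finally show "norm (avg j (\<lambda>x. H (r k) x - g x) z) \<le> \<eta> k * 2 powr (real_of_int j * ?n / s)" by simp
      qed
      show "(\<lambda>k. \<eta> k * 2 powr (real_of_int j * ?n / s)) \<longlonglongrightarrow> 0" by (intro tendsto_mult_left_zero \<eta>lim)
    qed
    then have "(\<lambda>k. avg j (H (r k)) z - avg j g z) \<longlonglongrightarrow> 0" unfolding avg_diff[OF lH lg] .
    then have "(\<lambda>k. avg j (H (r k)) z) \<longlonglongrightarrow> avg j g z" by (rule LIM_zero_cancel)
    then show ?thesis using zero[of j z] LIMSEQ_unique by blast
  qed
  then have g0: "AE y in lborel. g y = 0" by (rule avg_all_zero_AE[OF lg])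
  have H\<eta>: "mbd s t (H (r k)) (\<eta> k)" for k
    by (rule mbd_cong_AE[OF D(1) Hmeas]) (use g0 in \<open>auto elim: eventually_mono\<close>)
  \<comment> \<open>The lower bound from \<open>comm_series_sibling\<close> after normalisation. The
    dependence on the level cancels against the Morrey weight 2^(l n/s) through 1/s = 1/p -
    \<alpha>/n; the factor 2^\<alpha> stems from using the parent level l - 1.\<close>
  define c0 where "c0 = (2 powr \<alpha> - 1) * (2 powr \<alpha> * 2 powr (- ?n)) * (\<epsilon> / 2)"
  have c0: "c0 > 0" using powr_minus_1_pos[OF ep(1)] \<epsilon> by (simp add: c0_def)
  have "c0 \<le> \<eta> k" for k
  proof -
    define i where "i = r k"
    let ?I = "comm_series \<alpha> a (indicator (cell (l i) (w i)))"
    have m: "mbd s t (H i) (\<eta> k)" using H\<eta> by (simp add: i_def)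
    have "c i * ((2 powr \<alpha> - 1) * (2 powr (- \<alpha> * real_of_int (l i - 1)) * 2 powr (- ?n)) * (\<epsilon> / 2)) \<le> c i * avg (l i) (\<lambda>y. \<bar>?I y\<bar>) (x i)"
      using comm_series_sibling[OF ex o sib x(2)] by (intro mult_left_mono) (auto simp: c_def)
    also have "\<dots> = avg (l i) (\<lambda>y. c i * \<bar>?I y\<bar>) (x i)" by (rule avg_cmult[symmetric])
    also have "\<dots> = avg (l i) (\<lambda>y. \<bar>H i y\<bar>) (x i)"
    proof (rule avg_cong_AE)
      show "AE y in lborel. c i * \<bar>?I y\<bar> = \<bar>H i y\<bar>" using HI[of i] by eventually_elim (simp add: abs_mult c_def)
    qed (use Im Hmeas in measurable)
    also have "\<dots> \<le> \<eta> k * 2 powr (real_of_int (l i) * ?n / s)" by (rule mbd_avg_abs[OF m ep(4) D(2)])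
    finally have le: "c i * ((2 powr \<alpha> - 1) * (2 powr (- \<alpha> * real_of_int (l i - 1)) * 2 powr (- ?n)) * (\<epsilon> / 2)) \<le> \<eta> k * 2 powr (real_of_int (l i) * ?n / s)" .
    have "c i * 2 powr (- \<alpha> * real_of_int (l i - 1)) = 2 powr \<alpha> * 2 powr (real_of_int (l i) * ?n / s)"
    proof -
      have "real_of_int (l i) * ?n / p + - \<alpha> * real_of_int (l i - 1) = \<alpha> + - (\<alpha> - ?n / p) * real_of_int (l i)" by (simp add: algebra_simps)
      also have "\<dots> = \<alpha> + real_of_int (l i) * ?n / s" unfolding morrey_exps_gap[OF ex] by simp
      finally show ?thesis unfolding c_def by (simp only: powr_add[symmetric])
    qed
    then have "c i * ((2 powr \<alpha> - 1) * (2 powr (- \<alpha> * real_of_int (l i - 1)) * 2 powr (- ?n)) * (\<epsilon> / 2)) = c0 * 2 powr (real_of_int (l i) * ?n / s)"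
      by (simp add: c0_def mult_ac)
    then show ?thesis using le by simp
  qed
  then have "c0 \<le> 0" using \<eta>lim by (intro LIMSEQ_le_const[of \<eta> 0 c0]) auto
  then show False using c0 by simp
qed

theorem theorem7:
  fixes \<alpha> p q s t :: real and a :: "real^'n::finite \<Rightarrow> real"
  assumes "0 < \<alpha>" "\<alpha> < real CARD('n)"
    and "1 < q" "q \<le> p"
    and "1 < t" "t \<le> s"
    and "1/s = 1/p - \<alpha> / real CARD('n)"
    and "t/s = q/p"
    and "a \<in> BMO"
  shows "compact_op p q s t (commutator q \<alpha> a) \<longleftrightarrow> a \<in> VMO"
proof -
  have "morrey_exps TYPE('n) \<alpha> p q s t" using assms by (simp add: morrey_exps_def)
  then show ?thesis using compact_VMO assms(9) VMO_compact by blast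
qed

end
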